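(* Let $i\in\mathbb Z$, $z\in\mathbb C$, and let $\lambda\in\mathfrak h^*$ be such that $\lambda(c)=K\neq0$ and $\lambda(h_0)=J$. Let $M(\lambda)$ be the imaginary Verma module of highest weight $\lambda$ over $\widehat{\mathfrak{sl}}_2$, and let $\mathcal D_i$, $\mathcal D_i^z$ denote the localization and twisted localization functors with respect to $f_i$. (i) Let $z\in\mathbb Z$. Then $\mathcal D_i^zM(\lambda)\simeq\mathcal D_iM(\lambda)$, and $\mathcal D_iM(\lambda)/M(\lambda)$ is irreducible if and only if $J-iK\notin\mathbb Z$. In the latter case, $\mathcal D_iM(\lambda)/M(\lambda)$ is a dense module in $\mathcal W(-\beta+i\delta)$ all of whose weight multiplicities are infinite. (ii) Let $z\notin\mathbb Z$. Then $\mathcal D_i^zM(\lambda)$ is irreducible if and only if $z-J+iK\notin\mathbb Z$. In the latter case, $\mathcal D_i^zM(\lambda)$ is a dense torsion free module all of whose weight multiplicities are infinite. (iii) For $i_1,i_2\in\mathbb Z$ and $z_1,z_2\in\mathbb C$, one has $\mathcal D_{i_1}^{z_1}M(\lambda)\simeq\mathcal D_{i_2}^{z_2}M(\lambda)$ if and only if $z_1-z_2\in\mathbb Z$ and $i_1=i_2$.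
   Context: The ground field is $\mathbb C$; $\mathbb N$ is the set of positive integers. $\mathfrak g=\widehat{\mathfrak{sl}}_2=(\mathfrak{sl}_2\otimes\mathbb C[t,t^{-1}])\oplus\mathbb Cc\oplus\mathbb Cd$ with bracket $[a\otimes t^m,b\otimes t^n]=[a,b]\otimes t^{m+n}+\delta_{m,-n}\,m\,(a,b)\,c$, $[d,a\otimes t^m]=m\,a\otimes t^m$, $c$ central, where $(a,b)=\mathrm{tr}(ab)$ is the trace form on $\mathfrak{sl}_2$. With $e,f,h$ the standard basis of $\mathfrak{sl}_2$, put $e_n=e\otimes t^n$, $f_n=f\otimes t^n$, $h_n=h\otimes t^n$. The Cartan subalgebra is $\mathfrak h=\mathbb Ch_0\oplus\mathbb Cc\oplus\mathbb Cd$. Let $\beta\in\mathfrak h^*$ be the positive root of $\mathfrak{sl}_2$ (the weight of $e_0$) and $\delta\in\mathfrak h^*$ with $\delta(h_0)=\delta(c)=0$, $\delta(d)=1$. The real roots are $\Delta^{\mathsf{re}}=\{\pm\beta+n\delta: n\in\mathbb Z\}$, with root spaces spanned by $e_n$ (root $\beta+n\delta$) and $f_n$ (root $-\beta+n\delta$). The root lattice is $Q=\mathbb Z\beta+\mathbb Z\delta$. $U=U(\mathfrak g)$. Imaginary Verma module: let $\mathfrak g_+=\bigoplus_{n\in\mathbb Z}\mathfrak g_{\beta+n\delta}\oplus\bigoplus_{m\in\mathbb N}\mathfrak g_{m\delta}$. For $\lambda\in\mathfrak h^*$, let $\mathbb C_\lambda$ be the one-dimensional $(\mathfrak g_+\oplus\mathfrak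 h)$-module on which $\mathfrak g_+$ acts by $0$ and $\mathfrak h$ by $\lambda$; then $M(\lambda)=U(\mathfrak g)\otimes_{U(\mathfrak g_+\oplus\mathfrak h)}\mathbb C_\lambda$. A weight module is a module that is the direct sum of its simultaneous $\mathfrak h$-eigenspaces (weight spaces); its support is the set of weights with nonzero weight space. A weight module is dense if its support is a full coset $\mu+Q$, $\mu\in\mathfrak h^*$. It is torsion free if every $e_n$ and every $f_n$ ($n\in\mathbb Z$) acts injectively. For $\alpha\in\Delta^{\mathsf{re}}$, $\mathcal W(\alpha)$ is the category of weight modules on which a nonzero root vector $X_\alpha$ acts locally nilpotently and, for every $\gamma\in\Delta^{\mathsf{re}}$ with $\gamma\neq\alpha$, a nonzero root vector $X_\gamma$ acts injectively. Localization: $\{f_i^n: n\ge0\}\subset U$ is an Ore set; let $\mathcal D_iU$ be the localization of $U$ with respect to it and $\mathcal D_iM=\mathcal D_iU\otimes_UM$. If $f_i$ acts injectively on $M$, then $M\subset\mathcal D_iM$. For $w\in\mathbb C$ and $u\in\mathcal D_iU$ put $\Theta_w(u)=\sum_{j\ge0}\binom{w}{j}(\mathrm{ad} f_i)^j(u)f_i^{-j}$ (a finite sum; equal to $f_i^wuf_i^{-w}$ when $w\in\mathbb Z$). The twisted localization $\mathcal D_i^zM$ is the vector space $\mathcal D_iM$, with the element corresponding to $v\in\mathcal D_iM$ written $v^z$ (thought of as $f_i^{z}v$), and with action $u\cdot v^z=(\Theta_{-z}(u)v)^z$; thus if $v$ has weight $\mu$ then $v^z$ has weight $\mu+z(-\beta+i\delta)$.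 *)

theory Defs
  imports
    "HOL-Analysis.Analysis"
    "HOL-Algebra.QuotRing"
    "HOL-Algebra.Module"
    "HOL-Algebra.Generated_Groups"
    "HOL-Algebra.Free_Abelian_Groups"
begin

section \<open>Complex Lie algebras\<close>

class lie_algebra = ab_group_add +
  fixes scaleC :: "complex \<Rightarrow> 'a \<Rightarrow> 'a" (infixr \<open>*\<^sub>C\<close> 75)
    and lie :: "'a \<Rightarrow> 'a \<Rightarrow> 'a"
  assumes scaleC_add_right: "a *\<^sub>C (x + y) = a *\<^sub>C x + a *\<^sub>C y"
    and scaleC_add_left: "(a + b) *\<^sub>C x = a *\<^sub>C x + b *\<^sub>C x"
    and scaleC_scaleC: "a *\<^sub>C b *\<^sub>C x = (a * b) *\<^sub>C x"
    and scaleC_one: "1 *\<^sub>C x = x"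
    and lie_add_left: "lie (x + y) z = lie x z + lie y z"
    and lie_add_right: "lie x (y + z) = lie x y + lie x z"
    and lie_scaleC_left: "lie (a *\<^sub>C x) y = a *\<^sub>C lie x y"
    and lie_scaleC_right: "lie x (a *\<^sub>C y) = a *\<^sub>C lie x y"
    and lie_self: "lie x x = 0"
    and jacobi: "lie x (lie y z) + lie y (lie z x) + lie z (lie x y) = 0"

interpretation lie: vector_space "scaleC :: complex \<Rightarrow> 'a \<Rightarrow> 'a::lie_algebra"
  by unfold_locales (simp_all add: scaleC_add_right scaleC_add_left scaleC_scaleC scaleC_one)

lemma lie_zero_left [simp]: "lie 0 x = (0::'a::lie_algebra)"
  using lie_add_left[of 0 0 x] by simp

lemma lie_zero_right [simp]: "lie x 0 = (0::'a::lie_algebra)"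
  using lie_add_right[of x 0 0] by simp


section \<open>The Lie algebra \<open>sl\<^sub>2\<close>\<close>

typedef sl2 = "{A :: complex^2^2. trace A = 0}"
  morphisms sl2_matrix Abs_sl2
  by (rule exI[of _ 0]) (simp add: trace_def)

setup_lifting type_definition_sl2

instantiation sl2 :: lie_algebra
begin

lift_definition zero_sl2 :: sl2 is 0 by (simp add: trace_def)
lift_definition plus_sl2 :: "sl2 \<Rightarrow> sl2 \<Rightarrow> sl2" is "(+)" by (simp add: trace_add)
lift_definition uminus_sl2 :: "sl2 \<Rightarrow> sl2" is uminus by (simp add: trace_def sum_negf)
lift_definition minus_sl2 :: "sl2 \<Rightarrow> sl2 \<Rightarrow> sl2" is "(-)" by (simp add: trace_sub)
lift_definition scaleC_sl2 :: "complex \<Rightarrow> sl2 \<Rightarrow> sl2" is "\<lambda>a A. \<chi> i j. a * A $ i $ j"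
  by (simp add: trace_def flip: sum_distrib_left)
lift_definition lie_sl2 :: "sl2 \<Rightarrow> sl2 \<Rightarrow> sl2" is "\<lambda>A B. A ** B - B ** A"
  by (metis trace_sub trace_mul_sym right_minus_eq)

instance
proof
  fix x y z :: sl2 and a b :: complex
  show "x + y + z = x + (y + z)" "x + y = y + x" "0 + x = x" "- x + x = 0" "x - y = x + - y"
    by (transfer, simp)+
  show "a *\<^sub>C (x + y) = a *\<^sub>C x + a *\<^sub>C y" "(a + b) *\<^sub>C x = a *\<^sub>C x + b *\<^sub>C x"
    "a *\<^sub>C b *\<^sub>C x = (a * b) *\<^sub>C x" "1 *\<^sub>C x = x"
    by (transfer, simp add: vec_eq_iff algebra_simps)+
  show "lie (x + y) z = lie x z + lie y z" "lie x (y + z) = lie x y + lie x z"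
    "lie (a *\<^sub>C x) y = a *\<^sub>C lie x y" "lie x (a *\<^sub>C y) = a *\<^sub>C lie x y" "lie x x = 0"
    "lie x (lie y z) + lie y (lie z x) + lie z (lie x y) = 0"
    by (transfer, simp add: vec_eq_iff forall_2 matrix_matrix_mult_def sum_2 algebra_simps)+
qed

end

text \<open>The trace form \<open>(a, b) = tr (a b)\<close>.\<close>

lift_definition sl2_form :: "sl2 \<Rightarrow> sl2 \<Rightarrow> complex" is "\<lambda>A B. trace (A ** B)" .

lift_definition sl2_e :: sl2 is "vector [vector [0, 1], vector [0, 0]]"
  by (simp add: trace_def sum_2)
lift_definition sl2_f :: sl2 is "vector [vector [0, 0], vector [1, 0]]"
  by (simp add: trace_def sum_2)
lift_definition sl2_h :: sl2 is "vector [vector [1, 0], vector [0, -1]]"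
  by (simp add: trace_def sum_2)

lemma sl2_form_add_left: "sl2_form (a + b) c = sl2_form a c + sl2_form b c"
  by transfer (simp add: trace_def matrix_matrix_mult_def sum_2 algebra_simps)
lemma sl2_form_add_right: "sl2_form a (b + c) = sl2_form a b + sl2_form a c"
  by transfer (simp add: trace_def matrix_matrix_mult_def sum_2 algebra_simps)
lemma sl2_form_scaleC_left: "sl2_form (k *\<^sub>C a) b = k * sl2_form a b"
  by transfer (simp add: trace_def matrix_matrix_mult_def sum_2 algebra_simps)
lemma sl2_form_scaleC_right: "sl2_form a (k *\<^sub>C b) = k * sl2_form a b"
  by transfer (simp add: trace_def matrix_matrix_mult_def sum_2 algebra_simps)
lemma sl2_form_zero [simp]: "sl2_form 0 a = 0" "sl2_form a 0 = 0"
  by (transfer, simp add: trace_def matrix_matrix_mult_def)+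
lemma sl2_form_uminus [simp]: "sl2_form (- a) b = - sl2_form a b"
  by transfer (simp add: trace_def matrix_matrix_mult_def sum_2)
lemma sl2_form_sym: "sl2_form a b = sl2_form b a"
  by transfer (rule trace_mul_sym)
lemma sl2_form_invariant: "sl2_form a (lie b c) = sl2_form (lie a b) c"
  by transfer (simp add: trace_def matrix_matrix_mult_def sum_2 algebra_simps)

lemma lie_sl2:
  "lie sl2_e sl2_f = sl2_h" "lie sl2_h sl2_e = 2 *\<^sub>C sl2_e" "lie sl2_h sl2_f = (-2) *\<^sub>C sl2_f"
  by (transfer, simp add: vec_eq_iff forall_2 matrix_matrix_mult_def sum_2)+


section \<open>The affine Lie algebra\<close>

text \<open>The loop algebra \<open>sl\<^sub>2 \<otimes> \<complex>[t, t\<^sup>-\<^sup>1]\<close> is the space of finitely supported functions from \<open>\<int>\<close>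
  to \<open>sl\<^sub>2\<close>; \<open>a \<otimes> t\<^sup>m\<close> is \<open>Poly_Mapping.single m a\<close>.
  \<open>Affine x a s\<close> stands for \<open>x + a c + s d\<close>.\<close>

datatype affine = Affine (loop: "int \<Rightarrow>\<^sub>0 sl2") (central: complex) (deriv: complex)

definition loop_lie :: "(int \<Rightarrow>\<^sub>0 sl2) \<Rightarrow> (int \<Rightarrow>\<^sub>0 sl2) \<Rightarrow> int \<Rightarrow>\<^sub>0 sl2" where
  "loop_lie x y = (\<Sum>m\<in>Poly_Mapping.keys x. \<Sum>n\<in>Poly_Mapping.keys y.
     Poly_Mapping.single (m + n) (lie (Poly_Mapping.lookup x m) (Poly_Mapping.lookup y n)))"

definition loop_cocycle :: "(int \<Rightarrow>\<^sub>0 sl2) \<Rightarrow> (int \<Rightarrow>\<^sub>0 sl2) \<Rightarrow> complex" where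
  "loop_cocycle x y = (\<Sum>m\<in>Poly_Mapping.keys x.
     of_int m * sl2_form (Poly_Mapping.lookup x m) (Poly_Mapping.lookup y (- m)))"

definition loop_deriv :: "(int \<Rightarrow>\<^sub>0 sl2) \<Rightarrow> int \<Rightarrow>\<^sub>0 sl2" where
  "loop_deriv x = (\<Sum>m\<in>Poly_Mapping.keys x.
     Poly_Mapping.single m (of_int m *\<^sub>C Poly_Mapping.lookup x m))"

definition loop_scale :: "complex \<Rightarrow> (int \<Rightarrow>\<^sub>0 sl2) \<Rightarrow> int \<Rightarrow>\<^sub>0 sl2" where
  "loop_scale a = Poly_Mapping.map (scaleC a)"

lemma lookup_loop_scale [simp]:
  "Poly_Mapping.lookup (loop_scale a x) m = a *\<^sub>C Poly_Mapping.lookup x m"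
  unfolding loop_scale_def Poly_Mapping.map.rep_eq
  by (cases "Poly_Mapping.lookup x m = 0") (simp_all only: when_simps lie.scale_zero_right simp_thms not_True_eq_False not_False_eq_True)

lemma lookup_loop_deriv [simp]:
  "Poly_Mapping.lookup (loop_deriv x) m = of_int m *\<^sub>C Poly_Mapping.lookup x m"
  by (auto simp: loop_deriv_def lookup_sum lookup_single when_def in_keys_iff)

lemma loop_lie_superset:
  assumes "finite A" "finite B" "Poly_Mapping.keys x \<subseteq> A" "Poly_Mapping.keys y \<subseteq> B"
  shows "loop_lie x y = (\<Sum>m\<in>A. \<Sum>n\<in>B.
     Poly_Mapping.single (m + n) (lie (Poly_Mapping.lookup x m) (Poly_Mapping.lookup y n)))"
proof -
  have *: "(\<Sum>n\<in>Poly_Mapping.keys y. Poly_Mapping.single (m + n) (lie (Poly_Mapping.lookup x m) (Poly_Mapping.lookup y n)))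
    = (\<Sum>n\<in>B. Poly_Mapping.single (m + n) (lie (Poly_Mapping.lookup x m) (Poly_Mapping.lookup y n)))" for m
    by (rule sum.mono_neutral_left) (use assms in \<open>auto simp: in_keys_iff\<close>)
  show ?thesis
    unfolding loop_lie_def *
    by (rule sum.mono_neutral_left) (use assms in \<open>auto simp: in_keys_iff\<close>)
qed

lemma loop_cocycle_superset:
  assumes "finite A" "Poly_Mapping.keys x \<subseteq> A"
  shows "loop_cocycle x y = (\<Sum>m\<in>A.
     of_int m * sl2_form (Poly_Mapping.lookup x m) (Poly_Mapping.lookup y (- m)))"
  unfolding loop_cocycle_def
  by (rule sum.mono_neutral_left) (use assms in \<open>auto simp: in_keys_iff\<close>)

lemma loop_lie_add_left: "loop_lie (x + y) z = loop_lie x z + loop_lie y z"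
proof -
  let ?A = "Poly_Mapping.keys x \<union> Poly_Mapping.keys y" and ?B = "Poly_Mapping.keys z"
  have "Poly_Mapping.keys (x + y) \<subseteq> ?A" by (rule Poly_Mapping.keys_add)
  then show ?thesis
    by (simp add: loop_lie_superset[of ?A ?B] lookup_add lie_add_left single_add sum.distrib)
qed

lemma loop_lie_add_right: "loop_lie z (x + y) = loop_lie z x + loop_lie z y"
proof -
  let ?B = "Poly_Mapping.keys x \<union> Poly_Mapping.keys y" and ?A = "Poly_Mapping.keys z"
  have "Poly_Mapping.keys (x + y) \<subseteq> ?B" by (rule Poly_Mapping.keys_add)
  then show ?thesis
    by (simp add: loop_lie_superset[of ?A ?B] lookup_add lie_add_right single_add sum.distrib)
qed

lemma loop_cocycle_add_left: "loop_cocycle (x + y) z = loop_cocycle x z + loop_cocycle y z"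
proof -
  let ?A = "Poly_Mapping.keys x \<union> Poly_Mapping.keys y"
  have "Poly_Mapping.keys (x + y) \<subseteq> ?A" by (rule Poly_Mapping.keys_add)
  then show ?thesis
    by (simp add: loop_cocycle_superset[of ?A] lookup_add sl2_form_add_left distrib_left sum.distrib)
qed

lemma loop_cocycle_add_right: "loop_cocycle z (x + y) = loop_cocycle z x + loop_cocycle z y"
  by (simp add: loop_cocycle_def lookup_add sl2_form_add_right algebra_simps sum.distrib)

lemma loop_lie_scale_left: "loop_lie (loop_scale a x) y = loop_scale a (loop_lie x y)"
proof -
  have "Poly_Mapping.keys (loop_scale a x) \<subseteq> Poly_Mapping.keys x" by (auto simp: in_keys_iff)
  then show ?thesis
    by (intro poly_mapping_eqI)
      (auto simp: loop_lie_superset[of "Poly_Mapping.keys x" "Poly_Mapping.keys y"]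
        lookup_sum lookup_single when_def lie_scaleC_left lie.scale_sum_right intro!: sum.cong)
qed

lemma loop_lie_scale_right: "loop_lie x (loop_scale a y) = loop_scale a (loop_lie x y)"
proof -
  have "Poly_Mapping.keys (loop_scale a y) \<subseteq> Poly_Mapping.keys y" by (auto simp: in_keys_iff)
  then show ?thesis
    by (intro poly_mapping_eqI)
      (auto simp: loop_lie_superset[of "Poly_Mapping.keys x" "Poly_Mapping.keys y"]
        lookup_sum lookup_single when_def lie_scaleC_right lie.scale_sum_right intro!: sum.cong)
qed

lemma loop_cocycle_scale_left: "loop_cocycle (loop_scale a x) y = a * loop_cocycle x y"
proof -
  have "Poly_Mapping.keys (loop_scale a x) \<subseteq> Poly_Mapping.keys x" by (auto simp: in_keys_iff)
  then show ?thesis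
    by (simp add: loop_cocycle_superset[of "Poly_Mapping.keys x"] sl2_form_scaleC_left
        sum_distrib_left mult.left_commute)
qed

lemma loop_cocycle_scale_right: "loop_cocycle x (loop_scale a y) = a * loop_cocycle x y"
  by (simp add: loop_cocycle_def sl2_form_scaleC_right sum_distrib_left algebra_simps)

lemma loop_deriv_add: "loop_deriv (x + y) = loop_deriv x + loop_deriv y"
  by (rule poly_mapping_eqI) (simp add: lookup_add scaleC_add_right)

lemma loop_scale_add_right: "loop_scale a (x + y) = loop_scale a x + loop_scale a y"
  by (rule poly_mapping_eqI) (simp add: lookup_add scaleC_add_right)

lemma loop_scale_add_left: "loop_scale (a + b) x = loop_scale a x + loop_scale b x"
  by (rule poly_mapping_eqI) (simp add: lookup_add scaleC_add_left)

lemma loop_scale_scale: "loop_scale a (loop_scale b x) = loop_scale (a * b) x"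
  by (rule poly_mapping_eqI) (simp add: scaleC_scaleC)

lemma loop_scale_one [simp]: "loop_scale 1 x = x"
  by (rule poly_mapping_eqI) (simp add: scaleC_one)

lemma loop_scale_zero [simp]: "loop_scale 0 x = 0" "loop_scale a 0 = 0"
  by (rule poly_mapping_eqI, simp)+

lemma loop_deriv_scale: "loop_deriv (loop_scale a x) = loop_scale a (loop_deriv x)"
  by (rule poly_mapping_eqI) (simp add: scaleC_scaleC mult.commute)

lemma loop_zero [simp]: "loop_lie 0 x = 0" "loop_lie x 0 = 0" "loop_cocycle 0 x = 0"
  "loop_cocycle x 0 = 0" "loop_deriv 0 = 0"
  by (simp_all add: loop_lie_def loop_cocycle_def loop_deriv_def)

lemma loop_lie_single [simp]:
  "loop_lie (Poly_Mapping.single m a) (Poly_Mapping.single n b)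
     = Poly_Mapping.single (m + n) (lie a b)"
  by (subst loop_lie_superset[of "{m}" "{n}"]) auto

lemma loop_cocycle_single [simp]:
  "loop_cocycle (Poly_Mapping.single m a) (Poly_Mapping.single n b)
     = (if m = - n then of_int m * sl2_form a b else 0)"
  by (subst loop_cocycle_superset[of "{m}"]) (auto simp: lookup_single when_def)

lemma loop_deriv_single [simp]:
  "loop_deriv (Poly_Mapping.single m a) = Poly_Mapping.single m (of_int m *\<^sub>C a)"
  by (rule poly_mapping_eqI) (auto simp: lookup_single when_def)

lemma loop_scale_single [simp]:
  "loop_scale k (Poly_Mapping.single m a) = Poly_Mapping.single m (k *\<^sub>C a)"
  by (rule poly_mapping_eqI) (auto simp: lookup_single when_def)

lemma loop_induct [case_names zero single add]:
  assumes "P 0" "\<And>m a. P (Poly_Mapping.single m a)" "\<And>x y. P x \<Longrightarrow> P y \<Longrightarrow> P (x + y)"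
  shows "P (x :: int \<Rightarrow>\<^sub>0 sl2)"
proof (induction x rule: Poly_Mapping.update_induct)
  case const
  show ?case by (rule assms(1))
next
  case (update f m a)
  have "Poly_Mapping.update m a f = Poly_Mapping.single m a + f"
    using update(1)
    by (intro poly_mapping_eqI)
      (auto simp: lookup_update lookup_add lookup_single when_def in_keys_iff)
  then show ?case using assms(2,3) update(3) by simp
qed

lemma lie_skew: "lie x y = - lie y (x::'a::lie_algebra)"
  using lie_self[of "x + y"] unfolding lie_add_left lie_add_right
  by (simp add: lie_self eq_neg_iff_add_eq_0 add.commute)

lemma loop_lie_skew: "loop_lie x y = - loop_lie y x"
proof (induction x rule: loop_induct)
  case (single m a)
 show ?case
  proof (induction y rule: loop_induct)
    case (single n b)
   show ?case
      by (simp add: add.commute lie_skew[of a b] single_uminus)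
  qed (simp_all add: loop_lie_add_left loop_lie_add_right)
qed (simp_all add: loop_lie_add_left loop_lie_add_right)

lemma loop_cocycle_skew: "loop_cocycle x y = - loop_cocycle y x"
proof (induction x rule: loop_induct)
  case (single m a)
 show ?case
  proof (induction y rule: loop_induct)
    case (single n b)
   show ?case
      by (auto simp: sl2_form_sym[of a b])
  qed (simp_all add: loop_cocycle_add_left loop_cocycle_add_right)
qed (simp_all add: loop_cocycle_add_left loop_cocycle_add_right)

lemma loop_jacobi:
  "loop_lie x (loop_lie y z) + loop_lie y (loop_lie z x) + loop_lie z (loop_lie x y) = 0"
proof (induction x rule: loop_induct)
  case (single m a)
 show ?case
  proof (induction y rule: loop_induct)
    case (single n b)
   show ?case
    proof (induction z rule: loop_induct)
      case (single p c)
      have eqs: "n + (p + m) = m + (n + p)" "p + (m + n) = m + (n + p)" by simp_all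
     show ?case
        unfolding loop_lie_single
        by (subst eqs(1), subst eqs(2)) (simp add: jacobi flip: single_add)
    next
      case (add x y)
      show ?case
        using arg_cong2[of _ _ _ _ "(+)", OF add.IH] by (simp add: loop_lie_add_left loop_lie_add_right algebra_simps)
    qed simp
  next
    case (add x y)
    show ?case
      using arg_cong2[of _ _ _ _ "(+)", OF add.IH] by (simp add: loop_lie_add_left loop_lie_add_right algebra_simps)
  qed simp
next
  case (add x y)
  show ?case
    using arg_cong2[of _ _ _ _ "(+)", OF add.IH] by (simp add: loop_lie_add_left loop_lie_add_right algebra_simps)
qed simp

lemma loop_cocycle_jacobi:
  "loop_cocycle x (loop_lie y z) + loop_cocycle y (loop_lie z x) + loop_cocycle z (loop_lie x y) = 0"
proof (induction x rule: loop_induct)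
  case (single m a)
 show ?case
  proof (induction y rule: loop_induct)
    case (single n b)
   show ?case
    proof (induction z rule: loop_induct)
      case (single p c)
      have 1: "sl2_form b (lie c a) = sl2_form a (lie b c)"
        by (metis sl2_form_invariant sl2_form_sym)
      have 2: "sl2_form c (lie a b) = sl2_form a (lie b c)"
        by (metis sl2_form_invariant sl2_form_sym)
      have eqs: "n = - (p + m) \<longleftrightarrow> m = - (n + p)" "p = - (m + n) \<longleftrightarrow> m = - (n + p)" by auto
     show ?case
      proof (cases "m = - (n + p)")
        case True
        show ?thesis
          by (simp only: loop_lie_single loop_cocycle_single eqs True 1 2) (simp add: algebra_simps)
      next
        case False
        then show ?thesis by (simp only: loop_lie_single loop_cocycle_single eqs if_False) simp
      qed
    next
      case (add x y)
      show ?case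
        using arg_cong2[of _ _ _ _ "(+)", OF add.IH] by (simp add: loop_cocycle_add_left loop_cocycle_add_right loop_lie_add_left loop_lie_add_right algebra_simps)
    qed simp
  next
    case (add x y)
    show ?case
      using arg_cong2[of _ _ _ _ "(+)", OF add.IH] by (simp add: loop_cocycle_add_left loop_cocycle_add_right loop_lie_add_left loop_lie_add_right algebra_simps)
  qed simp
next
  case (add x y)
  show ?case
    using arg_cong2[of _ _ _ _ "(+)", OF add.IH] by (simp add: loop_cocycle_add_left loop_cocycle_add_right loop_lie_add_left loop_lie_add_right algebra_simps)
qed simp

lemma loop_deriv_lie: "loop_deriv (loop_lie x y) = loop_lie (loop_deriv x) y + loop_lie x (loop_deriv y)"
proof (induction x rule: loop_induct)
  case (single m a)
 show ?case
  proof (induction y rule: loop_induct)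
    case (single n b)
   show ?case
      by (simp add: lie_scaleC_left lie_scaleC_right scaleC_add_left flip: single_add)
  qed (simp_all add: loop_lie_add_right loop_deriv_add algebra_simps)
qed (simp_all add: loop_lie_add_left loop_deriv_add algebra_simps)

lemma loop_cocycle_deriv: "loop_cocycle (loop_deriv x) y + loop_cocycle x (loop_deriv y) = 0"
proof (induction x rule: loop_induct)
  case (single m a)
 show ?case
  proof (induction y rule: loop_induct)
    case (single n b)
   show ?case
      by (simp add: sl2_form_scaleC_left sl2_form_scaleC_right)
  next
    case (add x y)
    show ?case
      using arg_cong2[of _ _ _ _ "(+)", OF add.IH] by (simp add: loop_cocycle_add_right loop_deriv_add algebra_simps)
  qed simp
next
  case (add x y)
  show ?case
    using arg_cong2[of _ _ _ _ "(+)", OF add.IH] by (simp add: loop_cocycle_add_left loop_deriv_add algebra_simps)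
qed simp

instantiation affine :: lie_algebra
begin

definition "0 = Affine 0 0 0"
definition "x + y = Affine (loop x + loop y) (central x + central y) (deriv x + deriv y)"
definition "- x = Affine (- loop x) (- central x) (- deriv x)"
definition "x - y = Affine (loop x - loop y) (central x - central y) (deriv x - deriv y)"
definition "a *\<^sub>C x = Affine (loop_scale a (loop x)) (a * central x) (a * deriv x)"
definition "lie x y = Affine
  (loop_lie (loop x) (loop y)
     + loop_scale (deriv x) (loop_deriv (loop y)) - loop_scale (deriv y) (loop_deriv (loop x)))
  (loop_cocycle (loop x) (loop y)) 0"

instance
proof
  fix x y z :: affine and a b :: complex
  note defs = zero_affine_def plus_affine_def uminus_affine_def minus_affine_def
    scaleC_affine_def lie_affine_def
  have sub: "loop_scale k (u - v) = loop_scale k u - loop_scale k v" for k u v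
    by (rule poly_mapping_eqI) (simp add: lookup_minus lie.scale_right_diff_distrib)
  have dsub: "loop_deriv (u - v) = loop_deriv u - loop_deriv v" for u v
    by (rule poly_mapping_eqI) (simp add: lookup_minus lie.scale_right_diff_distrib)
  have lsub: "loop_lie (u - v) w = loop_lie u w - loop_lie v w" 
    "loop_lie w (u - v) = loop_lie w u - loop_lie w v" for u v w
    using loop_lie_add_left[of "u - v" v w] loop_lie_add_right[of w "u - v" v] by simp_all
  have csub: "loop_cocycle w (u - v) = loop_cocycle w u - loop_cocycle w v" for u v w
    using loop_cocycle_add_right[of w "u - v" v] by simp
  show "x + y + z = x + (y + z)" "x + y = y + x" "0 + x = x" "- x + x = 0" "x - y = x + - y"
    by (simp_all add: defs algebra_simps)
  show "a *\<^sub>C (x + y) = a *\<^sub>C x + a *\<^sub>C y" "(a + b) *\<^sub>C x = a *\<^sub>C x + b *\<^sub>C x"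
    "a *\<^sub>C b *\<^sub>C x = (a * b) *\<^sub>C x" "1 *\<^sub>C x = x"
    by (simp_all add: defs loop_scale_add_right loop_scale_add_left loop_scale_scale algebra_simps)
  show "lie (x + y) z = lie x z + lie y z" "lie x (y + z) = lie x y + lie x z"
    by (simp_all add: defs loop_lie_add_left loop_lie_add_right loop_cocycle_add_left
        loop_cocycle_add_right loop_deriv_add loop_scale_add_left loop_scale_add_right algebra_simps)
  show "lie (a *\<^sub>C x) y = a *\<^sub>C lie x y" "lie x (a *\<^sub>C y) = a *\<^sub>C lie x y"
    by (simp_all add: defs loop_lie_scale_left loop_lie_scale_right loop_cocycle_scale_left
        loop_cocycle_scale_right loop_deriv_scale loop_scale_scale loop_scale_add_right sub mult.commute)
  have half: "u = 0" if "u = - u" for u :: "int \<Rightarrow>\<^sub>0 sl2"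
  proof (rule poly_mapping_eqI)
    fix k
    have "Poly_Mapping.lookup u k = - Poly_Mapping.lookup u k"
      using that by (metis lookup_uminus)
    then have "Poly_Mapping.lookup u k + Poly_Mapping.lookup u k = 0"
      by (simp add: eq_neg_iff_add_eq_0)
    then have "(1 + 1) *\<^sub>C Poly_Mapping.lookup u k = 0"
      by (simp only: scaleC_add_left scaleC_one)
    then show "Poly_Mapping.lookup u k = Poly_Mapping.lookup 0 k" by simp
  qed
  show "lie x x = 0"
    using half[OF loop_lie_skew[of "loop x" "loop x"]] loop_cocycle_skew[of "loop x" "loop x"]
    by (simp add: defs)
  have cd: "loop_cocycle u (loop_deriv v) = loop_cocycle v (loop_deriv u)" for u v
    using loop_cocycle_deriv[of u v] loop_cocycle_skew[of "loop_deriv u" v] by simp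
  show "lie x (lie y z) + lie y (lie z x) + lie z (lie x y) = 0"
  proof -
    obtain u a s where x: "x = Affine u a s" by (cases x)
    obtain v b t where y: "y = Affine v b t" by (cases y)
    obtain w c r where z: "z = Affine w c r" by (cases z)
    have 1: "loop_cocycle u (loop_lie v w) + loop_cocycle v (loop_lie w u) + loop_cocycle w (loop_lie u v) = 0"
      by (rule loop_cocycle_jacobi)
    have sk: "loop_lie (loop_deriv v) w = - loop_lie w (loop_deriv v)"
      "loop_lie (loop_deriv w) u = - loop_lie u (loop_deriv w)"
      "loop_lie (loop_deriv u) v = - loop_lie v (loop_deriv u)"
      by (rule loop_lie_skew)+
    have lm: "loop_scale k (- p) = - loop_scale k p" for k p
      by (rule poly_mapping_eqI) simp
    have jac: "loop_lie u (loop_lie v w) + (loop_lie v (loop_lie w u) + loop_lie w (loop_lie u v)) = 0"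
      using loop_jacobi[of u v w] by (simp only: add.assoc)
    have "loop (lie x (lie y z) + lie y (lie z x) + lie z (lie x y)) = 0"
      by (simp add: x y z defs sub dsub lsub sk lm loop_lie_add_left loop_lie_add_right loop_deriv_add
          loop_lie_scale_left loop_lie_scale_right loop_scale_add_right loop_deriv_lie
          loop_deriv_scale loop_scale_scale mult.commute algebra_simps jac)
    moreover have "central (lie x (lie y z) + lie y (lie z x) + lie z (lie x y)) = 0"
      using 1 by (simp add: x y z defs csub loop_cocycle_add_right loop_cocycle_scale_right
          cd[of u v] cd[of u w] cd[of v w] algebra_simps)
    ultimately show ?thesis by (simp add: defs)
  qed
qed

end

definition loop_vec :: "sl2 \<Rightarrow> int \<Rightarrow> affine" where
  "loop_vec a m = Affine (Poly_Mapping.single m a) 0 0"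

definition e_vec :: "int \<Rightarrow> affine" where "e_vec = loop_vec sl2_e"
definition f_vec :: "int \<Rightarrow> affine" where "f_vec = loop_vec sl2_f"
definition h_vec :: "int \<Rightarrow> affine" where "h_vec = loop_vec sl2_h"
definition c_vec :: affine where "c_vec = Affine 0 1 0"
definition d_vec :: affine where "d_vec = Affine 0 0 1"

lemma lie_loop_vec:
  "lie (loop_vec a m) (loop_vec b n) =
     loop_vec (lie a b) (m + n) + (if m = - n then of_int m * sl2_form a b else 0) *\<^sub>C c_vec"
  by (simp add: loop_vec_def c_vec_def lie_affine_def plus_affine_def scaleC_affine_def)

lemma lie_c_vec: "lie c_vec x = 0"
  by (simp add: c_vec_def lie_affine_def zero_affine_def)

lemma lie_d_vec: "lie d_vec (loop_vec a m) = of_int m *\<^sub>C loop_vec a m"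
  by (simp add: loop_vec_def d_vec_def lie_affine_def scaleC_affine_def)


section \<open>Weights and roots\<close>

definition cartan :: "affine set" where
  "cartan = {a *\<^sub>C h_vec 0 + b *\<^sub>C c_vec + k *\<^sub>C d_vec | a b k. True}"

text \<open>A linear functional on the Cartan subalgebra is represented by its extension by \<open>0\<close>
  to all other elements (which is not linear on the whole Lie algebra), so that equality
  of functionals is equality of functions.\<close>

definition cartan_dual :: "(affine \<Rightarrow> complex) set" where
  "cartan_dual = {\<mu>. (\<forall>x\<in>cartan. \<forall>y\<in>cartan. \<mu> (x + y) = \<mu> x + \<mu> y) \<and>
     (\<forall>x\<in>cartan. \<forall>a. \<mu> (a *\<^sub>C x) = a * \<mu> x) \<and> (\<forall>x. x \<notin> cartan \<longrightarrow> \<mu> x = 0)}"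

definition beta :: "affine \<Rightarrow> complex" where
  "beta = (\<lambda>x. if x \<in> cartan then (THE b. lie x (e_vec 0) = b *\<^sub>C e_vec 0) else 0)"

definition delta :: "affine \<Rightarrow> complex" where
  "delta = (\<lambda>x. if x \<in> cartan then deriv x else 0)"

definition lattice_elt :: "int \<Rightarrow> int \<Rightarrow> affine \<Rightarrow> complex" where
  "lattice_elt k n = (\<lambda>x. of_int k * beta x + of_int n * delta x)"

definition root_lattice :: "(affine \<Rightarrow> complex) set" where
  "root_lattice = {lattice_elt k n | k n. True}"

definition real_roots :: "(affine \<Rightarrow> complex) set" where
  "real_roots = {lattice_elt k n | k n. k = 1 \<or> k = -1}"

definition root_space :: "(affine \<Rightarrow> complex) \<Rightarrow> affine set" where
  "root_space \<gamma> = {x. \<forall>y\<in>cartan. lie y x = \<gamma> y *\<^sub>C x}"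

definition g_plus :: "affine set" where
  "g_plus = lie.span ((\<Union>n. root_space (lattice_elt 1 n)) \<union> (\<Union>m\<in>{0<..}. root_space (lattice_elt 0 m)))"

definition borel :: "affine set" where
  "borel = {x + y | x y. x \<in> g_plus \<and> y \<in> cartan}"


section \<open>Universal enveloping algebras\<close>

instantiation list :: (type) monoid_add
begin
definition "0 = []"
definition "xs + ys = xs @ ys"
instance by standard (simp_all add: zero_list_def plus_list_def)
end

text \<open>The free associative algebra on \<open>X\<close>: finitely supported functions on words in \<open>X\<close>,
  multiplied by convolution along concatenation of words. The empty word is the unit.\<close>

definition falg :: "'x set \<Rightarrow> ('x list \<Rightarrow>\<^sub>0 'c::ring_1) ring" where
  "falg X = \<lparr>carrier = {p. Poly_Mapping.keys p \<subseteq> lists X}, mult = (*), one = 1, ring.zero = 0, add = (+)\<rparr>"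

definition gen :: "'x \<Rightarrow> 'x list \<Rightarrow>\<^sub>0 'c::ring_1" where
  "gen x = Poly_Mapping.single [x] 1"

lemma ring_falg: "ring (falg X :: ('x list \<Rightarrow>\<^sub>0 'c::ring_1) ring)"
proof (rule ringI)
  show "abelian_group (falg X :: ('x list \<Rightarrow>\<^sub>0 'c) ring)"
  proof (rule abelian_groupI)
    fix p :: "'x list \<Rightarrow>\<^sub>0 'c"
    assume "p \<in> carrier (falg X)"
    then show "\<exists>q\<in>carrier (falg X). q \<oplus>\<^bsub>falg X\<^esub> p = \<zero>\<^bsub>falg X\<^esub>"
      by (intro bexI[of _ "- p"]) (simp_all add: falg_def)
  qed (use Poly_Mapping.keys_add in \<open>force simp: falg_def add_ac\<close>)+
  show "monoid (falg X :: ('x list \<Rightarrow>\<^sub>0 'c) ring)"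
  proof
    fix p q :: "'x list \<Rightarrow>\<^sub>0 'c"
    assume "p \<in> carrier (falg X)" "q \<in> carrier (falg X)"
    then show "p \<otimes>\<^bsub>falg X\<^esub> q \<in> carrier (falg X)"
      using Poly_Mapping.keys_mult[of p q] by (fastforce simp: falg_def plus_list_def)
  qed (simp_all add: falg_def mult.assoc zero_list_def)
qed (simp_all add: falg_def algebra_simps)

text \<open>The universal enveloping algebra of a Lie subalgebra \<open>L\<close>.\<close>

definition env_rels :: "'g::lie_algebra set \<Rightarrow> ('g list \<Rightarrow>\<^sub>0 complex) set" where
  "env_rels L =
     {gen (x + y) - (gen x + gen y) | x y. x \<in> L \<and> y \<in> L} \<union>
     {gen (a *\<^sub>C x) - Poly_Mapping.single [] a * gen x | a x. x \<in> L} \<union>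
     {gen (lie x y) - (gen x * gen y - gen y * gen x) | x y. x \<in> L \<and> y \<in> L}"

definition env_ideal :: "'g::lie_algebra set \<Rightarrow> ('g list \<Rightarrow>\<^sub>0 complex) set" where
  "env_ideal L = Idl\<^bsub>falg L\<^esub> (env_rels L)"

definition env :: "'g::lie_algebra set \<Rightarrow> ('g list \<Rightarrow>\<^sub>0 complex) set ring" where
  "env L = falg L Quot env_ideal L"

definition env_of :: "'g::lie_algebra set \<Rightarrow> 'g \<Rightarrow> ('g list \<Rightarrow>\<^sub>0 complex) set" where
  "env_of L x = env_ideal L +>\<^bsub>falg L\<^esub> gen x"

definition env_scalar :: "'g::lie_algebra set \<Rightarrow> complex \<Rightarrow> ('g list \<Rightarrow>\<^sub>0 complex) set" where
  "env_scalar L a = env_ideal L +>\<^bsub>falg L\<^esub> Poly_Mapping.single [] a"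

text \<open>The homomorphism \<open>U(L) \<rightarrow> U(L')\<close> induced by an inclusion \<open>L \<subseteq> L'\<close>.\<close>

definition env_incl :: "'g::lie_algebra set \<Rightarrow> 'g set \<Rightarrow>
    ('g list \<Rightarrow>\<^sub>0 complex) set \<Rightarrow> ('g list \<Rightarrow>\<^sub>0 complex) set" where
  "env_incl L L' X = (\<Union>p\<in>X. env_ideal L' +>\<^bsub>falg L'\<^esub> p)"

abbreviation Uaff :: "(affine list \<Rightarrow>\<^sub>0 complex) set ring" where
  "Uaff \<equiv> env UNIV"


section \<open>Modules over noncommutative rings\<close>

text \<open>Left modules are represented by the record of the algebra library's \<^locale>\<open>module\<close>, whose
  \<open>mult\<close> and \<open>one\<close> fields carry no information. That locale itself assumes a
  commutative base ring.\<close>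

definition restrict_scalars :: "('r \<Rightarrow> 's) \<Rightarrow> ('s, 'm) module \<Rightarrow> ('r, 'm) module" where
  "restrict_scalars \<phi> M = \<lparr>carrier = carrier M, mult = mult M, one = one M, ring.zero = ring.zero M,
     add = add M, smult = (\<lambda>r. smult M (\<phi> r))\<rparr>"

definition quotient_module :: "('r, 'm) module \<Rightarrow> 'm set \<Rightarrow> ('r, 'm set) module" where
  "quotient_module M N = \<lparr>carrier = a_rcosets\<^bsub>M\<^esub> N, mult = undefined, one = undefined, ring.zero = N,
     add = set_add M, smult = (\<lambda>r X. \<Union>x\<in>X. N +>\<^bsub>M\<^esub> (r \<odot>\<^bsub>M\<^esub> x))\<rparr>"

definition module_isomorphic :: "'r ring \<Rightarrow> ('r, 'm) module \<Rightarrow> ('r, 'n) module \<Rightarrow> bool" where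
  "module_isomorphic R M N \<longleftrightarrow> (\<exists>\<phi>. bij_betw \<phi> (carrier M) (carrier N) \<and>
     (\<forall>x\<in>carrier M. \<forall>y\<in>carrier M. \<phi> (x \<oplus>\<^bsub>M\<^esub> y) = \<phi> x \<oplus>\<^bsub>N\<^esub> \<phi> y) \<and>
     (\<forall>r\<in>carrier R. \<forall>x\<in>carrier M. \<phi> (r \<odot>\<^bsub>M\<^esub> x) = r \<odot>\<^bsub>N\<^esub> \<phi> x))"

definition irreducible_module :: "'r ring \<Rightarrow> ('r, 'm) module \<Rightarrow> bool" where
  "irreducible_module R M \<longleftrightarrow> carrier M \<noteq> {\<zero>\<^bsub>M\<^esub>} \<and>
     (\<forall>N. submodule N R M \<longrightarrow> N = {\<zero>\<^bsub>M\<^esub>} \<or> N = carrier M)"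

text \<open>The tensor product \<open>S \<otimes>\<^sub>R M\<close> along a ring homomorphism \<open>\<phi> : R \<rightarrow> S\<close>, as a left \<open>S\<close>-module:
  the free abelian group on \<open>S \<times> M\<close> modulo the biadditivity and balancing relations.\<close>

definition tensor_rels ::
  "('r \<Rightarrow> 's) \<Rightarrow> 'r ring \<Rightarrow> 's ring \<Rightarrow> ('r, 'm) module \<Rightarrow> ('s \<times> 'm \<Rightarrow>\<^sub>0 int) set" where
  "tensor_rels \<phi> R S M =
     {frag_of (s \<oplus>\<^bsub>S\<^esub> t, m) - (frag_of (s, m) + frag_of (t, m)) | s t m.
        s \<in> carrier S \<and> t \<in> carrier S \<and> m \<in> carrier M} \<union>
     {frag_of (s, m \<oplus>\<^bsub>M\<^esub> n) - (frag_of (s, m) + frag_of (s, n)) | s m n.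
        s \<in> carrier S \<and> m \<in> carrier M \<and> n \<in> carrier M} \<union>
     {frag_of (s \<otimes>\<^bsub>S\<^esub> \<phi> r, m) - frag_of (s, r \<odot>\<^bsub>M\<^esub> m) | s r m.
        s \<in> carrier S \<and> r \<in> carrier R \<and> m \<in> carrier M}"

definition tensor_subgroup ::
  "('r \<Rightarrow> 's) \<Rightarrow> 'r ring \<Rightarrow> 's ring \<Rightarrow> ('r, 'm) module \<Rightarrow> ('s \<times> 'm \<Rightarrow>\<^sub>0 int) set" where
  "tensor_subgroup \<phi> R S M =
     generate (free_Abelian_group (carrier S \<times> carrier M)) (tensor_rels \<phi> R S M)"

definition tensor_coset ::
  "('r \<Rightarrow> 's) \<Rightarrow> 'r ring \<Rightarrow> 's ring \<Rightarrow> ('r, 'm) module \<Rightarrow> ('s \<times> 'm \<Rightarrow>\<^sub>0 int) \<Rightarrow> ('s \<times> 'm \<Rightarrow>\<^sub>0 int) set" where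
  "tensor_coset \<phi> R S M x =
     tensor_subgroup \<phi> R S M #>\<^bsub>free_Abelian_group (carrier S \<times> carrier M)\<^esub> x"

definition extend_scalars ::
  "('r \<Rightarrow> 's) \<Rightarrow> 'r ring \<Rightarrow> 's ring \<Rightarrow> ('r, 'm) module \<Rightarrow> ('s, ('s \<times> 'm \<Rightarrow>\<^sub>0 int) set) module" where
  "extend_scalars \<phi> R S M =
     (let Q = free_Abelian_group (carrier S \<times> carrier M) Mod tensor_subgroup \<phi> R S M
      in \<lparr>carrier = carrier Q, mult = undefined, one = undefined, ring.zero = one Q, add = mult Q,
          smult = (\<lambda>s X. \<Union>x\<in>X. tensor_coset \<phi> R S M
            (frag_extend (\<lambda>(t, m). frag_of (s \<otimes>\<^bsub>S\<^esub> t, m)) x))\<rparr>)"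


section \<open>Imaginary Verma modules\<close>

text \<open>The character by which \<open>g\<^sub>+ \<oplus> h\<close> acts on the one-dimensional module of weight \<open>\<lambda>\<close>.\<close>

definition borel_char :: "(affine \<Rightarrow> complex) \<Rightarrow> affine \<Rightarrow> complex" where
  "borel_char lam x = lam (THE y. y \<in> cartan \<and> x - y \<in> g_plus)"

text \<open>The extension of a linear functional \<open>ch\<close> to an algebra homomorphism on the free algebra.\<close>

definition eval_falg :: "('g \<Rightarrow> complex) \<Rightarrow> ('g list \<Rightarrow>\<^sub>0 complex) \<Rightarrow> complex" where
  "eval_falg ch p = (\<Sum>w\<in>Poly_Mapping.keys p. Poly_Mapping.lookup p w * prod_list (List.map ch w))"

definition one_dim_module :: "(affine \<Rightarrow> complex) \<Rightarrow> ((affine list \<Rightarrow>\<^sub>0 complex) set, complex) module" where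
  "one_dim_module lam = \<lparr>carrier = UNIV, mult = (*), one = 1, ring.zero = 0, add = (+),
     smult = (\<lambda>X v. (THE a. \<forall>p\<in>X. eval_falg (borel_char lam) p = a) * v)\<rparr>"

definition "verma lam = extend_scalars (env_incl borel UNIV) (env borel) Uaff (one_dim_module lam)"


section \<open>Localization\<close>

text \<open>The localization of a ring at a multiplicative set \<open>S\<close>, as the universal ring under \<open>R\<close>
  in which the elements of \<open>S\<close> are invertible (the ring of fractions when \<open>S\<close> is an Ore set).
  It is generated by \<open>Inl r\<close>, the image of \<open>r \<in> R\<close>, and \<open>Inr s\<close>, the inverse of \<open>s \<in> S\<close>.\<close>

definition loc_rels :: "'r ring \<Rightarrow> 'r set \<Rightarrow> (('r + 'r) list \<Rightarrow>\<^sub>0 int) set" where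
  "loc_rels R S =
     {gen (Inl (a \<oplus>\<^bsub>R\<^esub> b)) - (gen (Inl a) + gen (Inl b)) | a b. a \<in> carrier R \<and> b \<in> carrier R} \<union>
     {gen (Inl (a \<otimes>\<^bsub>R\<^esub> b)) - gen (Inl a) * gen (Inl b) | a b. a \<in> carrier R \<and> b \<in> carrier R} \<union>
     {gen (Inl \<one>\<^bsub>R\<^esub>) - 1} \<union>
     {gen (Inl s) * gen (Inr s) - 1 | s. s \<in> S} \<union>
     {gen (Inr s) * gen (Inl s) - 1 | s. s \<in> S}"

definition loc_gens :: "'r ring \<Rightarrow> 'r set \<Rightarrow> ('r + 'r) set" where
  "loc_gens R S = Inl ` carrier R \<union> Inr ` S"

definition loc_ideal :: "'r ring \<Rightarrow> 'r set \<Rightarrow> (('r + 'r) list \<Rightarrow>\<^sub>0 int) set" where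
  "loc_ideal R S = Idl\<^bsub>falg (loc_gens R S)\<^esub> (loc_rels R S)"

definition localization :: "'r ring \<Rightarrow> 'r set \<Rightarrow> (('r + 'r) list \<Rightarrow>\<^sub>0 int) set ring" where
  "localization R S = falg (loc_gens R S) Quot loc_ideal R S"

definition loc_of :: "'r ring \<Rightarrow> 'r set \<Rightarrow> 'r \<Rightarrow> (('r + 'r) list \<Rightarrow>\<^sub>0 int) set" where
  "loc_of R S r = loc_ideal R S +>\<^bsub>falg (loc_gens R S)\<^esub> gen (Inl r)"

definition loc_inv :: "'r ring \<Rightarrow> 'r set \<Rightarrow> 'r \<Rightarrow> (('r + 'r) list \<Rightarrow>\<^sub>0 int) set" where
  "loc_inv R S s = loc_ideal R S +>\<^bsub>falg (loc_gens R S)\<^esub> gen (Inr s)"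

abbreviation f_U :: "int \<Rightarrow> (affine list \<Rightarrow>\<^sub>0 complex) set" where
  "f_U i \<equiv> env_of UNIV (f_vec i)"

definition f_powers :: "int \<Rightarrow> (affine list \<Rightarrow>\<^sub>0 complex) set set" where
  "f_powers i = {f_U i [^]\<^bsub>Uaff\<^esub> n | n::nat. True}"

text \<open>\<open>DU i\<close> is the localized algebra, \<open>DU_of i\<close> the canonical homomorphism from \<open>Uaff\<close> to it.\<close>

abbreviation "DU i \<equiv> localization Uaff (f_powers i)"
abbreviation "DU_of i \<equiv> loc_of Uaff (f_powers i)"

definition "ad_f i u = (DU_of i (f_U i) \<otimes>\<^bsub>DU i\<^esub> u) \<ominus>\<^bsub>DU i\<^esub> (u \<otimes>\<^bsub>DU i\<^esub> DU_of i (f_U i))"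

text \<open>The terms of the sum defining \<open>\<Theta>\<^sub>w(u)\<close> are indexed by those \<open>j\<close> with
  \<open>(ad f\<^sub>i)\<^sup>j(u) \<noteq> 0\<close>; there are finitely many because \<open>ad f\<^sub>i\<close> is locally nilpotent.\<close>

definition "Theta i w u =
  finsum (DU i)
    (\<lambda>j::nat. DU_of i (env_scalar UNIV (w gchoose j)) \<otimes>\<^bsub>DU i\<^esub> ((ad_f i ^^ j) u)
       \<otimes>\<^bsub>DU i\<^esub> (loc_inv Uaff (f_powers i) (f_U i) [^]\<^bsub>DU i\<^esub> j))
    {j. (ad_f i ^^ j) u \<noteq> \<zero>\<^bsub>DU i\<^esub>}"

definition "loc_DU_module i M = extend_scalars (DU_of i) Uaff (DU i) M"

definition "twisted_DU_module i z M =
  (loc_DU_module i M)\<lparr>smult := \<lambda>u v. Theta i (- z) u \<odot>\<^bsub>loc_DU_module i M\<^esub> v\<rparr>"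

text \<open>The functors \<open>D\<^sub>i\<close> and \<open>D\<^sub>i\<^sup>z\<close>, with values regarded as \<open>U\<close>-modules.\<close>

definition "loc_module i M = restrict_scalars (DU_of i) (loc_DU_module i M)"

definition "twisted_loc_module i z M = restrict_scalars (DU_of i) (twisted_DU_module i z M)"

text \<open>The image of \<open>M\<close> in its localization under \<open>m \<mapsto> 1 \<otimes> m\<close>.\<close>

definition "loc_image i M =
  (\<lambda>m. tensor_coset (DU_of i) Uaff (DU i) M (frag_of (\<one>\<^bsub>DU i\<^esub>, m))) ` carrier M"

definition "loc_quotient i M = quotient_module (loc_module i M) (loc_image i M)"


section \<open>Weight modules\<close>

type_synonym 'm U_module = "((affine list \<Rightarrow>\<^sub>0 complex) set, 'm) module"

definition act :: "'m U_module \<Rightarrow> affine \<Rightarrow> 'm \<Rightarrow> 'm" where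
  "act M x v = env_of UNIV x \<odot>\<^bsub>M\<^esub> v"

definition scal :: "'m U_module \<Rightarrow> complex \<Rightarrow> 'm \<Rightarrow> 'm" where
  "scal M a v = env_scalar UNIV a \<odot>\<^bsub>M\<^esub> v"

definition weight_space :: "'m U_module \<Rightarrow> (affine \<Rightarrow> complex) \<Rightarrow> 'm set" where
  "weight_space M \<mu> = {v \<in> carrier M. \<forall>x\<in>cartan. act M x v = scal M (\<mu> x) v}"

text \<open>The module is the direct sum of its weight spaces: every vector is uniquely a sum of
  weight vectors, one for each weight and almost all zero.\<close>

definition weight_module :: "'m U_module \<Rightarrow> bool" where
  "weight_module M \<longleftrightarrow> (\<forall>v\<in>carrier M. \<exists>!w. (\<forall>\<mu>\<in>cartan_dual. w \<mu> \<in> weight_space M \<mu>) \<and>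
     (\<forall>\<mu>. \<mu> \<notin> cartan_dual \<longrightarrow> w \<mu> = \<zero>\<^bsub>M\<^esub>) \<and>
     finite {\<mu>. w \<mu> \<noteq> \<zero>\<^bsub>M\<^esub>} \<and> v = finsum M w {\<mu>. w \<mu> \<noteq> \<zero>\<^bsub>M\<^esub>})"

definition weight_support :: "'m U_module \<Rightarrow> (affine \<Rightarrow> complex) set" where
  "weight_support M = {\<mu> \<in> cartan_dual. weight_space M \<mu> \<noteq> {\<zero>\<^bsub>M\<^esub>}}"

definition dense_module :: "'m U_module \<Rightarrow> bool" where
  "dense_module M \<longleftrightarrow> weight_module M \<and>
     (\<exists>\<mu>\<in>cartan_dual. weight_support M = {(\<lambda>x. \<mu> x + \<gamma> x) | \<gamma>. \<gamma> \<in> root_lattice})"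

definition acts_injectively :: "'m U_module \<Rightarrow> affine \<Rightarrow> bool" where
  "acts_injectively M x \<longleftrightarrow> inj_on (act M x) (carrier M)"

definition acts_locally_nilpotently :: "'m U_module \<Rightarrow> affine \<Rightarrow> bool" where
  "acts_locally_nilpotently M x \<longleftrightarrow> (\<forall>v\<in>carrier M. \<exists>n::nat. (act M x ^^ n) v = \<zero>\<^bsub>M\<^esub>)"

definition torsion_free_module :: "'m U_module \<Rightarrow> bool" where
  "torsion_free_module M \<longleftrightarrow> weight_module M \<and>
     (\<forall>n. acts_injectively M (e_vec n) \<and> acts_injectively M (f_vec n))"

definition in_W :: "(affine \<Rightarrow> complex) \<Rightarrow> 'm U_module \<Rightarrow> bool" where
  "in_W \<alpha> M \<longleftrightarrow> weight_module M \<and>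
     (\<exists>x\<in>root_space \<alpha>. x \<noteq> 0 \<and> acts_locally_nilpotently M x) \<and>
     (\<forall>\<gamma>\<in>real_roots. \<gamma> \<noteq> \<alpha> \<longrightarrow> (\<exists>x\<in>root_space \<gamma>. x \<noteq> 0 \<and> acts_injectively M x))"

definition finite_dim_subspace :: "'m U_module \<Rightarrow> 'm set \<Rightarrow> bool" where
  "finite_dim_subspace M V \<longleftrightarrow> (\<exists>B. finite B \<and> B \<subseteq> V \<and>
     (\<forall>v\<in>V. \<exists>a. v = finsum M (\<lambda>b. scal M (a b) b) B))"

definition infinite_multiplicities :: "'m U_module \<Rightarrow> bool" where
  "infinite_multiplicities M \<longleftrightarrow>
     (\<forall>\<mu>\<in>weight_support M. \<not> finite_dim_subspace M (weight_space M \<mu>))"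

end

theory Submission
  imports Defs "HOL-Computational_Algebra.Polynomial" "HOL-Library.Multiset"
begin

text \<open>The Verma module is realized on polynomials in variables \<open>x\<^sub>n\<close> for \<open>f\<^sub>n\<close> and \<open>y\<^sub>m\<close> for
  \<open>h\<^sub>-\<^sub>m\<^sub>-\<^sub>1\<close>: \<open>f\<^sub>n\<close> multiplies by \<open>x\<^sub>n\<close>, \<open>h\<^sub>n\<close> is a Heisenberg operator minus twice the derivation
  \<open>x\<^sub>k \<mapsto> x\<^sub>k\<^sub>+\<^sub>n\<close>, and \<open>e\<^sub>n\<close> is a second order operator. Allowing complex exponents of \<open>x\<^sub>i\<close>, the twisted
  localization becomes the span of the monomials whose exponent of \<open>x\<^sub>i\<close> lies in \<open>z + \<int>\<close>, because
  \<open>\<Theta>\<close> is conjugation by a power of \<open>x\<^sub>i\<close>: both sides are polynomial in the exponent and agree on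
  the natural numbers.

  The operator \<open>f\<^sub>i e\<^sub>-\<^sub>i\<close> is triangular on monomials. Under the stated conditions on \<open>J - i K\<close> its
  relevant eigenvalues are nonzero, so a submodule is stable under \<open>x\<^sub>i\<^sup>-\<^sup>1\<close>; multiplying by a power of \<open>x\<^sub>i\<close>
  leads into the Verma module, which is irreducible because \<open>K \<noteq> 0\<close>. Otherwise the vectors on which
  \<open>e\<^sub>-\<^sub>i\<close> is nilpotent form a proper submodule. Finally, \<open>f\<^sub>j\<close> is bijective on a localization with
  respect to \<open>f\<^sub>i\<close> only if \<open>j = i\<close>, and the eigenvalues of \<open>h\<^sub>0\<close> determine \<open>z\<close> modulo \<open>\<int>\<close>.\<close>

text \<open>All modules in the statement are quotients of free objects, so a priori nothing shows
  that they are nonzero. The operators bound them from below, because whatever acts nontrivially on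
  a polynomial is nonzero; spanning arguments, by straightening words and by the Ore condition,
  bound them from above. The arithmetic conditions come from one computation. The elements e_{-i},
  f_i and h_0 - iK form an sl_2-triple. If a monomial has exponent w in x_i and total degree s in
  the x_k, the diagonal entry of f_i e_{-i} there is w (J - iK + 1 + w - 2s). The first factor
  vanishes only for w = 0, which is impossible for non-integral z and describes monomials of the
  Verma module for z = 0. The second factor differs from J - iK - z by an integer, so it can vanish
  only when this number is an integer. Weight spaces are infinite dimensional, so finite dimensional
  linear algebra does not apply. Triangularity with a bounded number of steps gives each vector an
  annihilating polynomial, whose nonzero constant term takes the place of an invertible
  matrix.\<close>

abbreviation (input) "lookup \<equiv> Poly_Mapping.lookup"
abbreviation (input) "keys \<equiv> Poly_Mapping.keys"
abbreviation (input) "single \<equiv> Poly_Mapping.single"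


section \<open>Additive endomorphisms\<close>

text \<open>Only additivity is built into the type, so that operators form a ring and commutator
  identities are plain ring identities. Complex linearity is tracked separately by
  \<open>clin\<close>.\<close>

typedef (overloaded) 'a endo = "{f :: 'a::ring_1 \<Rightarrow> 'a. \<forall>x y. f (x + y) = f x + f y}"
  morphisms app Endo
  by (rule exI[of _ id]) simp

setup_lifting type_definition_endo

lemma endo_eqI: "(\<And>x. app S x = app T x) \<Longrightarrow> S = T"
  by (metis app_inject ext)

lemma app_add_right: "app T (x + y) = app T x + app T y"
  using app by blast

lemma app_zero_right [simp]: "app T 0 = 0"
  using app_add_right[of T 0 0] by simp

lemma app_uminus_right: "app T (- x) = - app T x"
  using app_add_right[of T x "- x"] by (simp add: eq_neg_iff_add_eq_0 add.commute)

lemma app_diff_right: "app T (x - y) = app T x - app T y"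
  using app_add_right[of T x "- y"] by (simp add: app_uminus_right)

lemma app_sum_right: "app T (sum g A) = (\<Sum>a\<in>A. app T (g a))"
  by (induction A rule: infinite_finite_induct) (simp_all add: app_add_right)

instantiation endo :: (ring_1) ring_1
begin

lift_definition zero_endo :: "'a endo" is "\<lambda>_. 0" by simp
lift_definition one_endo :: "'a endo" is "\<lambda>x. x" by simp
lift_definition plus_endo :: "'a endo \<Rightarrow> 'a endo \<Rightarrow> 'a endo" is "\<lambda>f g x. f x + g x"
  by (simp add: algebra_simps)
lift_definition uminus_endo :: "'a endo \<Rightarrow> 'a endo" is "\<lambda>f x. - f x" by simp
lift_definition minus_endo :: "'a endo \<Rightarrow> 'a endo \<Rightarrow> 'a endo" is "\<lambda>f g x. f x - g x"
  by (simp add: algebra_simps)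
lift_definition times_endo :: "'a endo \<Rightarrow> 'a endo \<Rightarrow> 'a endo" is "\<lambda>f g x. f (g x)" by simp

instance
proof
  fix S T W :: "'a endo"
  show "(0::'a endo) \<noteq> 1"
    by transfer (metis zero_neq_one)
  show "S * (T + W) = S * T + S * W"
    by (rule endo_eqI) (simp add: times_endo.rep_eq plus_endo.rep_eq app_add_right)
qed (transfer, simp add: algebra_simps fun_eq_iff)+

end

lemmas app_simps [simp] = zero_endo.rep_eq one_endo.rep_eq plus_endo.rep_eq uminus_endo.rep_eq
  minus_endo.rep_eq times_endo.rep_eq

lemma app_sum: "app (sum G A) x = (\<Sum>a\<in>A. app (G a) x)"
  by (induction A rule: infinite_finite_induct) simp_all

lift_definition lmul :: "'a::ring_1 \<Rightarrow> 'a endo" is "\<lambda>a x. a * x" by (simp add: algebra_simps)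

lemmas app_lmul [simp] = lmul.rep_eq

lemma lmul_hom: "lmul (a + b) = lmul a + lmul b" "lmul (a - b) = lmul a - lmul b"
  "lmul (- a) = - lmul a" "lmul (a * b) = lmul a * lmul b" "lmul 0 = 0" "lmul 1 = 1"
  by (auto intro!: endo_eqI simp: algebra_simps)

lemma lmul_commute: "lmul (a::'a::comm_ring_1) * lmul b = lmul b * lmul a"
  by (simp flip: lmul_hom add: mult.commute)


section \<open>Finitely supported functions\<close>

lemma poly_mapping_induct [case_names zero single add]:
  fixes p :: "'k \<Rightarrow>\<^sub>0 'c::ab_group_add"
  assumes "P 0" "\<And>k a. P (single k a)" "\<And>p q. P p \<Longrightarrow> P q \<Longrightarrow> P (p + q)"
  shows "P p"
proof (induction p rule: Poly_Mapping.update_induct)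
  case const
  show ?case by (rule assms(1))
next
  case (update f k a)
  have "Poly_Mapping.update k a f = single k a + f"
    using update(1)
    by (intro poly_mapping_eqI)
      (auto simp: lookup_update lookup_add lookup_single when_def in_keys_iff)
  then show ?case using assms(2,3) update(3) by simp
qed

lemma poly_mapping_sum_singles: "(p :: 'k \<Rightarrow>\<^sub>0 'c::ab_group_add) = (\<Sum>k\<in>keys p. single k (lookup p k))"
  by (rule poly_mapping_eqI)
    (auto simp: lookup_sum lookup_single when_def in_keys_iff)

lemma poly_mapping_keys_induct [consumes 1, case_names zero single add]:
  fixes p :: "'k \<Rightarrow>\<^sub>0 'c::ab_group_add"
  assumes "keys p \<subseteq> K" "P 0" "\<And>k a. k \<in> K \<Longrightarrow> P (single k a)"
    "\<And>p q. P p \<Longrightarrow> P q \<Longrightarrow> P (p + q)"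
  shows "P p"
proof -
  have "P (\<Sum>k\<in>B. single k (lookup p k))" if "finite B" "B \<subseteq> K" for B
    using that by (induction B) (auto simp: assms(2-4))
  then show ?thesis
    using assms(1) poly_mapping_sum_singles[of p] by (metis finite_keys)
qed

lemma sum_keys_add:
  fixes F :: "'k \<Rightarrow> 'c::ab_group_add \<Rightarrow> 'r::comm_monoid_add"
  assumes "\<And>k. F k 0 = 0" "\<And>k a b. F k (a + b) = F k a + F k b"
  shows "(\<Sum>k\<in>keys (p + q). F k (lookup (p + q) k))
    = (\<Sum>k\<in>keys p. F k (lookup p k)) + (\<Sum>k\<in>keys q. F k (lookup q k))"
proof -
  have *: "(\<Sum>k\<in>keys r. F k (lookup r k)) = (\<Sum>k\<in>keys p \<union> keys q. F k (lookup r k))"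
    if "keys r \<subseteq> keys p \<union> keys q" for r
    by (rule sum.mono_neutral_left) (use that in \<open>auto simp: in_keys_iff assms\<close>)
  show ?thesis
    unfolding *[OF keys_add] *[OF Un_upper1] *[OF Un_upper2]
    by (simp add: lookup_add assms sum.distrib)
qed

text \<open>Under the assumptions of \<open>word_evaluation\<close> this is the homomorphism from
  the free algebra that extends \<open>s\<close> on coefficients and \<open>g\<close> on letters.
  Three instances occur: the action of U with complex coefficients, the action of the localized
  algebra with integer coefficients, and the character of the Borel subalgebra.\<close>

definition eval_words :: "('c::ring_1 \<Rightarrow> 'r::ring_1) \<Rightarrow> ('x \<Rightarrow> 'r) \<Rightarrow> ('x list \<Rightarrow>\<^sub>0 'c) \<Rightarrow> 'r" where
  "eval_words s g p = (\<Sum>w\<in>keys p. s (lookup p w) * prod_list (map g w))"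

locale word_evaluation =
  fixes s :: "'c::ring_1 \<Rightarrow> 'r::ring_1" and g :: "'x \<Rightarrow> 'r"
  assumes s_add: "s (a + b) = s a + s b" and s_mult: "s (a * b) = s a * s b" and s_one: "s 1 = 1"
    and central: "s a * g x = g x * s a"
begin

lemma s_zero: "s 0 = 0"
  using s_add[of 0 0] by simp

lemma eval_zero: "eval_words s g 0 = 0"
  by (simp add: eval_words_def)

lemma eval_add: "eval_words s g (p + q) = eval_words s g p + eval_words s g q"
  unfolding eval_words_def
  by (rule sum_keys_add) (simp_all add: s_zero s_add distrib_right)

lemma eval_uminus: "eval_words s g (- p) = - eval_words s g p"
  using eval_add[of p "- p"] eval_zero by (simp add: eq_neg_iff_add_eq_0 add.commute)

lemma eval_diff: "eval_words s g (p - q) = eval_words s g p - eval_words s g q"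
  using eval_add[of p "- q"] by (simp add: eval_uminus)

lemma eval_single: "eval_words s g (single w a) = s a * prod_list (map g w)"
  by (cases "a = 0") (simp_all add: eval_words_def s_zero)

lemma eval_gen: "eval_words s g (gen x) = g x"
  by (simp add: gen_def eval_single s_one)

lemma eval_scalar: "eval_words s g (single [] a) = s a"
  by (simp add: eval_single)

lemma eval_one: "eval_words s g 1 = 1"
  by (simp add: eval_single s_one zero_list_def flip: single_one)

lemma central_word: "prod_list (map g w) * s a = s a * prod_list (map g w)"
proof (induction w)
  case (Cons x w)
  have "g x * prod_list (map g w) * s a = g x * s a * prod_list (map g w)"
    by (simp add: mult.assoc Cons.IH)
  then show ?case by (simp add: mult.assoc flip: central)
qed simp

lemma eval_mult: "eval_words s g (p * q) = eval_words s g p * eval_words s g q"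
proof (induction p rule: poly_mapping_induct)
  case (single v a)
  show ?case
  proof (induction q rule: poly_mapping_induct)
    case (single w b)
    have "s a * s b * (prod_list (map g v) * prod_list (map g w))
      = s a * prod_list (map g v) * (s b * prod_list (map g w))"
      by (metis mult.assoc central_word)
    then show ?case
      by (simp add: mult_single eval_single s_mult plus_list_def)
  qed (simp_all add: eval_zero eval_add distrib_left)
qed (simp_all add: eval_zero eval_add distrib_right)

end

lemma word_induct [consumes 1]:
  fixes p :: "'x list \<Rightarrow>\<^sub>0 'c::ring_1"
  assumes "keys p \<subseteq> lists X" "P 0" "\<And>a. P (single [] a)"
    "\<And>p q. P p \<Longrightarrow> P q \<Longrightarrow> P (p + q)" "\<And>x p. x \<in> X \<Longrightarrow> P p \<Longrightarrow> P (gen x * p)"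
  shows "P p"
  using assms(1)
proof (induction p rule: poly_mapping_keys_induct)
  case (single w a)
  then show ?case
  proof (induction w)
    case (Cons x w)
    have "single (x # w) a = gen x * single w a"
      by (simp add: gen_def mult_single plus_list_def)
    with Cons show ?case using assms(5)[of x "single w a"] by auto
  qed (rule assms(3))
qed (use assms in auto)


section \<open>Locally nilpotent derivations\<close>

definition comm_with :: "'r::ring_1 \<Rightarrow> 'r \<Rightarrow> 'r" where
  "comm_with f u = f * u - u * f"

lemma comm_with_mult: "comm_with f (u * v) = comm_with f u * v + u * comm_with f v"
  by (simp add: comm_with_def algebra_simps)

lemma comm_with_add: "comm_with f (u + v) = comm_with f u + comm_with f v"
  by (simp add: comm_with_def algebra_simps)

lemma comm_with_pow_add: "(comm_with f ^^ n) (u + v) = (comm_with f ^^ n) u + (comm_with f ^^ n) v"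
  by (induction n arbitrary: u v) (simp_all add: comm_with_add funpow_swap1)

text \<open>Two-sided ideals of a whole type. Statements such as nilpotency of ad f are made modulo
  an ideal of words, which avoids computing with cosets.\<close>

definition ring_ideal :: "'r::ring_1 set \<Rightarrow> bool" where
  "ring_ideal I \<longleftrightarrow> 0 \<in> I \<and> (\<forall>x\<in>I. \<forall>y\<in>I. x - y \<in> I) \<and> (\<forall>x\<in>I. \<forall>r. r * x \<in> I \<and> x * r \<in> I)"

lemma ring_idealD:
  assumes "ring_ideal I"
  shows "0 \<in> I" "x \<in> I \<Longrightarrow> y \<in> I \<Longrightarrow> x - y \<in> I" "x \<in> I \<Longrightarrow> r * x \<in> I" "x \<in> I \<Longrightarrow> x * r \<in> I"
    "x \<in> I \<Longrightarrow> y \<in> I \<Longrightarrow> x + y \<in> I"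
proof -
  show *: "0 \<in> I" "x \<in> I \<Longrightarrow> y \<in> I \<Longrightarrow> x - y \<in> I" "x \<in> I \<Longrightarrow> r * x \<in> I" "x \<in> I \<Longrightarrow> x * r \<in> I" for x y r
    using assms unfolding ring_ideal_def by auto
  show "x + y \<in> I" if "x \<in> I" "y \<in> I"
    using *(2)[OF that(1) *(2)[OF *(1) that(2)]] by simp
qed

lemma comm_with_ideal: "ring_ideal I \<Longrightarrow> u \<in> I \<Longrightarrow> (comm_with f ^^ n) u \<in> I"
  by (induction n) (auto simp: comm_with_def intro: ring_idealD)

lemma comm_with_nilpotent_mono:
  assumes "ring_ideal I" "(comm_with f ^^ n) u \<in> I" "n \<le> m"
  shows "(comm_with f ^^ m) u \<in> I"
proof -
  have "(comm_with f ^^ m) u = (comm_with f ^^ (m - n)) ((comm_with f ^^ n) u)"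
    by (metis assms(3) funpow_add le_add_diff_inverse2 o_apply)
  then show ?thesis using comm_with_ideal[OF assms(1,2)] by simp
qed

lemma comm_with_nilpotent_add:
  assumes "ring_ideal I" "(comm_with f ^^ m) u \<in> I" "(comm_with f ^^ n) v \<in> I"
  shows "(comm_with f ^^ (max m n)) (u + v) \<in> I"
  unfolding comm_with_pow_add
  by (intro ring_idealD(5)[OF assms(1)] comm_with_nilpotent_mono[OF assms(1,2)]
      comm_with_nilpotent_mono[OF assms(1,3)]) simp_all

text \<open>By the Leibniz rule each application of ad f falls on one of the factors and lowers the
  bound of that factor by one; once a bound is 0, the factor itself lies in the ideal.\<close>

lemma comm_with_nilpotent_mult:
  assumes "ring_ideal I" "(comm_with f ^^ m) u \<in> I" "(comm_with f ^^ n) v \<in> I"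
  shows "(comm_with f ^^ (m + n)) (u * v) \<in> I"
  using assms(2,3)
proof (induction "m + n" arbitrary: m n u v)
  case 0
  then show ?case by (simp add: ring_idealD[OF assms(1)])
next
  case (Suc k)
  show ?case
  proof (cases "m = 0 \<or> n = 0")
    case True
    then have "u * v \<in> I"
      using Suc.prems ring_idealD[OF assms(1)] by auto
    then show ?thesis by (rule comm_with_ideal[OF assms(1)])
  next
    case False
    then obtain m' n' where mn: "m = Suc m'" "n = Suc n'"
      by (meson not0_implies_Suc)
    have "(comm_with f ^^ (m' + n)) (comm_with f u * v) \<in> I"
      using Suc.prems Suc.hyps(2) unfolding mn
      by (intro Suc.hyps(1)) (simp_all add: funpow_swap1)
    moreover have "(comm_with f ^^ (m + n')) (u * comm_with f v) \<in> I"
      using Suc.prems Suc.hyps(2) unfolding mn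
      by (intro Suc.hyps(1)) (simp_all add: funpow_swap1)
    moreover have "m + n = Suc (m' + n)" "m + n' = m' + n"
      by (simp_all add: mn)
    ultimately show ?thesis
      by (simp add: funpow_Suc_right comm_with_mult comm_with_pow_add ring_idealD(5)[OF assms(1)]
          del: funpow.simps)
  qed
qed

text \<open>From f u = [f, u] + u f, each application of f lowers either the ad-nilpotency degree
  \<open>m\<close> of u or the exponent \<open>n\<close> for v. Applied with M = 0 or M the Verma
  module, this shows that the vectors on which f is nilpotent modulo M form a submodule.\<close>

lemma nilpotent_on_product:
  fixes f u :: "'a::ring_1 endo"
  assumes M: "0 \<in> M" "\<And>x y. x \<in> M \<Longrightarrow> y \<in> M \<Longrightarrow> x + y \<in> M" "\<And>x. x \<in> M \<Longrightarrow> app f x \<in> M"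
    and stable: "\<And>k x. x \<in> M \<Longrightarrow> app ((comm_with f ^^ k) u) x \<in> M"
    and "(comm_with f ^^ m) u = 0" "app (f ^ n) v \<in> M"
  shows "app (f ^ (m + n)) (app u v) \<in> M"
  using assms(4-)
proof (induction "m + n" arbitrary: m n u v)
  case 0
  then show ?case using M by simp
next
  case (Suc k)
  have pw: "app (f ^ j) x \<in> M" if "x \<in> M" for x j
    by (induction j) (use that M in auto)
  show ?case
  proof (cases "m = 0 \<or> n = 0")
    case True
    then show ?thesis
    proof
      assume "m = 0"
      then have "u = 0" using Suc.prems by simp
      then show ?thesis using M by simp
    next
      assume "n = 0"
      then have "app u v \<in> M" using Suc.prems(1)[of v 0] Suc.prems by simp
      then show ?thesis by (rule pw)
    qed
  next
    case False
    then obtain m' n' where mn: "m = Suc m'" "n = Suc n'"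
      by (meson not0_implies_Suc)
    have st: "app ((comm_with f ^^ k) (comm_with f u)) x \<in> M" if "x \<in> M" for k x
      using Suc.prems(1)[OF that, of "Suc k"] by (simp add: funpow_swap1)
    have 1: "app (f ^ (m' + n)) (app (comm_with f u) v) \<in> M"
      using Suc.prems Suc.hyps(2) unfolding mn
      by (intro Suc.hyps(1) st) (simp_all add: funpow_swap1)
    have 2: "app (f ^ (m + n')) (app u (app f v)) \<in> M"
      using Suc.prems Suc.hyps(2) unfolding mn
      by (intro Suc.hyps(1)) (simp_all add: funpow_swap1 power_Suc2 del: power_Suc)
    have "app (f ^ (m + n)) (app u v) = app (f ^ (m' + n)) (app (comm_with f u) v)
        + app (f ^ (m + n')) (app u (app f v))"
      unfolding mn
      by (simp add: power_Suc2 comm_with_def app_add_right app_diff_right power_add del: power_Suc)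
    with 1 2 M(2) show ?thesis by simp
  qed
qed


section \<open>Differential operators on polynomials with complex exponents\<close>

text \<open>The variables \<open>X n\<close> stand for \<open>f\<^sub>n\<close> and \<open>Y n\<close> for \<open>h\<^sub>-\<^sub>n\<^sub>-\<^sub>1\<close>. Admitting complex exponents
  turns \<open>f\<^sub>i\<^sup>z\<close> into an honest element, so that one representation serves all twists.\<close>

datatype var = X int | Y nat

type_synonym expo = "var \<Rightarrow>\<^sub>0 complex"
type_synonym alg = "expo \<Rightarrow>\<^sub>0 complex"

definition sc :: "complex \<Rightarrow> alg endo" where "sc a = lmul (single 0 a)"

definition mul :: "var \<Rightarrow> complex \<Rightarrow> alg endo" where "mul v w = lmul (single (single v w) 1)"

lemma app_sc_single [simp]: "app (sc a) (single \<mu> b) = single \<mu> (a * b)"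
  by (simp add: sc_def mult_single)

lemma lookup_sc [simp]: "lookup (app (sc a) p) \<mu> = a * lookup p \<mu>"
  by (induction p rule: poly_mapping_induct)
    (auto simp: app_add_right lookup_add algebra_simps lookup_single when_def)

lemma app_mul_single [simp]: "app (mul v w) (single \<mu> b) = single (single v w + \<mu>) b"
  by (simp add: mul_def mult_single)

lemma endo_eq_singles:
  fixes S T :: "alg endo"
  assumes "\<And>\<mu> a. app S (single \<mu> a) = app T (single \<mu> a)"
  shows "S = T"
proof (rule endo_eqI)
  show "app S p = app T p" for p
    by (induction p rule: poly_mapping_induct) (simp_all add: assms app_add_right)
qed

lemma sc_hom: "sc (a + b) = sc a + sc b" "sc (a - b) = sc a - sc b" "sc (- a) = - sc a"
  "sc 0 = 0" "sc 1 = 1" and sc_mult: "sc (a * b) = sc a * sc b"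
  by (simp_all add: sc_def single_add single_diff single_uminus flip: lmul_hom)
    (simp_all add: mult_single lmul_hom)

lemma sc_sc: "sc a * sc b = sc (a * b)" "sc a * (sc b * T) = sc (a * b) * T"
  by (simp_all add: sc_mult mult.assoc)

lemma sc_of_nat: "sc (of_nat n) = of_nat n"
  by (induction n) (simp_all add: sc_hom)

lemma sc_numeral: "sc (numeral n) = numeral n"
  using sc_of_nat[of "numeral n"] by simp

lemma mul_add: "mul v (a + b) = mul v a * mul v b" and mul_zero [simp]: "mul v 0 = 1"
  by (simp_all add: mul_def mult_single single_add lmul_hom flip: lmul_hom(4))

lemma mul_commute: "mul u a * mul v b = mul v b * mul u a"
  by (simp add: mul_def lmul_commute)

lemma mul_inverse: "mul v a * mul v (- a) = 1" "mul v (- a) * mul v a = 1"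
  by (simp_all flip: mul_add)

lemma mul_power: "mul v 1 ^ n = mul v (of_nat n)"
  by (induction n) (simp_all add: mul_add)

text \<open>Complex linearity. A linear operator is determined by its values on monomials with
  coefficient 1, which is how stability of spans of monomials is checked.\<close>

definition clin :: "alg endo \<Rightarrow> bool" where
  "clin T \<longleftrightarrow> (\<forall>a. T * sc a = sc a * T)"

lemma clin_mul [simp]: "clin (mul v w)"
  unfolding clin_def by (simp add: mul_def sc_def lmul_commute)

lemma clin_sc [simp]: "clin (sc a)"
  unfolding clin_def by (simp add: sc_def lmul_commute)

lemma clin_one [simp]: "clin 1" and clin_zero [simp]: "clin 0"
  and clin_add [simp]: "clin S \<Longrightarrow> clin T \<Longrightarrow> clin (S + T)"
  and clin_diff [simp]: "clin S \<Longrightarrow> clin T \<Longrightarrow> clin (S - T)"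
  and clin_uminus [simp]: "clin S \<Longrightarrow> clin (- S)"
  unfolding clin_def by (simp_all add: algebra_simps)

lemma clin_mult [simp]: "clin S \<Longrightarrow> clin T \<Longrightarrow> clin (S * T)"
  unfolding clin_def by (metis mult.assoc)

lemma clin_comm: "clin T \<Longrightarrow> T * sc a = sc a * T" "clin T \<Longrightarrow> T * (sc a * S) = sc a * (T * S)"
  unfolding clin_def by (simp, metis mult.assoc)

lemma clin_app: "clin T \<Longrightarrow> app T (app (sc a) p) = app (sc a) (app T p)"
  unfolding clin_def by (metis app_simps(6))

lemma clin_single: "clin T \<Longrightarrow> app T (single \<mu> a) = app (sc a) (app T (single \<mu> 1))"
  using clin_app[of T a "single \<mu> 1"] by simp

text \<open>The power rule applied to complex exponents. Since the coefficient is the exponent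
  itself, a monomial without \<open>v\<close> is killed, and natural exponents never become
  negative.\<close>

lift_definition pd :: "var \<Rightarrow> alg endo" is
  "\<lambda>v p. \<Sum>\<mu>\<in>keys p. single (\<mu> - single v 1) (lookup \<mu> v * lookup p \<mu>)"
proof -
  fix v and p q :: alg
  show "(\<Sum>\<mu>\<in>keys (p + q). single (\<mu> - single v 1) (lookup \<mu> v * lookup (p + q) \<mu>))
    = (\<Sum>\<mu>\<in>keys p. single (\<mu> - single v 1) (lookup \<mu> v * lookup p \<mu>))
    + (\<Sum>\<mu>\<in>keys q. single (\<mu> - single v 1) (lookup \<mu> v * lookup q \<mu>))"
    by (rule sum_keys_add) (simp_all add: distrib_left single_add)
qed

lemma app_pd_single [simp]: "app (pd v) (single \<mu> a) = single (\<mu> - single v 1) (lookup \<mu> v * a)"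
  by (cases "a = 0") (simp_all add: pd.rep_eq)

lemma clin_pd [simp]: "clin (pd v)"
  unfolding clin_def by (intro allI endo_eq_singles) (simp add: mult.left_commute)

lemma pd_mul: "pd v * mul u w = mul u w * pd v + (if u = v then sc w * mul v (w - 1) else 0)"
  by (rule endo_eq_singles)
    (auto simp: lookup_add lookup_single when_def single_diff algebra_simps simp flip: single_add)

lemma pd_commute: "pd u * pd v = pd v * pd u"
  by (rule endo_eq_singles)
    (auto simp: lookup_minus lookup_single when_def algebra_simps)

definition wt :: "(var \<Rightarrow> complex) \<Rightarrow> expo \<Rightarrow> complex" where
  "wt g \<mu> = (\<Sum>v\<in>keys \<mu>. g v * lookup \<mu> v)"

lemma wt_add: "wt g (\<mu> + \<nu>) = wt g \<mu> + wt g \<nu>"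
  unfolding wt_def by (rule sum_keys_add) (simp_all add: distrib_left)

lemma wt_single [simp]: "wt g (single v a) = g v * a"
  by (cases "a = 0") (simp_all add: wt_def)

lemma wt_zero [simp]: "wt g 0 = 0"
  by (simp add: wt_def)

lemma wt_diff: "wt g (\<mu> - \<nu>) = wt g \<mu> - wt g \<nu>"
  using wt_add[of g "\<mu> - \<nu>" \<nu>] by simp

lift_definition dg :: "(var \<Rightarrow> complex) \<Rightarrow> alg endo" is
  "\<lambda>g p. \<Sum>\<mu>\<in>keys p. single \<mu> (wt g \<mu> * lookup p \<mu>)"
proof -
  fix g and p q :: alg
  show "(\<Sum>\<mu>\<in>keys (p + q). single \<mu> (wt g \<mu> * lookup (p + q) \<mu>))
    = (\<Sum>\<mu>\<in>keys p. single \<mu> (wt g \<mu> * lookup p \<mu>))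
    + (\<Sum>\<mu>\<in>keys q. single \<mu> (wt g \<mu> * lookup q \<mu>))"
    by (rule sum_keys_add) (simp_all add: distrib_left single_add)
qed

lemma app_dg_single [simp]: "app (dg g) (single \<mu> a) = single \<mu> (wt g \<mu> * a)"
  by (cases "a = 0") (simp_all add: dg.rep_eq)

lemma lookup_dg [simp]: "lookup (app (dg g) p) \<mu> = wt g \<mu> * lookup p \<mu>"
  by (induction p rule: poly_mapping_induct)
    (auto simp: app_add_right lookup_add algebra_simps lookup_single when_def)

lemma clin_dg [simp]: "clin (dg g)"
  unfolding clin_def by (intro allI endo_eq_singles) (simp add: mult.left_commute)

lemma dg_mul: "dg g * mul v w = mul v w * dg g + sc (g v * w) * mul v w"
  by (rule endo_eq_singles) (simp add: wt_add algebra_simps flip: single_add)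

lemma pd_dg: "pd v * dg g = dg g * pd v + sc (g v) * pd v"
  by (rule endo_eq_singles) (simp add: wt_diff algebra_simps flip: single_add)

subsection \<open>Locally finite sums of derivatives\<close>

definition alg_vars :: "alg \<Rightarrow> var set" where
  "alg_vars p = (\<Union>\<mu>\<in>keys p. keys \<mu>)"

lemma finite_alg_vars [simp]: "finite (alg_vars p)"
  by (simp add: alg_vars_def)

lemma pd_eq_0: "v \<notin> alg_vars p \<Longrightarrow> app (pd v) p = 0"
  by (auto simp: pd.rep_eq alg_vars_def in_keys_iff intro!: sum.neutral)

lemma finite_pd: "finite {k. app (pd (X k)) p \<noteq> 0}"
proof -
  have "{k. app (pd (X k)) p \<noteq> 0} \<subseteq> X -` alg_vars p"
    using pd_eq_0 by auto
  then show ?thesis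
    by (rule finite_subset) (simp add: finite_vimageI inj_def)
qed

text \<open>The infinite sum of G_k d/dx_k over all integers k. A polynomial contains finitely many
  variables, so only finitely many summands act on it. The \<open>G k\<close> may themselves be
  differential operators.\<close>

lift_definition SD :: "(int \<Rightarrow> alg endo) \<Rightarrow> alg endo" is
  "\<lambda>G p. \<Sum>k | app (pd (X k)) p \<noteq> 0. app (G k) (app (pd (X k)) p)"
proof -
  fix G :: "int \<Rightarrow> alg endo" and p q
  let ?A = "\<lambda>p. {k. app (pd (X k)) p \<noteq> 0}"
  let ?F = "\<lambda>p k. app (G k) (app (pd (X k)) p)"
  have *: "sum (?F r) (?A r) = sum (?F r) (?A p \<union> ?A q)" if "?A r \<subseteq> ?A p \<union> ?A q" for r
    by (rule sum.mono_neutral_left) (use that in \<open>auto simp: finite_pd\<close>)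
  have "?A (p + q) \<subseteq> ?A p \<union> ?A q"
    by (auto simp: app_add_right)
  then show "sum (?F (p + q)) (?A (p + q)) = sum (?F p) (?A p) + sum (?F q) (?A q)"
    unfolding *[OF \<open>?A (p + q) \<subseteq> _\<close>] *[OF Un_upper1] *[OF Un_upper2]
    by (simp add: app_add_right sum.distrib)
qed

lemma app_SD:
  assumes "finite B" "\<And>k. k \<notin> B \<Longrightarrow> app (pd (X k)) p = 0"
  shows "app (SD G) p = (\<Sum>k\<in>B. app (G k) (app (pd (X k)) p))"
  unfolding SD.rep_eq
  by (rule sum.mono_neutral_left) (use assms in auto)

lemma SD_add: "SD (\<lambda>k. G k + H k) = SD G + SD H"
  by (rule endo_eqI) (simp add: SD.rep_eq sum.distrib)

lemma SD_diff: "SD (\<lambda>k. G k - H k) = SD G - SD H"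
  by (rule endo_eqI) (simp add: SD.rep_eq sum_subtractf)

lemma SD_mult_left: "T * SD G = SD (\<lambda>k. T * G k)"
  by (rule endo_eqI) (simp add: SD.rep_eq app_sum_right)

lemma SD_delta: "SD (\<lambda>k. if k = n then T k else 0) = T n * pd (X n)"
proof (rule endo_eqI)
  fix p
  have "app (SD (\<lambda>k. if k = n then T k else 0)) p
    = (\<Sum>k\<in>insert n {k. app (pd (X k)) p \<noteq> 0}. app (if k = n then T k else 0) (app (pd (X k)) p))"
    by (rule app_SD) (auto simp: finite_pd)
  also have "\<dots> = app (T n) (app (pd (X n)) p)"
    by (subst sum.mono_neutral_right[of _ "{n}"]) (auto simp: finite_pd)
  finally show "app (SD (\<lambda>k. if k = n then T k else 0)) p = app (T n * pd (X n)) p" by simp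
qed

lemma SD_mult_right:
  assumes "\<And>k. pd (X k) * T = S k * pd (X k)"
  shows "SD G * T = SD (\<lambda>k. G k * S k)"
proof (rule endo_eqI)
  fix p
  let ?B = "{k. app (pd (X k)) p \<noteq> 0}"
  have eq: "app (pd (X k)) (app T p) = app (S k) (app (pd (X k)) p)" for k
    using assms[of k] by (metis app_simps(6))
  have "app (SD G) (app T p) = (\<Sum>k\<in>?B. app (G k) (app (pd (X k)) (app T p)))"
    by (rule app_SD) (auto simp: finite_pd eq)
  then show "app (SD G * T) p = app (SD (\<lambda>k. G k * S k)) p"
    by (simp add: eq SD.rep_eq)
qed

text \<open>An operator T with [d/dx_k, T] = d/dx_{k-m} produces a second sum over derivatives with
  shifted index; reindexing by k + m moves the shift to the coefficients.\<close>

lemma SD_mult_right_shift: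
  assumes "\<And>k. pd (X k) * T = T * pd (X k) + pd (X (k - m))"
  shows "SD G * T = SD (\<lambda>k. G k * T) + SD (\<lambda>k. G (k + m))"
proof (rule endo_eqI)
  fix p
  let ?B = "{k. app (pd (X k)) p \<noteq> 0}"
  have eq: "app (pd (X k)) (app T p) = app T (app (pd (X k)) p) + app (pd (X (k - m))) p" for k
    using assms[of k] by (metis app_simps(3,6))
  have img: "k \<in> (\<lambda>k. k + m) ` ?B \<longleftrightarrow> app (pd (X (k - m))) p \<noteq> 0" for k
    by (auto simp: image_iff intro: exI[of _ "k - m"])
  have fin: "finite (?B \<union> (\<lambda>k. k + m) ` ?B)"
    by (simp add: finite_pd)
  have "app (SD G) (app T p) = (\<Sum>k\<in>?B \<union> (\<lambda>k. k + m) ` ?B. app (G k) (app (pd (X k)) (app T p)))"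
    by (rule app_SD[OF fin]) (auto simp: eq img)
  also have "\<dots> = (\<Sum>k\<in>?B \<union> (\<lambda>k. k + m) ` ?B. app (G k * T) (app (pd (X k)) p))
      + (\<Sum>k\<in>?B \<union> (\<lambda>k. k + m) ` ?B. app (G k) (app (pd (X (k - m))) p))"
    by (simp add: eq app_add_right sum.distrib)
  also have "(\<Sum>k\<in>?B \<union> (\<lambda>k. k + m) ` ?B. app (G k * T) (app (pd (X k)) p)) = app (SD (\<lambda>k. G k * T)) p"
    by (rule app_SD[OF fin, symmetric]) auto
  also have "(\<Sum>k\<in>?B \<union> (\<lambda>k. k + m) ` ?B. app (G k) (app (pd (X (k - m))) p))
      = (\<Sum>k\<in>(\<lambda>k. k + m) ` ?B. app (G k) (app (pd (X (k - m))) p))"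
    by (rule sum.mono_neutral_right[OF fin]) (auto simp: img)
  also have "\<dots> = (\<Sum>k\<in>?B. app (G (k + m)) (app (pd (X k)) p))"
    by (subst sum.reindex) (auto simp: inj_on_def)
  also have "\<dots> = app (SD (\<lambda>k. G (k + m))) p"
    by (simp add: SD.rep_eq)
  finally show "app (SD G * T) p = app (SD (\<lambda>k. G k * T) + SD (\<lambda>k. G (k + m))) p"
    by simp
qed

lemma SD_mult_mul:
  assumes "\<And>k. clin (G k)"
  shows "SD G * mul (X n) w = SD (\<lambda>k. G k * mul (X n) w) + sc w * G n * mul (X n) (w - 1)"
proof (rule endo_eqI)
  fix p
  let ?B = "insert n {k. app (pd (X k)) p \<noteq> 0}"
  have fin: "finite ?B" by (simp add: finite_pd)
  have eq: "app (pd (X k)) (app (mul (X n) w) p) = app (mul (X n) w) (app (pd (X k)) p)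
      + (if k = n then app (sc w) (app (mul (X n) (w - 1)) p) else 0)" for k
    using arg_cong[OF pd_mul[of "X k" "X n" w], of "\<lambda>T. app T p"] by auto
  have "app (SD G) (app (mul (X n) w) p) = (\<Sum>k\<in>?B. app (G k) (app (pd (X k)) (app (mul (X n) w) p)))"
    by (rule app_SD[OF fin]) (auto simp: eq)
  also have "\<dots> = (\<Sum>k\<in>?B. app (G k * mul (X n) w) (app (pd (X k)) p))
      + (\<Sum>k\<in>?B. if k = n then app (G n) (app (sc w) (app (mul (X n) (w - 1)) p)) else 0)"
    by (simp only: eq app_add_right sum.distrib app_simps) (auto intro!: sum.cong arg_cong2[of _ _ _ _ "(+)"])
  also have "(\<Sum>k\<in>?B. app (G k * mul (X n) w) (app (pd (X k)) p)) = app (SD (\<lambda>k. G k * mul (X n) w)) p"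
    by (rule app_SD[OF fin, symmetric]) auto
  also have "(\<Sum>k\<in>?B. if k = n then app (G n) (app (sc w) (app (mul (X n) (w - 1)) p)) else 0)
      = app (sc w) (app (G n) (app (mul (X n) (w - 1)) p))"
    using fin by (simp add: clin_app[OF assms])
  finally show "app (SD G * mul (X n) w) p = app (SD (\<lambda>k. G k * mul (X n) w) + sc w * G n * mul (X n) (w - 1)) p"
    by simp
qed

lemma clin_SD [simp]:
  assumes "\<And>k. clin (G k)"
  shows "clin (SD G)"
  unfolding clin_def
proof
  fix a
  have "SD G * sc a = SD (\<lambda>k. G k * sc a)"
    by (rule SD_mult_right) (simp add: clin_comm)
  then show "SD G * sc a = sc a * SD G"
    by (simp add: SD_mult_left clin_comm assms)
qed

definition D :: "int \<Rightarrow> alg endo" where "D m = SD (\<lambda>n. mul (X (n + m)) 1)"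

lemma clin_D [simp]: "clin (D m)"
  by (simp add: D_def)

lemma pd_D: "pd (X k) * D m = D m * pd (X k) + pd (X (k - m))"
proof -
  have "pd (X k) * D m = SD (\<lambda>n. mul (X (n + m)) 1 * pd (X k)) + SD (\<lambda>n. if n = k - m then 1 else 0)"
    unfolding D_def SD_mult_left SD_add[symmetric]
    by (rule arg_cong[of _ _ SD]) (auto simp: fun_eq_iff pd_mul sc_hom)
  also have "SD (\<lambda>n. mul (X (n + m)) 1 * pd (X k)) = D m * pd (X k)"
    unfolding D_def by (rule SD_mult_right[symmetric]) (rule pd_commute)
  finally show ?thesis by (simp add: SD_delta)
qed

lemma D_pd_Y: "pd (Y j) * D m = D m * pd (Y j)"
proof -
  have "pd (Y j) * D m = SD (\<lambda>n. mul (X (n + m)) 1 * pd (Y j))"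
    unfolding D_def SD_mult_left by (simp add: pd_mul)
  also have "\<dots> = D m * pd (Y j)"
    unfolding D_def by (rule SD_mult_right[symmetric]) (rule pd_commute)
  finally show ?thesis .
qed

lemma D_mul: "D m * mul (X n) w = mul (X n) w * D m + sc w * mul (X (n + m)) 1 * mul (X n) (w - 1)"
  unfolding D_def by (subst SD_mult_mul) (simp_all add: SD_mult_left mul_commute)

lemma D_mul_Y: "D m * mul (Y j) w = mul (Y j) w * D m"
proof -
  have "D m * mul (Y j) w = SD (\<lambda>k. mul (X (k + m)) 1 * mul (Y j) w)"
    unfolding D_def by (rule SD_mult_right) (simp add: pd_mul)
  then show ?thesis by (simp add: D_def SD_mult_left mul_commute)
qed

lemma D_commute: "D m * D p = D p * D m"
proof -
  have "D m * D p = SD (\<lambda>k. mul (X (k + m)) 1 * D p) + SD (\<lambda>k. mul (X (k + p + m)) 1)"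
    unfolding D_def[of m] by (rule SD_mult_right_shift) (rule pd_D)
  also have "\<dots> = SD (\<lambda>k. D p * mul (X (k + m)) 1)"
    unfolding SD_add[symmetric]
    by (rule arg_cong[of _ _ SD]) (simp add: fun_eq_iff D_mul sc_hom add_ac)
  also have "\<dots> = D p * D m"
    by (simp add: D_def[of m] SD_mult_left)
  finally show ?thesis .
qed

text \<open>Three gradings for use with \<open>wt\<close>: the number of f's, the number of h's, and
  the degree for d, in which \<open>Y n\<close> has degree -n-1 because it stands for
  h_{-n-1}.\<close>

definition gX :: "var \<Rightarrow> complex" where "gX v = (case v of X n \<Rightarrow> 1 | Y n \<Rightarrow> 0)"
definition gY :: "var \<Rightarrow> complex" where "gY v = (case v of X n \<Rightarrow> 0 | Y n \<Rightarrow> 1)"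
definition gd :: "var \<Rightarrow> complex" where "gd v = (case v of X n \<Rightarrow> of_int n | Y n \<Rightarrow> - (of_nat n + 1))"

lemma g_simps [simp]: "gX (X n) = 1" "gX (Y j) = 0" "gY (X n) = 0" "gY (Y j) = 1"
  "gd (X n) = of_int n" "gd (Y j) = - (of_nat j + 1)"
  by (simp_all add: gX_def gY_def gd_def)

lemma D_0: "D 0 = dg gX"
proof (rule endo_eq_singles)
  fix \<mu> :: expo and a
  let ?N = "X -` keys \<mu>"
  have fin: "finite ?N" by (simp add: finite_vimageI inj_def)
  have "app (D 0) (single \<mu> a) = (\<Sum>n\<in>?N. single \<mu> (lookup \<mu> (X n) * a))"
    unfolding D_def by (subst app_SD[OF fin]) (simp_all add: in_keys_iff)
  also have "\<dots> = single \<mu> ((\<Sum>n\<in>?N. lookup \<mu> (X n)) * a)"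
    by (rule poly_mapping_eqI) (auto simp: lookup_sum lookup_single when_def sum_distrib_right)
  also have "(\<Sum>n\<in>?N. lookup \<mu> (X n)) = wt gX \<mu>"
  proof -
    have "wt gX \<mu> = (\<Sum>v\<in>X ` ?N. gX v * lookup \<mu> v)"
      unfolding wt_def
      by (rule sum.mono_neutral_right) (auto simp: gX_def split: var.splits)
    also have "\<dots> = (\<Sum>n\<in>?N. lookup \<mu> (X n))"
      by (subst sum.reindex) (auto simp: inj_on_def)
    finally show ?thesis by simp
  qed
  finally show "app (D 0) (single \<mu> a) = app (dg gX) (single \<mu> a)" by simp
qed

lemma dg_D: "dg gd * D m = D m * dg gd + sc (of_int m) * D m"
proof -
  have "D m * dg gd = SD (\<lambda>k. mul (X (k + m)) 1 * (dg gd + sc (of_int k)))"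
    unfolding D_def by (rule SD_mult_right) (simp add: pd_dg distrib_right)
  also have "\<dots> = SD (\<lambda>k. dg gd * mul (X (k + m)) 1 - sc (of_int m) * mul (X (k + m)) 1)"
    by (rule arg_cong[of _ _ SD])
      (simp add: fun_eq_iff dg_mul distrib_left clin_comm sc_hom algebra_simps)
  finally show ?thesis
    by (simp add: SD_diff D_def SD_mult_left)
qed


section \<open>The Fock space representation\<close>

subsection \<open>Polynomial families of operators\<close>

text \<open>Identities between operators that depend polynomially on an exponent \<open>w\<close> extend from
  natural to complex \<open>w\<close>; they are proved for the powers of \<open>f\<^sub>i\<close> first.\<close>

inductive polyop :: "(complex \<Rightarrow> alg endo) \<Rightarrow> bool" where
  const: "clin T \<Longrightarrow> polyop (\<lambda>w. T)"
| add: "polyop S \<Longrightarrow> polyop T \<Longrightarrow> polyop (\<lambda>w. S w + T w)"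
| step: "polyop T \<Longrightarrow> polyop (\<lambda>w. sc w * T w)"

lemma polyop_clin: "polyop T \<Longrightarrow> clin (T w)"
  by (induction rule: polyop.induct) simp_all

lemma polyop_mult_left: "polyop T \<Longrightarrow> clin S \<Longrightarrow> polyop (\<lambda>w. S * T w)"
  by (induction rule: polyop.induct) (simp_all add: polyop.intros distrib_left clin_comm)

lemma polyop_mult: "polyop S \<Longrightarrow> polyop T \<Longrightarrow> polyop (\<lambda>w. S w * T w)"
  by (induction rule: polyop.induct)
    (simp_all add: polyop_mult_left distrib_right mult.assoc polyop.intros)

lemma polyop_diff: "polyop S \<Longrightarrow> polyop T \<Longrightarrow> polyop (\<lambda>w. S w - T w)"
  using polyop.add[of S "\<lambda>w. - 1 * T w"] polyop_mult_left[of T "- 1"] by simp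

lemma polyop_id: "polyop (\<lambda>w. sc w)"
  using polyop.step[OF polyop.const, of 1] by simp

lemma polyop_sum: "(\<And>j. j \<in> A \<Longrightarrow> polyop (S j)) \<Longrightarrow> polyop (\<lambda>w. \<Sum>j\<in>A. S j w)"
  by (induction A rule: infinite_finite_induct) (simp_all add: polyop.intros)

text \<open>Each matrix coefficient of T w is a polynomial in w that vanishes at all natural
  numbers, hence identically.\<close>

lemma polyop_vanish:
  assumes "polyop T" "\<And>n. T (of_nat n) = 0"
  shows "T w = 0"
proof (rule endo_eqI, rule poly_mapping_eqI)
  fix p \<nu>
  have "\<exists>q. \<forall>w. lookup (app (T w) p) \<nu> = poly q w"
    using assms(1)
  proof (induction rule: polyop.induct)
    case (const T)
    show ?case by (rule exI[of _ "[:lookup (app T p) \<nu>:]"]) simp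
  next
    case (add S T)
    then obtain q r where "\<forall>w. lookup (app (S w) p) \<nu> = poly q w" "\<forall>w. lookup (app (T w) p) \<nu> = poly r w"
      by blast
    then show ?case by (intro exI[of _ "q + r"]) (simp add: lookup_add)
  next
    case (step T)
    then obtain q where "\<forall>w. lookup (app (T w) p) \<nu> = poly q w" by blast
    then show ?case by (intro exI[of _ "[:0, 1:] * q"]) simp
  qed
  then obtain q where q: "\<And>w. lookup (app (T w) p) \<nu> = poly q w" by blast
  have "range of_nat \<subseteq> {w. poly q w = 0}"
    using assms(2) by (auto simp flip: q)
  then have "infinite {w. poly q w = 0}"
    by (metis infinite_UNIV_char_0 finite_imageD finite_subset inj_of_nat)
  then have "q = 0"
    using poly_roots_finite by blast
  then show "lookup (app (T w) p) \<nu> = lookup (app 0 p) \<nu>"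
    by (simp add: q)
qed

text \<open>Conjugation by the formal power f_k^w in the direction x_k^{-w} T x_k^w; thus \<Theta>_w
  corresponds to the parameter -w.\<close>

definition conj_by :: "int \<Rightarrow> complex \<Rightarrow> alg endo \<Rightarrow> alg endo" where
  "conj_by k w T = mul (X k) (- w) * T * mul (X k) w"

lemma mul_inverse_left: "mul v a * (mul v (- a) * T) = T" "mul v (- a) * (mul v a * T) = T"
  by (simp_all add: mul_inverse flip: mult.assoc)

lemma conj_by_mult: "conj_by k w (S * T) = conj_by k w S * conj_by k w T"
  by (simp add: conj_by_def mult.assoc mul_inverse_left)

lemma conj_by_add: "conj_by k w (S + T) = conj_by k w S + conj_by k w T"
  and conj_by_diff: "conj_by k w (S - T) = conj_by k w S - conj_by k w T"
  and conj_by_zero [simp]: "conj_by k w 0 = 0"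
  by (simp_all add: conj_by_def algebra_simps)

lemma conj_by_sc [simp]: "conj_by k w (sc a) = sc a"
  by (simp add: conj_by_def clin_comm mult.assoc mul_inverse)

lemma conj_by_eq: "T * mul (X k) w = mul (X k) w * S \<Longrightarrow> conj_by k w T = S"
  by (simp add: conj_by_def mult.assoc mul_inverse_left)

lemma conj_by_mul [simp]: "conj_by k w (mul v a) = mul v a"
  by (rule conj_by_eq) (rule mul_commute)

lemma mul_left_commute: "mul u a * (mul v b * T) = mul v b * (mul u a * T)"
proof -
  have "mul u a * mul v b * T = mul v b * mul u a * T"
    by (simp only: mul_commute[of u a v b])
  then show ?thesis by (simp only: mult.assoc)
qed

lemmas mul_ac = mul_commute mul_left_commute mult.assoc

subsection \<open>The operators\<close>

text \<open>J, K and L are the values of h_0, c and d on the vacuum.\<close>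

locale fock =
  fixes J K L :: complex
begin

text \<open>The Heisenberg relations are [a_p, a_{-p}] = 2pK, with the factor (h, h) = 2 of the
  trace form: creation operators for p < 0, the scalar J for p = 0, annihilation operators for p >
  0. The index shift is due to \<open>Y 0\<close> standing for h_{-1}.\<close>

definition a :: "int \<Rightarrow> alg endo" where
  "a p = (if p < 0 then mul (Y (nat (- p - 1))) 1 else if p = 0 then sc J
     else sc (2 * of_int p * K) * pd (Y (nat (p - 1))))"

definition h :: "int \<Rightarrow> alg endo" where "h p = a p - sc 2 * D p"

text \<open>Only half of the derivation in \<open>h\<close> is taken, because \<open>b\<close>
  enters \<open>e\<close> in front of a derivative. Commuting x_n through \<open>e\<close> produces
  b_{m+n} from the derivative and another -D_{m+n} from the coefficients, and b - D = h.\<close>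

definition b :: "int \<Rightarrow> alg endo" where "b p = a p - D p"

text \<open>\<open>e m\<close> is determined by killing the vacuum and \<open>[e\<^sub>m, f\<^sub>n] = h\<^sub>m\<^sub>+\<^sub>n + m \<delta>\<^sub>m\<^sub>,\<^sub>-\<^sub>n K\<close>.\<close>

definition e :: "int \<Rightarrow> alg endo" where
  "e m = SD (\<lambda>k. b (m + k)) + sc (of_int m * K) * pd (X (- m))"

abbreviation f :: "int \<Rightarrow> alg endo" where "f n \<equiv> mul (X n) 1"

definition d :: "alg endo" where "d = dg gd + sc L"

lemma clin_a [simp]: "clin (a p)"
  by (simp add: a_def)

lemma clin_h [simp]: "clin (h p)" and clin_b [simp]: "clin (b p)" and clin_d [simp]: "clin d"
  by (simp_all add: h_def b_def d_def)

lemma clin_e [simp]: "clin (e p)"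
  by (simp add: e_def)

lemmas scl = clin_comm[OF clin_mul] clin_comm[OF clin_pd] clin_comm[OF clin_dg] clin_comm[OF clin_D]
  clin_comm[OF clin_a] clin_comm[OF clin_h] clin_comm[OF clin_b] clin_comm[OF clin_e]

lemma a_neg: "a (- int j - 1) = mul (Y j) 1"
  by (simp add: a_def)

lemma h_0: "h 0 = sc J - sc 2 * dg gX"
  by (simp add: h_def a_def D_0)

lemma pd_Y_a: "pd (Y j) * a p = a p * pd (Y j) + (if p = - int j - 1 then 1 else 0)"
  by (auto simp: a_def pd_mul sc_hom scl pd_commute mult.assoc)

lemma a_commute: "a p * a q = a q * a p + (if p = - q then sc (2 * of_int p * K) else 0)"
proof -
  have *: "a p * a q = a q * a p + (if p = - q then sc (2 * of_int p * K) else 0)" if "p > 0" for p q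
  proof -
    have p: "a p = sc (2 * of_int p * K) * pd (Y (nat (p - 1)))"
      using that by (simp add: a_def)
    have "q = - int (nat (p - 1)) - 1 \<longleftrightarrow> p = - q"
      using that by auto
    then show ?thesis
      unfolding p by (simp add: mult.assoc pd_Y_a distrib_left scl)
  qed
  consider "p > 0" | "q > 0" | "p \<le> 0" "q \<le> 0" by linarith
  then show ?thesis
  proof cases
    case 2
    then show ?thesis
      using *[OF 2, of p] by (auto simp: sc_hom)
  next
    case 3
    then show ?thesis
      by (auto simp: a_def mul_commute scl sc_hom)
  qed (rule *)
qed

lemma pd_X_a: "pd (X k) * a p = a p * pd (X k)"
  by (simp add: a_def pd_mul scl pd_commute mult.assoc)

lemma a_mul_X: "a p * mul (X n) w = mul (X n) w * a p"
  by (simp add: a_def mul_commute scl pd_mul mult.assoc)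

lemma a_D: "a p * D m = D m * a p"
  by (simp add: a_def scl D_mul_Y D_pd_Y mult.assoc)

lemma dg_a: "dg gd * a p = a p * dg gd + sc (of_int p) * a p"
proof (cases "p > 0")
  case True
  then have "gd (Y (nat (p - 1))) = - of_int p"
    by (simp flip: of_nat_Suc)
  then have "dg gd * pd (Y (nat (p - 1))) = pd (Y (nat (p - 1))) * dg gd + sc (of_int p) * pd (Y (nat (p - 1)))"
    using pd_dg[of "Y (nat (p - 1))" gd] by (simp add: sc_hom)
  with True show ?thesis
    by (simp add: a_def scl mult.assoc distrib_left sc_sc mult_ac)
next
  case False
  then show ?thesis
    by (auto simp: a_def scl dg_mul sc_hom)
qed

lemma b_mul_X:
  "b p * mul (X n) w = mul (X n) w * b p - sc w * (mul (X (n + p)) 1 * mul (X n) (w - 1))"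
  by (simp add: b_def left_diff_distrib right_diff_distrib a_mul_X D_mul mult.assoc)

lemma h_mul_X:
  "h p * mul (X n) w = mul (X n) w * h p - sc (2 * w) * (mul (X (n + p)) 1 * mul (X n) (w - 1))"
  by (simp add: h_def left_diff_distrib right_diff_distrib a_mul_X D_mul mult.assoc scl
      distrib_left sc_sc)

lemma h_h: "h p * h q = h q * h p + (if p = - q then sc (2 * of_int p * K) else 0)"
  by (simp add: h_def left_diff_distrib right_diff_distrib a_commute[of p q] a_D D_commute[of p q]
      scl mult.assoc)

text \<open>The derivative contributes b_{m+n} and the commutators of the coefficients contribute
  -D_{m+n}, together h_{m+n}; moving x_n^{w-1} to the left of b_{m+n} leaves the quadratic term. For
  m = -n this is the sl_2 formula for e f^w, with a complex exponent.\<close>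

lemma e_mul_X:
  "e m * mul (X n) w = mul (X n) w * e m
     + sc w * (mul (X n) (w - 1) * h (m + n))
     + (if n = - m then sc (w * of_int m * K) * mul (X n) (w - 1) else 0)
     - sc (w * (w - 1)) * (mul (X (m + 2 * n)) 1 * mul (X n) (w - 2))"
proof -
  have 1: "SD (\<lambda>k. b (m + k)) * mul (X n) w = SD (\<lambda>k. b (m + k) * mul (X n) w)
      + sc w * (b (m + n) * mul (X n) (w - 1))"
    by (simp add: SD_mult_mul mult.assoc)
  have "SD (\<lambda>k. b (m + k) * mul (X n) w)
      = SD (\<lambda>k. mul (X n) w * b (m + k) - (sc w * mul (X n) (w - 1)) * mul (X (k + (m + n))) 1)"
    by (rule arg_cong[of _ _ SD])
      (simp add: fun_eq_iff b_mul_X mult.assoc mul_commute[of "X n" "w - 1"] add_ac)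
  also have "\<dots> = mul (X n) w * SD (\<lambda>k. b (m + k)) - sc w * (mul (X n) (w - 1) * D (m + n))"
    by (simp add: SD_diff SD_mult_left D_def mult.assoc)
  finally have 2: "SD (\<lambda>k. b (m + k) * mul (X n) w) = \<dots>" .
  have "b (m + n) * mul (X n) (w - 1) = mul (X n) (w - 1) * b (m + n)
      - sc (w - 1) * (mul (X (m + 2 * n)) 1 * mul (X n) (w - 2))"
    by (simp add: b_mul_X algebra_simps)
  moreover have "b (m + n) - D (m + n) = h (m + n)"
    by (simp add: b_def h_def sc_numeral mult_2)
  ultimately have 3: "sc w * (b (m + n) * mul (X n) (w - 1)) - sc w * (mul (X n) (w - 1) * D (m + n))
      = sc w * (mul (X n) (w - 1) * h (m + n)) - sc (w * (w - 1)) * (mul (X (m + 2 * n)) 1 * mul (X n) (w - 2))"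
    by (simp add: right_diff_distrib sc_sc flip: \<open>b (m + n) - D (m + n) = h (m + n)\<close>)
  have 4: "sc (of_int m * K) * pd (X (- m)) * mul (X n) w = mul (X n) w * (sc (of_int m * K) * pd (X (- m)))
      + (if n = - m then sc (w * of_int m * K) * mul (X n) (w - 1) else 0)"
    by (simp add: pd_mul mult.assoc distrib_left scl sc_sc mult_ac)
  show ?thesis
    unfolding e_def distrib_right 1 2 4 using 3 by (simp add: algebra_simps)
qed

lemma pd_h: "pd (X k) * h p = h p * pd (X k) - sc 2 * pd (X (k - p))"
  by (simp add: h_def left_diff_distrib right_diff_distrib pd_X_a pd_D scl mult.assoc distrib_left)

lemma b_D: "b p * D m = D m * b p"
  by (simp add: b_def left_diff_distrib right_diff_distrib a_D D_commute)

text \<open>The derivation part of h_p shifts the index of the sum in \<open>e\<close>. The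
  remaining coefficient 2(m + p)K of d/dx_{-m-p} has two sources: 2pK comes from the Heisenberg
  relation, 2mK from the last summand of \<open>e\<close>.\<close>

lemma h_e: "h p * e m = e m * h p + sc 2 * e (m + p)"
proof -
  have 1: "a p * SD (\<lambda>k. b (m + k)) = SD (\<lambda>k. b (m + k)) * a p + sc (2 * of_int p * K) * pd (X (- m - p))"
  proof -
    have "a p * SD (\<lambda>k. b (m + k)) = SD (\<lambda>k. b (m + k) * a p + (if k = - m - p then sc (2 * of_int p * K) else 0))"
      unfolding SD_mult_left
      by (rule arg_cong[of _ _ SD])
        (auto simp: fun_eq_iff b_def left_diff_distrib right_diff_distrib a_D a_commute[of p])
    also have "SD (\<lambda>k. b (m + k) * a p + (if k = - m - p then sc (2 * of_int p * K) else 0))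
        = SD (\<lambda>k. b (m + k)) * a p + sc (2 * of_int p * K) * pd (X (- m - p))"
      by (simp add: SD_add SD_delta SD_mult_right[OF pd_X_a])
    finally show ?thesis .
  qed
  have 2: "SD (\<lambda>k. b (m + k)) * D p = D p * SD (\<lambda>k. b (m + k)) + SD (\<lambda>k. b (m + p + k))"
    by (simp add: SD_mult_right_shift[OF pd_D] SD_mult_left b_D add_ac)
  have 3: "h p * pd (X (- m)) = pd (X (- m)) * h p + sc 2 * pd (X (- m - p))"
    by (simp add: pd_h)
  have "h p * SD (\<lambda>k. b (m + k)) = SD (\<lambda>k. b (m + k)) * h p
      + sc (2 * of_int p * K) * pd (X (- m - p)) + sc 2 * SD (\<lambda>k. b (m + p + k))"
    using 1 2 clin_comm(2)[OF clin_SD[of "\<lambda>k. b (m + k)"]]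
    by (simp add: h_def left_diff_distrib right_diff_distrib mult.assoc scl distrib_left)
  then show ?thesis
    using 3 by (simp add: e_def distrib_left distrib_right mult.assoc scl sc_sc sc_hom algebra_simps)
qed

lemma pd_Y_e: "pd (Y j) * e m = e m * pd (Y j) + pd (X (- int j - 1 - m))"
proof -
  have "pd (Y j) * SD (\<lambda>k. b (m + k)) = SD (\<lambda>k. b (m + k) * pd (Y j) + (if k = - int j - 1 - m then 1 else 0))"
    unfolding SD_mult_left
    by (rule arg_cong[of _ _ SD])
      (auto simp: fun_eq_iff b_def left_diff_distrib right_diff_distrib pd_Y_a D_pd_Y)
  also have "\<dots> = SD (\<lambda>k. b (m + k)) * pd (Y j) + pd (X (- int j - 1 - m))"
    by (simp add: SD_add SD_delta SD_mult_right[OF pd_commute])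
  finally show ?thesis
    by (simp add: e_def distrib_left distrib_right mult.assoc scl pd_commute)
qed

lemma dg_b: "dg gd * b p = b p * dg gd + sc (of_int p) * b p"
  by (simp add: b_def dg_a dg_D left_diff_distrib right_diff_distrib)

lemma dg_h: "dg gd * h p = h p * dg gd + sc (of_int p) * h p"
  by (simp add: h_def dg_a dg_D left_diff_distrib right_diff_distrib scl mult.assoc distrib_left
      sc_sc mult.commute)

lemma dg_e: "dg gd * e m = e m * dg gd + sc (of_int m) * e m"
proof -
  have "SD (\<lambda>k. b (m + k)) * dg gd = SD (\<lambda>k. b (m + k) * (dg gd + sc (of_int k)))"
    by (rule SD_mult_right) (simp add: pd_dg distrib_right)
  also have "\<dots> = SD (\<lambda>k. dg gd * b (m + k) - sc (of_int m) * b (m + k))"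
    by (rule arg_cong[of _ _ SD])
      (simp add: fun_eq_iff dg_b distrib_left scl sc_hom algebra_simps)
  finally have 1: "dg gd * SD (\<lambda>k. b (m + k)) = SD (\<lambda>k. b (m + k)) * dg gd + sc (of_int m) * SD (\<lambda>k. b (m + k))"
    by (simp add: SD_diff SD_mult_left)
  have 2: "dg gd * pd (X (- m)) = pd (X (- m)) * dg gd + sc (of_int m) * pd (X (- m))"
    using pd_dg[of "X (- m)" gd] by (simp add: sc_hom)
  show ?thesis
    by (simp add: e_def distrib_left distrib_right mult.assoc scl sc_sc 1 2) (simp add: mult_ac)
qed

text \<open>The right-hand side is arranged as a polynomial in w whose coefficients are operators
  free of w, the form that \<open>polyop\<close> recognizes.\<close>

lemma conj_e: "conj_by k w (e m) = e m + sc w * (mul (X k) (- 1) * (h (m + k)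
    + (if k = - m then sc (of_int m * K) else 0)))
    - sc w * ((sc w - 1) * (mul (X (m + 2 * k)) 1 * mul (X k) (- 2)))"
proof (rule conj_by_eq)
  have m: "mul (X k) (w - 1) = mul (X k) w * mul (X k) (- 1)"
    "mul (X k) (w - 2) = mul (X k) w * mul (X k) (- 2)" for k
    by (simp_all flip: mul_add)
  show "e m * mul (X k) w = mul (X k) w * (e m + sc w * (mul (X k) (- 1) * (h (m + k)
    + (if k = - m then sc (of_int m * K) else 0)))
    - sc w * ((sc w - 1) * (mul (X (m + 2 * k)) 1 * mul (X k) (- 2))))"
    by (simp add: e_mul_X m right_diff_distrib left_diff_distrib distrib_left scl sc_sc sc_hom
        mul_ac)
qed

lemma conj_h: "conj_by k w (h p) = h p - sc w * (2 * mul (X (k + p)) 1 * mul (X k) (- 1))"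
proof (rule conj_by_eq)
  have m: "mul (X k) (w - 1) = mul (X k) w * mul (X k) (- 1)"
    by (simp flip: mul_add)
  show "h p * mul (X k) w = mul (X k) w * (h p - sc w * (2 * mul (X (k + p)) 1 * mul (X k) (- 1)))"
    by (simp add: h_mul_X m right_diff_distrib scl sc_sc mul_ac mult.commute[of 2] flip: sc_numeral)
qed

lemma polyop_conj_e: "polyop (\<lambda>w. conj_by k w (e m))"
  unfolding conj_e by (intro polyop.add polyop_diff polyop.step polyop.const polyop_mult polyop_id) simp_all

lemma polyop_conj_h: "polyop (\<lambda>w. conj_by k w (h m))"
  unfolding conj_h by (intro polyop.add polyop_diff polyop.step polyop.const) (simp_all flip: sc_numeral)

lemma e_kills:
  assumes "\<And>k. lookup \<mu> (X k) = 0"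
  shows "app (e m) (single \<mu> c) = 0"
proof -
  have "app (SD G) (single \<mu> c) = 0" for G
    by (simp add: SD.rep_eq assms)
  then show ?thesis by (simp add: e_def assms)
qed

lemma e_f: "e m * f n = f n * e m + h (m + n) + (if n = - m then sc (of_int m * K) else 0)"
  by (simp add: e_mul_X sc_hom)

text \<open>The commutator \<open>Z\<close> of two operators \<open>e\<close> commutes with every \<open>x\<^sub>k\<close>, hence with every \<open>x\<^sub>k\<^sup>w\<close> because
  \<open>x\<^sub>k\<^sup>-\<^sup>w Z x\<^sub>k\<^sup>w\<close> is polynomial in \<open>w\<close>; and it vanishes on monomials without \<open>X\<close>.\<close>

lemma e_e: "e m * e n = e n * e m"
proof -
  define Z where "Z = e m * e n - e n * e m"
  have "e m * e n * f k = f k * (e m * e n) + h (m + k) * e n + e m * h (n + k)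
      + ((if k = - m then sc (of_int m * K) else 0) * e n + e m * (if k = - n then sc (of_int n * K) else 0))" for k m n
    by (simp add: mult.assoc e_f distrib_left) (simp add: e_f distrib_right flip: mult.assoc)
  then have Z1: "Z * f k = f k * Z" for k
    by (simp add: Z_def left_diff_distrib right_diff_distrib h_e algebra_simps scl)
  have nat: "conj_by k (of_nat j) Z = Z" for k j
  proof (rule conj_by_eq, induction j)
    case (Suc j)
    have "Z * mul (X k) (of_nat (Suc j)) = Z * (f k * mul (X k) (of_nat j))"
      by (simp flip: mul_add)
    also have "\<dots> = f k * (Z * mul (X k) (of_nat j))"
      by (simp add: Z1 flip: mult.assoc)
    also have "\<dots> = f k * (mul (X k) (of_nat j) * Z)"
      by (simp only: Suc)
    finally show ?case by (simp add: mul_add mult.assoc)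
  qed simp
  have "polyop (\<lambda>w. conj_by k w Z - Z)" for k
    unfolding Z_def conj_by_diff conj_by_mult
    by (intro polyop_diff polyop_mult polyop_conj_e polyop.const) simp_all
  then have conj: "conj_by k w Z = Z" for k w
    using polyop_vanish[of "\<lambda>w. conj_by k w Z - Z" w] nat by simp
  have Zw: "Z * mul (X k) w = mul (X k) w * Z" for k w
  proof -
    have "mul (X k) w * conj_by k w Z = Z * mul (X k) w"
      by (simp add: conj_by_def mult.assoc mul_inverse_left)
    then show ?thesis by (simp add: conj)
  qed
  \<comment> \<open>The number of x-variables in the monomial decreases in each step, because a
    whole power with complex exponent is split off at once.\<close>
  have "app Z (single \<mu> c) = 0" for \<mu> c
  proof (induction "card (X -` keys \<mu>)" arbitrary: \<mu> rule: less_induct)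
    case less
    show ?case
    proof (cases "X -` keys \<mu> = {}")
      case True
      then have "lookup \<mu> (X k) = 0" for k by (auto simp: in_keys_iff)
      then show ?thesis by (simp add: Z_def e_kills)
    next
      case False
      then obtain k where k: "X k \<in> keys \<mu>" by auto
      define \<nu> where "\<nu> = \<mu> - single (X k) (lookup \<mu> (X k))"
      have look: "lookup \<nu> v = (if v = X k then 0 else lookup \<mu> v)" for v
        by (simp add: \<nu>_def lookup_minus lookup_single when_def)
      have "X -` keys \<nu> \<subseteq> X -` keys \<mu>" "k \<in> X -` keys \<mu> - X -` keys \<nu>"
        using k by (auto simp: in_keys_iff look split: if_splits)
      then have "X -` keys \<nu> \<subset> X -` keys \<mu>" by blast
      then have "card (X -` keys \<nu>) < card (X -` keys \<mu>)"
        by (intro psubset_card_mono) (simp_all add: finite_vimageI inj_def)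
      then have "app Z (single \<nu> c) = 0" by (rule less)
      moreover have "single \<mu> c = app (mul (X k) (lookup \<mu> (X k))) (single \<nu> c)"
        by (simp add: \<nu>_def)
      ultimately show ?thesis
        using arg_cong[OF Zw, of "\<lambda>T. app T (single \<nu> c)"] by simp
    qed
  qed
  then have "Z = 0" by (intro endo_eq_singles) simp
  then show ?thesis by (simp add: Z_def)
qed

subsection \<open>The representation\<close>

end

section \<open>Coordinates on sl_2 and the verification of the bracket relations\<close>

lift_definition sl2_ce :: "sl2 \<Rightarrow> complex" is "\<lambda>A. A $ 1 $ 2" .
lift_definition sl2_cf :: "sl2 \<Rightarrow> complex" is "\<lambda>A. A $ 2 $ 1" .
lift_definition sl2_ch :: "sl2 \<Rightarrow> complex" is "\<lambda>A. A $ 1 $ 1" .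

lemma sl2_coord_add [simp]: "sl2_ce (x + y) = sl2_ce x + sl2_ce y" "sl2_cf (x + y) = sl2_cf x + sl2_cf y"
  "sl2_ch (x + y) = sl2_ch x + sl2_ch y"
  by (transfer, simp)+

lemma sl2_coord_scale [simp]: "sl2_ce (c *\<^sub>C y) = c * sl2_ce y" "sl2_cf (c *\<^sub>C y) = c * sl2_cf y"
  "sl2_ch (c *\<^sub>C y) = c * sl2_ch y"
  by (transfer, simp)+

lemma sl2_coord_zero [simp]: "sl2_ce 0 = 0" "sl2_cf 0 = 0" "sl2_ch 0 = 0"
  by (transfer, simp)+

lemma sl2_coord_basis [simp]: "sl2_ce sl2_e = 1" "sl2_cf sl2_e = 0" "sl2_ch sl2_e = 0"
  "sl2_ce sl2_f = 0" "sl2_cf sl2_f = 1" "sl2_ch sl2_f = 0"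
  "sl2_ce sl2_h = 0" "sl2_cf sl2_h = 0" "sl2_ch sl2_h = 1"
  by (transfer, simp)+

lemma sl2_coord_lie [simp]:
  "sl2_ce (lie x y) = 2 * (sl2_ch x * sl2_ce y - sl2_ce x * sl2_ch y)"
  "sl2_cf (lie x y) = - 2 * (sl2_ch x * sl2_cf y - sl2_cf x * sl2_ch y)"
  "sl2_ch (lie x y) = sl2_ce x * sl2_cf y - sl2_cf x * sl2_ce y"
proof -
  have tr: "A $ 2 $ 2 = - (A $ 1 $ 1)" if "trace A = 0" for A :: "complex^2^2"
    using that by (simp add: trace_def sum_2 add_eq_0_iff)
  show "sl2_ce (lie x y) = 2 * (sl2_ch x * sl2_ce y - sl2_ce x * sl2_ch y)"
    by transfer (simp add: matrix_matrix_mult_def sum_2 tr algebra_simps)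
  show "sl2_cf (lie x y) = - 2 * (sl2_ch x * sl2_cf y - sl2_cf x * sl2_ch y)"
    by transfer (simp add: matrix_matrix_mult_def sum_2 tr algebra_simps)
  show "sl2_ch (lie x y) = sl2_ce x * sl2_cf y - sl2_cf x * sl2_ce y"
    by transfer (simp add: matrix_matrix_mult_def sum_2 tr algebra_simps)
qed

lemma sl2_form_coord:
  "sl2_form x y = 2 * sl2_ch x * sl2_ch y + sl2_ce x * sl2_cf y + sl2_cf x * sl2_ce y"
proof -
  have tr: "A $ 2 $ 2 = - (A $ 1 $ 1)" if "trace A = 0" for A :: "complex^2^2"
    using that by (simp add: trace_def sum_2 add_eq_0_iff)
  show ?thesis
    by transfer (subst trace_def, simp add: matrix_matrix_mult_def sum_2 tr algebra_simps)
qed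

lemma sl2_eqI: "sl2_ce x = sl2_ce y \<Longrightarrow> sl2_cf x = sl2_cf y \<Longrightarrow> sl2_ch x = sl2_ch y \<Longrightarrow> x = y"
  by (transfer, simp add: vec_eq_iff forall_2 sum_2 trace_def add_eq_0_iff)

context fock
begin

definition rho1 :: "int \<Rightarrow> sl2 \<Rightarrow> alg endo" where
  "rho1 m x = sc (sl2_ce x) * e m + sc (sl2_cf x) * f m + sc (sl2_ch x) * h m"

definition rho_loop :: "(int \<Rightarrow>\<^sub>0 sl2) \<Rightarrow> alg endo" where
  "rho_loop x = (\<Sum>m\<in>keys x. rho1 m (lookup x m))"

definition rho :: "affine \<Rightarrow> alg endo" where
  "rho x = rho_loop (loop x) + sc (central x * K) + sc (deriv x) * d"

lemma rho1_add: "rho1 m (x + y) = rho1 m x + rho1 m y"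
  and rho1_zero [simp]: "rho1 m 0 = 0"
  and rho1_scale: "rho1 m (c *\<^sub>C x) = sc c * rho1 m x"
  and clin_rho1 [simp]: "clin (rho1 m x)"
  by (simp_all add: rho1_def sc_hom sc_sc distrib_left distrib_right)

lemma rho_loop_add: "rho_loop (x + y) = rho_loop x + rho_loop y"
  unfolding rho_loop_def by (rule sum_keys_add) (simp_all add: rho1_add)

lemma rho_loop_single [simp]: "rho_loop (single m x) = rho1 m x"
  and rho_loop_zero [simp]: "rho_loop 0 = 0"
  by (cases "x = 0"; simp add: rho_loop_def)+

lemma clin_rho_loop [simp]: "clin (rho_loop x)"
  by (induction x rule: loop_induct) (simp_all add: rho_loop_add)

lemma rho_loop_scale: "rho_loop (loop_scale c x) = sc c * rho_loop x"
  by (induction x rule: loop_induct)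
    (simp_all add: rho_loop_add rho1_scale loop_scale_add_right distrib_left)

lemma rho_loop_uminus: "rho_loop (- x) = - rho_loop x"
  using rho_loop_add[of x "- x"] by (simp add: eq_neg_iff_add_eq_0 add.commute)

lemma clin_rho [simp]: "clin (rho x)"
  by (simp add: rho_def)

lemma f_h: "h p * f m = f m * h p - sc 2 * f (m + p)"
  by (simp add: h_mul_X)

text \<open>Bilinearity reduces the claim to pure tensors a t^m and b t^n. There, expansion in the
  coordinates of sl_2 leaves the six commutation relations among \<open>e\<close>, \<open>f\<close>
  and \<open>h\<close>; \<open>loop_cocycle\<close> collects the scalar terms.\<close>

lemma rho_loop_lie:
  "rho_loop (loop_lie x y) + sc (loop_cocycle x y * K) = rho_loop x * rho_loop y - rho_loop y * rho_loop x"
proof (induction x rule: loop_induct)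
  case (single m u)
  show ?case
  proof (induction y rule: loop_induct)
    case (single n v)
    have hh: "h m * h n = h n * h m + (if m = - n then sc (2 * of_int m * K) else 0)"
      by (rule h_h)
    have ee: "e m * e n = e n * e m" by (rule e_e)
    have ff: "f m * f n = f n * f m" by (rule mul_commute)
    have he: "h m * e n = e n * h m + sc 2 * e (m + n)" "h n * e m = e m * h n + sc 2 * e (m + n)"
      using h_e[of m n] h_e[of n m] by (simp_all add: add.commute)
    have hf: "h m * f n = f n * h m - sc 2 * f (m + n)" "h n * f m = f m * h n - sc 2 * f (m + n)"
      using f_h[of m n] f_h[of n m] by (simp_all add: add.commute)
    have ef: "e m * f n = f n * e m + h (m + n) + (if m = - n then sc (of_int m * K) else 0)"
      "e n * f m = f m * e n + h (m + n) - (if m = - n then sc (of_int m * K) else 0)"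
      using e_f[of m n] e_f[of n m] by (auto simp: add.commute sc_hom)
    show ?case
      unfolding loop_lie_single loop_cocycle_single rho_loop_single rho1_def
      by (simp add: distrib_left distrib_right mult.assoc scl sc_sc left_diff_distrib right_diff_distrib
          hh ee ff he hf ef sl2_form_coord sc_hom)
         (simp add: algebra_simps sc_hom)
  next
    case (add x y)
    show ?case
      using arg_cong2[of _ _ _ _ "(+)", OF add.IH]
      by (simp add: loop_lie_add_right loop_cocycle_add_right rho_loop_add sc_hom algebra_simps)
  qed (simp add: sc_hom)
next
  case (add x y)
  show ?case
    using arg_cong2[of _ _ _ _ "(+)", OF add.IH]
    by (simp add: loop_lie_add_left loop_cocycle_add_left rho_loop_add sc_hom algebra_simps)
qed (simp add: sc_hom)

lemma rho_loop_deriv: "d * rho_loop x = rho_loop x * d + rho_loop (loop_deriv x)"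
proof (induction x rule: loop_induct)
  case (single m u)
  have "d * e m = e m * d + sc (of_int m) * e m" "d * h m = h m * d + sc (of_int m) * h m"
    "d * f m = f m * d + sc (of_int m) * f m"
    by (simp_all add: d_def distrib_left distrib_right dg_e dg_h dg_mul scl)
  then show ?case
    by (simp add: rho1_def distrib_left distrib_right scl clin_comm[OF clin_d] mult.assoc sc_sc mult_ac)
qed (simp_all add: rho_loop_add loop_deriv_add algebra_simps)

lemma rho_add: "rho (x + y) = rho x + rho y"
  by (simp add: rho_def plus_affine_def rho_loop_add sc_hom algebra_simps)

lemma rho_scale: "rho (c *\<^sub>C x) = sc c * rho x"
  by (simp add: rho_def scaleC_affine_def rho_loop_scale sc_sc distrib_left mult.assoc)

lemma rho_lie: "rho (lie x y) = rho x * rho y - rho y * rho x"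
proof -
  let ?u = "loop x" and ?v = "loop y" and ?s = "deriv x" and ?t = "deriv y"
  note cl = clin_comm[OF clin_rho_loop] clin_comm[OF clin_d]
  have "rho (lie x y) = rho_loop ?u * rho_loop ?v - rho_loop ?v * rho_loop ?u
      + sc ?s * rho_loop (loop_deriv ?v) - sc ?t * rho_loop (loop_deriv ?u)"
    using rho_loop_add[of "loop_lie ?u ?v + loop_scale ?s (loop_deriv ?v)" "- loop_scale ?t (loop_deriv ?u)"]
    by (simp add: rho_def lie_affine_def rho_loop_add rho_loop_uminus rho_loop_scale sc_hom
        flip: rho_loop_lie)
  also have "rho_loop (loop_deriv ?v) = d * rho_loop ?v - rho_loop ?v * d"
    by (simp add: rho_loop_deriv)
  also have "rho_loop (loop_deriv ?u) = d * rho_loop ?u - rho_loop ?u * d"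
    by (simp add: rho_loop_deriv)
  finally show ?thesis
    by (simp add: rho_def distrib_left distrib_right right_diff_distrib cl mult.assoc sc_sc mult_ac)
qed

lemma rho_e [simp]: "rho (e_vec m) = e m" and rho_f [simp]: "rho (f_vec m) = f m"
  and rho_h [simp]: "rho (h_vec m) = h m" and rho_c [simp]: "rho c_vec = sc K"
  and rho_d [simp]: "rho d_vec = d"
  by (simp_all add: rho_def e_vec_def f_vec_def h_vec_def c_vec_def d_vec_def loop_vec_def rho1_def sc_hom)

end


section \<open>Subspaces spanned by monomials\<close>

definition span_on :: "expo set \<Rightarrow> alg set" where "span_on K = {p. keys p \<subseteq> K}"

lemma span_on_zero [simp]: "0 \<in> span_on K"
  and span_on_add: "p \<in> span_on K \<Longrightarrow> q \<in> span_on K \<Longrightarrow> p + q \<in> span_on K"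
  and span_on_diff: "p \<in> span_on K \<Longrightarrow> q \<in> span_on K \<Longrightarrow> p - q \<in> span_on K"
  and span_on_single: "\<mu> \<in> K \<Longrightarrow> single \<mu> c \<in> span_on K"
  and span_on_mono: "p \<in> span_on K \<Longrightarrow> K \<subseteq> K' \<Longrightarrow> p \<in> span_on K'"
  using keys_add[of p q] keys_diff[of p q] by (auto simp: span_on_def)

lemma span_on_sc: "p \<in> span_on K \<Longrightarrow> app (sc c) p \<in> span_on K"
  by (auto simp: span_on_def in_keys_iff)

lemma sc_cancel: "c \<noteq> 0 \<Longrightarrow> app (sc (inverse c)) (app (sc c) p) = p"
  by (rule poly_mapping_eqI) simp

lemma span_on_sum: "(\<And>j. j \<in> A \<Longrightarrow> g j \<in> span_on K) \<Longrightarrow> sum g A \<in> span_on K"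
  by (induction A rule: infinite_finite_induct) (simp_all add: span_on_add)

lemma span_on_induct [consumes 1, case_names zero single add]:
  assumes "p \<in> span_on K" "P 0" "\<And>\<mu> c. \<mu> \<in> K \<Longrightarrow> P (single \<mu> c)"
    "\<And>p q. P p \<Longrightarrow> P q \<Longrightarrow> P (p + q)"
  shows "P p"
  using assms unfolding span_on_def by (metis (mono_tags, lifting) mem_Collect_eq poly_mapping_keys_induct)

lemma clin_span_on:
  assumes "clin T" "\<And>\<mu>. \<mu> \<in> K \<Longrightarrow> app T (single \<mu> 1) \<in> span_on K'" "p \<in> span_on K"
  shows "app T p \<in> span_on K'"
  using assms(3)
proof (induction rule: span_on_induct)
  case (single \<mu> c)
  then show ?case using assms(1,2) clin_single span_on_sc by metis
qed (simp_all add: app_add_right span_on_add)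

lemma pd_single_span: "(lookup \<mu> v \<noteq> 0 \<Longrightarrow> \<mu> - single v 1 \<in> K) \<Longrightarrow> app (pd v) (single \<mu> c) \<in> span_on K"
  by (cases "lookup \<mu> v = 0") (simp_all add: span_on_single)

lemma SD_span:
  assumes "\<And>k. app (G k) (app (pd (X k)) p) \<in> span_on K"
  shows "app (SD G) p \<in> span_on K"
  unfolding SD.rep_eq using assms by (intro span_on_sum)

lemma lookup_pd: "lookup (app (pd v) p) \<mu> = (lookup \<mu> v + 1) * lookup p (\<mu> + single v 1)"
proof (induction p rule: poly_mapping_induct)
  case (single \<nu> c)
  have "\<nu> - single v 1 = \<mu> \<longleftrightarrow> \<nu> = \<mu> + single v 1" by (auto simp: algebra_simps)
  then show ?case by (auto simp: lookup_single when_def lookup_add)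
qed (simp_all add: app_add_right lookup_add distrib_left)

lemma pd_eq_0_iff: "app (pd v) p = 0 \<longleftrightarrow> (\<forall>\<mu>\<in>keys p. lookup \<mu> v = 0)"
proof
  assume *: "app (pd v) p = 0"
  show "\<forall>\<mu>\<in>keys p. lookup \<mu> v = 0"
  proof
    fix \<mu> assume "\<mu> \<in> keys p"
    then show "lookup \<mu> v = 0"
      using arg_cong[OF *, of "\<lambda>q. lookup q (\<mu> - single v 1)"]
      by (simp add: lookup_pd lookup_minus in_keys_iff)
  qed
next
  assume *: "\<forall>\<mu>\<in>keys p. lookup \<mu> v = 0"
  show "app (pd v) p = 0"
    by (simp add: pd.rep_eq *)
qed

lemma lookup_mul: "lookup (app (mul v w) p) \<mu> = lookup p (\<mu> - single v w)"
proof (induction p rule: poly_mapping_induct)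
  case (single \<nu> c)
  show ?case by (auto simp: lookup_single when_def)
qed (simp_all add: app_add_right lookup_add)

lemma mul_cancel [simp]: "app (mul v w) (app (mul v (- w)) p) = p" "app (mul v (- w)) (app (mul v w) p) = p"
  using arg_cong[OF mul_inverse(1), of "\<lambda>T. app T p"] arg_cong[OF mul_inverse(2), of "\<lambda>T. app T p"] by simp_all

lemma mul_eq_0 [simp]: "app (mul v w) p = 0 \<longleftrightarrow> p = 0"
  by (metis app_zero_right mul_cancel(2))

lemma app_mul_add: "app (mul v w) (app (mul v u) p) = app (mul v (w + u)) p"
  by (simp add: mul_add)

text \<open>Applying [dg g, T] = r T to a monomial of degree s and comparing coefficients shows that
  only monomials of degree s + r occur in its image. The set of degrees is arbitrary, so that bounds
  on degrees can be carried along.\<close>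

lemma wt_graded:
  assumes "clin T" "dg g * T = T * dg g + sc r * T" "p \<in> span_on {\<mu>. wt g \<mu> \<in> S}"
  shows "app T p \<in> span_on {\<mu>. wt g \<mu> - r \<in> S}"
proof (rule clin_span_on[OF assms(1) _ assms(3)])
  fix \<mu> assume "\<mu> \<in> {\<mu>. wt g \<mu> \<in> S}"
  have "app (dg g) (app T (single \<mu> 1)) = app T (single \<mu> (wt g \<mu>)) + app (sc r) (app T (single \<mu> 1))"
    using arg_cong[OF assms(2), of "\<lambda>T. app T (single \<mu> 1)"] by simp
  also have "app T (single \<mu> (wt g \<mu>)) = app (sc (wt g \<mu>)) (app T (single \<mu> 1))"
    by (rule clin_single[OF assms(1)])
  finally have "wt g \<nu> * lookup (app T (single \<mu> 1)) \<nu> = (wt g \<mu> + r) * lookup (app T (single \<mu> 1)) \<nu>" for \<nu>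
    by (metis distrib_right lookup_add lookup_dg lookup_sc)
  then have "wt g \<nu> = wt g \<mu> + r" if "\<nu> \<in> keys (app T (single \<mu> 1))" for \<nu>
    using that by (metis in_keys_iff mult_right_cancel)
  then show "app T (single \<mu> 1) \<in> span_on {\<mu>. wt g \<mu> - r \<in> S}"
    using \<open>\<mu> \<in> _\<close> by (auto simp: span_on_def)
qed

definition allowed :: "(var \<Rightarrow> complex set) \<Rightarrow> expo set" where
  "allowed G = {\<mu>. \<forall>v. lookup \<mu> v \<in> G v}"

text \<open>Monomials of the Verma module, of its twisted localization, and of the quotient
  of the localization by the Verma module.\<close>

definition EV :: "expo set" where "EV = allowed (\<lambda>_. \<nat>)"

definition ET :: "int \<Rightarrow> complex \<Rightarrow> expo set" where
  "ET i z = allowed (\<lambda>v. if v = X i then {c. c - z \<in> \<int>} else \<nat>)"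

definition EQ :: "int \<Rightarrow> expo set" where "EQ i = ET i 0 - EV"

lemma ET_iff: "\<mu> \<in> ET i z \<longleftrightarrow> lookup \<mu> (X i) - z \<in> \<int> \<and> (\<forall>v. v \<noteq> X i \<longrightarrow> lookup \<mu> v \<in> \<nat>)"
  by (auto simp: ET_def allowed_def)

lemma EV_iff: "\<mu> \<in> EV \<longleftrightarrow> (\<forall>v. lookup \<mu> v \<in> \<nat>)"
  by (auto simp: EV_def allowed_def)

lemma ET_EV: "\<mu> \<in> ET i z \<Longrightarrow> lookup \<mu> (X i) \<in> \<nat> \<Longrightarrow> \<mu> \<in> EV"
  unfolding ET_iff EV_iff by metis

lemma EV_ET: "EV \<subseteq> ET i 0"
proof -
  have "c \<in> \<int>" if "c \<in> \<nat>" for c :: complex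
    using that by (auto elim!: Nats_cases)
  then show ?thesis by (auto simp: ET_iff EV_iff)
qed

lemma EQ_iff: "\<mu> \<in> EQ i \<longleftrightarrow> \<mu> \<in> ET i 0 \<and> lookup \<mu> (X i) \<notin> \<nat>"
  unfolding EQ_def using ET_EV EV_iff by blast

lemma ET_cong: "z - z' \<in> \<int> \<Longrightarrow> ET i z = ET i z'"
proof -
  have "c - z \<in> \<int> \<longleftrightarrow> c - z' \<in> \<int>" if "z - z' \<in> \<int>" for c
    using Ints_add[OF _ that, of "c - z"] Ints_diff[OF _ that, of "c - z'"] by auto
  then show "z - z' \<in> \<int> \<Longrightarrow> ET i z = ET i z'"
    by (auto simp: ET_iff)
qed

lemma ET_decompose:
  assumes "\<mu> \<in> ET i z"
  obtains \<nu> where "\<mu> = single (X i) (lookup \<mu> (X i)) + \<nu>" "\<nu> \<in> EV" "lookup \<nu> (X i) = 0"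
proof
  show "\<mu> = single (X i) (lookup \<mu> (X i)) + (\<mu> - single (X i) (lookup \<mu> (X i)))" by simp
qed (use assms in \<open>auto simp: ET_iff EV_iff lookup_minus lookup_single when_def\<close>)

lemma sum_Nats: "(\<And>x. x \<in> A \<Longrightarrow> g x \<in> \<nat>) \<Longrightarrow> sum g A \<in> \<nat>"
  by (induction A rule: infinite_finite_induct) simp_all

lemma wt_Nats:
  assumes "\<mu> \<in> EV"
  shows "wt gX \<mu> \<in> \<nat>" "wt gY \<mu> \<in> \<nat>"
  unfolding wt_def
  by (intro sum_Nats; use assms in \<open>auto simp: EV_iff gX_def gY_def split: var.splits\<close>)+

lemma ET_wt: "\<mu> \<in> ET i z \<Longrightarrow> wt gX \<mu> - lookup \<mu> (X i) \<in> \<nat>"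
  by (elim ET_decompose) (metis add_diff_cancel_left' g_simps(1) mult_1 wt_Nats(1) wt_add wt_single)

text \<open>Stability under multiplication by variables and under derivatives. Lowering is not
  demanded at 0, where the derivative vanishes; thus both \<nat> and a class z + \<int>
  qualify.\<close>

locale good_exponents =
  fixes G :: "var \<Rightarrow> complex set"
  assumes up: "c \<in> G v \<Longrightarrow> c + 1 \<in> G v"
    and down: "c \<in> G v \<Longrightarrow> c \<noteq> 0 \<Longrightarrow> c - 1 \<in> G v"
begin

lemma mul_allowed: "p \<in> span_on (allowed G) \<Longrightarrow> app (mul v 1) p \<in> span_on (allowed G)"
  by (erule clin_span_on[rotated -1])
    (use up in \<open>auto simp: allowed_def lookup_add lookup_single when_def add.commute[of 1] intro!: span_on_single\<close>)

lemma pd_allowed: "p \<in> span_on (allowed G) \<Longrightarrow> app (pd v) p \<in> span_on (allowed G)"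
  by (erule clin_span_on[rotated -1])
    (use down in \<open>auto simp: allowed_def lookup_minus lookup_single when_def simp del: app_pd_single intro!: pd_single_span\<close>)

lemma D_allowed: "p \<in> span_on (allowed G) \<Longrightarrow> app (D m) p \<in> span_on (allowed G)"
  unfolding D_def by (intro SD_span mul_allowed pd_allowed)

end

interpretation EV: good_exponents "\<lambda>_. \<nat>"
proof
  fix c :: complex
  assume "c \<in> \<nat>" "c \<noteq> 0"
  then obtain n where "c = of_nat (Suc n)" by (metis Nats_cases not0_implies_Suc of_nat_0)
  then show "c - 1 \<in> \<nat>" by simp
qed simp

interpretation ET: good_exponents "\<lambda>v. if v = X i then {c. c - z \<in> \<int>} else \<nat>" for i z
proof
  fix c :: complex and v
  assume c: "c \<in> (if v = X i then {c. c - z \<in> \<int>} else \<nat>)"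
  then show "c + 1 \<in> (if v = X i then {c. c - z \<in> \<int>} else \<nat>)"
    using Ints_add[of "c - z" 1] by (auto simp: algebra_simps split: if_splits)
  show "c - 1 \<in> (if v = X i then {c. c - z \<in> \<int>} else \<nat>)" if "c \<noteq> 0"
    using c that Ints_diff[of "c - z" 1] EV.down by (auto simp: algebra_simps split: if_splits)
qed

context fock
begin

lemma a_allowed: "good_exponents G \<Longrightarrow> p \<in> span_on (allowed G) \<Longrightarrow> app (a q) p \<in> span_on (allowed G)"
  by (simp add: a_def good_exponents.mul_allowed good_exponents.pd_allowed span_on_sc)

lemma h_allowed: "good_exponents G \<Longrightarrow> p \<in> span_on (allowed G) \<Longrightarrow> app (h q) p \<in> span_on (allowed G)"
  by (simp add: h_def a_allowed good_exponents.D_allowed span_on_sc span_on_diff)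

lemma e_allowed: "good_exponents G \<Longrightarrow> p \<in> span_on (allowed G) \<Longrightarrow> app (e q) p \<in> span_on (allowed G)"
  unfolding e_def b_def
  by (auto intro!: span_on_add SD_span span_on_sc span_on_diff simp: a_allowed good_exponents.D_allowed good_exponents.pd_allowed)

lemma dg_span: "p \<in> span_on S \<Longrightarrow> app (dg g) p \<in> span_on S"
  by (auto simp: span_on_def in_keys_iff)

lemma d_span: "p \<in> span_on S \<Longrightarrow> app d p \<in> span_on S"
  by (simp add: d_def dg_span span_on_add span_on_sc)

text \<open>Submodules of the space of all generalized polynomials, not confined to one module. The
  modules of the statement appear as subspaces such as \<open>span_on EV\<close> or as
  subquotients.\<close>

definition gsub :: "alg set \<Rightarrow> bool" where
  "gsub N \<longleftrightarrow> 0 \<in> N \<and> (\<forall>p\<in>N. \<forall>q\<in>N. p + q \<in> N) \<and> (\<forall>c. \<forall>p\<in>N. app (sc c) p \<in> N)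
     \<and> (\<forall>x. \<forall>p\<in>N. app (rho x) p \<in> N)"

lemma gsubD:
  assumes "gsub N"
  shows "0 \<in> N" "p \<in> N \<Longrightarrow> q \<in> N \<Longrightarrow> p + q \<in> N" "p \<in> N \<Longrightarrow> app (sc c) p \<in> N"
    "p \<in> N \<Longrightarrow> app (rho x) p \<in> N" "p \<in> N \<Longrightarrow> app (e m) p \<in> N" "p \<in> N \<Longrightarrow> app (f m) p \<in> N"
    "p \<in> N \<Longrightarrow> app (h m) p \<in> N" "p \<in> N \<Longrightarrow> app d p \<in> N" "p \<in> N \<Longrightarrow> q \<in> N \<Longrightarrow> p - q \<in> N"
proof -
  show *: "0 \<in> N" "p \<in> N \<Longrightarrow> q \<in> N \<Longrightarrow> p + q \<in> N" "p \<in> N \<Longrightarrow> app (sc c) p \<in> N"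
    "p \<in> N \<Longrightarrow> app (rho x) p \<in> N" for p q c x
    using assms by (auto simp: gsub_def)
  show "p \<in> N \<Longrightarrow> app (e m) p \<in> N" "p \<in> N \<Longrightarrow> app (f m) p \<in> N"
    "p \<in> N \<Longrightarrow> app (h m) p \<in> N" "p \<in> N \<Longrightarrow> app d p \<in> N"
    using *(4)[of p "e_vec m"] *(4)[of p "f_vec m"] *(4)[of p "h_vec m"] *(4)[of p d_vec] by simp_all
  show "p \<in> N \<Longrightarrow> q \<in> N \<Longrightarrow> p - q \<in> N"
    using *(2)[of p "app (sc (- 1)) q"] *(3)[of q "- 1"] by (simp add: sc_hom)
qed

lemma gsubI:
  assumes "0 \<in> N" and add: "\<And>p q. p \<in> N \<Longrightarrow> q \<in> N \<Longrightarrow> p + q \<in> N"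
    and sc: "\<And>c p. p \<in> N \<Longrightarrow> app (sc c) p \<in> N"
    and "\<And>m p. p \<in> N \<Longrightarrow> app (e m) p \<in> N" "\<And>m p. p \<in> N \<Longrightarrow> app (f m) p \<in> N"
    "\<And>m p. p \<in> N \<Longrightarrow> app (h m) p \<in> N" and d: "\<And>p. p \<in> N \<Longrightarrow> app d p \<in> N"
  shows "gsub N"
proof -
  have rho1: "app (rho1 m x) p \<in> N" if "p \<in> N" for m x p
    using that by (simp add: rho1_def assms)
  have "app (rho_loop x) p \<in> N" if "p \<in> N" for x p
    using that by (induction x rule: loop_induct) (simp_all add: rho_loop_add assms rho1)
  then show ?thesis
    unfolding gsub_def by (simp add: assms rho_def)
qed

lemma gsub_span:
  assumes "good_exponents G"
  shows "gsub (span_on (allowed G))"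
  by (rule gsubI)
    (simp_all add: span_on_add span_on_sc d_span e_allowed h_allowed good_exponents.mul_allowed assms)

lemma gsub_EV: "gsub (span_on EV)" and gsub_ET: "gsub (span_on (ET i z))"
  unfolding EV_def ET_def
  by (intro gsub_span EV.good_exponents_axioms ET.good_exponents_axioms)+

lemma gsub_zero: "gsub {0}"
  by (simp add: gsub_def)

text \<open>Read off from [h_0, e_m] = 2 e_m, because \<open>h 0\<close> is J minus twice the degree
  operator; the common factor 2 is cancelled at the end.\<close>

lemma dgX_e: "dg gX * e m = e m * dg gX + sc (- 1) * e m"
proof -
  have "sc 2 * (dg gX * e m) = sc 2 * (e m * dg gX + sc (- 1) * e m)"
    using h_e[of 0 m] by (simp add: h_0 left_diff_distrib right_diff_distrib scl mult.assoc sc_hom distrib_left algebra_simps)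
  then have "sc (1/2) * (sc 2 * (dg gX * e m)) = sc (1/2) * (sc 2 * (e m * dg gX + sc (- 1) * e m))" by simp
  then show ?thesis by (simp add: sc_sc sc_hom)
qed

lemma e_degree: "p \<in> span_on {\<mu>. wt gX \<mu> \<in> S} \<Longrightarrow> app (e m) p \<in> span_on {\<mu>. wt gX \<mu> + 1 \<in> S}"
  using wt_graded[OF clin_e dgX_e] by simp

end


section \<open>Irreducibility of the Verma module\<close>

lemma span_on_Int: "p \<in> span_on A \<Longrightarrow> p \<in> span_on B \<Longrightarrow> p \<in> span_on (A \<inter> B)"
  by (auto simp: span_on_def)

lemma EV_diff: "\<mu> \<in> EV \<Longrightarrow> lookup \<mu> v \<noteq> 0 \<Longrightarrow> \<mu> - single v 1 \<in> EV"
  using EV.down by (auto simp: EV_iff lookup_minus lookup_single when_def)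

lemma Nats_minus_one:
  assumes "of_nat n - 1 \<in> (\<nat> :: complex set)"
  shows "n \<noteq> 0"
proof
  assume "n = 0"
  with assms obtain m where "of_nat m = (- 1 :: complex)" by (auto elim!: Nats_cases)
  then have "of_nat (Suc m) = (0 :: complex)" by simp
  then show False by (simp only: of_nat_neq_0)
qed

lemma EV_degree_bound:
  assumes "v \<in> span_on EV" "\<And>\<mu>. \<mu> \<in> EV \<Longrightarrow> wt g \<mu> \<in> \<nat>"
  obtains n where "v \<in> span_on {\<mu>. wt g \<mu> \<in> of_nat ` {..n}}"
  using assms(1)
proof (induction arbitrary: thesis rule: span_on_induct)
  case (single \<mu> c)
  then obtain n where "wt g \<mu> = of_nat n" using assms(2) by (metis Nats_cases)
  then show ?case using single(2)[of n] by (auto intro: span_on_single)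
next
  case (add p q)
  obtain m where m: "p \<in> span_on {\<mu>. wt g \<mu> \<in> of_nat ` {..m}}" using add(1) by blast
  obtain n where n: "q \<in> span_on {\<mu>. wt g \<mu> \<in> of_nat ` {..n}}" using add(2) by blast
  show ?case
    by (rule add(3)[of "max m n"], intro span_on_add span_on_mono[OF m] span_on_mono[OF n]) auto
qed simp

context fock
begin

text \<open>On a vector free of the x_k the derivations vanish, and h_{j+1} acts as 2(j+1)K d/dy_j.
  As K is nonzero, N contains this derivative, so the degree in the y's can be lowered until a
  nonzero constant is left.\<close>

lemma pure_Y_to_one:
  assumes "K \<noteq> 0" "gsub N" "N \<subseteq> span_on EV"
  shows "v \<in> N \<Longrightarrow> v \<noteq> 0 \<Longrightarrow> (\<And>k. app (pd (X k)) v = 0) \<Longrightarrow>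
    v \<in> span_on {\<mu>. wt gY \<mu> \<in> of_nat ` {..n}} \<Longrightarrow> single 0 1 \<in> N"
proof (induction n arbitrary: v rule: less_induct)
  case (less n)
  show ?case
  proof (cases "\<exists>j. app (pd (Y j)) v \<noteq> 0")
    case True
    then obtain j where j: "app (pd (Y j)) v \<noteq> 0" by blast
    let ?u = "app (pd (Y j)) v"
    have "app (D m) v = 0" for m
      by (simp add: D_def SD.rep_eq less.prems)
    then have hv: "app (h (int j + 1)) v = app (sc (2 * (of_nat j + 1) * K)) ?u"
      by (simp add: h_def a_def)
    have "app (sc (inverse (2 * (of_nat j + 1) * K))) (app (h (int j + 1)) v) \<in> N"
      using assms less.prems by (intro gsubD(3,7)) auto
    moreover have "2 * (of_nat j + 1) * K \<noteq> 0"
      using assms(1) of_nat_neq_0[of j, where 'a = complex] by (metis add.commute mult_eq_0_iff of_nat_Suc zero_neq_numeral)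
    ultimately have u: "?u \<in> N"
      unfolding hv by (simp only: sc_cancel not_False_eq_True)
    have uEV: "?u \<in> span_on EV" using u assms by auto
    have "?u \<in> span_on {\<mu>. wt gY \<mu> + 1 \<in> of_nat ` {..n}}"
      by (rule clin_span_on[OF clin_pd _ less.prems(4)], rule pd_single_span) (simp add: wt_diff)
    \<comment> \<open>With \<open>n > 0\<close> inside the set, the span is zero for n = 0, so that
      \<open>?u \<noteq> 0\<close> excludes this case.\<close>
    from span_on_Int[OF uEV this]
    have u2: "?u \<in> span_on {\<mu>. wt gY \<mu> \<in> of_nat ` {..n - 1} \<and> n > 0}"
    proof (rule span_on_mono, intro subsetI CollectI)
      fix \<mu> assume "\<mu> \<in> EV \<inter> {\<mu>. wt gY \<mu> + 1 \<in> of_nat ` {..n}}"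
      then obtain m l where m: "wt gY \<mu> = of_nat m" and l: "wt gY \<mu> + 1 = of_nat l" "l \<le> n"
        using wt_Nats(2)[of \<mu>] by (auto elim!: Nats_cases)
      then have "Suc m = l" by (metis add.commute of_nat_Suc of_nat_eq_iff)
      with m l show "wt gY \<mu> \<in> of_nat ` {..n - 1} \<and> 0 < n" by auto
    qed
    then have "n > 0" using j unfolding span_on_def by (metis (mono_tags, lifting) keys_eq_empty mem_Collect_eq subset_empty subset_eq)
    then show ?thesis
    proof (intro less.IH[of "n - 1" ?u])
      show "?u \<in> span_on {\<mu>. wt gY \<mu> \<in> of_nat ` {..n - 1}}"
        by (rule span_on_mono[OF u2]) auto
      show "app (pd (X k)) ?u = 0" for k
        using arg_cong[OF pd_commute[of "X k" "Y j"], of "\<lambda>T. app T v"] less.prems(3) by simp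
    qed (use u j in auto)
  next
    case False
    then have "lookup \<mu> u = 0" if "\<mu> \<in> keys v" for \<mu> u
      using that less.prems(3) by (cases u) (simp_all add: pd_eq_0_iff)
    then have "keys v \<subseteq> {0}" by (auto intro!: poly_mapping_eqI)
    then have "v = single 0 (lookup v 0)"
      by (intro poly_mapping_eqI) (auto simp: lookup_single when_def in_keys_iff)
    moreover from this have "lookup v 0 \<noteq> 0" using less.prems(2) by auto
    ultimately have "app (sc (inverse (lookup v 0))) v = single 0 1"
      by (metis app_sc_single left_inverse)
    then show ?thesis using gsubD(3)[OF assms(2) less.prems(1)] by metis
  qed
qed

text \<open>For a fresh variable \<open>Y j\<close>, the derivative of \<open>e\<^sub>m v\<close> by \<open>Y j\<close> is the derivative of \<open>v\<close> by
  \<open>X k\<close> with \<open>k = - j - 1 - m\<close>, so that \<open>e\<^sub>m\<close> lowers the degree in the \<open>X\<close> without killing \<open>v\<close>.\<close>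

lemma verma_to_one:
  assumes "K \<noteq> 0" "gsub N" "N \<subseteq> span_on EV"
  shows "v \<in> N \<Longrightarrow> v \<noteq> 0 \<Longrightarrow> v \<in> span_on {\<mu>. wt gX \<mu> \<in> of_nat ` {..n}} \<Longrightarrow> single 0 1 \<in> N"
proof (induction n arbitrary: v rule: less_induct)
  case (less n)
  show ?case
  proof (cases "\<exists>k. app (pd (X k)) v \<noteq> 0")
    case True
    then obtain k where k: "app (pd (X k)) v \<noteq> 0" by blast
    have "finite (Y -` alg_vars v)" by (simp add: finite_vimageI inj_def)
    then obtain j where "Y j \<notin> alg_vars v"
      by (metis ex_new_if_finite infinite_UNIV_nat vimageI)
    then have j: "app (pd (Y j)) v = 0" by (rule pd_eq_0)
    define m where "m = - int j - 1 - k"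
    let ?u = "app (e m) v"
    have "app (pd (Y j)) ?u = app (pd (X k)) v"
      using arg_cong[OF pd_Y_e[of j m], of "\<lambda>T. app T v"] j by (simp add: m_def)
    then have u0: "?u \<noteq> 0" using k by auto
    have u: "?u \<in> N" using gsubD(5)[OF assms(2)] less.prems by blast
    have uEV: "?u \<in> span_on EV" using u assms by auto
    from span_on_Int[OF uEV e_degree[OF less.prems(3)]]
    have u2: "?u \<in> span_on {\<mu>. wt gX \<mu> \<in> of_nat ` {..n - 1} \<and> n > 0}"
    proof (rule span_on_mono, intro subsetI CollectI)
      fix \<mu> assume "\<mu> \<in> EV \<inter> {\<mu>. wt gX \<mu> + 1 \<in> of_nat ` {..n}}"
      then obtain m l where m: "wt gX \<mu> = of_nat m" and l: "wt gX \<mu> + 1 = of_nat l" "l \<le> n"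
        using wt_Nats(1)[of \<mu>] by (auto elim!: Nats_cases)
      then have "Suc m = l" by (metis add.commute of_nat_Suc of_nat_eq_iff)
      with m l show "wt gX \<mu> \<in> of_nat ` {..n - 1} \<and> 0 < n" by auto
    qed
    then have "n > 0" using u0 unfolding span_on_def by (metis (mono_tags, lifting) keys_eq_empty mem_Collect_eq subset_empty subset_eq)
    then show ?thesis
      by (intro less.IH[of "n - 1" ?u] u u0 span_on_mono[OF u2]) auto
  next
    case False
    have "v \<in> span_on EV" using less.prems assms by auto
    then obtain n' where "v \<in> span_on {\<mu>. wt gY \<mu> \<in> of_nat ` {..n'}}"
      using EV_degree_bound wt_Nats(2) by blast
    then show ?thesis
      using pure_Y_to_one[OF assms less.prems(1,2)] False by blast
  qed
qed

lemma span_on_subset: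
  assumes "gsub N" "\<And>\<mu>. \<mu> \<in> A \<Longrightarrow> single \<mu> 1 \<in> N"
  shows "span_on A \<subseteq> N"
proof
  fix p assume "p \<in> span_on A"
  then show "p \<in> N"
  proof (induction rule: span_on_induct)
    case (single \<mu> c)
    then show ?case using gsubD(3)[OF assms(1) assms(2), of \<mu> c] by simp
  qed (simp_all add: gsubD[OF assms(1)])
qed

lemma wt_nonzero: "wt g \<mu> \<noteq> 0 \<Longrightarrow> \<exists>v. g v \<noteq> 0 \<and> lookup \<mu> v \<noteq> 0"
  using sum.not_neutral_contains_not_neutral[of "\<lambda>v. g v * lookup \<mu> v" "keys \<mu>"]
  unfolding wt_def by auto

text \<open>Products of f's reach all monomials in the x_k. A factor y_j is produced by h_{-j-1} up
  to a term with D_{-j-1}, which keeps the degree in the y's and therefore lies in N by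
  induction.\<close>

lemma verma_generated:
  assumes "gsub N" "single 0 1 \<in> N" "\<mu> \<in> EV"
  shows "single \<mu> 1 \<in> N"
proof -
  have X: "single \<mu> 1 \<in> N" if "\<mu> \<in> EV" "\<And>j. lookup \<mu> (Y j) = 0" "wt gX \<mu> = of_nat n" for \<mu> n
    using that
  proof (induction n arbitrary: \<mu>)
    case 0
    have "lookup \<mu> (X k) = 0" for k
    proof (rule ccontr)
      assume "lookup \<mu> (X k) \<noteq> 0"
      then have "wt gX (\<mu> - single (X k) 1) \<in> \<nat>" using EV_diff wt_Nats 0 by blast
      then show False using Nats_minus_one[of 0] 0 by (simp add: wt_diff)
    qed
    with 0 have "\<mu> = 0" by (intro poly_mapping_eqI) (metis lookup_zero var.exhaust)
    then show ?case using assms by simp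
  next
    case (Suc n)
    then obtain v where v: "gX v \<noteq> 0" "lookup \<mu> v \<noteq> 0"
      using wt_nonzero[of gX \<mu>] Suc.prems of_nat_neq_0[of n, where 'a = complex] by metis
    then obtain k where k: "v = X k" by (cases v) auto
    have "single (\<mu> - single (X k) 1) 1 \<in> N"
      using Suc.prems v unfolding k
      by (intro Suc.IH EV_diff) (auto simp: wt_diff lookup_minus lookup_single)
    then show ?case using gsubD(6)[OF assms(1), of "single (\<mu> - single (X k) 1) 1" k] by simp
  qed
  have "single \<mu> 1 \<in> N" if "\<mu> \<in> EV" "wt gY \<mu> = of_nat n" for \<mu> n
    using that
  proof (induction n arbitrary: \<mu>)
    case 0
    have "lookup \<mu> (Y j) = 0" for j
    proof (rule ccontr)
      assume "lookup \<mu> (Y j) \<noteq> 0"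
      then have "wt gY (\<mu> - single (Y j) 1) \<in> \<nat>" using EV_diff wt_Nats 0 by blast
      then show False using Nats_minus_one[of 0] 0 by (simp add: wt_diff)
    qed
    then show ?case using X[OF 0(1)] wt_Nats(1)[OF 0(1)] by (metis Nats_cases)
  next
    case (Suc n)
    then obtain v where v: "gY v \<noteq> 0" "lookup \<mu> v \<noteq> 0"
      using wt_nonzero[of gY \<mu>] Suc.prems of_nat_neq_0[of n, where 'a = complex] by metis
    then obtain j where j: "v = Y j" by (cases v) auto
    define \<nu> where "\<nu> = \<mu> - single (Y j) 1"
    have \<nu>: "\<nu> \<in> EV" "wt gY \<nu> = of_nat n"
      using Suc.prems v unfolding j \<nu>_def by (auto simp: wt_diff intro!: EV_diff)
    have \<nu>N: "single \<nu> 1 \<in> N" using Suc.IH \<nu> by blast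
    let ?m = "- int j - 1"
    have "app (D ?m) (single \<nu> 1) \<in> span_on (EV \<inter> {\<mu>. wt gY \<mu> = of_nat n})"
      unfolding D_def
    proof (rule SD_span)
      fix k
      show "app (mul (X (k + ?m)) 1) (app (pd (X k)) (single \<nu> 1)) \<in> span_on (EV \<inter> {\<mu>. wt gY \<mu> = of_nat n})"
        using EV.D_allowed EV_diff[OF \<nu>(1), of "X k"] \<nu>(2)
        by (cases "lookup \<nu> (X k) = 0")
          (auto intro!: span_on_single simp: wt_add wt_diff EV_iff lookup_add lookup_single when_def)
    qed
    then have D: "app (D ?m) (single \<nu> 1) \<in> N"
      by (rule subsetD[OF span_on_subset[OF assms(1)], rotated]) (simp add: Suc.IH)
    have "single \<mu> 1 = app (h ?m) (single \<nu> 1) + app (sc 2) (app (D ?m) (single \<nu> 1))"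
      by (simp add: h_def a_neg \<nu>_def)
    then show ?case
      by (simp only: gsubD(2)[OF assms(1) gsubD(7)[OF assms(1) \<nu>N] gsubD(3)[OF assms(1) D]])
  qed
  then show ?thesis using wt_Nats(2)[OF assms(3)] assms(3) by (metis Nats_cases)
qed

theorem verma_irreducible:
  assumes "K \<noteq> 0" "gsub N" "N \<subseteq> span_on EV" "N \<noteq> {0}"
  shows "N = span_on EV"
proof -
  obtain v where v: "v \<in> N" "v \<noteq> 0" using assms gsubD(1) by blast
  moreover have "v \<in> span_on EV" using v assms by auto
  then obtain n where "v \<in> span_on {\<mu>. wt gX \<mu> \<in> of_nat ` {..n}}"
    using EV_degree_bound wt_Nats(1) by blast
  ultimately have "single 0 1 \<in> N" using verma_to_one assms by blast
  then show ?thesis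
    using span_on_subset[OF assms(2)] verma_generated[OF assms(2)] assms(3) by blast
qed

end


section \<open>The action of the \<open>sl\<^sub>2\<close>-triple of \<open>f\<^sub>i\<close>\<close>

text \<open>Clearing denominators: a vector has finitely many monomials, so one power of x_i with
  exponent in -z + \<nat> serves all of them.\<close>

lemma ET_shift_nat:
  assumes "v \<in> span_on (ET i z)"
  obtains n :: nat where "app (mul (X i) (of_nat n - z)) v \<in> span_on EV"
  using assms
proof (induction arbitrary: thesis rule: span_on_induct)
  case (single \<mu> c)
  then obtain m where m: "lookup \<mu> (X i) - z = of_int m" by (auto simp: ET_iff elim!: Ints_cases)
  have "of_nat (nat \<bar>m\<bar>) + of_int m \<in> (\<nat> :: complex set)"
  proof -
    have "of_nat (nat \<bar>m\<bar>) + of_int m = (of_nat (nat (\<bar>m\<bar> + m)) :: complex)"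
      by (simp add: of_nat_nat)
    then show ?thesis by (simp only: of_nat_in_Nats)
  qed
  then show ?case
    using single(1) m
    by (intro single(2)[of "nat \<bar>m\<bar>"])
      (auto simp: ET_iff EV_iff lookup_add lookup_single when_def algebra_simps intro!: span_on_single)
next
  case (add p q)
  have up: "app (mul (X i) (of_nat (n + k) - z)) r \<in> span_on EV"
    if "app (mul (X i) (of_nat n - z)) r \<in> span_on EV" for n k r
  proof (induction k)
    case (Suc k)
    have "app (mul (X i) (of_nat (n + Suc k) - z)) r = app (mul (X i) 1) (app (mul (X i) (of_nat (n + k) - z)) r)"
      by (simp add: app_mul_add algebra_simps)
    then show ?case using Suc EV.mul_allowed unfolding EV_def by simp
  qed (use that in simp)
  obtain m where m: "app (mul (X i) (of_nat m - z)) p \<in> span_on EV" using add(1) by blast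
  obtain n where n: "app (mul (X i) (of_nat n - z)) q \<in> span_on EV" using add(2) by blast
  show ?case
    using up[OF m, of n] up[OF n, of m]
    by (intro add(3)[of "m + n"]) (simp add: app_add_right span_on_add add.commute)
qed simp

lemma mul_ET: "p \<in> span_on (ET i z) \<Longrightarrow> app (mul (X i) w) p \<in> span_on (ET i (w + z))"
  by (erule clin_span_on[OF clin_mul, rotated])
    (auto simp: ET_iff lookup_add lookup_single when_def intro!: span_on_single)

lemma Ints_wt:
  assumes "\<mu> \<in> ET i z"
  shows "wt gX \<mu> - z \<in> \<int>"
proof -
  obtain m where "wt gX \<mu> - lookup \<mu> (X i) = of_nat m" using ET_wt[OF assms] by (auto elim: Nats_cases)
  then have "wt gX \<mu> - z = (lookup \<mu> (X i) - z) + of_int (int m)" by (simp add: algebra_simps)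
  moreover have "lookup \<mu> (X i) - z \<in> \<int>" using assms by (simp add: ET_iff)
  ultimately show ?thesis by (metis Ints_add Ints_of_int)
qed

context fock
begin

section \<open>Annihilating polynomials and invertibility on stable subspaces\<close>

definition T_sub :: "alg endo \<Rightarrow> alg set \<Rightarrow> bool" where
  "T_sub T N \<longleftrightarrow> 0 \<in> N \<and> (\<forall>p\<in>N. \<forall>q\<in>N. p + q \<in> N) \<and> (\<forall>c. \<forall>p\<in>N. app (sc c) p \<in> N)
     \<and> (\<forall>p\<in>N. app T p \<in> N)"

lemma T_subD:
  assumes "T_sub T N"
  shows "0 \<in> N" "p \<in> N \<Longrightarrow> q \<in> N \<Longrightarrow> p + q \<in> N" "p \<in> N \<Longrightarrow> app (sc c) p \<in> N"
    "p \<in> N \<Longrightarrow> app T p \<in> N" "p \<in> N \<Longrightarrow> q \<in> N \<Longrightarrow> p - q \<in> N"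
proof -
  show *: "0 \<in> N" "p \<in> N \<Longrightarrow> q \<in> N \<Longrightarrow> p + q \<in> N" "p \<in> N \<Longrightarrow> app (sc c) p \<in> N"
    "p \<in> N \<Longrightarrow> app T p \<in> N" for p q c
    using assms by (auto simp: T_sub_def)
  show "p \<in> N \<Longrightarrow> q \<in> N \<Longrightarrow> p - q \<in> N"
    using *(2)[of p "app (sc (- 1)) q"] *(3)[of q "- 1"] by (simp add: sc_hom)
qed

primrec prodT :: "alg endo \<Rightarrow> complex list \<Rightarrow> alg endo" where
  "prodT T [] = 1"
| "prodT T (\<epsilon> # es) = (T - sc \<epsilon>) * prodT T es"

lemma prodT_append: "prodT T (es @ es') = prodT T es * prodT T es'"
  by (induction es) (simp_all add: mult.assoc)

lemma clin_prodT: "clin T \<Longrightarrow> clin (prodT T es)"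
  by (induction es) simp_all

lemma prodT_commute:
  assumes "clin T"
  shows "prodT T es * prodT T es' = prodT T es' * prodT T es"
proof -
  have T: "prodT T es * T = T * prodT T es" for es
  proof (induction es)
    case (Cons \<epsilon> es)
    then show ?case
      by (simp add: mult.assoc) (simp add: left_diff_distrib right_diff_distrib clin_comm[OF assms] flip: mult.assoc)
  qed simp
  show ?thesis
  proof (induction es)
    case (Cons \<epsilon> es)
    have "prodT T es' * (T - sc \<epsilon>) = (T - sc \<epsilon>) * prodT T es'"
      by (simp add: left_diff_distrib right_diff_distrib T clin_comm(1)[OF clin_prodT[OF assms]])
    with Cons show ?case by (metis mult.assoc prodT.simps(2))
  qed simp
qed

text \<open>A polynomial in T without root 0 is a nonzero constant plus T times another polynomial Q
  in T. What is used of Q being a polynomial is recorded: it is linear, commutes with T and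
  preserves every T-stable subspace.\<close>

lemma prodT_split:
  assumes "clin T" "0 \<notin> set es"
  shows "\<exists>\<delta> Q. \<delta> \<noteq> 0 \<and> prodT T es = sc \<delta> + T * Q \<and> T * Q = Q * T \<and> clin Q
    \<and> (\<forall>N. T_sub T N \<longrightarrow> (\<forall>p\<in>N. app Q p \<in> N))"
  using assms(2)
proof (induction es)
  case Nil
  show ?case
    by (rule exI[of _ 1], rule exI[of _ 0]) (auto simp: sc_hom T_subD)
next
  case (Cons \<epsilon> es)
  then obtain \<delta> Q where Q: "\<delta> \<noteq> 0" "prodT T es = sc \<delta> + T * Q" "T * Q = Q * T" "clin Q"
    "\<And>N p. T_sub T N \<Longrightarrow> p \<in> N \<Longrightarrow> app Q p \<in> N" by auto
  let ?Q = "sc \<delta> + T * Q - sc \<epsilon> * Q"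
  have "prodT T (\<epsilon> # es) = sc (- \<epsilon> * \<delta>) + T * ?Q"
    by (simp add: Q(2) algebra_simps sc_sc clin_comm[OF assms(1)] sc_hom)
  moreover have "T * (Q * S) = Q * (T * S)" for S
    using Q(3) by (metis mult.assoc)
  then have "T * ?Q = ?Q * T"
    by (simp add: distrib_left distrib_right left_diff_distrib right_diff_distrib
        clin_comm[OF assms(1)] Q(3) mult.assoc)
  moreover have "app ?Q p \<in> N" if "T_sub T N" "p \<in> N" for N p
    using that by (auto intro!: T_subD(2-5)[OF that(1)] Q(5))
  ultimately show ?case
    using Q(1,4) Cons.prems assms(1)
    by (intro exI[of _ "- \<epsilon> * \<delta>"] exI[of _ ?Q]) auto
qed

text \<open>A locally finite operator with nonzero eigenvalues is invertible on every stable subspace.\<close>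

lemma prodT_surj:
  assumes "clin T" "0 \<notin> set es" "app (prodT T es) p = 0" "T_sub T N" "p \<in> N"
  obtains q where "q \<in> N" "app T q = p"
proof -
  obtain \<delta> Q where Q: "\<delta> \<noteq> 0" "prodT T es = sc \<delta> + T * Q" "app Q p \<in> N"
    using prodT_split[OF assms(1,2)] assms(4,5) by blast
  let ?q = "app (sc (- inverse \<delta>)) (app Q p)"
  have "app (sc \<delta>) p = app (sc (- 1)) (app T (app Q p))"
    using assms(3) by (simp add: Q(2) sc_hom eq_neg_iff_add_eq_0)
  then have "app (sc (inverse \<delta>)) (app (sc \<delta>) p) = app (sc (inverse \<delta>)) (app (sc (- 1)) (app T (app Q p)))"
    by (rule arg_cong)
  then have "p = app T ?q"
    by (simp only: sc_cancel[OF Q(1)] clin_app[OF assms(1)])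
      (simp add: sc_sc(1)[THEN arg_cong, of "\<lambda>S. app S (app T (app Q p))", simplified])
  with Q(3) assms(4) that[of ?q] show thesis by (simp add: T_subD(3))
qed

text \<open>Both the polynomial in T and Q T send p into M; their difference is a nonzero scalar, so
  p lies in M as well.\<close>

lemma prodT_inj:
  assumes "clin T" "0 \<notin> set es" "app (prodT T es) p \<in> M" "T_sub T M" "app T p \<in> M"
  shows "p \<in> M"
proof -
  obtain \<delta> Q where Q: "\<delta> \<noteq> 0" "prodT T es = sc \<delta> + T * Q" "T * Q = Q * T" "app Q (app T p) \<in> M"
    using prodT_split[OF assms(1,2)] assms(4,5) by blast
  then have "app (sc \<delta>) p = app (prodT T es) p - app Q (app T p)"
    by (simp flip: Q(3)[THEN arg_cong, of "\<lambda>T. app T p", simplified])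
  then have "app (sc \<delta>) p \<in> M"
    using T_subD(5)[OF assms(4,3) Q(4)] by simp
  then show ?thesis
    using T_subD(3)[OF assms(4), of _ "inverse \<delta>"] Q(1) by (metis sc_cancel)
qed

definition T :: "int \<Rightarrow> alg endo" where "T i = f i * e (- i)"

lemma clin_T [simp]: "clin (T i)"
  by (simp add: T_def)

text \<open>The sl_2 value w (l - w + 1) of f e on f^w times a highest weight vector of weight l,
  for the triple e_{-i}, f_i, h_0 - iK. Here w is the exponent of x_i and l = J - iK - 2
  (\<open>wt gX \<mu>\<close> - w) is the weight of the remaining factor.\<close>

definition eig :: "int \<Rightarrow> expo \<Rightarrow> complex" where
  "eig i \<mu> = lookup \<mu> (X i) * (J - of_int i * K + 1 + lookup \<mu> (X i) - 2 * wt gX \<mu>)"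

text \<open>The monomials off the diagonal in the image under \<open>T\<close>. The total degree in
  the x_k is preserved, and e_{-i} applied to the part free of x_i yields no negative power of x_i,
  so the exponent of x_i grows by at least 1.\<close>

definition raised :: "int \<Rightarrow> complex \<Rightarrow> expo \<Rightarrow> expo set" where
  "raised i z \<mu> = {\<nu> \<in> ET i z. wt gX \<nu> = wt gX \<mu> \<and> lookup \<nu> (X i) - lookup \<mu> (X i) - 1 \<in> \<nat>}"

lemma e_X_power:
  assumes "\<nu> \<in> EV" "lookup \<nu> (X i) = 0"
  shows "app (e (- i)) (app (mul (X i) w) (single \<nu> 1))
    = app (mul (X i) w) (app (e (- i)) (single \<nu> 1))
      + single (single (X i) (w - 1) + \<nu>) (w * (J - 2 * wt gX \<nu> - of_int i * K - w + 1))"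
proof -
  have m: "single (single (X i) 1 + (single (X i) (w - 2) + \<nu>)) c = (single (single (X i) (w - 1) + \<nu>) c :: alg)" for c
    by (simp add: add.assoc[symmetric] flip: single_add)
  have h0: "app (h 0) (single \<nu> 1) = single \<nu> (J - 2 * wt gX \<nu>)"
    by (simp add: h_0 single_diff)
  show ?thesis
    using arg_cong[OF e_mul_X[of "- i" i w], of "\<lambda>T. app T (single \<nu> 1)"]
    by (simp add: h0 m) (simp add: algebra_simps flip: single_add single_diff)
qed

text \<open>With x^\<nu> the part free of x_i, e_{-i} maps x_i^w x^\<nu> to x_i^w e_{-i} x^\<nu>
  plus a multiple of x_i^{w-1} x^\<nu>. After multiplication by x_i the second summand is the
  diagonal term and the first consists of raised monomials.\<close>

lemma T_triangular:
  assumes "\<mu> \<in> ET i z"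
  shows "app (T i) (single \<mu> 1) - single \<mu> (eig i \<mu>) \<in> span_on (raised i z \<mu>)"
proof -
  define w where "w = lookup \<mu> (X i)"
  obtain \<nu> where \<nu>: "\<mu> = single (X i) w + \<nu>" "\<nu> \<in> EV" "lookup \<nu> (X i) = 0"
    using ET_decompose[OF assms] unfolding w_def by metis
  have wt: "wt gX \<mu> = w + wt gX \<nu>" by (simp add: \<nu>(1) wt_add)
  have m: "single (X i) 1 + (single (X i) (w - 1) + \<nu>) = \<mu>"
    by (simp add: \<nu>(1) add.assoc[symmetric] flip: single_add)
  have "app (e (- i)) (single \<mu> 1) = app (mul (X i) w) (app (e (- i)) (single \<nu> 1))
      + single (single (X i) (w - 1) + \<nu>) (w * (J - 2 * wt gX \<nu> - of_int i * K - w + 1))"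
    using e_X_power[OF \<nu>(2,3), of w] by (simp add: \<nu>(1))
  then have "app (T i) (single \<mu> 1) = app (mul (X i) (w + 1)) (app (e (- i)) (single \<nu> 1)) + single \<mu> (eig i \<mu>)"
    by (simp add: T_def app_add_right m app_mul_add eig_def wt add.commute[of 1 w] flip: w_def)
      (simp add: algebra_simps)
  moreover have "app (mul (X i) (w + 1)) (app (e (- i)) (single \<nu> 1)) \<in> span_on (raised i z \<mu>)"
  proof (rule clin_span_on[OF clin_mul])
    have "app (e (- i)) (single \<nu> 1) \<in> span_on EV"
      using gsubD(5)[OF gsub_EV] \<nu>(2) by (simp add: span_on_single)
    moreover have "app (e (- i)) (single \<nu> 1) \<in> span_on {\<kappa>. wt gX \<kappa> + 1 \<in> {wt gX \<nu>}}"
      by (rule e_degree) (simp add: span_on_single)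
    ultimately show "app (e (- i)) (single \<nu> 1) \<in> span_on (EV \<inter> {\<kappa>. wt gX \<kappa> + 1 \<in> {wt gX \<nu>}})"
      by (rule span_on_Int)
    fix \<kappa> assume \<kappa>: "\<kappa> \<in> EV \<inter> {\<kappa>. wt gX \<kappa> + 1 \<in> {wt gX \<nu>}}"
    then obtain n where n: "lookup \<kappa> (X i) = of_nat n" by (auto simp: EV_iff elim!: Nats_cases)
    have "w - z \<in> \<int>" using assms by (simp add: ET_iff w_def)
    then have "w - z + of_int (int n + 1) \<in> \<int>" by (intro Ints_add) auto
    then have "w + 1 + of_nat n - z \<in> \<int>" by (simp add: algebra_simps)
    then show "app (mul (X i) (w + 1)) (single \<kappa> 1) \<in> span_on (raised i z \<mu>)"
      using \<kappa> by (auto intro!: span_on_single simp: raised_def ET_iff EV_iff lookup_add lookup_single when_def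
          wt_add wt n add.commute[of 1] simp flip: w_def)
  qed
  ultimately show ?thesis by simp
qed

text \<open>The operator \<open>T\<close> is locally finite: it is triangular, and the exponent of \<open>X i\<close> can only be
  raised as often as the total degree in the remaining \<open>X k\<close> allows.\<close>

lemma T_locally_finite:
  assumes M: "T_sub (T i) M" and P: "P \<subseteq> ET i z"
    and eig: "\<And>\<mu>. \<mu> \<in> P \<Longrightarrow> single \<mu> 1 \<in> M \<or> (eig i \<mu> \<noteq> 0 \<and> raised i z \<mu> \<subseteq> P)"
    and p: "p \<in> span_on P"
  shows "\<exists>es. 0 \<notin> set es \<and> app (prodT (T i) es) p \<in> M"
proof -
  define dg' where "dg' \<mu> = wt gX \<mu> - lookup \<mu> (X i)" for \<mu>
  have pM: "app (prodT (T i) es) q \<in> M" if "q \<in> M" for es q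
    using that by (induction es) (auto intro: T_subD[OF M])
  have main: "\<exists>es. 0 \<notin> set es \<and> app (prodT (T i) es) p \<in> M"
    if "p \<in> span_on {\<mu> \<in> P. dg' \<mu> \<in> of_nat ` {..<n}}" for n p
    using that
  proof (induction n arbitrary: p)
    case 0
    then have "p = 0" by (simp add: span_on_def)
    then show ?case by (intro exI[of _ "[]"]) (simp add: T_subD[OF M])
  next
    case (Suc n)
    from Suc.prems show ?case
    proof (induction rule: span_on_induct)
      case zero
      then show ?case by (intro exI[of _ "[]"]) (simp add: T_subD[OF M])
    next
      case (single \<mu> c)
      then have \<mu>: "\<mu> \<in> P" and dg: "dg' \<mu> \<in> of_nat ` {..<Suc n}" by auto
      show ?case
      proof (cases "single \<mu> 1 \<in> M")
        case True
        then have "app (sc c) (single \<mu> 1) \<in> M" by (rule T_subD[OF M])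
        then show ?thesis by (intro exI[of _ "[]"]) simp
      next
        case False
        with eig[OF \<mu>] have e: "eig i \<mu> \<noteq> 0" "raised i z \<mu> \<subseteq> P" by auto
        let ?r = "app (T i) (single \<mu> 1) - single \<mu> (eig i \<mu>)"
        have "?r \<in> span_on {\<mu> \<in> P. dg' \<mu> \<in> of_nat ` {..<n}}"
        proof (rule span_on_mono[OF T_triangular])
          show "\<mu> \<in> ET i z" using \<mu> P by auto
          show "raised i z \<mu> \<subseteq> {\<mu> \<in> P. dg' \<mu> \<in> of_nat ` {..<n}}"
          proof safe
            fix \<nu> assume \<nu>: "\<nu> \<in> raised i z \<mu>"
            then show "\<nu> \<in> P" using e by auto
            obtain k where k: "lookup \<nu> (X i) = lookup \<mu> (X i) + 1 + of_nat k"
              using \<nu> unfolding raised_def by (auto elim!: Nats_cases simp: algebra_simps)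
            obtain l where l: "dg' \<mu> = of_nat l" "l < Suc n" using dg by auto
            have "dg' \<nu> \<in> \<nat>"
              using ET_wt[of \<nu> i z] \<nu> unfolding dg'_def raised_def by auto
            then obtain m where m: "dg' \<nu> = of_nat m" by (auto elim: Nats_cases)
            have "wt gX \<nu> = wt gX \<mu>" using \<nu> by (simp add: raised_def)
            then have "dg' \<mu> = dg' \<nu> + 1 + of_nat k" by (simp add: dg'_def k)
            then have "(of_nat l :: complex) = of_nat (m + 1 + k)" by (simp add: l m)
            then have "l = m + 1 + k" by (simp only: of_nat_eq_iff)
            then show "dg' \<nu> \<in> of_nat ` {..<n}" using l m by auto
          qed
        qed
        then obtain es where es: "0 \<notin> set es" "app (prodT (T i) es) ?r \<in> M"
          using Suc.IH by blast
        \<comment> \<open>The last entry of the list is the factor applied first: T -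
          \<open>eig\<close> removes the diagonal term and leaves a vector to which the induction
          hypothesis for n applies.\<close>
        have "app (T i - sc (eig i \<mu>)) (single \<mu> c) = app (sc c) ?r"
          using clin_single[OF clin_T, of i \<mu> c] by (simp add: app_diff_right mult.commute)
        then have "app (prodT (T i) (es @ [eig i \<mu>])) (single \<mu> c) = app (sc c) (app (prodT (T i) es) ?r)"
          by (simp add: prodT_append clin_app clin_prodT del: app_simps(5))
        then show ?thesis
          using es e T_subD(3)[OF M] by (intro exI[of _ "es @ [eig i \<mu>]"]) auto
      qed
    next
      case (add p q)
      then obtain es es' where es: "0 \<notin> set es" "app (prodT (T i) es) p \<in> M"
        "0 \<notin> set es'" "app (prodT (T i) es') q \<in> M" by blast
      have "app (prodT (T i) (es @ es')) (p + q)
          = app (prodT (T i) es') (app (prodT (T i) es) p) + app (prodT (T i) es) (app (prodT (T i) es') q)"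
        using arg_cong[OF prodT_commute[OF clin_T, of i es es'], of "\<lambda>S. app S p"]
        by (simp add: prodT_append app_add_right)
      with es pM T_subD[OF M] show ?case by (intro exI[of _ "es @ es'"]) auto
    qed
  qed
  have "\<exists>n. p \<in> span_on {\<mu> \<in> P. dg' \<mu> \<in> of_nat ` {..<n}}"
    using p
  proof (induction rule: span_on_induct)
    case (single \<mu> c)
    then have "dg' \<mu> \<in> \<nat>" using ET_wt P by (auto simp: dg'_def)
    then obtain n where "dg' \<mu> = of_nat n" by (auto elim: Nats_cases)
    with single show ?case by (intro exI[of _ "Suc n"] span_on_single) auto
  next
    case (add p q)
    then obtain m n where m: "p \<in> span_on {\<mu> \<in> P. dg' \<mu> \<in> of_nat ` {..<m}}"
      and n: "q \<in> span_on {\<mu> \<in> P. dg' \<mu> \<in> of_nat ` {..<n}}" by blast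
    show ?case
      by (rule exI[of _ "max m n"], intro span_on_add span_on_mono[OF m] span_on_mono[OF n]) auto
  qed simp
  then show ?thesis using main by blast
qed


section \<open>Irreducibility of the localizations\<close>

text \<open>Apart from a scalar for d, conjugation by x_i^z changes the operators only by terms
  containing x_i^{-1} or x_i^{-2}. Stability of N under x_i^{-1} therefore makes its pullback along
  x_i^z a submodule of the Verma module. It is nonzero after clearing denominators, hence
  everything, and division by powers of x_i recovers all of the localization.\<close>

lemma localization_irreducible:
  assumes "K \<noteq> 0" "gsub N" "N \<subseteq> span_on (ET i z)" "N \<noteq> {0}"
    and inv: "\<And>p. p \<in> N \<Longrightarrow> app (mul (X i) (- 1)) p \<in> N"
  shows "N = span_on (ET i z)"
proof -
  have neg: "app (mul (X i) (- of_nat n)) p \<in> N" if "p \<in> N" for n p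
  proof (induction n)
    case (Suc n)
    have "app (mul (X i) (- of_nat (Suc n))) p = app (mul (X i) (- 1)) (app (mul (X i) (- of_nat n)) p)"
      by (simp add: app_mul_add)
    then show ?case using Suc inv by simp
  qed (use that in simp)
  define N' where "N' = {p \<in> span_on EV. app (mul (X i) z) p \<in> N}"
  have m1: "mul (X i) (z - 1) = mul (X i) (- 1) * mul (X i) z"
    and m2: "mul (X i) (z - 2) = mul (X i) (- of_nat 2) * mul (X i) z" for i
    by (simp_all flip: mul_add)
  have N'h: "app (mul (X i) z) (app (h m) p) \<in> N" if "app (mul (X i) z) p \<in> N" for m p
  proof -
    have "app (mul (X i) z) (app (h m) p) = app (h m) (app (mul (X i) z) p)
        + app (sc (2 * z)) (app (f (i + m)) (app (mul (X i) (- 1)) (app (mul (X i) z) p)))"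
      using arg_cong[OF h_mul_X[of m i z], of "\<lambda>T. app T p"] by (simp add: m1)
    then show ?thesis using that gsubD[OF assms(2)] inv by simp
  qed
  have "gsub N'"
  proof (rule gsubI)
    fix m p assume "p \<in> N'"
    then have p: "p \<in> span_on EV" "app (mul (X i) z) p \<in> N" by (auto simp: N'_def)
    show "app (h m) p \<in> N'" using p N'h gsubD[OF gsub_EV] by (simp add: N'_def)
    show "app (f m) p \<in> N'"
      using p gsubD[OF gsub_EV] gsubD(6)[OF assms(2), of "app (mul (X i) z) p" m]
        arg_cong[OF mul_commute[of "X i" z "X m" 1], of "\<lambda>T. app T p"]
      by (simp add: N'_def)
    show "app d p \<in> N'"
      using p gsubD[OF gsub_EV] gsubD[OF assms(2)]
        arg_cong[OF dg_mul[of gd "X i" z], of "\<lambda>T. app T p"]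
    proof -
      have "app (mul (X i) z) (app d p) = app d (app (mul (X i) z) p) - app (sc (of_int i * z)) (app (mul (X i) z) p)"
        using arg_cong[OF dg_mul[of gd "X i" z], of "\<lambda>T. app T p"]
        by (simp add: d_def app_add_right clin_app)
      then show ?thesis using p gsubD[OF gsub_EV] gsubD[OF assms(2)] by (simp add: N'_def)
    qed
    show "app (e m) p \<in> N'"
    proof -
      let ?q = "app (mul (X i) z) p"
      have "app (mul (X i) z) (app (e m) p) = app (e m) ?q
          - app (sc z) (app (mul (X i) (- 1)) (app (mul (X i) z) (app (h (m + i)) p)))
          - (if i = - m then app (sc (z * of_int m * K)) (app (mul (X i) (- 1)) ?q) else 0)
          + app (sc (z * (z - 1))) (app (f (m + 2 * i)) (app (mul (X i) (- of_nat 2)) ?q))"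
        using arg_cong[OF e_mul_X[of m i z], of "\<lambda>T. app T p"] by (simp add: m1 m2)
      also have "\<dots> \<in> N"
        using N'h[OF p(2)] neg[OF p(2), of 2] inv[OF p(2)] p(2)
        by (intro gsubD(2,9)[OF assms(2)]) (auto intro!: gsubD[OF assms(2)] inv)
      finally show ?thesis using p gsubD[OF gsub_EV] by (simp add: N'_def)
    qed
  next
    fix c p assume "p \<in> N'"
    then show "app (sc c) p \<in> N'"
      using gsubD[OF gsub_EV] gsubD[OF assms(2)] by (simp add: N'_def clin_app)
  qed (use gsubD[OF gsub_EV] gsubD[OF assms(2)] in \<open>auto simp: N'_def app_add_right\<close>)
  moreover have shift: "app (mul (X i) z) (app (mul (X i) (of_nat n - z)) v) = app (mul (X i) 1 ^ n) v" for n v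
    by (simp add: app_mul_add mul_power)
  have pow: "app (mul (X i) 1 ^ n) v \<in> N" if "v \<in> N" for n v
    using that gsubD(6)[OF assms(2)] by (induction n) auto
  obtain v where v: "v \<in> N" "v \<noteq> 0" using assms(4) gsubD(1)[OF assms(2)] by blast
  then obtain n where n: "app (mul (X i) (of_nat n - z)) v \<in> span_on EV"
    using ET_shift_nat assms(3) by blast
  then have "app (mul (X i) (of_nat n - z)) v \<in> N'"
    using shift pow v by (simp add: N'_def)
  then have "N' \<noteq> {0}" using v(2) by auto
  ultimately have N': "N' = span_on EV"
    using verma_irreducible[OF assms(1)] unfolding N'_def by blast
  have "q \<in> N" if q: "q \<in> span_on (ET i z)" for q
  proof -
    obtain n where "app (mul (X i) (of_nat n - z)) q \<in> span_on EV"
      using ET_shift_nat[OF q] by blast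
    then have "app (mul (X i) (of_nat n - z)) q \<in> N'" by (simp only: N')
    then have "app (mul (X i) 1 ^ n) q \<in> N"
      using shift[of n q] by (simp add: N'_def)
    from neg[OF this, of n] show ?thesis by (simp add: mul_power)
  qed
  then show ?thesis using assms(3) by auto
qed

lemma T_sub_gsub: "gsub N \<Longrightarrow> T_sub (T i) N"
  by (auto simp: T_sub_def T_def gsubD)

text \<open>Both the exponent of x_i and the total degree lie in z + \<int>, so this factor of
  \<open>eig\<close> differs from J - iK - z by an integer.\<close>

lemma eig_factor:
  assumes "\<mu> \<in> ET i z" "z - J + of_int i * K \<notin> \<int>"
  shows "J - of_int i * K + 1 + lookup \<mu> (X i) - 2 * wt gX \<mu> \<noteq> 0"
proof
  assume *: "J - of_int i * K + 1 + lookup \<mu> (X i) - 2 * wt gX \<mu> = 0"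
  have "z - J + of_int i * K = 1 + (lookup \<mu> (X i) - z) - 2 * (wt gX \<mu> - z)"
    using * by (simp add: algebra_simps)
  also have "\<dots> \<in> \<int>"
  proof -
    have "lookup \<mu> (X i) - z \<in> \<int>" using assms(1) by (simp add: ET_iff)
    from Ints_diff[OF Ints_add[OF Ints_1 this] Ints_mult[OF Ints_numeral[of "num.Bit0 num.One"] Ints_wt[OF assms(1)]]]
    show ?thesis .
  qed
  finally show False using assms(2) by simp
qed

text \<open>All eigenvalues of f_i e_{-i} are nonzero, so p = f_i e_{-i} q for some q in N; then
  x_i^{-1} p = e_{-i} q lies in N again.\<close>

theorem twisted_irreducible:
  assumes "K \<noteq> 0" "gsub N" "N \<subseteq> span_on (ET i z)" "N \<noteq> {0}" "z \<notin> \<int>" "z - J + of_int i * K \<notin> \<int>"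
  shows "N = span_on (ET i z)"
proof (rule localization_irreducible[OF assms(1-4)])
  fix p assume p: "p \<in> N"
  have "eig i \<mu> \<noteq> 0" if "\<mu> \<in> ET i z" for \<mu>
  proof -
    have "lookup \<mu> (X i) \<noteq> 0"
      using that assms(5) by (auto simp: ET_iff minus_in_Ints_iff)
    then show ?thesis using eig_factor[OF that assms(6)] by (simp add: eig_def)
  qed
  then have "\<exists>es. 0 \<notin> set es \<and> app (prodT (T i) es) p \<in> {0}"
    using p assms(3) by (intro T_locally_finite[of i _ "ET i z" z] T_sub_gsub gsub_zero) (auto simp: raised_def)
  then obtain q where q: "q \<in> N" "app (T i) q = p"
    using prodT_surj[OF clin_T _ _ T_sub_gsub[OF assms(2)] p] by blast
  then have "app (mul (X i) (- 1)) p = app (e (- i)) q"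
    using mul_cancel(2)[of "X i" 1] by (auto simp: T_def)
  then show "app (mul (X i) (- 1)) p \<in> N" using q gsubD[OF assms(2)] by simp
qed

text \<open>An eigenvalue of f_i e_{-i} can vanish only at a monomial without x_i, which already
  lies in the Verma module. Hence f_i e_{-i} is injective modulo the Verma module, and so is
  e_{-i}.\<close>

lemma e_injective_mod_verma:
  assumes "J - of_int i * K \<notin> \<int>" "p \<in> span_on (ET i 0)" "app (e (- i)) p \<in> span_on EV"
  shows "p \<in> span_on EV"
proof -
  have "single \<mu> 1 \<in> span_on EV \<or> (eig i \<mu> \<noteq> 0 \<and> raised i 0 \<mu> \<subseteq> ET i 0)" if "\<mu> \<in> ET i 0" for \<mu>
  proof (cases "lookup \<mu> (X i) = 0")
    case True
    then show ?thesis using ET_EV[OF that] by (simp add: span_on_single)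
  next
    case False
    then show ?thesis
      using eig_factor[OF that] assms(1) minus_in_Ints_iff[of "J - of_int i * K"]
      by (auto simp: eig_def raised_def)
  qed
  then obtain es where "0 \<notin> set es" "app (prodT (T i) es) p \<in> span_on EV"
    using T_locally_finite[OF T_sub_gsub[OF gsub_EV] order_refl _ assms(2)] by blast
  moreover have "app (T i) p \<in> span_on EV"
    using gsubD(6)[OF gsub_EV assms(3)] by (simp add: T_def)
  ultimately show ?thesis
    using prodT_inj[OF clin_T _ _ T_sub_gsub[OF gsub_EV]] by blast
qed

lemma ET_0_degree_bound:
  assumes "v \<in> span_on (ET i 0)"
  obtains n where "v \<in> span_on {\<mu>. wt gX \<mu> \<in> of_int ` {..n}}"
  using assms
proof (induction arbitrary: thesis rule: span_on_induct)
  case (single \<mu> c)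
  have "wt gX \<mu> \<in> \<int>" using Ints_wt[OF single(1)] by simp
  then obtain n where "wt gX \<mu> = of_int n" by (auto elim: Ints_cases)
  then show ?case using single(2)[of n] by (auto intro: span_on_single)
next
  case (add p q)
  obtain m where m: "p \<in> span_on {\<mu>. wt gX \<mu> \<in> of_int ` {..m}}" using add(1) by blast
  obtain n where n: "q \<in> span_on {\<mu>. wt gX \<mu> \<in> of_int ` {..n}}" using add(2) by blast
  show ?case
    by (rule add(3)[of "max m n"], intro span_on_add span_on_mono[OF m] span_on_mono[OF n]) auto
qed simp

text \<open>Vectors of \<open>N\<close> of negative degree are divisible by \<open>x\<^sub>i\<close> in \<open>N\<close>, so that the largest
  subspace \<open>B\<close> of \<open>N\<close> stable under \<open>x\<^sub>i\<^sup>-\<^sup>1\<close> is nonzero.\<close>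

theorem quotient_irreducible:
  assumes "K \<noteq> 0" "gsub N" "span_on EV \<subset> N" "N \<subseteq> span_on (ET i 0)" "J - of_int i * K \<notin> \<int>"
  shows "N = span_on (ET i 0)"
proof -
  define B where "B = {p. \<forall>j::nat. app (mul (X i) (- of_nat j)) p \<in> N}"
  have BN: "p \<in> B \<Longrightarrow> app (mul (X i) (- of_nat j)) p \<in> N" for p j
    by (simp add: B_def)
  have "B \<subseteq> N" using BN[of _ 0] by auto
  have minus1: "- of_nat (Suc j) = (- of_nat j - 1 :: complex)"
    and minus2: "- of_nat (Suc (Suc j)) = (- of_nat j - 2 :: complex)" for j
    by simp_all
  have Bh: "app (h m) p \<in> B" if "p \<in> B" for m p
  proof -
    have "app (mul (X i) (- of_nat j)) (app (h m) p) \<in> N" for j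
    proof -
      have "app (mul (X i) (- of_nat j)) (app (h m) p) = app (h m) (app (mul (X i) (- of_nat j)) p)
          + app (sc (2 * (- of_nat j))) (app (f (i + m)) (app (mul (X i) (- of_nat (Suc j))) p))"
        using arg_cong[OF h_mul_X[of m i "- of_nat j"], of "\<lambda>T. app T p"]
        by (simp add: minus1 del: of_nat_Suc)
      then show ?thesis using BN[OF that] gsubD[OF assms(2)] by metis
    qed
    then show ?thesis by (simp add: B_def)
  qed
  have "gsub B"
  proof (rule gsubI)
    fix m p assume p: "p \<in> B"
    show "app (h m) p \<in> B" by (rule Bh[OF p])
    have "app (mul (X i) (- of_nat j)) (app (f m) p) \<in> N" for j
      using gsubD(6)[OF assms(2) BN[OF p, of j], of m]
        arg_cong[OF mul_commute[of "X i" "- of_nat j" "X m" 1], of "\<lambda>T. app T p"] by simp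
    then show "app (f m) p \<in> B" by (simp add: B_def)
    have "app (mul (X i) (- of_nat j)) (app d p) = app d (app (mul (X i) (- of_nat j)) p)
        - app (sc (of_int i * - of_nat j)) (app (mul (X i) (- of_nat j)) p)" for j
      using arg_cong[OF dg_mul[of gd "X i" "- of_nat j"], of "\<lambda>T. app T p"]
      by (simp add: d_def app_add_right clin_app)
    moreover have "app d (app (mul (X i) (- of_nat j)) p)
        - app (sc (of_int i * - of_nat j)) (app (mul (X i) (- of_nat j)) p) \<in> N" for j
      by (intro gsubD(3,8,9)[OF assms(2)] BN[OF p])
    ultimately show "app d p \<in> B" by (simp add: B_def)
    have "app (mul (X i) (- of_nat j)) (app (e m) p) \<in> N" for j
    proof -
      let ?w = "- of_nat j :: complex"
      have m1: "mul (X i) (?w - 1) = mul (X i) (- of_nat (Suc j))"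
        and m2: "mul (X i) (?w - 2) = mul (X i) (- of_nat (Suc (Suc j)))"
        by (simp only: minus1, simp only: minus2)
      have "app (mul (X i) ?w) (app (e m) p) = app (e m) (app (mul (X i) ?w) p)
          - app (sc ?w) (app (mul (X i) (- of_nat (Suc j))) (app (h (m + i)) p))
          - (if i = - m then app (sc (?w * of_int m * K)) (app (mul (X i) (- of_nat (Suc j))) p) else 0)
          + app (sc (?w * (?w - 1))) (app (f (m + 2 * i)) (app (mul (X i) (- of_nat (Suc (Suc j)))) p))"
        using arg_cong[OF e_mul_X[of m i ?w], of "\<lambda>T. app T p"] unfolding m1 m2
        by (simp del: of_nat_Suc)
      also have "\<dots> \<in> N"
        using BN[OF p] BN[OF Bh[OF p]]
        by (intro gsubD(2,9)[OF assms(2)]) (auto intro!: gsubD[OF assms(2)] simp del: of_nat_Suc)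
      finally show ?thesis .
    qed
    then show "app (e m) p \<in> B" by (simp add: B_def)
  qed (use gsubD[OF assms(2)] in \<open>auto simp: B_def app_add_right clin_app\<close>)
  moreover have inv: "app (mul (X i) (- 1)) p \<in> B" if "p \<in> B" for p
  proof -
    have "app (mul (X i) (- of_nat j)) (app (mul (X i) (- 1)) p) = app (mul (X i) (- of_nat (Suc j))) p" for j
      by (simp only: app_mul_add) (simp add: minus1 del: of_nat_Suc)
    then show ?thesis using BN[OF that] unfolding B_def by (simp del: of_nat_Suc)
  qed
  moreover have "B \<noteq> {0}"
  proof -
    \<comment> \<open>The other exponents are natural, so negative total degree forces a negative
      exponent of x_i and no eigenvalue vanishes on \<open>P\<close>. As T keeps the degree and each
      e_m lowers it, \<open>P\<close> is stable, and division by x_i works exactly and not only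
      modulo the Verma module.\<close>
    define P where "P = {\<mu> \<in> ET i 0. wt gX \<mu> \<in> of_int ` {..<0}}"
    have eT: "app (e m) q \<in> span_on P" if "q \<in> span_on P" for m q
    proof -
      have "q \<in> span_on (ET i 0)" "q \<in> span_on {\<mu>. wt gX \<mu> \<in> of_int ` {..<0}}"
        using that by (auto simp: P_def span_on_def)
      then have "app (e m) q \<in> span_on (ET i 0 \<inter> {\<mu>. wt gX \<mu> + 1 \<in> of_int ` {..<0}})"
        by (intro span_on_Int gsubD(5)[OF gsub_ET] e_degree)
      then show ?thesis
      proof (rule span_on_mono)
        show "ET i 0 \<inter> {\<mu>. wt gX \<mu> + 1 \<in> of_int ` {..<0}} \<subseteq> P"
        proof safe
          fix \<mu> :: expo and k :: int assume "\<mu> \<in> ET i 0" "wt gX \<mu> + 1 = of_int k" "k < 0"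
          moreover from this(2) have "wt gX \<mu> = of_int (k - 1)" by (simp add: algebra_simps)
          ultimately show "\<mu> \<in> P" unfolding P_def by (intro CollectI conjI image_eqI[of _ _ "k - 1"]) auto
        qed
      qed
    qed
    have TP: "app (T i) q \<in> span_on P" if "q \<in> span_on P" for q
      using that
    proof (rule clin_span_on[OF clin_T, rotated])
      fix \<mu> assume \<mu>: "\<mu> \<in> P"
      then have "\<mu> \<in> ET i 0" "raised i 0 \<mu> \<subseteq> P" by (auto simp: P_def raised_def)
      from span_on_add[OF span_on_mono[OF T_triangular[OF this(1)] this(2)] span_on_single[OF \<mu>, of "eig i \<mu>"]]
      show "app (T i) (single \<mu> 1) \<in> span_on P" by simp
    qed
    have PB: "app (mul (X i) (- 1)) p \<in> N \<inter> span_on P" if p: "p \<in> N" "p \<in> span_on P" for p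
    proof -
      have "eig i \<mu> \<noteq> 0 \<and> raised i 0 \<mu> \<subseteq> P" if mP: "\<mu> \<in> P" for \<mu>
      proof -
        have \<mu>: "\<mu> \<in> ET i 0" using mP by (simp add: P_def)
        have "lookup \<mu> (X i) \<noteq> 0"
        proof
          assume "lookup \<mu> (X i) = 0"
          then obtain n where "wt gX \<mu> = of_nat n" using ET_wt[OF \<mu>] by (auto elim: Nats_cases)
          moreover obtain k where "wt gX \<mu> = of_int k" "k < 0" using mP by (auto simp: P_def)
          ultimately have "(of_int (int n) :: complex) = of_int k" by simp
          then show False using \<open>k < 0\<close> by (simp only: of_int_eq_iff)
        qed
        then show ?thesis
          using eig_factor[OF \<mu>] assms(5) minus_in_Ints_iff[of "J - of_int i * K"] mP
          by (auto simp: eig_def raised_def P_def)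
      qed
      then have "\<exists>es. 0 \<notin> set es \<and> app (prodT (T i) es) p \<in> {0}"
        using p by (intro T_locally_finite[of i _ P 0] T_sub_gsub gsub_zero) (auto simp: P_def)
      moreover have "T_sub (T i) (N \<inter> span_on P)"
        using T_subD[OF T_sub_gsub[OF assms(2)]] TP
        by (auto simp: T_sub_def span_on_add span_on_sc)
      ultimately obtain q where q: "q \<in> N \<inter> span_on P" "app (T i) q = p"
        using prodT_surj[OF clin_T, of _ i p "N \<inter> span_on P"] p by blast
      then have "app (mul (X i) (- 1)) p = app (e (- i)) q"
        using mul_cancel(2)[of "X i" 1] by (auto simp: T_def)
      then show ?thesis using q(1) gsubD(5)[OF assms(2)] eT by auto
    qed
    have PB': "p \<in> B" if "p \<in> N" "p \<in> span_on P" for p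
    proof -
      have "app (mul (X i) (- of_nat j)) p \<in> N \<inter> span_on P" for j
      proof (induction j)
        case (Suc j)
        have "app (mul (X i) (- of_nat (Suc j))) p = app (mul (X i) (- 1)) (app (mul (X i) (- of_nat j)) p)"
          by (simp add: app_mul_add)
        then show ?case using PB Suc by auto
      qed (use that in simp)
      then show ?thesis by (simp add: B_def)
    qed
    obtain v where v: "v \<in> N" "v \<notin> span_on EV" using assms(3) by blast
    then obtain n where n: "v \<in> span_on {\<mu>. wt gX \<mu> \<in> of_int ` {..n}}"
      using ET_0_degree_bound assms(4) by blast
    \<comment> \<open>Each application of e_{-i} lowers the degree by 1 and, by injectivity modulo
      the Verma module, never leads into it; after \<open>nat (n + 1)\<close> applications the
      degree is negative.\<close>
    have "app (e (- i) ^ j) v \<in> N \<and> app (e (- i) ^ j) v \<notin> span_on EV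
      \<and> app (e (- i) ^ j) v \<in> span_on {\<mu>. wt gX \<mu> \<in> of_int ` {..n - int j}}" for j
    proof (induction j)
      case (Suc j)
      then have "app (e (- i)) (app (e (- i) ^ j) v) \<in> span_on {\<mu>. wt gX \<mu> + 1 \<in> of_int ` {..n - int j}}"
        by (intro e_degree) simp
      moreover have "{\<mu>. wt gX \<mu> + 1 \<in> of_int ` {..n - int j}} \<subseteq> {\<mu>. wt gX \<mu> \<in> of_int ` {..n - int (Suc j)}}"
      proof safe
        fix \<mu> k assume "wt gX \<mu> + 1 = of_int k" "k \<le> n - int j"
        moreover from this(1) have "wt gX \<mu> = of_int (k - 1)" by (simp add: algebra_simps)
        ultimately show "wt gX \<mu> \<in> of_int ` {..n - int (Suc j)}"
          by (intro image_eqI[of _ _ "k - 1"]) auto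
      qed
      ultimately have "app (e (- i)) (app (e (- i) ^ j) v) \<in> span_on {\<mu>. wt gX \<mu> \<in> of_int ` {..n - int (Suc j)}}"
        by (rule span_on_mono)
      moreover have "app (e (- i) ^ j) v \<in> span_on (ET i 0)" using Suc assms(4) by auto
      ultimately show ?case
        using Suc e_injective_mod_verma[OF assms(5)] gsubD(5)[OF assms(2)] by auto
    qed (use v n in simp)
    from this[of "nat (n + 1)"]
    obtain u where u: "u \<in> N" "u \<notin> span_on EV" "u \<in> span_on {\<mu>. wt gX \<mu> \<in> of_int ` {..n - int (nat (n + 1))}}"
      by blast
    have "{\<mu>. wt gX \<mu> \<in> of_int ` {..n - int (nat (n + 1))}} \<subseteq> {\<mu>. wt gX \<mu> \<in> of_int ` {..<0}}"
      by auto
    from span_on_Int[OF subsetD[OF assms(4) u(1)] span_on_mono[OF u(3) this]]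
    have "u \<in> span_on P" by (simp add: P_def Int_def)
    then have "u \<in> B" using PB' u by blast
    moreover have "u \<noteq> 0" using u(2) by auto
    ultimately show ?thesis by auto
  qed
  ultimately have "B = span_on (ET i 0)"
    using \<open>B \<subseteq> N\<close> assms(4) by (intro localization_irreducible[OF assms(1)]) auto
  then show ?thesis using \<open>B \<subseteq> N\<close> assms(4) by auto
qed

end


section \<open>Locally nilpotent root vectors\<close>

lemma ad_cube_sl2:
  assumes "x = sl2_e \<or> x = sl2_f"
  shows "lie x (lie x (lie x y)) = 0"
  using assms by (auto intro!: sl2_eqI)

lemma ad_cube_loop:
  assumes "x = sl2_e \<or> x = sl2_f"
  shows "lie (loop_vec x m) (lie (loop_vec x m) (lie (loop_vec x m) y)) = 0"
proof -
  let ?s = "single m x"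
  have xx: "lie x x = 0" by (rule lie_self)
  have 1: "loop_lie ?s (loop_lie ?s (loop_lie ?s u)) = 0" for u
    by (induction u rule: loop_induct) (simp_all add: ad_cube_sl2[OF assms] loop_lie_add_right)
  have f0: "sl2_form x (lie x (lie x v)) = 0" for v
    using sl2_form_invariant[of x x "lie x v"] by (simp add: lie_self)
  have 2: "loop_cocycle ?s (loop_lie ?s (loop_lie ?s u)) = 0" for u
    by (induction u rule: loop_induct) (simp_all add: f0 loop_lie_add_right loop_cocycle_add_right)
  have lsub: "loop_lie w (u - v) = loop_lie w u - loop_lie w v" for u v w
    using loop_lie_add_right[of w "u - v" v] by simp
  show ?thesis
    by (simp add: lie_affine_def loop_vec_def zero_affine_def lsub 1 2 xx lie_scaleC_right)
qed

lemma single_eq_0 [simp]: "single k c = 0 \<longleftrightarrow> c = 0"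
  by (metis lookup_single_eq lookup_zero single_zero)

context fock
begin

lemma comm_with_rho: "comm_with (rho x) (rho y) = rho (lie x y)"
  by (simp add: comm_with_def rho_lie)

lemma rho_zero [simp]: "rho 0 = 0"
  using rho_scale[of 0 0] by (simp add: sc_hom)

lemma comm_with_cube: "(comm_with (e m) ^^ 3) (rho x) = 0"
proof -
  have "(comm_with (rho (e_vec m)) ^^ 3) (rho x) = rho (lie (e_vec m) (lie (e_vec m) (lie (e_vec m) x)))"
    by (simp add: numeral_3_eq_3 comm_with_rho del: rho_e)
  then show ?thesis by (simp add: e_vec_def ad_cube_loop flip: rho_e)
qed

definition nilpotent_part :: "int \<Rightarrow> complex \<Rightarrow> alg set \<Rightarrow> alg set" where
  "nilpotent_part i z M = {p \<in> span_on (ET i z). \<exists>n. app (e (- i) ^ n) p \<in> M}"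

text \<open>The third power of ad e_{-i} vanishes on the Lie algebra. So if e_{-i}^n p lies in M,
  then e_{-i}^{n+3} sends x p into M for every x.\<close>

lemma gsub_nilpotent_part:
  assumes M: "gsub M"
  shows "gsub (nilpotent_part i z M)"
  unfolding gsub_def
proof (intro conjI ballI allI)
  have pw: "app (e (- i) ^ k) q \<in> M" if "q \<in> M" for k q
    by (induction k) (use that gsubD[OF M] in auto)
  have up: "app (e (- i) ^ (k + n)) q \<in> M" if "app (e (- i) ^ n) q \<in> M" for k n q
    using pw[OF that, of k] by (simp add: power_add)
  have clin_pow: "clin (e (- i) ^ n)" for n by (induction n) simp_all
  show "0 \<in> nilpotent_part i z M"
    using gsubD[OF M] by (simp add: nilpotent_part_def)
  fix p assume "p \<in> nilpotent_part i z M"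
  then obtain n where p: "p \<in> span_on (ET i z)" "app (e (- i) ^ n) p \<in> M"
    by (auto simp: nilpotent_part_def)
  show "app (sc c) p \<in> nilpotent_part i z M" for c
    unfolding nilpotent_part_def
    by (intro CollectI conjI exI[of _ n]) (simp_all add: p span_on_sc clin_app[OF clin_pow] gsubD[OF M])
  show "app (rho x) p \<in> nilpotent_part i z M" for x
  proof -
    have st: "app ((comm_with (e (- i)) ^^ k) (rho x)) q \<in> M" if "q \<in> M" for k q
    proof -
      have "\<exists>y. (comm_with (e (- i)) ^^ k) (rho x) = rho y"
        by (induction k) (auto simp: comm_with_rho simp flip: rho_e)
      then show ?thesis using gsubD[OF M] that by auto
    qed
    have "app (e (- i) ^ (3 + n)) (app (rho x) p) \<in> M"
      by (rule nilpotent_on_product) (use gsubD[OF M] st comm_with_cube p in auto)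
    then show ?thesis
      using gsubD(4)[OF gsub_ET p(1)] by (auto simp: nilpotent_part_def)
  qed
  fix q assume "q \<in> nilpotent_part i z M"
  then obtain m where q: "q \<in> span_on (ET i z)" "app (e (- i) ^ m) q \<in> M"
    by (auto simp: nilpotent_part_def)
  have "app (e (- i) ^ (m + n)) (p + q) \<in> M"
    using up[OF p(2), of m] up[OF q(2), of n] gsubD[OF M] by (simp add: app_add_right add.commute)
  then show "p + q \<in> nilpotent_part i z M"
    using p q by (auto simp: nilpotent_part_def span_on_add)
qed

lemma e_power_X:
  "app (e (- i)) (single (single (X i) w) c) = single (single (X i) (w - 1)) (w * (J - of_int i * K - w + 1) * c)"
proof -
  have "app (e (- i)) (single (single (X i) w) 1) = single (single (X i) (w - 1)) (w * (J - of_int i * K - w + 1))"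
    using e_X_power[of 0 i w] e_kills[of 0 "- i" 1] by (simp add: EV_iff del: single_one)
  then show ?thesis
    using clin_single[OF clin_e, of "- i" "single (X i) w" c] by (simp add: mult.commute)
qed

lemma e_power_X_nonzero:
  assumes "\<And>j::nat. w - of_nat j \<noteq> 0" "\<And>j::nat. J - of_int i * K - w + of_nat j + 1 \<noteq> 0"
  shows "\<exists>c. c \<noteq> 0 \<and> app (e (- i) ^ n) (single (single (X i) w) 1) = single (single (X i) (w - of_nat n)) c"
proof (induction n)
  case (Suc n)
  then obtain c where c: "c \<noteq> 0" "app (e (- i) ^ n) (single (single (X i) w) 1) = single (single (X i) (w - of_nat n)) c"
    by blast
  have "J - of_int i * K - (w - of_nat n) + 1 \<noteq> 0"
    using assms(2)[of n] by (simp add: algebra_simps)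
  then show ?case
    using c assms(1)[of n]
    by (intro exI[of _ "(w - of_nat n) * (J - of_int i * K - (w - of_nat n) + 1) * c"])
      (simp add: e_power_X diff_diff_eq add.commute)
qed (simp add: exI[of _ 1])

theorem twisted_reducible:
  assumes "z \<notin> \<int>" "z - J + of_int i * K \<in> \<int>"
  obtains N where "gsub N" "N \<subset> span_on (ET i z)" "N \<noteq> {0}"
proof (rule that)
  let ?N = "nilpotent_part i z {0}"
  \<comment> \<open>At exponent w = c the factor J - iK - w + 1 in \<open>e_power_X\<close>
    vanishes, so e_{-i} kills x_i^c. Starting from x_i^{c-1} this factor takes the values 1, 2, 3,
    ... and the exponents are never integers, so no power of e_{-i} kills that vector.\<close>
  define c where "c = J - of_int i * K + 1"
  have cz: "c - z \<in> \<int>"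
    using Ints_diff[OF Ints_1 assms(2)] by (simp add: c_def algebra_simps)
  have cZ: "c - of_int j \<notin> \<int>" for j
  proof
    assume "c - of_int j \<in> \<int>"
    from Ints_diff[OF Ints_add[OF this Ints_of_int[of j]] cz] assms(1) show False by simp
  qed
  show "gsub ?N" by (intro gsub_nilpotent_part gsub_zero)
  have in_ET: "single (single (X i) (c - of_int j)) 1 \<in> span_on (ET i z)" for j
    using Ints_diff[OF cz Ints_of_int[of j]]
    by (auto intro!: span_on_single simp: ET_iff lookup_single when_def algebra_simps)
  have "app (e (- i) ^ 1) (single (single (X i) c) 1) \<in> {0}"
    by (simp add: e_power_X) (simp add: c_def)
  then have "single (single (X i) c) 1 \<in> ?N"
    using in_ET[of 0] unfolding nilpotent_part_def by (intro CollectI conjI exI[of _ 1]) simp_all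
  moreover have "single (single (X i) c) 1 \<noteq> (0 :: alg)" by simp
  ultimately show "?N \<noteq> {0}" by blast
  have "app (e (- i) ^ n) (single (single (X i) (c - 1)) 1) \<noteq> 0" for n
  proof -
    have "c - 1 - of_nat j \<noteq> 0" for j
      using cZ[of "1 + int j"] by (auto simp: algebra_simps)
    moreover have "J - of_int i * K - (c - 1) + of_nat j + 1 \<noteq> 0" for j
      using of_nat_neq_0[of j, where 'a = complex] by (simp add: c_def add.commute[of 1])
    ultimately show ?thesis using e_power_X_nonzero[of "c - 1" i n] by auto
  qed
  then have "single (single (X i) (c - 1)) 1 \<notin> ?N" by (auto simp: nilpotent_part_def)
  then show "?N \<subset> span_on (ET i z)"
    using in_ET[of 1] by (auto simp: nilpotent_part_def)
qed

theorem quotient_reducible: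
  assumes "J - of_int i * K \<in> \<int>"
  obtains N where "gsub N" "span_on EV \<subset> N" "N \<subset> span_on (ET i 0)"
proof (rule that)
  let ?N = "nilpotent_part i 0 (span_on EV)"
  obtain r where r: "J - of_int i * K = of_int r" using assms by (auto elim: Ints_cases)
  show "gsub ?N" by (intro gsub_nilpotent_part gsub_EV)
  have EVN: "span_on EV \<subseteq> ?N"
  proof
    fix p assume "p \<in> span_on EV"
    then have "p \<in> span_on (ET i 0)" "app (e (- i) ^ 0) p \<in> span_on EV"
      using span_on_mono EV_ET by auto
    then show "p \<in> ?N" unfolding nilpotent_part_def by blast
  qed
  \<comment> \<open>For w \<le> -1 and w \<le> r both w - j and r - w + j + 1 stay nonzero for all
    natural j, and the exponent stays negative, so no power of e_{-i} sends x_i^w into the Verma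
    module.\<close>
  define w :: int where "w = min (- 1) r"
  have "app (e (- i) ^ n) (single (single (X i) (of_int w)) 1) \<notin> span_on EV" for n
  proof -
    have "of_int w - of_nat j \<noteq> (0 :: complex)" for j
    proof -
      have "w - int j \<noteq> 0" by (simp add: w_def)
      then have "of_int (w - int j) \<noteq> (0 :: complex)" by (simp only: of_int_eq_0_iff not_False_eq_True)
      then show ?thesis by simp
    qed
    moreover have "J - of_int i * K - of_int w + of_nat j + 1 \<noteq> 0" for j
    proof -
      have "r - w + int j + 1 \<noteq> 0" by (simp add: w_def)
      then have "of_int (r - w + int j + 1) \<noteq> (0 :: complex)" by (simp only: of_int_eq_0_iff not_False_eq_True)
      then show ?thesis by (simp add: r)
    qed
    ultimately obtain c where c: "c \<noteq> 0"
      "app (e (- i) ^ n) (single (single (X i) (of_int w)) 1) = single (single (X i) (of_int w - of_nat n)) c"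
      using e_power_X_nonzero by blast
    have "of_int w - of_nat n \<notin> (\<nat> :: complex set)"
    proof
      assume "of_int w - of_nat n \<in> (\<nat> :: complex set)"
      then obtain m where "of_int w - of_nat n = (of_nat m :: complex)" by (auto elim: Nats_cases)
      then have "of_int (w - int n) = (of_int (int m) :: complex)" by simp
      then have "w - int n = int m" by (simp only: of_int_eq_iff)
      then show False by (simp add: w_def)
    qed
    then show ?thesis using c by (auto simp: span_on_def EV_iff intro!: exI[of _ "X i"])
  qed
  then have "single (single (X i) (of_int w)) 1 \<notin> ?N" by (auto simp: nilpotent_part_def)
  moreover have "single (single (X i) (of_int w)) 1 \<in> span_on (ET i 0)"
    by (auto intro!: span_on_single simp: ET_iff lookup_single when_def)
  ultimately show "?N \<subset> span_on (ET i 0)" by (auto simp: nilpotent_part_def)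

  text \<open>A vector of \<open>sl\<^sub>2\<close>-weight high enough that \<open>T\<close> annihilates its leading term, while all the
    other eigenvalues that occur are nonzero.\<close>
  define dd :: nat where "dd = nat (max 0 (r + 2))"
  \<comment> \<open>This exponent makes the second factor of \<open>eig\<close> vanish at total
    degree w0 + dd. As dd \<ge> r + 2, this degree is at most -1; it bounds the exponents of x_i in
    \<open>P\<close>, where the first factor is therefore nonzero. For r \<ge> -1 the vector
    x_i^{r+1} killed by e_{-i} lies in the Verma module, which is why x_{i+1} is brought in.\<close>
  define w0 :: int where "w0 = r + 1 - 2 * int dd"
  define \<mu> :: expo where "\<mu> = single (X i) (of_int w0) + single (X (i + 1)) (of_nat dd)"
  have lk: "lookup \<mu> (X i) = of_int w0" by (simp add: \<mu>_def lookup_add lookup_single)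
  have wt: "wt gX \<mu> = of_int (w0 + int dd)" by (simp add: \<mu>_def wt_add)
  have \<mu>: "\<mu> \<in> ET i 0"
    by (auto simp: \<mu>_def ET_iff lookup_add lookup_single when_def)
  define P where "P = {\<nu> \<in> ET i 0. wt gX \<nu> = wt gX \<mu> \<and> lookup \<nu> (X i) - of_int w0 - 1 \<in> \<nat>}"
  have P: "raised i 0 \<mu> = P" by (simp add: raised_def P_def lk)
  have "eig i \<mu> = of_int (w0 * (r + 1 + w0 - 2 * (w0 + int dd)))"
    unfolding eig_def lk wt r by simp
  also have "r + 1 + w0 - 2 * (w0 + int dd) = 0" by (simp add: w0_def)
  finally have "eig i \<mu> = 0" by simp
  then have TP: "app (T i) (single \<mu> 1) \<in> span_on P"
    using T_triangular[OF \<mu>] by (simp add: P)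
  have "eig i \<nu> \<noteq> 0 \<and> raised i 0 \<nu> \<subseteq> P" if \<nu>: "\<nu> \<in> P" for \<nu>
  proof -
    have "lookup \<nu> (X i) - of_int w0 - 1 \<in> \<nat>" using \<nu> by (simp add: P_def)
    then obtain k where "lookup \<nu> (X i) - of_int w0 - 1 = of_nat k" by (auto elim: Nats_cases)
    then have k: "lookup \<nu> (X i) = of_int (w0 + 1 + int k)" by (simp add: algebra_simps)
    have wt\<nu>: "wt gX \<nu> = of_int (w0 + int dd)" using \<nu> wt by (simp add: P_def)
    obtain l where "wt gX \<nu> - lookup \<nu> (X i) = of_nat l"
      using ET_wt \<nu> by (force simp: P_def elim: Nats_cases)
    then have "of_int (int dd - 1 - int k) = (of_int (int l) :: complex)"
      by (simp add: k wt\<nu> algebra_simps)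
    then have l: "int dd - 1 - int k = int l" by (simp only: of_int_eq_iff)
    have "int dd \<ge> r + 2" by (simp add: dd_def)
    then have "w0 + 1 + int k \<noteq> 0" using l unfolding w0_def by linarith
    moreover have "r + 1 + (w0 + 1 + int k) - 2 * (w0 + int dd) \<noteq> 0" by (simp add: w0_def)
    ultimately have "(w0 + 1 + int k) * (r + 1 + (w0 + 1 + int k) - 2 * (w0 + int dd)) \<noteq> 0" by simp
    then have "of_int ((w0 + 1 + int k) * (r + 1 + (w0 + 1 + int k) - 2 * (w0 + int dd))) \<noteq> (0 :: complex)"
      by (simp only: of_int_eq_0_iff not_False_eq_True)
    also have "of_int ((w0 + 1 + int k) * (r + 1 + (w0 + 1 + int k) - 2 * (w0 + int dd))) = eig i \<nu>"
      unfolding eig_def k wt\<nu> r by simp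
    finally have "eig i \<nu> \<noteq> 0" .
    moreover have "raised i 0 \<nu> \<subseteq> P"
    proof
      fix \<kappa> assume \<kappa>: "\<kappa> \<in> raised i 0 \<nu>"
      then obtain m where "lookup \<kappa> (X i) - lookup \<nu> (X i) - 1 = of_nat m"
        by (auto simp: raised_def elim: Nats_cases)
      then have "lookup \<kappa> (X i) - of_int w0 - 1 = of_nat (k + 1 + m)"
        by (simp add: k algebra_simps)
      then have "lookup \<kappa> (X i) - of_int w0 - 1 \<in> \<nat>" by (simp only: of_nat_in_Nats)
      moreover have "\<kappa> \<in> ET i 0" "wt gX \<kappa> = wt gX \<nu>" using \<kappa> by (auto simp: raised_def)
      moreover have "wt gX \<nu> = wt gX \<mu>" using \<nu> by (simp add: P_def)
      ultimately show "\<kappa> \<in> P" by (simp add: P_def)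
    qed
    ultimately show ?thesis by blast
  qed
  note P_eig = this
  have "P \<subseteq> ET i 0" by (auto simp: P_def)
  then have "\<exists>es. 0 \<notin> set es \<and> app (prodT (T i) es) (app (T i) (single \<mu> 1)) \<in> {0}"
    using P_eig by (intro T_locally_finite[OF T_sub_gsub[OF gsub_zero] _ _ TP]) blast+
  then obtain es where es: "0 \<notin> set es" "app (prodT (T i) es) (app (T i) (single \<mu> 1)) \<in> {0}"
    by blast
  obtain \<delta> Q where Q: "\<delta> \<noteq> 0" "prodT (T i) es = sc \<delta> + T i * Q" "T i * Q = Q * T i"
    "\<forall>N. T_sub (T i) N \<longrightarrow> (\<forall>p\<in>N. app Q p \<in> N)"
    using prodT_split[OF clin_T[of i] es(1)] by blast
  \<comment> \<open>As T commutes with the polynomial, T u = 0 and hence e_{-i} u = 0. The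
    coefficient of u at \<open>\<mu>\<close> is \<open>\<delta>\<close>, which is nonzero, because
    \<open>\<mu>\<close> is not in \<open>P\<close>.\<close>
  define u where "u = app (prodT (T i) es) (single \<mu> 1)"
  have "T_sub (T i) (span_on P)"
    unfolding T_sub_def
  proof (intro conjI ballI allI)
    fix p assume "p \<in> span_on P"
    then show "app (T i) p \<in> span_on P"
    proof (rule clin_span_on[OF clin_T, rotated])
      fix \<nu> assume \<nu>: "\<nu> \<in> P"
      then have "\<nu> \<in> ET i 0" "raised i 0 \<nu> \<subseteq> P"
        using P_eig \<open>P \<subseteq> ET i 0\<close> by blast+
      from span_on_add[OF span_on_mono[OF T_triangular[OF this(1)] this(2)] span_on_single[OF \<nu>, of "eig i \<nu>"]]
      show "app (T i) (single \<nu> 1) \<in> span_on P" by simp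
    qed
  qed (simp_all add: span_on_add span_on_sc)
  then have "app Q (app (T i) (single \<mu> 1)) \<in> span_on P"
    using Q(4) TP by blast
  note QP = this
  have u: "u = single \<mu> \<delta> + app Q (app (T i) (single \<mu> 1))"
    using arg_cong[OF Q(3), of "\<lambda>S. app S (single \<mu> 1)"] by (simp add: u_def Q(2))
  have "\<mu> \<notin> P"
  proof
    assume "\<mu> \<in> P"
    then have "of_nat 0 - 1 \<in> (\<nat> :: complex set)" by (simp add: P_def lk)
    then show False using Nats_minus_one by blast
  qed
  then have "\<mu> \<notin> keys (app Q (app (T i) (single \<mu> 1)))"
    using QP unfolding span_on_def by blast
  then have "lookup u \<mu> = \<delta>"
    by (simp add: u lookup_add in_keys_iff)
  have "int dd \<ge> r + 2" by (simp add: dd_def)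
  then have w0neg: "w0 < 0" unfolding w0_def by linarith
  have "lookup \<mu> (X i) \<notin> \<nat>"
  proof
    assume "lookup \<mu> (X i) \<in> \<nat>"
    then obtain m where "of_int w0 = (of_nat m :: complex)" by (auto simp: lk elim: Nats_cases)
    then have "of_int w0 = (of_int (int m) :: complex)" by simp
    then have "w0 = int m" by (simp only: of_int_eq_iff)
    then show False using w0neg by simp
  qed
  then have "u \<notin> span_on EV"
    using \<open>lookup u \<mu> = \<delta>\<close> Q(1) by (auto simp: span_on_def EV_iff in_keys_iff)
  moreover have "u \<in> ?N"
  proof -
    have "app (T i) u = app (prodT (T i) es) (app (T i) (single \<mu> 1))"
      using arg_cong[OF prodT_commute[OF clin_T, of i es "[0]"], of "\<lambda>S. app S (single \<mu> 1)"]
      by (simp add: u_def sc_hom)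
    then have "app (e (- i)) u = 0" using es(2) by (simp add: T_def)
    moreover have "u \<in> span_on (ET i 0)"
      unfolding u by (intro span_on_add span_on_single span_on_mono[OF QP] \<mu> \<open>P \<subseteq> ET i 0\<close>)
    ultimately show ?thesis
      unfolding nilpotent_part_def by (intro CollectI conjI exI[of _ 1]) simp_all
  qed
  ultimately show "span_on EV \<subset> ?N" using EVN by blast
qed


section \<open>Injectivity of the real root vectors\<close>

text \<open>The quadratic term of e_n x_i^v produces x_{n+2i} x_i^{v-2}, with a lower power of x_i
  than all other terms; n \<noteq> -i ensures that x_{n+2i} is a different variable. At the lowest
  power w of x_i nothing else can cancel it.\<close>

lemma e_leading_term:
  assumes "n \<noteq> - i"
    and p: "p \<in> span_on {\<mu> \<in> ET i z. lookup \<mu> (X i) - w \<in> \<nat>}" and \<mu>0: "lookup \<mu>0 (X i) = w"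
  shows "lookup (app (e n) p) (single (X (n + 2 * i)) 1 + single (X i) (- 2) + \<mu>0)
    = - (w * (w - 1)) * lookup p \<mu>0" (is "lookup _ ?\<kappa> = _")
  using p
proof (induction rule: span_on_induct)
  case (single \<mu> c)
  define v where "v = lookup \<mu> (X i)"
  obtain k where k: "v = w + of_nat k" using single by (auto simp: v_def algebra_simps elim: Nats_cases)
  obtain \<nu> where \<nu>: "\<mu> = single (X i) v + \<nu>" "\<nu> \<in> EV" "lookup \<nu> (X i) = 0"
    using ET_decompose[of \<mu> i z] single unfolding v_def by blast
  have *: "lookup (app (mul (X i) u) q) ?\<kappa> = 0" if q: "q \<in> span_on EV" and u: "u = v \<or> u = v - 1" for q u
  proof -
    have "lookup (?\<kappa> - single (X i) u) (X i) = w - 2 - u"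
      using assms(1) \<mu>0 by (simp add: lookup_add lookup_minus lookup_single when_def)
    moreover have "w - 2 - u \<notin> \<nat>"
    proof
      assume "w - 2 - u \<in> \<nat>"
      then obtain m where "w - 2 - u = of_nat m" by (auto elim: Nats_cases)
      then have "of_nat (m + k + 1) = (0 :: complex) \<or> of_nat (m + k + 2) = (0 :: complex)"
        using u k by (auto simp: algebra_simps)
      then show False by (simp only: of_nat_eq_0_iff) simp
    qed
    ultimately have "?\<kappa> - single (X i) u \<notin> EV" by (metis EV_iff)
    then show ?thesis using q by (auto simp: lookup_mul span_on_def in_keys_iff)
  qed
  have "single \<nu> 1 \<in> span_on EV" using \<nu> by (simp add: span_on_single)
  note EVs = gsubD(5,7)[OF gsub_EV this]
  have "app (e n) (single \<mu> 1) = app (mul (X i) v) (app (e n) (single \<nu> 1))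
      + app (sc v) (app (mul (X i) (v - 1)) (app (h (n + i)) (single \<nu> 1)))
      - single (single (X (n + 2 * i)) 1 + (single (X i) (v - 2) + \<nu>)) (v * (v - 1))"
    using arg_cong[OF e_mul_X[of n i v], of "\<lambda>T. app T (single \<nu> 1)"] assms(1) by (simp add: \<nu>(1))
  then have "lookup (app (e n) (single \<mu> 1)) ?\<kappa>
      = - lookup (single (single (X (n + 2 * i)) 1 + (single (X i) (v - 2) + \<nu>)) (v * (v - 1))) ?\<kappa>"
    using *[OF EVs(1), of v] *[OF EVs(2), of "v - 1"] by (simp add: lookup_add lookup_minus)
  also have "single (X (n + 2 * i)) 1 + (single (X i) (v - 2) + \<nu>) = ?\<kappa> \<longleftrightarrow> \<mu> = \<mu>0"
    unfolding \<nu>(1) by (simp add: single_diff algebra_simps flip: single_add)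
  then have "- lookup (single (single (X (n + 2 * i)) 1 + (single (X i) (v - 2) + \<nu>)) (v * (v - 1))) ?\<kappa>
      = - (w * (w - 1)) * lookup (single \<mu> 1) \<mu>0"
    using \<mu>0 by (auto simp: lookup_single when_def v_def)
  finally show ?case
    using clin_single[OF clin_e, of n \<mu> c] by (simp add: lookup_single when_def)
qed (simp_all add: app_add_right lookup_add distrib_left)

lemma lowest_key:
  assumes "p \<in> span_on (ET i z)" "p \<noteq> 0"
  obtains \<mu> where "\<mu> \<in> keys p" "p \<in> span_on {\<nu> \<in> ET i z. lookup \<nu> (X i) - lookup \<mu> (X i) \<in> \<nat>}"
proof -
  have "\<exists>k. lookup \<nu> (X i) - z = of_int k" if "\<nu> \<in> keys p" for \<nu>
    using that assms(1) by (force simp: span_on_def ET_iff elim: Ints_cases)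
  then obtain k where k: "\<And>\<nu>. \<nu> \<in> keys p \<Longrightarrow> lookup \<nu> (X i) - z = of_int (k \<nu>)" by metis
  have "keys p \<noteq> {}" using assms(2) by simp
  then have "Min (k ` keys p) \<in> k ` keys p" by (intro Min_in) auto
  then obtain \<mu> where \<mu>: "\<mu> \<in> keys p" "k \<mu> = Min (k ` keys p)" by auto
  have "lookup \<nu> (X i) - lookup \<mu> (X i) \<in> \<nat>" if "\<nu> \<in> keys p" for \<nu>
  proof -
    have "k \<mu> \<le> k \<nu>" using that \<mu>(2) by simp
    have "lookup \<nu> (X i) - lookup \<mu> (X i) = of_int (k \<nu> - k \<mu>)"
      using k[OF that] k[OF \<mu>(1)] by (simp add: algebra_simps)
    also have "\<dots> = of_nat (nat (k \<nu> - k \<mu>))" using \<open>k \<mu> \<le> k \<nu>\<close> by simp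
    finally show ?thesis by (simp only: of_nat_in_Nats)
  qed
  then show thesis using that \<mu>(1) assms(1) by (auto simp: span_on_def)
qed

text \<open>For n = -i the eigenvalues of f_i e_{-i} decide. Otherwise the lowest power of x_i in p
  has a non-integral exponent w, so the leading coefficient -w(w - 1) is nonzero.\<close>

lemma e_twisted_injective:
  assumes "z \<notin> \<int>" "z - J + of_int i * K \<notin> \<int>" "p \<in> span_on (ET i z)" "app (e n) p = 0"
  shows "p = 0"
proof (cases "n = - i")
  case True
  have "eig i \<mu> \<noteq> 0" if "\<mu> \<in> ET i z" for \<mu>
  proof -
    have "lookup \<mu> (X i) \<noteq> 0"
      using that assms(1) by (auto simp: ET_iff minus_in_Ints_iff)
    then show ?thesis using eig_factor[OF that assms(2)] by (simp add: eig_def)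
  qed
  then have "\<exists>es. 0 \<notin> set es \<and> app (prodT (T i) es) p \<in> {0}"
    using assms(3) by (intro T_locally_finite[of i _ "ET i z" z] T_sub_gsub gsub_zero) (auto simp: raised_def)
  then obtain es where "0 \<notin> set es" "app (prodT (T i) es) p \<in> {0}" by blast
  moreover have "app (T i) p \<in> {0}" using assms(4) True by (simp add: T_def)
  ultimately have "p \<in> {0}" using prodT_inj[OF clin_T _ _ T_sub_gsub[OF gsub_zero]] by blast
  then show ?thesis by simp
next
  case False
  show ?thesis
  proof (rule ccontr)
    assume "p \<noteq> 0"
    then obtain \<mu> where \<mu>: "\<mu> \<in> keys p" "p \<in> span_on {\<nu> \<in> ET i z. lookup \<nu> (X i) - lookup \<mu> (X i) \<in> \<nat>}"
      using lowest_key[OF assms(3)] by blast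
    have "lookup \<mu> (X i) - z \<in> \<int>" using \<mu>(1) assms(3) by (auto simp: span_on_def ET_iff)
    then have "lookup \<mu> (X i) \<notin> \<int>" using assms(1) Ints_diff[of "lookup \<mu> (X i)" "lookup \<mu> (X i) - z"] by auto
    then have "lookup \<mu> (X i) \<noteq> 0" "lookup \<mu> (X i) \<noteq> 1" by auto
    then show False
      using e_leading_term[OF False \<mu>(2) refl] assms(4) \<mu>(1) by (simp add: in_keys_iff)
  qed
qed

lemma span_on_EQ_EV: "p \<in> span_on (EQ i) \<Longrightarrow> p \<in> span_on EV \<Longrightarrow> p = 0"
  by (auto simp: span_on_def EQ_def) (metis Diff_iff in_mono keys_eq_empty subsetI subset_empty)

text \<open>For n \<noteq> -i the leading term has to survive modulo the Verma module: if the lowest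
  exponent w of x_i is not natural, then w(w - 1) is nonzero and w - 2 is not natural
  either.\<close>

lemma e_quotient_injective:
  assumes "J - of_int i * K \<notin> \<int>" "p \<in> span_on (EQ i)" "app (e n) p \<in> span_on EV"
  shows "p = 0"
proof (cases "n = - i")
  case True
  have "p \<in> span_on (ET i 0)" using assms(2) by (rule span_on_mono) (auto simp: EQ_def)
  with assms(1,3) True have "p \<in> span_on EV" using e_injective_mod_verma by blast
  then show ?thesis using assms(2) span_on_EQ_EV by blast
next
  case False
  show ?thesis
  proof (rule ccontr)
    assume "p \<noteq> 0"
    moreover have "p \<in> span_on (ET i 0)" using assms(2) by (rule span_on_mono) (auto simp: EQ_def)
    ultimately obtain \<mu> where \<mu>: "\<mu> \<in> keys p" "p \<in> span_on {\<nu> \<in> ET i 0. lookup \<nu> (X i) - lookup \<mu> (X i) \<in> \<nat>}"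
      using lowest_key by blast
    have "\<mu> \<in> EQ i" using \<mu>(1) assms(2) by (auto simp: span_on_def)
    then have nn: "lookup \<mu> (X i) \<notin> \<nat>" by (simp add: EQ_iff)
    then have "lookup \<mu> (X i) \<noteq> 0" "lookup \<mu> (X i) \<noteq> 1" by auto
    let ?\<kappa> = "single (X (n + 2 * i)) 1 + single (X i) (- 2) + \<mu>"
    have "lookup (app (e n) p) ?\<kappa> \<noteq> 0"
      using e_leading_term[OF False \<mu>(2) refl] \<mu>(1) \<open>lookup \<mu> (X i) \<noteq> 0\<close> \<open>lookup \<mu> (X i) \<noteq> 1\<close>
      by (simp add: in_keys_iff)
    then have "?\<kappa> \<in> EV" using assms(3) by (auto simp: span_on_def in_keys_iff)
    then have "lookup ?\<kappa> (X i) \<in> \<nat>" by (simp add: EV_iff)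
    then have "lookup \<mu> (X i) - 2 \<in> \<nat>" using False by (simp add: lookup_add lookup_single when_def)
    from Nats_add[OF this, of 2] nn show False by simp
  qed
qed

end


section \<open>Quotients of free algebras\<close>

lemma falg_simps [simp]:
  "p \<in> carrier (falg A) \<longleftrightarrow> keys p \<subseteq> lists A"
  "\<zero>\<^bsub>falg A\<^esub> = 0" "\<one>\<^bsub>falg A\<^esub> = 1" "p \<oplus>\<^bsub>falg A\<^esub> q = p + q" "p \<otimes>\<^bsub>falg A\<^esub> q = p * q"
  by (simp_all add: falg_def)

lemma falg_UNIV [simp]: "carrier (falg UNIV) = UNIV"
  by (simp add: falg_def)

lemma falg_closed:
  "keys p \<subseteq> lists A \<Longrightarrow> keys q \<subseteq> lists A \<Longrightarrow> keys (p + q) \<subseteq> lists A"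
  "keys p \<subseteq> lists A \<Longrightarrow> keys q \<subseteq> lists A \<Longrightarrow> keys (p - q) \<subseteq> lists A"
  "keys p \<subseteq> lists A \<Longrightarrow> keys q \<subseteq> lists A \<Longrightarrow> keys (p * q) \<subseteq> lists A"
  "x \<in> A \<Longrightarrow> keys (gen x) \<subseteq> lists A"
  "keys (single [] c) \<subseteq> lists A"
  "keys (1 :: 'x list \<Rightarrow>\<^sub>0 'c::ring_1) \<subseteq> lists A"
  for p q :: "'x list \<Rightarrow>\<^sub>0 'c::ring_1"
proof -
  show "keys p \<subseteq> lists A \<Longrightarrow> keys q \<subseteq> lists A \<Longrightarrow> keys (p * q) \<subseteq> lists A"
    using monoid.m_closed[OF ring.is_monoid[OF ring_falg], of p A q] by simp
qed (use keys_add[of p q] in blast, use keys_diff[of p q] in blast,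
    auto simp: gen_def zero_list_def split: if_splits)

text \<open>Intersecting an ideal of the whole type with the free algebra on \<open>A\<close> gives
  an ideal there, so generated ideals can be compared with kernels of evaluations defined on all
  words.\<close>

lemma falg_genideal_le:
  assumes "ring_ideal I" "R \<subseteq> I" "R \<subseteq> carrier (falg A)"
  shows "Idl\<^bsub>falg A\<^esub> R \<subseteq> (I :: ('x list \<Rightarrow>\<^sub>0 'c::ring_1) set)"
proof -
  have "ideal (I \<inter> carrier (falg A)) (falg A)"
  proof (rule idealI[OF ring_falg])
    show "subgroup (I \<inter> carrier (falg A)) (add_monoid (falg A))"
    proof (rule group.subgroupI[OF abelian_group.a_group[OF ring.is_abelian_group[OF ring_falg]]])
      fix p assume p: "p \<in> I \<inter> carrier (falg A)"
      have "\<ominus>\<^bsub>falg A\<^esub> p = - p"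
        using p abelian_group.r_neg[OF ring.is_abelian_group[OF ring_falg], of p A]
        by (simp add: eq_neg_iff_add_eq_0 add.commute)
      then show "inv\<^bsub>add_monoid (falg A)\<^esub> p \<in> I \<inter> carrier (falg A)"
        using p ring_idealD(2)[OF assms(1) ring_idealD(1)[OF assms(1)], of p]
        by (simp add: a_inv_def)
    next
      show "I \<inter> carrier (falg A) \<noteq> {}"
        using ring_idealD(1)[OF assms(1)] by (intro ex_in_conv[THEN iffD1] exI[of _ 0]) simp
    qed (simp_all add: ring_idealD[OF assms(1)] falg_closed)
  qed (simp_all add: ring_idealD[OF assms(1)] falg_closed)
  then show ?thesis
    using ring.genideal_minimal[OF ring_falg] assms(2,3) by blast
qed

text \<open>Common ground of three algebras defined as quotients of free algebras: U of the Borel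
  subalgebra, U itself and the localized algebra.\<close>

locale falg_quotient =
  fixes A :: "'x set" and I :: "('x list \<Rightarrow>\<^sub>0 'c::ring_1) set"
  assumes idl: "ideal I (falg A)"
begin

abbreviation Q where "Q \<equiv> falg A Quot I"

definition cls :: "('x list \<Rightarrow>\<^sub>0 'c) \<Rightarrow> ('x list \<Rightarrow>\<^sub>0 'c) set" where
  "cls p = I +>\<^bsub>falg A\<^esub> p"

lemma cls_eq_image: "cls p = (\<lambda>q. q + p) ` I"
  by (auto simp: cls_def a_r_coset_def r_coset_def)

lemma I_closed: "0 \<in> I" "p \<in> I \<Longrightarrow> q \<in> I \<Longrightarrow> p + q \<in> I" "p \<in> I \<Longrightarrow> q \<in> I \<Longrightarrow> p - q \<in> I"
  "p \<in> I \<Longrightarrow> r \<in> carrier (falg A) \<Longrightarrow> r * p \<in> I" "p \<in> I \<Longrightarrow> r \<in> carrier (falg A) \<Longrightarrow> p * r \<in> I"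
  "I \<subseteq> carrier (falg A)"
proof -
  interpret ideal I "falg A" by (rule idl)
  show *: "0 \<in> I" "p \<in> I \<Longrightarrow> q \<in> I \<Longrightarrow> p + q \<in> I"
    "p \<in> I \<Longrightarrow> r \<in> carrier (falg A) \<Longrightarrow> r * p \<in> I" "p \<in> I \<Longrightarrow> r \<in> carrier (falg A) \<Longrightarrow> p * r \<in> I"
    "I \<subseteq> carrier (falg A)" for p q r
    using additive_subgroup.zero_closed[OF additive_subgroup_axioms]
      additive_subgroup.a_closed[OF additive_subgroup_axioms, of p q]
      I_l_closed[of p r] I_r_closed[of p r] a_subset by simp_all
  show "p - q \<in> I" if "p \<in> I" "q \<in> I"
  proof -
    have "keys (- 1 :: 'x list \<Rightarrow>\<^sub>0 'c) \<subseteq> lists A"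
      using falg_closed(2)[of 0 A 1] falg_closed(6) by simp
    then have "- 1 * q \<in> I" using *(3)[of q "- 1"] that by simp
    then show ?thesis using *(2)[of p "- 1 * q"] that by simp
  qed
qed

lemma cls_eq_iff: "cls p = cls q \<longleftrightarrow> p - q \<in> I"
proof
  assume "cls p = cls q"
  then have "p \<in> cls q"
    using I_closed(1) unfolding cls_eq_image by (metis (no_types, lifting) add_0 image_eqI)
  then show "p - q \<in> I" by (auto simp: cls_eq_image)
next
  assume *: "p - q \<in> I"
  show "cls p = cls q"
  proof safe
    fix r assume "r \<in> cls p"
    then obtain s where "s \<in> I" "r = s + p" by (auto simp: cls_eq_image)
    then show "r \<in> cls q"
      using I_closed(2)[OF _ *, of s] by (auto simp: cls_eq_image image_iff intro!: bexI[of _ "s + (p - q)"])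
  next
    fix r assume "r \<in> cls q"
    then obtain s where "s \<in> I" "r = s + q" by (auto simp: cls_eq_image)
    then show "r \<in> cls p"
      using I_closed(3)[OF _ *, of s] by (auto simp: cls_eq_image image_iff intro!: bexI[of _ "s - (p - q)"])
  qed
qed

lemma self_in_cls: "p \<in> cls p"
  using I_closed(1) by (force simp: cls_eq_image)

lemma in_cls: "q \<in> cls p \<Longrightarrow> q - p \<in> I"
  by (auto simp: cls_eq_image)

lemma ring_Q: "ring Q"
  by (rule ideal.quotient_is_ring[OF idl])

lemma carrier_Q: "carrier Q = cls ` carrier (falg A)"
  unfolding cls_def FactRing_def A_RCOSETS_def RCOSETS_def a_r_coset_def by auto

lemma cls_hom:
  assumes "keys p \<subseteq> lists A" "keys q \<subseteq> lists A"
  shows "cls p \<oplus>\<^bsub>Q\<^esub> cls q = cls (p + q)" "cls p \<otimes>\<^bsub>Q\<^esub> cls q = cls (p * q)"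
  using ring_hom_add[OF ideal.rcos_ring_hom[OF idl], of p q] ring_hom_mult[OF ideal.rcos_ring_hom[OF idl], of p q] assms
  by (simp_all add: cls_def)

lemma cls_one: "\<one>\<^bsub>Q\<^esub> = cls 1"
  using ring_hom_one[OF ideal.rcos_ring_hom[OF idl]] by (simp add: cls_def)

lemma cls_zero: "\<zero>\<^bsub>Q\<^esub> = cls 0"
  by (simp add: FactRing_def cls_eq_image)

lemma cls_closed: "keys p \<subseteq> lists A \<Longrightarrow> cls p \<in> carrier Q"
  by (simp add: carrier_Q)

end


section \<open>Extension of scalars\<close>

locale scalar_extension =
  fixes \<phi> :: "'r \<Rightarrow> 's" and R :: "'r ring" and S :: "'s ring" and M :: "('r, 'm) module"
  assumes ring_S: "ring S"
    and phi_closed: "r \<in> carrier R \<Longrightarrow> \<phi> r \<in> carrier S"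
    and M_add: "m \<in> carrier M \<Longrightarrow> n \<in> carrier M \<Longrightarrow> m \<oplus>\<^bsub>M\<^esub> n \<in> carrier M"
    and M_smult: "r \<in> carrier R \<Longrightarrow> m \<in> carrier M \<Longrightarrow> r \<odot>\<^bsub>M\<^esub> m \<in> carrier M"
begin

abbreviation E where "E \<equiv> extend_scalars \<phi> R S M"
abbreviation H where "H \<equiv> tensor_subgroup \<phi> R S M"
abbreviation G where "G \<equiv> free_Abelian_group (carrier S \<times> carrier M)"
abbreviation coset where "coset \<equiv> tensor_coset \<phi> R S M"

definition tens :: "'s \<Rightarrow> 'm \<Rightarrow> ('s \<times> 'm \<Rightarrow>\<^sub>0 int) set" where
  "tens s m = coset (frag_of (s, m))"

interpretation S: ring S by (rule ring_S)

lemma G_closed: "x \<in> carrier G \<Longrightarrow> y \<in> carrier G \<Longrightarrow> x + y \<in> carrier G"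
  "x \<in> carrier G \<Longrightarrow> y \<in> carrier G \<Longrightarrow> x - y \<in> carrier G"
  "s \<in> carrier S \<Longrightarrow> m \<in> carrier M \<Longrightarrow> frag_of (s, m) \<in> carrier G"
  using keys_add[of x y] keys_diff[of x y] by (auto simp: keys_frag_of)

lemma rels_carrier: "tensor_rels \<phi> R S M \<subseteq> carrier G"
  unfolding tensor_rels_def
  by (intro Un_least subsetI; clarify; intro G_closed; simp add: M_add M_smult phi_closed)

lemma H_subgroup: "subgroup H G"
  unfolding tensor_subgroup_def
  by (intro group.generate_is_subgroup rels_carrier group_free_Abelian_group)

lemma H_carrier: "H \<subseteq> carrier G"
  using subgroup.subset[OF H_subgroup] .

lemma H_closed: "0 \<in> H" "x \<in> H \<Longrightarrow> y \<in> H \<Longrightarrow> x + y \<in> H" "x \<in> H \<Longrightarrow> y \<in> H \<Longrightarrow> x - y \<in> H"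
proof -
  show *: "0 \<in> H" "x \<in> H \<Longrightarrow> y \<in> H \<Longrightarrow> x + y \<in> H" for x y
    using subgroup.one_closed[OF H_subgroup] subgroup.m_closed[OF H_subgroup] by simp_all
  have "- y \<in> H" if "y \<in> H" for y
    using subgroup.m_inv_closed[OF H_subgroup that] H_carrier that by auto
  then show "x \<in> H \<Longrightarrow> y \<in> H \<Longrightarrow> x - y \<in> H"
    using *(2)[of x "- y"] by simp
qed

lemma H_induct [consumes 1, case_names zero rel add uminus]:
  assumes "x \<in> H" "P 0" "\<And>r. r \<in> tensor_rels \<phi> R S M \<Longrightarrow> P r"
    "\<And>x y. P x \<Longrightarrow> P y \<Longrightarrow> P (x + y)" "\<And>x. P x \<Longrightarrow> P (- x)"
  shows "P x"
  using assms(1) unfolding tensor_subgroup_def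
proof (induction rule: generate.induct)
  case (inv r)
  then show ?case using rels_carrier assms(3,5) by auto
qed (simp_all add: assms)

lemma H_rel: "r \<in> tensor_rels \<phi> R S M \<Longrightarrow> r \<in> H"
  unfolding tensor_subgroup_def by (rule generate.incl)

lemma H_add_left: "s \<in> carrier S \<Longrightarrow> t \<in> carrier S \<Longrightarrow> m \<in> carrier M \<Longrightarrow>
    frag_of (s \<oplus>\<^bsub>S\<^esub> t, m) - (frag_of (s, m) + frag_of (t, m)) \<in> H"
  and H_add_right: "s \<in> carrier S \<Longrightarrow> m \<in> carrier M \<Longrightarrow> n \<in> carrier M \<Longrightarrow>
    frag_of (s, m \<oplus>\<^bsub>M\<^esub> n) - (frag_of (s, m) + frag_of (s, n)) \<in> H"
  and H_balanced: "s \<in> carrier S \<Longrightarrow> r \<in> carrier R \<Longrightarrow> m \<in> carrier M \<Longrightarrow>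
    frag_of (s \<otimes>\<^bsub>S\<^esub> \<phi> r, m) - frag_of (s, r \<odot>\<^bsub>M\<^esub> m) \<in> H"
  by (rule H_rel, unfold tensor_rels_def, blast)+

lemma coset_image: "coset x = (\<lambda>h. h + x) ` H"
  by (auto simp: tensor_coset_def r_coset_def)

lemma coset_eq_iff: "coset x = coset y \<longleftrightarrow> x - y \<in> H"
proof
  assume "coset x = coset y"
  then have "x \<in> coset y"
    using H_closed(1) unfolding coset_image by (metis (no_types, lifting) add_0 image_eqI)
  then show "x - y \<in> H" by (auto simp: coset_image)
next
  assume *: "x - y \<in> H"
  show "coset x = coset y"
  proof safe
    fix r assume "r \<in> coset x"
    then obtain s where "s \<in> H" "r = s + x" by (auto simp: coset_image)
    then show "r \<in> coset y"
      using H_closed(2)[OF _ *, of s] by (auto simp: coset_image image_iff intro!: bexI[of _ "s + (x - y)"])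
  next
    fix r assume "r \<in> coset y"
    then obtain s where "s \<in> H" "r = s + y" by (auto simp: coset_image)
    then show "r \<in> coset x"
      using H_closed(3)[OF _ *, of s] by (auto simp: coset_image image_iff intro!: bexI[of _ "s - (x - y)"])
  qed
qed

lemma carrier_E: "carrier E = coset ` carrier G"
  unfolding extend_scalars_def Let_def FactGroup_def RCOSETS_def tensor_coset_def by auto

lemma zero_E: "\<zero>\<^bsub>E\<^esub> = coset 0"
  by (simp add: extend_scalars_def Let_def FactGroup_def coset_image)

lemma add_E: "coset x \<oplus>\<^bsub>E\<^esub> coset y = coset (x + y)"
proof -
  have "coset x \<oplus>\<^bsub>E\<^esub> coset y = {u + v | u v. u \<in> coset x \<and> v \<in> coset y}"
    by (auto simp: extend_scalars_def Let_def FactGroup_def set_mult_def)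
  also have "\<dots> = coset (x + y)"
  proof safe
    fix u v assume "u \<in> coset x" "v \<in> coset y"
    then obtain h k where "h \<in> H" "k \<in> H" "u = h + x" "v = k + y" by (auto simp: coset_image)
    then show "u + v \<in> coset (x + y)"
      using H_closed(2)[of h k] by (auto simp: coset_image image_iff add_ac intro!: bexI[of _ "h + k"])
  next
    fix u assume "u \<in> coset (x + y)"
    then obtain h where "h \<in> H" "u = h + (x + y)" by (auto simp: coset_image)
    then show "\<exists>v w. u = v + w \<and> v \<in> coset x \<and> w \<in> coset y"
      using H_closed(1) by (intro exI[of _ "h + x"] exI[of _ "0 + y"]) (auto simp: coset_image add_ac)
  qed
  finally show ?thesis .
qed

lemma tens_closed: "s \<in> carrier S \<Longrightarrow> m \<in> carrier M \<Longrightarrow> tens s m \<in> carrier E"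
  using G_closed(3) by (auto simp: tens_def carrier_E)

lemma tens_add_left:
  assumes "s \<in> carrier S" "t \<in> carrier S" "m \<in> carrier M"
  shows "tens (s \<oplus>\<^bsub>S\<^esub> t) m = tens s m \<oplus>\<^bsub>E\<^esub> tens t m"
  using H_add_left[OF assms] by (simp add: tens_def add_E coset_eq_iff)

lemma tens_add_right:
  assumes "s \<in> carrier S" "m \<in> carrier M" "n \<in> carrier M"
  shows "tens s (m \<oplus>\<^bsub>M\<^esub> n) = tens s m \<oplus>\<^bsub>E\<^esub> tens s n"
  using H_add_right[OF assms] by (simp add: tens_def add_E coset_eq_iff)

lemma tens_balanced:
  assumes "s \<in> carrier S" "r \<in> carrier R" "m \<in> carrier M"
  shows "tens (s \<otimes>\<^bsub>S\<^esub> \<phi> r) m = tens s (r \<odot>\<^bsub>M\<^esub> m)"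
  using H_balanced[OF assms] by (simp add: tens_def coset_eq_iff)

lemma tens_zero_left: "m \<in> carrier M \<Longrightarrow> tens \<zero>\<^bsub>S\<^esub> m = \<zero>\<^bsub>E\<^esub>"
proof -
  assume m: "m \<in> carrier M"
  have "tens \<zero>\<^bsub>S\<^esub> m = tens \<zero>\<^bsub>S\<^esub> m \<oplus>\<^bsub>E\<^esub> tens \<zero>\<^bsub>S\<^esub> m"
    using tens_add_left[of "\<zero>\<^bsub>S\<^esub>" "\<zero>\<^bsub>S\<^esub>" m] m by simp
  then show ?thesis
    by (simp add: tens_def add_E coset_eq_iff zero_E)
      (metis H_closed(1,3) diff_0 minus_minus)
qed

lemma tens_neg: "s \<in> carrier S \<Longrightarrow> m \<in> carrier M \<Longrightarrow> coset (- frag_of (s, m)) = tens (\<ominus>\<^bsub>S\<^esub> s) m"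
proof -
  assume sm: "s \<in> carrier S" "m \<in> carrier M"
  then have "tens (\<ominus>\<^bsub>S\<^esub> s) m \<oplus>\<^bsub>E\<^esub> tens s m = \<zero>\<^bsub>E\<^esub>"
    using tens_add_left[of "\<ominus>\<^bsub>S\<^esub> s" s m] by (simp add: S.l_neg tens_zero_left)
  then have "frag_of (\<ominus>\<^bsub>S\<^esub> s, m) + frag_of (s, m) \<in> H"
    by (simp add: tens_def add_E zero_E coset_eq_iff)
  then have "coset (frag_of (\<ominus>\<^bsub>S\<^esub> s, m)) = coset (- frag_of (s, m))"
    by (simp add: coset_eq_iff)
  then show ?thesis by (simp add: tens_def)
qed

text \<open>Integer combinations of pure tensors reduce to sums, since the negative of a pure tensor
  is the pure tensor with negated first factor.\<close>

lemma E_induct [consumes 1, case_names tens add]: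
  assumes "U \<in> carrier E"
    "\<And>s m. s \<in> carrier S \<Longrightarrow> m \<in> carrier M \<Longrightarrow> P (tens s m)"
    "\<And>U Z. U \<in> carrier E \<Longrightarrow> Z \<in> carrier E \<Longrightarrow> P U \<Longrightarrow> P Z \<Longrightarrow> P (U \<oplus>\<^bsub>E\<^esub> Z)"
    and zero: "P \<zero>\<^bsub>E\<^esub>"
  shows "P U"
proof -
  obtain y where y: "U = coset y" "keys y \<subseteq> carrier S \<times> carrier M"
    using assms(1) by (auto simp: carrier_E)
  have cE: "coset x \<in> carrier E" if "x \<in> carrier G" for x
    using that by (simp add: carrier_E)
  have "y \<in> carrier G \<and> P (coset y)"
    using y(2)
  proof (induction y rule: poly_mapping_keys_induct)
    case zero
    then show ?case using assms(4) by (simp add: zero_E)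
  next
    case (single k n)
    then obtain s m where k: "k = (s, m)" "s \<in> carrier S" "m \<in> carrier M" by auto
    show ?case
    proof (induction n rule: int_induct[of _ 0])
      case base
      then show ?case using assms(4) by (simp add: zero_E)
    next
      case (step1 n)
      have "single k (n + 1) = single k n + frag_of (s, m)" by (simp add: single_add k)
      then show ?case
        using step1 assms(2)[OF k(2,3)] assms(3)[OF cE cE, of "single k n" "frag_of (s, m)"] G_closed(1,3) k
        by (simp add: add_E tens_def)
    next
      case (step2 n)
      have eq: "single k (n - 1) = single k n + - frag_of (s, m)" by (simp add: single_diff k)
      have neg: "- frag_of (s, m) \<in> carrier G" using G_closed(3)[OF k(2,3)] by simp
      have "P (coset (- frag_of (s, m)))"
        unfolding tens_neg[OF k(2,3)] using assms(2) k by simp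
      then show ?case
        unfolding eq using step2 assms(3)[OF cE cE, of "single k n" "- frag_of (s, m)"] G_closed(1) G_closed(2)[OF _ G_closed(3)[OF k(2,3)]] neg
        by (simp add: add_E)
    qed
  next
    case (add p q)
    then show ?case
      using assms(3)[OF cE cE, of p q] G_closed(1) by (simp add: add_E)
  qed
  then show ?thesis using y(1) by simp
qed

text \<open>The union in the definition of scalar multiplication collapses to one coset, because
  left multiplication by s maps each of the three kinds of relations to relations of the same
  kind.\<close>

lemma smult_coset:
  assumes "s \<in> carrier S" "x \<in> carrier G"
  shows "s \<odot>\<^bsub>E\<^esub> coset x = coset (frag_extend (\<lambda>(t, m). frag_of (s \<otimes>\<^bsub>S\<^esub> t, m)) x)"
proof -
  let ?F = "frag_extend (\<lambda>(t, m). frag_of (s \<otimes>\<^bsub>S\<^esub> t, m))"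
  have FH: "?F h \<in> H" if "h \<in> H" for h
    using that
  proof (induction rule: H_induct)
    case (rel r)
    then show ?case
      unfolding tensor_rels_def
    proof (elim UnE)
      assume "r \<in> {frag_of (t \<oplus>\<^bsub>S\<^esub> u, m) - (frag_of (t, m) + frag_of (u, m)) | t u m.
        t \<in> carrier S \<and> u \<in> carrier S \<and> m \<in> carrier M}"
      then obtain t u m where r: "r = frag_of (t \<oplus>\<^bsub>S\<^esub> u, m) - (frag_of (t, m) + frag_of (u, m))"
        "t \<in> carrier S" "u \<in> carrier S" "m \<in> carrier M" by blast
      have "frag_of (s \<otimes>\<^bsub>S\<^esub> t \<oplus>\<^bsub>S\<^esub> s \<otimes>\<^bsub>S\<^esub> u, m) - (frag_of (s \<otimes>\<^bsub>S\<^esub> t, m) + frag_of (s \<otimes>\<^bsub>S\<^esub> u, m)) \<in> H"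
        by (rule H_add_left[OF S.m_closed[OF assms(1) r(2)] S.m_closed[OF assms(1) r(3)] r(4)])
      then show ?thesis by (simp add: r frag_extend_diff frag_extend_add S.r_distr assms(1))
    next
      assume "r \<in> {frag_of (t, m \<oplus>\<^bsub>M\<^esub> n) - (frag_of (t, m) + frag_of (t, n)) | t m n.
        t \<in> carrier S \<and> m \<in> carrier M \<and> n \<in> carrier M}"
      then obtain t m n where r: "r = frag_of (t, m \<oplus>\<^bsub>M\<^esub> n) - (frag_of (t, m) + frag_of (t, n))"
        "t \<in> carrier S" "m \<in> carrier M" "n \<in> carrier M" by blast
      have "frag_of (s \<otimes>\<^bsub>S\<^esub> t, m \<oplus>\<^bsub>M\<^esub> n) - (frag_of (s \<otimes>\<^bsub>S\<^esub> t, m) + frag_of (s \<otimes>\<^bsub>S\<^esub> t, n)) \<in> H"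
        by (rule H_add_right[OF S.m_closed[OF assms(1) r(2)] r(3,4)])
      then show ?thesis by (simp add: r frag_extend_diff frag_extend_add)
    next
      assume "r \<in> {frag_of (t \<otimes>\<^bsub>S\<^esub> \<phi> q, m) - frag_of (t, q \<odot>\<^bsub>M\<^esub> m) | t q m.
        t \<in> carrier S \<and> q \<in> carrier R \<and> m \<in> carrier M}"
      then obtain t q m where r: "r = frag_of (t \<otimes>\<^bsub>S\<^esub> \<phi> q, m) - frag_of (t, q \<odot>\<^bsub>M\<^esub> m)"
        "t \<in> carrier S" "q \<in> carrier R" "m \<in> carrier M" by blast
      have "frag_of (s \<otimes>\<^bsub>S\<^esub> t \<otimes>\<^bsub>S\<^esub> \<phi> q, m) - frag_of (s \<otimes>\<^bsub>S\<^esub> t, q \<odot>\<^bsub>M\<^esub> m) \<in> H"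
        by (rule H_balanced[OF S.m_closed[OF assms(1) r(2)] r(3,4)])
      then show ?thesis by (simp add: r frag_extend_diff S.m_assoc assms(1) phi_closed)
    qed
  qed (use H_closed(1) H_closed(2) H_closed(3)[OF H_closed(1)] in \<open>simp_all add: frag_extend_add frag_extend_minus\<close>)
  have "s \<odot>\<^bsub>E\<^esub> coset x = (\<Union>y\<in>coset x. coset (?F y))"
    by (simp add: extend_scalars_def Let_def)
  also have "\<dots> = (\<Union>h\<in>H. coset (?F h + ?F x))"
    by (simp add: coset_image frag_extend_add)
  also have "\<dots> = (\<Union>h\<in>H. coset (?F x))"
    by (rule SUP_cong) (simp_all add: coset_eq_iff FH)
  finally show ?thesis using H_closed(1) by auto
qed

lemma smult_tens:
  "s \<in> carrier S \<Longrightarrow> t \<in> carrier S \<Longrightarrow> m \<in> carrier M \<Longrightarrow> s \<odot>\<^bsub>E\<^esub> tens t m = tens (s \<otimes>\<^bsub>S\<^esub> t) m"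
  using G_closed(3) by (simp add: tens_def smult_coset)

lemma smult_add:
  assumes "s \<in> carrier S" "U \<in> carrier E" "Z \<in> carrier E"
  shows "s \<odot>\<^bsub>E\<^esub> (U \<oplus>\<^bsub>E\<^esub> Z) = s \<odot>\<^bsub>E\<^esub> U \<oplus>\<^bsub>E\<^esub> s \<odot>\<^bsub>E\<^esub> Z"
  using assms G_closed(1) by (auto simp: carrier_E add_E smult_coset frag_extend_add simp del: carrier_free_Abelian_group_iff)

lemma add_closed_E: "U \<in> carrier E \<Longrightarrow> Z \<in> carrier E \<Longrightarrow> U \<oplus>\<^bsub>E\<^esub> Z \<in> carrier E"
  using G_closed(1) by (auto simp: carrier_E add_E simp del: carrier_free_Abelian_group_iff)

lemma zero_closed_E: "\<zero>\<^bsub>E\<^esub> \<in> carrier E"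
  by (auto simp: carrier_E zero_E)

lemma smult_zero: "s \<in> carrier S \<Longrightarrow> s \<odot>\<^bsub>E\<^esub> \<zero>\<^bsub>E\<^esub> = \<zero>\<^bsub>E\<^esub>"
  by (simp add: zero_E smult_coset)

lemma smult_closed_E:
  assumes "s \<in> carrier S" "U \<in> carrier E"
  shows "s \<odot>\<^bsub>E\<^esub> U \<in> carrier E"
  using assms(2)
  by (induction rule: E_induct)
    (simp_all add: smult_tens smult_add assms(1) tens_closed add_closed_E smult_zero zero_closed_E)

lemma add_comm_group_E: "comm_group (add_monoid E)"
proof (rule comm_groupI)
  fix U assume "U \<in> carrier (add_monoid E)"
  then obtain y where y: "U = coset y" "y \<in> carrier G" by (auto simp: carrier_E)
  then have "coset (- y) \<in> carrier E" by (auto simp: carrier_E)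
  then show "\<exists>Z\<in>carrier (add_monoid E). Z \<otimes>\<^bsub>add_monoid E\<^esub> U = \<one>\<^bsub>add_monoid E\<^esub>"
    by (intro bexI[of _ "coset (- y)"]) (simp_all add: y(1) add_E zero_E)
qed (auto simp: add_closed_E zero_closed_E, auto simp: carrier_E add_E zero_E add_ac simp del: carrier_free_Abelian_group_iff)

text \<open>The universal property of the tensor product: \<open>l\<close> kills the relations, so
  its value at an arbitrarily chosen representative is well defined.\<close>

lemma E_lift:
  fixes \<beta> :: "'s \<Rightarrow> 'm \<Rightarrow> 'v::ring_1"
  assumes "\<And>s t m. s \<in> carrier S \<Longrightarrow> t \<in> carrier S \<Longrightarrow> m \<in> carrier M \<Longrightarrow> \<beta> (s \<oplus>\<^bsub>S\<^esub> t) m = \<beta> s m + \<beta> t m"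
    "\<And>s m n. s \<in> carrier S \<Longrightarrow> m \<in> carrier M \<Longrightarrow> n \<in> carrier M \<Longrightarrow> \<beta> s (m \<oplus>\<^bsub>M\<^esub> n) = \<beta> s m + \<beta> s n"
    "\<And>s r m. s \<in> carrier S \<Longrightarrow> r \<in> carrier R \<Longrightarrow> m \<in> carrier M \<Longrightarrow> \<beta> (s \<otimes>\<^bsub>S\<^esub> \<phi> r) m = \<beta> s (r \<odot>\<^bsub>M\<^esub> m)"
  obtains \<L> where "\<And>s m. s \<in> carrier S \<Longrightarrow> m \<in> carrier M \<Longrightarrow> \<L> (tens s m) = \<beta> s m"
    "\<And>U Z. U \<in> carrier E \<Longrightarrow> Z \<in> carrier E \<Longrightarrow> \<L> (U \<oplus>\<^bsub>E\<^esub> Z) = \<L> U + \<L> Z"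
proof
  define l where "l x = (\<Sum>k\<in>keys x. of_int (lookup x k) * case_prod \<beta> k)" for x
  have l_add: "l (x + y) = l x + l y" for x y
    unfolding l_def by (rule sum_keys_add) (simp_all add: distrib_right)
  have l_zero: "l 0 = 0" by (simp add: l_def)
  have l_uminus: "l (- x) = - l x" for x
    using l_add[of x "- x"] by (simp add: l_zero eq_neg_iff_add_eq_0 add.commute)
  have l_diff: "l (x - y) = l x - l y" for x y
    using l_add[of x "- y"] by (simp add: l_uminus)
  have l_of: "l (frag_of (s, m)) = \<beta> s m" for s m
    by (simp add: l_def keys_frag_of)
  have l_H: "l h = 0" if "h \<in> H" for h
    using that
  proof (induction rule: H_induct)
    case (rel r)
    then show ?case
      unfolding tensor_rels_def by (elim UnE) (clarsimp simp: l_diff l_add l_of assms)+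
  qed (simp_all add: l_zero l_add l_uminus)
  define \<L> where "\<L> U = l (SOME y. y \<in> U)" for U
  have \<L>: "\<L> (coset y) = l y" for y
  proof -
    have "y \<in> coset y" using H_closed(1) by (force simp: coset_image)
    then have "(SOME x. x \<in> coset y) \<in> coset y" by (rule someI)
    then show ?thesis by (auto simp: \<L>_def coset_image l_add l_H)
  qed
  show "\<L> (tens s m) = \<beta> s m" for s m by (simp add: tens_def \<L> l_of)
  show "\<L> (U \<oplus>\<^bsub>E\<^esub> Z) = \<L> U + \<L> Z" if "U \<in> carrier E" "Z \<in> carrier E" for U Z
    using that by (auto simp: carrier_E add_E \<L> l_add)
qed

end


section \<open>The Borel subalgebra\<close>

abbreviation "cce m x \<equiv> sl2_ce (lookup (loop x) m)"
abbreviation "ccf m x \<equiv> sl2_cf (lookup (loop x) m)"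
abbreviation "cch m x \<equiv> sl2_ch (lookup (loop x) m)"

lemma affine_sel [simp]:
  "loop (x + y) = loop x + loop y" "central (x + y) = central x + central y" "deriv (x + y) = deriv x + deriv y"
  "loop (x - y) = loop x - loop y" "central (x - y) = central x - central y" "deriv (x - y) = deriv x - deriv y"
  "loop (k *\<^sub>C x) = loop_scale k (loop x)" "central (k *\<^sub>C x) = k * central x" "deriv (k *\<^sub>C x) = k * deriv x"
  "loop 0 = 0" "central 0 = 0" "deriv 0 = 0"
  by (simp_all add: plus_affine_def minus_affine_def scaleC_affine_def zero_affine_def)

lemma affine_vec_sel [simp]:
  "loop (e_vec m) = single m sl2_e" "loop (f_vec m) = single m sl2_f" "loop (h_vec m) = single m sl2_h"
  "loop c_vec = 0" "loop d_vec = 0"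
  "central (e_vec m) = 0" "central (f_vec m) = 0" "central (h_vec m) = 0" "central c_vec = 1" "central d_vec = 0"
  "deriv (e_vec m) = 0" "deriv (f_vec m) = 0" "deriv (h_vec m) = 0" "deriv c_vec = 0" "deriv d_vec = 1"
  by (simp_all add: e_vec_def f_vec_def h_vec_def c_vec_def d_vec_def loop_vec_def)

lemma affine_eqI: "loop x = loop y \<Longrightarrow> central x = central y \<Longrightarrow> deriv x = deriv y \<Longrightarrow> x = y"
  by (cases x; cases y) simp

lemma sl2_coord_diff [simp]: "sl2_ce (x - y) = sl2_ce x - sl2_ce y" "sl2_cf (x - y) = sl2_cf x - sl2_cf y"
  "sl2_ch (x - y) = sl2_ch x - sl2_ch y"
  "sl2_ce (- x) = - sl2_ce x" "sl2_cf (- x) = - sl2_cf x" "sl2_ch (- x) = - sl2_ch x"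
  by (transfer, simp)+

lemma single_sl2:
  "single m u = loop_scale (sl2_ce u) (single m sl2_e) + loop_scale (sl2_cf u) (single m sl2_f)
    + loop_scale (sl2_ch u) (single m sl2_h)"
  by (simp flip: single_add) (intro arg_cong[of _ _ "single m"] sl2_eqI; simp)

lemma affine_sum_decompose:
  "x = (\<Sum>m\<in>keys (loop x). cce m x *\<^sub>C e_vec m + ccf m x *\<^sub>C f_vec m + cch m x *\<^sub>C h_vec m)
    + central x *\<^sub>C c_vec + deriv x *\<^sub>C d_vec"
proof -
  have loop_sum: "loop (sum g A) = (\<Sum>m\<in>A. loop (g m))" and "central (sum g A) = (\<Sum>m\<in>A. central (g m))"
    and "deriv (sum g A) = (\<Sum>m\<in>A. deriv (g m))" for g and A :: "int set"
    by (induction A rule: infinite_finite_induct) simp_all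
  then show ?thesis
    by (intro affine_eqI)
      (simp_all add: single_sl2[symmetric] del: loop_scale_single flip: poly_mapping_sum_singles)
qed

lemma affine_induct [case_names e f h c d add scale]:
  assumes "\<And>m. P (e_vec m)" "\<And>m. P (f_vec m)" "\<And>m. P (h_vec m)" "P c_vec" "P d_vec"
    "\<And>x y. P x \<Longrightarrow> P y \<Longrightarrow> P (x + y)" "\<And>k x. P x \<Longrightarrow> P (k *\<^sub>C x)"
  shows "P x"
proof -
  have "P 0" using assms(7)[OF assms(4), of 0] by simp
  then have "P (\<Sum>m\<in>A. cce m x *\<^sub>C e_vec m + ccf m x *\<^sub>C f_vec m + cch m x *\<^sub>C h_vec m)" for A
    by (induction A rule: infinite_finite_induct) (simp_all add: assms)
  then show ?thesis
    by (subst affine_sum_decompose) (intro assms)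
qed

lemma lie_basis:
  "lie (h_vec m) (h_vec n) = (if m = - n then 2 * of_int m else 0) *\<^sub>C c_vec"
  "lie (f_vec m) (f_vec n) = 0"
  "lie (e_vec m) (f_vec n) = h_vec (m + n) + (if m = - n then of_int m else 0) *\<^sub>C c_vec"
  "lie (h_vec m) (f_vec n) = (- 2) *\<^sub>C f_vec (m + n)"
  "lie (h_vec m) (e_vec n) = 2 *\<^sub>C e_vec (m + n)"
  "lie (e_vec m) (h_vec n) = (- 2) *\<^sub>C e_vec (m + n)"
  "lie c_vec x = 0"
  "lie d_vec (e_vec m) = of_int m *\<^sub>C e_vec m" "lie d_vec (f_vec m) = of_int m *\<^sub>C f_vec m"
  "lie d_vec (h_vec m) = of_int m *\<^sub>C h_vec m"
proof -
  have loop_scale: "k *\<^sub>C loop_vec u m = loop_vec (k *\<^sub>C u) m" for k u m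
    by (simp add: loop_vec_def scaleC_affine_def)
  have eh: "lie sl2_e sl2_h = (- 2) *\<^sub>C sl2_e"
    by (rule sl2_eqI) simp_all
  have z: "loop_vec 0 m = 0" for m by (simp add: loop_vec_def zero_affine_def)
  show "lie (h_vec m) (h_vec n) = (if m = - n then 2 * of_int m else 0) *\<^sub>C c_vec"
    "lie (f_vec m) (f_vec n) = 0"
    "lie (e_vec m) (f_vec n) = h_vec (m + n) + (if m = - n then of_int m else 0) *\<^sub>C c_vec"
    "lie (h_vec m) (f_vec n) = (- 2) *\<^sub>C f_vec (m + n)"
    "lie (h_vec m) (e_vec n) = 2 *\<^sub>C e_vec (m + n)"
    "lie (e_vec m) (h_vec n) = (- 2) *\<^sub>C e_vec (m + n)"
    by (simp_all add: e_vec_def f_vec_def h_vec_def lie_loop_vec lie_sl2 lie_self sl2_form_coord loop_scale eh z)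
  show "lie c_vec x = 0" by (rule lie_c_vec)
  show "lie d_vec (e_vec m) = of_int m *\<^sub>C e_vec m" "lie d_vec (f_vec m) = of_int m *\<^sub>C f_vec m"
    "lie d_vec (h_vec m) = of_int m *\<^sub>C h_vec m"
    by (simp_all add: e_vec_def f_vec_def h_vec_def lie_d_vec)
qed

lemma cartanE:
  assumes "x \<in> cartan"
  obtains "x = cch 0 x *\<^sub>C h_vec 0 + central x *\<^sub>C c_vec + deriv x *\<^sub>C d_vec"
  using assms by (auto simp: cartan_def)

lemma cartanI: "a *\<^sub>C h_vec 0 + b *\<^sub>C c_vec + k *\<^sub>C d_vec \<in> cartan"
  unfolding cartan_def by blast

lemma vec_in_cartan: "h_vec 0 \<in> cartan" "c_vec \<in> cartan" "d_vec \<in> cartan"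
  using cartanI[of 1 0 0] cartanI[of 0 1 0] cartanI[of 0 0 1] by (simp_all add: scaleC_one)

lemma cartan_lie:
  assumes "x \<in> cartan"
  shows "lie x (e_vec m) = (2 * cch 0 x + of_int m * deriv x) *\<^sub>C e_vec m"
    "lie x (f_vec m) = (- 2 * cch 0 x + of_int m * deriv x) *\<^sub>C f_vec m"
    "lie x (h_vec m) = (of_int m * deriv x) *\<^sub>C h_vec m"
proof -
  have comb: "lie (a *\<^sub>C h_vec 0 + b *\<^sub>C c_vec + k *\<^sub>C d_vec) (e_vec m) = (2 * a + of_int m * k) *\<^sub>C e_vec m"
    "lie (a *\<^sub>C h_vec 0 + b *\<^sub>C c_vec + k *\<^sub>C d_vec) (f_vec m) = (- 2 * a + of_int m * k) *\<^sub>C f_vec m"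
    "lie (a *\<^sub>C h_vec 0 + b *\<^sub>C c_vec + k *\<^sub>C d_vec) (h_vec m) = (of_int m * k) *\<^sub>C h_vec m" for a b k
    unfolding lie_add_left lie_scaleC_left lie_basis scaleC_scaleC scaleC_add_left
    by (simp_all add: mult.commute)
  obtain x: "x = cch 0 x *\<^sub>C h_vec 0 + central x *\<^sub>C c_vec + deriv x *\<^sub>C d_vec"
    using cartanE[OF assms] .
  show "lie x (e_vec m) = (2 * cch 0 x + of_int m * deriv x) *\<^sub>C e_vec m"
    by (rule trans[OF arg_cong[OF x, of "\<lambda>y. lie y (e_vec m)"] comb(1)])
  show "lie x (f_vec m) = (- 2 * cch 0 x + of_int m * deriv x) *\<^sub>C f_vec m"
    by (rule trans[OF arg_cong[OF x, of "\<lambda>y. lie y (f_vec m)"] comb(2)])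
  show "lie x (h_vec m) = (of_int m * deriv x) *\<^sub>C h_vec m"
    by (rule trans[OF arg_cong[OF x, of "\<lambda>y. lie y (h_vec m)"] comb(3)])
qed

lemma beta_eq: "x \<in> cartan \<Longrightarrow> beta x = 2 * cch 0 x"
proof -
  assume x: "x \<in> cartan"
  have "(THE b. lie x (e_vec 0) = b *\<^sub>C e_vec 0) = 2 * cch 0 x"
  proof (rule the_equality)
    show "lie x (e_vec 0) = (2 * cch 0 x) *\<^sub>C e_vec 0" using cartan_lie(1)[OF x, of 0] by simp
    fix b assume "lie x (e_vec 0) = b *\<^sub>C e_vec 0"
    then have "(2 * cch 0 x) *\<^sub>C e_vec 0 = b *\<^sub>C e_vec 0" using cartan_lie(1)[OF x, of 0] by simp
    then have "cce 0 ((2 * cch 0 x) *\<^sub>C e_vec 0) = cce 0 (b *\<^sub>C e_vec 0)" by (rule arg_cong)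
    then show "b = 2 * cch 0 x" by simp
  qed
  then show ?thesis by (simp add: beta_def x)
qed

lemma lattice_elt_eq: "x \<in> cartan \<Longrightarrow> lattice_elt k n x = of_int k * (2 * cch 0 x) + of_int n * deriv x"
  by (simp add: lattice_elt_def beta_eq delta_def)

lemma e_root_space: "e_vec m \<in> root_space (lattice_elt 1 m)"
  and f_root_space: "f_vec m \<in> root_space (lattice_elt (- 1) m)"
  and h_root_space: "h_vec m \<in> root_space (lattice_elt 0 m)"
  by (simp_all add: root_space_def cartan_lie lattice_elt_eq)

lemma lie_h0_d_coords:
  "cce m (lie (h_vec 0) x) = 2 * cce m x" "ccf m (lie (h_vec 0) x) = - 2 * ccf m x" "cch m (lie (h_vec 0) x) = 0"
  "central (lie (h_vec 0) x) = 0" "deriv (lie y x) = 0"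
  "cch m (lie d_vec x) = of_int m * cch m x" "central (lie d_vec x) = 0"
proof -
  have 1: "lookup (loop_lie (single 0 u) v) m = lie u (lookup v m)" for u v m
    by (induction v rule: loop_induct)
      (simp_all add: loop_lie_add_right lookup_add lie_add_right lookup_single when_def)
  have 2: "loop_cocycle (single 0 u) v = 0" for u v
    by (induction v rule: loop_induct) (simp_all add: loop_cocycle_add_right)
  show "cce m (lie (h_vec 0) x) = 2 * cce m x" "ccf m (lie (h_vec 0) x) = - 2 * ccf m x" "cch m (lie (h_vec 0) x) = 0"
    "central (lie (h_vec 0) x) = 0" "deriv (lie y x) = 0"
    "cch m (lie d_vec x) = of_int m * cch m x" "central (lie d_vec x) = 0"
    by (simp_all add: lie_affine_def 1 2 lookup_minus lookup_add)
qed

text \<open>Eigenvalue equations bound the root spaces: for \<beta> + n\<delta> the equation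
  [h_0, x] = 2x leaves only e-coordinates, and for m\<delta> the equations for h_0 and d leave only
  the h-coordinate at m. Conversely, the e_n and the h_m with m > 0 lie in root spaces and
  span.\<close>

lemma g_plus_iff:
  "x \<in> g_plus \<longleftrightarrow> (\<forall>m. ccf m x = 0) \<and> (\<forall>m\<le>0. cch m x = 0) \<and> central x = 0 \<and> deriv x = 0"
proof
  let ?S = "{x. (\<forall>m. ccf m x = 0) \<and> (\<forall>m\<le>0. cch m x = 0) \<and> central x = 0 \<and> deriv x = 0}"
  have "g_plus \<subseteq> ?S"
    unfolding g_plus_def
  proof (rule lie.span_minimal)
    show "lie.subspace ?S"
      unfolding lie.subspace_def by (auto simp: lookup_add)
    show "(\<Union>n. root_space (lattice_elt 1 n)) \<union> (\<Union>m\<in>{0<..}. root_space (lattice_elt 0 m)) \<subseteq> ?S"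
    proof (intro Un_least UN_least subsetI)
      fix n x assume "x \<in> root_space (lattice_elt 1 n)"
      then have l: "lie (h_vec 0) x = 2 *\<^sub>C x"
        using vec_in_cartan by (simp add: root_space_def lattice_elt_eq)
      have "- 2 * ccf m x = 2 * ccf m x" "0 = 2 * cch m x" "0 = 2 * central x" "0 = 2 * deriv x" for m
        using arg_cong[OF l, of "ccf m"] arg_cong[OF l, of "cch m"] arg_cong[OF l, of central]
          arg_cong[OF l, of deriv]
        by (simp_all add: lie_h0_d_coords del: mult_minus_left)
      then show "x \<in> ?S" by simp
    next
      fix n x assume n: "n \<in> {0::int<..}" and x: "x \<in> root_space (lattice_elt 0 n)"
      then have l: "lie (h_vec 0) x = 0 *\<^sub>C x" "lie d_vec x = of_int n *\<^sub>C x"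
        using vec_in_cartan by (simp_all add: root_space_def lattice_elt_eq)
      have "- 2 * ccf m x = 0" "of_int m * cch m x = of_int n * cch m x" "0 = of_int n * central x" "0 = of_int n * deriv x" for m
        using arg_cong[OF l(1), of "ccf m"] arg_cong[OF l(2), of "cch m"] arg_cong[OF l(2), of central]
          arg_cong[OF l(2), of deriv]
        by (simp_all add: lie_h0_d_coords)
      then show "x \<in> ?S" using n by force
    qed
  qed
  then show "x \<in> g_plus \<Longrightarrow> (\<forall>m. ccf m x = 0) \<and> (\<forall>m\<le>0. cch m x = 0) \<and> central x = 0 \<and> deriv x = 0"
    by auto
next
  assume x: "(\<forall>m. ccf m x = 0) \<and> (\<forall>m\<le>0. cch m x = 0) \<and> central x = 0 \<and> deriv x = 0"
  have e: "k *\<^sub>C e_vec m \<in> g_plus" for k m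
    unfolding g_plus_def using e_root_space by (intro lie.span_scale lie.span_base) blast
  have h: "cch m x *\<^sub>C h_vec m \<in> g_plus" for m
  proof (cases "m > 0")
    case True
    then show ?thesis
      unfolding g_plus_def using h_root_space by (intro lie.span_scale lie.span_base) blast
  next
    case False
    then show ?thesis using x by (simp add: g_plus_def lie.span_zero)
  qed
  have "x = (\<Sum>m\<in>keys (loop x). cce m x *\<^sub>C e_vec m + cch m x *\<^sub>C h_vec m)"
    using affine_sum_decompose[of x] x by simp
  also have "\<dots> \<in> g_plus"
    using e h unfolding g_plus_def by (intro lie.span_sum lie.span_add)
  finally show "x \<in> g_plus" .
qed

lemma borel_iff: "x \<in> borel \<longleftrightarrow> (\<forall>m. ccf m x = 0) \<and> (\<forall>m<0. cch m x = 0)"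
proof
  assume "x \<in> borel"
  then obtain u v where x: "x = u + v" "u \<in> g_plus" "v \<in> cartan" by (auto simp: borel_def)
  obtain v: "v = cch 0 v *\<^sub>C h_vec 0 + central v *\<^sub>C c_vec + deriv v *\<^sub>C d_vec"
    using cartanE[OF x(3)] .
  have "ccf m v = 0" "m \<noteq> 0 \<Longrightarrow> cch m v = 0" for m
    by (subst v, simp add: lookup_add lookup_single when_def)+
  then show "(\<forall>m. ccf m x = 0) \<and> (\<forall>m<0. cch m x = 0)"
    using x(2) by (auto simp: x(1) g_plus_iff lookup_add)
next
  assume x: "(\<forall>m. ccf m x = 0) \<and> (\<forall>m<0. cch m x = 0)"
  let ?v = "cch 0 x *\<^sub>C h_vec 0 + central x *\<^sub>C c_vec + deriv x *\<^sub>C d_vec"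
  have "x - ?v \<in> g_plus"
    using x by (auto simp: g_plus_iff lookup_add lookup_minus lookup_single when_def)
  then show "x \<in> borel"
    unfolding borel_def using cartanI by (intro CollectI exI[of _ "x - ?v"] exI[of _ ?v]) auto
qed

lemma borel_closed: "x \<in> borel \<Longrightarrow> y \<in> borel \<Longrightarrow> x + y \<in> borel" "x \<in> borel \<Longrightarrow> k *\<^sub>C x \<in> borel"
  by (simp_all add: borel_iff lookup_add)

lemma loop_lie_coords:
  assumes "\<And>m. sl2_cf (lookup u m) = 0" "\<And>m. sl2_cf (lookup v m) = 0"
  shows "sl2_cf (lookup (loop_lie u v) m) = 0" "sl2_ch (lookup (loop_lie u v) m) = 0"
proof -
  have *: "sl2_cf (lookup (sum G A) m) = 0 \<and> sl2_ch (lookup (sum G A) m) = 0"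
    if "\<And>k. k \<in> A \<Longrightarrow> \<forall>m. sl2_cf (lookup (G k) m) = 0 \<and> sl2_ch (lookup (G k) m) = 0"
    for A :: "int set" and G :: "int \<Rightarrow> int \<Rightarrow>\<^sub>0 sl2" and m
    using that by (induction A rule: infinite_finite_induct) (auto simp: lookup_add)
  have "sl2_cf (lookup (loop_lie u v) m) = 0 \<and> sl2_ch (lookup (loop_lie u v) m) = 0"
    unfolding loop_lie_def by (intro * allI) (auto simp: assms lookup_single when_def)
  then show "sl2_cf (lookup (loop_lie u v) m) = 0" "sl2_ch (lookup (loop_lie u v) m) = 0"
    by auto
qed

lemma borel_lie: "x \<in> borel \<Longrightarrow> y \<in> borel \<Longrightarrow> lie x y \<in> borel"
  by (simp add: borel_iff lie_affine_def lookup_add lookup_minus loop_lie_coords)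

lemma cartan_dual_decompose:
  assumes "\<mu> \<in> cartan_dual" "x \<in> cartan"
  shows "\<mu> x = cch 0 x * \<mu> (h_vec 0) + central x * \<mu> c_vec + deriv x * \<mu> d_vec"
proof -
  obtain x: "x = cch 0 x *\<^sub>C h_vec 0 + central x *\<^sub>C c_vec + deriv x *\<^sub>C d_vec"
    using cartanE[OF assms(2)] .
  have c: "cch 0 x *\<^sub>C h_vec 0 \<in> cartan" "central x *\<^sub>C c_vec \<in> cartan" "deriv x *\<^sub>C d_vec \<in> cartan"
    "cch 0 x *\<^sub>C h_vec 0 + central x *\<^sub>C c_vec \<in> cartan"
    using cartanI[of "cch 0 x" 0 0] cartanI[of 0 "central x" 0] cartanI[of 0 0 "deriv x"]
      cartanI[of "cch 0 x" "central x" 0] by simp_all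
  have add: "u \<in> cartan \<Longrightarrow> v \<in> cartan \<Longrightarrow> \<mu> (u + v) = \<mu> u + \<mu> v" and sc: "u \<in> cartan \<Longrightarrow> \<mu> (k *\<^sub>C u) = k * \<mu> u" for u v k
    using assms(1) by (auto simp: cartan_dual_def)
  have "\<mu> x = \<mu> (cch 0 x *\<^sub>C h_vec 0 + central x *\<^sub>C c_vec + deriv x *\<^sub>C d_vec)"
    using x by simp
  then show ?thesis by (simp only: add c sc vec_in_cartan)
qed

lemma borel_char_eq:
  assumes "lam \<in> cartan_dual" "x \<in> borel"
  shows "borel_char lam x = cch 0 x * lam (h_vec 0) + central x * lam c_vec + deriv x * lam d_vec"
proof -
  let ?v = "cch 0 x *\<^sub>C h_vec 0 + central x *\<^sub>C c_vec + deriv x *\<^sub>C d_vec"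
  have "(THE y. y \<in> cartan \<and> x - y \<in> g_plus) = ?v"
  proof (rule the_equality)
    show "?v \<in> cartan \<and> x - ?v \<in> g_plus"
      using assms(2) cartanI by (auto simp: g_plus_iff borel_iff lookup_add lookup_minus lookup_single when_def)
    fix y assume y: "y \<in> cartan \<and> x - y \<in> g_plus"
    then have "cch 0 x = cch 0 y" "central x = central y" "deriv x = deriv y"
      by (auto simp: g_plus_iff lookup_minus)
    then show "y = ?v" using cartanE[of y] y by metis
  qed
  then have "borel_char lam x = lam ?v" by (simp add: borel_char_def)
  then show ?thesis
    by (simp add: cartan_dual_decompose[OF assms(1) cartanI] lookup_add)
qed


section \<open>The enveloping algebra\<close>

lemma env_rels_carrier:
  assumes "\<And>x y. x \<in> B \<Longrightarrow> y \<in> B \<Longrightarrow> x + y \<in> B" "\<And>k x. x \<in> B \<Longrightarrow> k *\<^sub>C x \<in> B"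
    "\<And>x y. x \<in> B \<Longrightarrow> y \<in> B \<Longrightarrow> lie x y \<in> B"
  shows "env_rels B \<subseteq> carrier (falg B)"
  unfolding env_rels_def
  by (intro Un_least subsetI; clarify; simp add: falg_closed assms)

interpretation UB: falg_quotient "borel :: affine set" "env_ideal borel"
  unfolding env_ideal_def
  by (rule falg_quotient.intro) (intro ring.genideal_ideal[OF ring_falg] env_rels_carrier borel_closed borel_lie)

interpretation U: falg_quotient "UNIV :: affine set" "env_ideal UNIV"
  unfolding env_ideal_def
  by (rule falg_quotient.intro) (intro ring.genideal_ideal[OF ring_falg] env_rels_carrier; simp)

lemma env_ideal_rels: "r \<in> env_rels UNIV \<Longrightarrow> r \<in> env_ideal UNIV"
  unfolding env_ideal_def using ring.genideal_self[OF ring_falg, of "env_rels UNIV" UNIV] by auto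

lemma ring_ideal_env: "ring_ideal (env_ideal (UNIV :: affine set))"
  unfolding ring_ideal_def using U.I_closed by auto

lemma env_ideal_borel: "env_ideal borel \<subseteq> env_ideal (UNIV :: affine set)"
proof -
  have "env_rels borel \<subseteq> env_rels (UNIV :: affine set)"
    unfolding env_rels_def by blast
  then have "env_rels borel \<subseteq> env_ideal (UNIV :: affine set)" using env_ideal_rels by blast
  then show ?thesis
    unfolding env_ideal_def[of borel]
    by (intro falg_genideal_le ring_ideal_env env_rels_carrier borel_closed borel_lie)
qed

lemma env_of_eq: "env_of UNIV x = U.cls (gen x)" and env_scalar_eq: "env_scalar UNIV c = U.cls (single [] c)"
  by (simp_all add: env_of_def env_scalar_def U.cls_def)

lemma Uaff_eq: "Uaff = falg UNIV Quot env_ideal UNIV"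
  by (simp add: env_def)

lemma Uaff_simps: "carrier Uaff = range U.cls" "U.cls p \<oplus>\<^bsub>Uaff\<^esub> U.cls q = U.cls (p + q)"
  "U.cls p \<otimes>\<^bsub>Uaff\<^esub> U.cls q = U.cls (p * q)" "\<one>\<^bsub>Uaff\<^esub> = U.cls 1" "\<zero>\<^bsub>Uaff\<^esub> = U.cls 0"
  using U.carrier_Q U.cls_hom[of p q] U.cls_one U.cls_zero by (simp_all add: Uaff_eq)

lemma ring_Uaff: "ring Uaff"
  using U.ring_Q by (simp add: Uaff_eq)

lemma env_incl_cls: "env_incl borel UNIV (UB.cls p) = U.cls p"
proof -
  have eq: "U.cls q = U.cls p" if "q \<in> UB.cls p" for q
    using UB.in_cls[OF that] env_ideal_borel by (auto simp: U.cls_eq_iff)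
  have "env_incl borel UNIV (UB.cls p) = (\<Union>q\<in>UB.cls p. U.cls q)"
    by (simp only: env_incl_def U.cls_def)
  also have "\<dots> = (\<Union>q\<in>UB.cls p. U.cls p)"
    by (rule SUP_cong[OF refl]) (rule eq)
  also have "\<dots> = U.cls p"
    using UB.self_in_cls[of p] by (metis UN_constant empty_iff)
  finally show ?thesis .
qed

lemma gen_lie: "gen (lie x y) - (gen x * gen y - gen y * gen x) \<in> env_ideal (UNIV :: affine set)"
  by (rule env_ideal_rels) (auto simp: env_rels_def)

lemma gen_add: "gen (x + y) - (gen x + gen y) \<in> env_ideal (UNIV :: affine set)"
  by (rule env_ideal_rels) (auto simp: env_rels_def)

lemma gen_scale: "gen (k *\<^sub>C x) - single [] k * gen x \<in> env_ideal (UNIV :: affine set)"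
  by (rule env_ideal_rels) (auto simp: env_rels_def)

context fock
begin

sublocale ev: word_evaluation sc rho
  by unfold_locales (simp_all only: sc_hom sc_mult clin_comm(1)[OF clin_rho])

definition ev :: "(affine list \<Rightarrow>\<^sub>0 complex) \<Rightarrow> alg endo" where "ev = eval_words sc rho"

lemma ev_simps [simp]: "ev 0 = 0" "ev (p + q) = ev p + ev q" "ev (p - q) = ev p - ev q" "ev (- p) = - ev p"
  "ev (p * q) = ev p * ev q" "ev 1 = 1" "ev (gen x) = rho x" "ev (single [] c) = sc c"
  by (simp_all add: ev_def ev.eval_zero ev.eval_add ev.eval_diff ev.eval_uminus ev.eval_mult ev.eval_one
      ev.eval_gen ev.eval_scalar)

lemma ev_ideal: "p \<in> env_ideal UNIV \<Longrightarrow> ev p = 0"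
proof -
  have "ring_ideal {p. ev p = 0}" by (simp add: ring_ideal_def)
  moreover have "env_rels UNIV \<subseteq> {p. ev p = 0}"
    unfolding env_rels_def by (auto simp: rho_add rho_scale rho_lie)
  ultimately have "env_ideal UNIV \<subseteq> {p. ev p = 0}"
    unfolding env_ideal_def by (intro falg_genideal_le) auto
  then show "p \<in> env_ideal UNIV \<Longrightarrow> ev p = 0" by blast
qed

text \<open>Elements of U are cosets of words; any representative serves, by
  \<open>ev_ideal\<close>.\<close>

definition uact :: "(affine list \<Rightarrow>\<^sub>0 complex) set \<Rightarrow> alg endo" where
  "uact u = ev (SOME p. p \<in> u)"

lemma uact_cls [simp]: "uact (U.cls p) = ev p"
proof -
  have "(SOME q. q \<in> U.cls p) \<in> U.cls p" using U.self_in_cls by (rule someI)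
  from ev_ideal[OF U.in_cls[OF this]] show ?thesis by (simp add: uact_def)
qed

lemma gsub_ev:
  assumes "gsub N" "p \<in> N"
  shows "app (ev u) p \<in> N"
proof -
  have "keys u \<subseteq> lists UNIV" by simp
  then show ?thesis
    by (induction u rule: word_induct[where X = UNIV]) (use assms in \<open>auto intro: gsubD\<close>)
qed

lemma clin_ev: "clin (ev u)"
proof -
  have "keys u \<subseteq> lists UNIV" by simp
  then show ?thesis by (induction u rule: word_induct[where X = UNIV]) simp_all
qed

end


section \<open>The imaginary Verma module\<close>

text \<open>The first letter is moved through the other word at the cost of commutators, which lie
  in the ideal; the rest is compared by induction. This makes the order inside blocks of commuting
  generators irrelevant.\<close>

lemma commuting_products:
  fixes g :: "'x \<Rightarrow> 'r::ring_1"
  assumes "ring_ideal I" and comm: "\<And>x y. g x * g y - g y * g x \<in> I"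
  shows "mset xs = mset ys \<Longrightarrow> prod_list (map g xs) - prod_list (map g ys) \<in> I"
proof (induction xs arbitrary: ys)
  case (Cons x xs)
  note I = ring_idealD[OF assms(1)]
  have word: "prod_list (map g zs) * g x - g x * prod_list (map g zs) \<in> I" for zs
  proof (induction zs)
    case (Cons z zs)
    have "g z * prod_list (map g zs) * g x - g x * (g z * prod_list (map g zs))
      = g z * (prod_list (map g zs) * g x - g x * prod_list (map g zs)) + (g z * g x - g x * g z) * prod_list (map g zs)"
      by (simp add: algebra_simps)
    also have "\<dots> \<in> I"
      by (rule I(5)[OF I(3)[OF Cons] I(4)[OF comm]])
    finally show ?case by (simp add: mult.assoc)
  qed (simp add: I)
  have "x \<in> set ys" using Cons.prems by (metis list.set_intros(1) set_mset_mset)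
  then obtain ys1 ys2 where ys: "ys = ys1 @ x # ys2" by (metis split_list)
  then have "prod_list (map g xs) - prod_list (map g (ys1 @ ys2)) \<in> I"
    using Cons by (intro Cons.IH) simp
  then have "g x * (prod_list (map g xs) - prod_list (map g (ys1 @ ys2)))
      - (prod_list (map g ys1) * g x - g x * prod_list (map g ys1)) * prod_list (map g ys2) \<in> I"
    by (rule I(2)[OF I(3) I(4)[OF word]])
  moreover have "g x * (prod_list (map g xs) - prod_list (map g (ys1 @ ys2)))
      - (prod_list (map g ys1) * g x - g x * prod_list (map g ys1)) * prod_list (map g ys2)
      = prod_list (map g (x # xs)) - prod_list (map g ys)"
    by (simp add: ys algebra_simps)
  ultimately show ?case by simp
qed (simp add: ring_idealD[OF assms(1)])

locale verma_rep = fock J K L for J K L :: complex +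
  fixes lam :: "affine \<Rightarrow> complex"
  assumes lam: "lam \<in> cartan_dual" and lam_c: "lam c_vec = K" and lam_h: "lam (h_vec 0) = J"
    and lam_d: "lam d_vec = L"
begin

abbreviation vac :: alg where "vac \<equiv> single 0 1"

lemma borel_char: "x \<in> borel \<Longrightarrow> borel_char lam x = cch 0 x * J + central x * K + deriv x * L"
  using borel_char_eq[OF lam] by (simp add: lam_c lam_h lam_d)

lemma h_vac: "m \<ge> 0 \<Longrightarrow> app (h m) (single 0 c) = single 0 (if m = 0 then J * c else 0)"
  by (simp add: h_def a_def D_def SD.rep_eq)

lemma rho_vac:
  assumes "x \<in> borel"
  shows "app (rho x) (single 0 c) = single 0 (borel_char lam x * c)"
proof -
  have r1: "app (rho1 m (lookup (loop x) m)) (single 0 c) = (if m = 0 then single 0 (cch 0 x * J * c) else 0)" for m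
    using assms by (cases "m \<ge> 0") (auto simp: rho1_def e_kills borel_iff h_vac sc_hom mult.assoc)
  have "app (rho_loop (loop x)) (single 0 c) = (\<Sum>m\<in>keys (loop x). if m = 0 then single 0 (cch 0 x * J * c) else 0)"
    by (simp add: rho_loop_def app_sum r1)
  also have "\<dots> = single 0 (cch 0 x * J * c)"
    by (auto simp: in_keys_iff)
  finally show ?thesis
    by (simp add: rho_def borel_char[OF assms] d_def algebra_simps flip: single_add)
qed

lemma eval_falg_eq: "eval_falg ch = eval_words (\<lambda>c. c) ch"
  by (simp add: eval_falg_def eval_words_def fun_eq_iff)

interpretation ch: word_evaluation "\<lambda>c::complex. c" "borel_char lam"
  by unfold_locales simp_all

lemma ev_borel:
  assumes "keys p \<subseteq> lists borel"
  shows "app (ev p) vac = single 0 (eval_falg (borel_char lam) p)"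
  using assms
proof (induction p rule: word_induct)
  case (4 x p)
  then show ?case by (simp add: eval_falg_eq ch.eval_mult ch.eval_gen rho_vac)
qed (simp_all add: eval_falg_eq ch.eval_zero ch.eval_scalar ch.eval_add single_add del: single_one)

definition Wf :: "int list \<Rightarrow> affine list \<Rightarrow>\<^sub>0 complex" where
  "Wf ns = prod_list (map (\<lambda>n. gen (f_vec n)) ns)"

definition Wh :: "nat list \<Rightarrow> affine list \<Rightarrow>\<^sub>0 complex" where
  "Wh js = prod_list (map (\<lambda>j. gen (h_vec (- int j - 1))) js)"

definition monom :: "int list \<Rightarrow> nat list \<Rightarrow> expo" where
  "monom ns js = sum_list (map (\<lambda>n. single (X n) 1) ns) + sum_list (map (\<lambda>j. single (Y j) 1) js)"

lemma monom_simps [simp]: "monom [] [] = 0" "monom (n # ns) js = single (X n) 1 + monom ns js"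
  "monom [] (j # js) = single (Y j) 1 + monom [] js"
  by (simp_all add: monom_def add.assoc)

lemma lookup_monom: "lookup (monom ns js) (X n) = of_nat (count (mset ns) n)"
  "lookup (monom ns js) (Y j) = of_nat (count (mset js) j)"
proof -
  have Y: "lookup (monom [] js) (X n) = 0" "lookup (monom [] js) (Y j) = of_nat (count (mset js) j)"
    by (induction js) (auto simp: lookup_add lookup_single when_def)
  show "lookup (monom ns js) (X n) = of_nat (count (mset ns) n)"
    by (induction ns) (auto simp: lookup_add lookup_single when_def Y)
  show "lookup (monom ns js) (Y j) = of_nat (count (mset js) j)"
    by (induction ns) (auto simp: lookup_add lookup_single when_def Y)
qed

lemma monom_eqD:
  assumes "monom ns js = monom ns' js'"
  shows "mset ns = mset ns'" "mset js = mset js'"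
  using arg_cong[OF assms, of "\<lambda>\<mu>. lookup \<mu> (X n)" for n] arg_cong[OF assms, of "\<lambda>\<mu>. lookup \<mu> (Y j)" for j]
  by (auto simp: lookup_monom multiset_eq_iff)

lemma monom_append: "monom (ns @ ns') (js @ js') = monom ns js + monom ns' js'"
  by (simp add: monom_def add_ac)

lemma EV_monom:
  assumes "\<mu> \<in> EV"
  obtains ns js where "\<mu> = monom ns js"
proof -
  have rep: "monom (replicate n k) [] = single (X k) (of_nat n)" "monom [] (replicate n j) = single (Y j) (of_nat n)" for n k j
    by (induction n) (simp_all flip: single_add)
  have "\<exists>ns js. (\<Sum>v\<in>A. single v (lookup \<mu> v)) = monom ns js" if "finite A" for A
    using that
  proof induction
    case empty
    show ?case by (intro exI[of _ "[]"]) simp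
  next
    case (insert v A)
    then obtain ns js where IH: "(\<Sum>v\<in>A. single v (lookup \<mu> v)) = monom ns js" by blast
    obtain n where n: "lookup \<mu> v = of_nat n" using assms by (auto simp: EV_iff elim: Nats_cases)
    show ?case
    proof (cases v)
      case (X k)
      then show ?thesis
        using insert.hyps IH n rep(1)[of n k] monom_append[of "replicate n k" ns "[]" js]
        by (intro exI[of _ "replicate n k @ ns"] exI[of _ js]) simp
    next
      case (Y j)
      then show ?thesis
        using insert.hyps IH n rep(2)[of n j] monom_append[of "[]" ns "replicate n j" js]
        by (intro exI[of _ ns] exI[of _ "replicate n j @ js"]) simp
    qed
  qed
  then show thesis using that poly_mapping_sum_singles[of \<mu>] by (metis finite_keys)
qed

lemma ev_W: "app (ev (Wf ns * Wh js)) vac = single (monom ns js) 1"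
proof (induction ns)
  case Nil
  have "app (ev (Wh js)) vac = single (monom [] js) 1"
  proof (induction js)
    case (Cons j js)
    have "app (D m) (single (monom [] js) 1) = 0" for m
      using lookup_monom(1)[of "[]" js] by (simp add: D_def SD.rep_eq)
    then show ?case
      using Cons by (simp add: Wh_def h_def a_neg)
  qed (simp add: Wh_def)
  then show ?case by (simp add: Wf_def)
next
  case (Cons n ns)
  then show ?case by (simp add: Wf_def)
qed

text \<open>A monomial has several words, which differ in the order of letters that commute in U;
  one is chosen for each exponent.\<close>

definition W :: "expo \<Rightarrow> affine list \<Rightarrow>\<^sub>0 complex" where
  "W \<mu> = (SOME w. \<exists>ns js. w = Wf ns * Wh js \<and> \<mu> = monom ns js)"

lemma W_eq:
  assumes "\<mu> \<in> EV"
  obtains ns js where "W \<mu> = Wf ns * Wh js" "\<mu> = monom ns js"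
proof -
  obtain ns js where "\<mu> = monom ns js" using EV_monom[OF assms] .
  then have "\<exists>w ns js. w = Wf ns * Wh js \<and> \<mu> = monom ns js" by blast
  from someI_ex[OF this] that show thesis unfolding W_def by blast
qed

text \<open>A linear section of the map that sends an element of the free algebra to its value on
  the vacuum, using only the chosen ordered words.\<close>

definition Psi :: "alg \<Rightarrow> affine list \<Rightarrow>\<^sub>0 complex" where
  "Psi q = (\<Sum>\<mu>\<in>keys q. single [] (lookup q \<mu>) * W \<mu>)"

lemma Psi_add: "Psi (p + q) = Psi p + Psi q"
  unfolding Psi_def by (rule sum_keys_add) (simp_all add: single_add distrib_right)

lemma Psi_single: "Psi (single \<mu> c) = single [] c * W \<mu>"
  by (cases "c = 0") (simp_all add: Psi_def)

lemma Psi_zero [simp]: "Psi 0 = 0" by (simp add: Psi_def)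

lemma scalar_mult: "single [] c * (single [] k * p) = single [] (c * k) * (p :: affine list \<Rightarrow>\<^sub>0 complex)"
  by (simp add: mult_single plus_list_def flip: mult.assoc)

lemma scalar_central: "(p :: affine list \<Rightarrow>\<^sub>0 complex) * single [] c = single [] c * p"
  by (induction p rule: poly_mapping_induct)
    (simp_all add: mult_single plus_list_def distrib_left distrib_right mult.commute)

lemma scalar_one: "single [] 1 = (1 :: affine list \<Rightarrow>\<^sub>0 complex)"
  by (simp add: zero_list_def flip: single_one)

lemma Psi_sc: "Psi (app (sc c) q) = single [] c * Psi q"
  by (induction q rule: poly_mapping_induct)
    (simp_all add: app_add_right Psi_add Psi_single scalar_mult distrib_left)

lemma ev_Psi: "q \<in> span_on EV \<Longrightarrow> app (ev (Psi q)) vac = q"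
proof (induction rule: span_on_induct)
  case (single \<mu> c)
  obtain ns js where "W \<mu> = Wf ns * Wh js" "\<mu> = monom ns js" using W_eq[OF single] .
  then show ?case using ev_W[of ns js] by (simp add: Psi_single)
qed (simp_all add: Psi_add)

text \<open>\<open>Ker\<close> is a left ideal containing the defining relations of U and those of
  the vacuum. It stays abstract here and becomes the kernel of u \<mapsto> u \<otimes> 1 in
  \<open>verma_model\<close>.\<close>

context
  fixes Ker :: "(affine list \<Rightarrow>\<^sub>0 complex) set"
  assumes Ker_diff: "\<And>p q. p \<in> Ker \<Longrightarrow> q \<in> Ker \<Longrightarrow> p - q \<in> Ker"
    and Ker_mult: "\<And>p r. p \<in> Ker \<Longrightarrow> r * p \<in> Ker"
    and Ker_ideal: "env_ideal UNIV \<subseteq> Ker"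
    and Ker_vac: "\<And>x. x \<in> borel \<Longrightarrow> gen x - single [] (borel_char lam x) \<in> Ker"
begin

text \<open>The straightening argument: the ordered monomials span modulo \<open>Ker\<close>. Their independence
  comes from their action on the vacuum, so that no Poincare-Birkhoff-Witt theorem is needed.\<close>

definition Sp :: "(affine list \<Rightarrow>\<^sub>0 complex) set" where
  "Sp = {p. \<exists>q\<in>span_on EV. p - Psi q \<in> Ker}"

lemma Ker_zero: "0 \<in> Ker"
  using Ker_ideal ring_idealD(1)[OF ring_ideal_env] by blast

lemma Ker_add: "p \<in> Ker \<Longrightarrow> q \<in> Ker \<Longrightarrow> p + q \<in> Ker"
  using Ker_diff[OF _ Ker_diff[OF Ker_zero], of p q] by simp

lemma Sp_add:
  assumes "p \<in> Sp" "q \<in> Sp"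
  shows "p + q \<in> Sp"
proof -
  obtain p' q' where *: "p' \<in> span_on EV" "p - Psi p' \<in> Ker" "q' \<in> span_on EV" "q - Psi q' \<in> Ker"
    using assms by (auto simp: Sp_def)
  have "p + q - Psi (p' + q') = (p - Psi p') + (q - Psi q')" by (simp add: Psi_add)
  then have "p + q - Psi (p' + q') \<in> Ker" using Ker_add[OF *(2,4)] by (simp only:)
  then show ?thesis
    using span_on_add[OF *(1,3)] unfolding Sp_def by blast
qed

lemma Sp_cong:
  assumes "p \<in> Sp" "q - p \<in> Ker"
  shows "q \<in> Sp"
proof -
  obtain p' where *: "p' \<in> span_on EV" "p - Psi p' \<in> Ker" using assms by (auto simp: Sp_def)
  have "q - Psi p' = (q - p) + (p - Psi p')" by simp
  then have "q - Psi p' \<in> Ker" using Ker_add[OF assms(2) *(2)] by (simp only:)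
  then show ?thesis using *(1) unfolding Sp_def by blast
qed

lemma Ker_Sp: "p \<in> Ker \<Longrightarrow> p \<in> Sp"
  unfolding Sp_def by (auto intro!: bexI[of _ 0])

lemma Sp_scalar:
  assumes "p \<in> Sp"
  shows "single [] c * p \<in> Sp"
proof -
  obtain p' where *: "p' \<in> span_on EV" "p - Psi p' \<in> Ker" using assms by (auto simp: Sp_def)
  have "single [] c * p - Psi (app (sc c) p') = single [] c * (p - Psi p')"
    by (simp add: Psi_sc right_diff_distrib)
  then show ?thesis using * Ker_mult span_on_sc by (auto simp: Sp_def intro!: bexI[of _ "app (sc c) p'"])
qed

lemma gen_zero: "gen 0 \<in> env_ideal (UNIV :: affine set)"
  using ring_idealD(2)[OF ring_ideal_env ring_idealD(1)[OF ring_ideal_env] gen_add[of 0 0]] by simp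

text \<open>The given word need not be the one chosen by \<open>W\<close> for its monomial; the two
  differ by the order of commuting letters, hence by an element of the ideal of relations.\<close>

lemma W_Sp: "Wf ns * Wh js \<in> Sp"
proof -
  have EV: "monom ns js \<in> EV"
    unfolding EV_iff
  proof
    show "lookup (monom ns js) v \<in> \<nat>" for v by (cases v) (simp_all add: lookup_monom)
  qed
  obtain ns' js' where W: "W (monom ns js) = Wf ns' * Wh js'" "monom ns js = monom ns' js'" using W_eq[OF EV] .
  have comm0: "gen x * gen y - gen y * gen x \<in> env_ideal UNIV" if "lie x y = 0" for x y :: affine
    using ring_idealD(2)[OF ring_ideal_env gen_zero gen_lie[of x y]] that by simp
  have "Wf ns - Wf ns' \<in> env_ideal UNIV" "Wh js - Wh js' \<in> env_ideal UNIV"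
    unfolding Wf_def Wh_def using monom_eqD[OF W(2)]
    by (intro commuting_products ring_ideal_env comm0; simp add: lie_basis)+
  then have "(Wf ns - Wf ns') * Wh js + Wf ns' * (Wh js - Wh js') \<in> env_ideal UNIV"
    by (intro ring_idealD(5)[OF ring_ideal_env] ring_idealD(4)[OF ring_ideal_env, of "Wf ns - Wf ns'"]
        ring_idealD(3)[OF ring_ideal_env, of "Wh js - Wh js'"])
  then have "Wf ns * Wh js - Psi (single (monom ns js) 1) \<in> Ker"
    using Ker_ideal by (auto simp: Psi_single W(1) scalar_one algebra_simps)
  then show ?thesis using EV unfolding Sp_def by (blast intro: span_on_single)
qed

lemma one_Sp: "1 \<in> Sp"
  using W_Sp[of "[]" "[]"] by (simp add: Wf_def Wh_def)

lemma Sp_mult: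
  assumes "\<And>ns js. u * (Wf ns * Wh js) \<in> Sp" "p \<in> Sp"
  shows "u * p \<in> Sp"
proof -
  obtain p' where *: "p' \<in> span_on EV" "p - Psi p' \<in> Ker" using assms(2) by (auto simp: Sp_def)
  have "u * Psi p' \<in> Sp"
    using *(1)
  proof (induction rule: span_on_induct)
    case zero
    show ?case by (simp add: Ker_Sp Ker_zero)
  next
    case (single \<mu> c)
    obtain ns js where "W \<mu> = Wf ns * Wh js" using W_eq[OF single] .
    then have "u * Psi (single \<mu> c) = single [] c * (u * (Wf ns * Wh js))"
      by (simp add: Psi_single scalar_central flip: mult.assoc)
    then show ?case using Sp_scalar[OF assms(1)] by simp
  next
    case (add p q)
    then show ?case by (simp add: Psi_add distrib_left Sp_add)
  qed
  moreover have "u * p - u * Psi p' \<in> Ker"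
    using Ker_mult[OF *(2), of u] by (simp add: right_diff_distrib)
  ultimately show ?thesis by (rule Sp_cong)
qed

text \<open>To show that this is the whole Lie algebra suffices, because \<open>Sp\<close> contains
  1 and words are built by left multiplication.\<close>

definition Act :: "affine set" where "Act = {x. \<forall>p\<in>Sp. gen x * p \<in> Sp}"

lemma ideal_Ker: "p \<in> env_ideal UNIV \<Longrightarrow> p * w \<in> Ker"
  using Ker_ideal ring_idealD(4)[OF ring_ideal_env] by blast

lemma gen_scale_Sp:
  assumes "gen x * w \<in> Sp"
  shows "gen (k *\<^sub>C x) * w \<in> Sp"
proof (rule Sp_cong[OF Sp_scalar[OF assms]])
  show "gen (k *\<^sub>C x) * w - single [] k * (gen x * w) \<in> Ker"
    using ideal_Ker[OF gen_scale[of k x], of w] by (simp add: left_diff_distrib mult.assoc)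
qed

lemma gen_add_Sp:
  assumes "gen x * w \<in> Sp" "gen y * w \<in> Sp"
  shows "gen (x + y) * w \<in> Sp"
proof (rule Sp_cong[OF Sp_add[OF assms]])
  show "gen (x + y) * w - (gen x * w + gen y * w) \<in> Ker"
    using ideal_Ker[OF gen_add[of x y], of w] by (simp add: left_diff_distrib distrib_right)
qed

lemma Act_scale: "x \<in> Act \<Longrightarrow> k *\<^sub>C x \<in> Act" and Act_add: "x \<in> Act \<Longrightarrow> y \<in> Act \<Longrightarrow> x + y \<in> Act"
  by (simp_all add: Act_def gen_scale_Sp gen_add_Sp)

lemma Act_zero: "0 \<in> Act"
  using ideal_Ker[OF gen_zero] Ker_Sp by (simp add: Act_def)

lemma comm_step:
  assumes "y \<in> Act" "gen x * w \<in> Sp" "gen (lie x y) * w \<in> Sp"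
  shows "gen x * (gen y * w) \<in> Sp"
proof (rule Sp_cong)
  show "gen y * (gen x * w) + gen (lie x y) * w \<in> Sp"
    using assms by (intro Sp_add) (simp_all add: Act_def)
  have "0 - (gen (lie x y) - (gen x * gen y - gen y * gen x)) * w \<in> Ker"
    by (intro Ker_diff Ker_zero ideal_Ker gen_lie)
  then show "gen x * (gen y * w) - (gen y * (gen x * w) + gen (lie x y) * w) \<in> Ker"
    by (simp add: left_diff_distrib algebra_simps)
qed

lemma Act_f: "f_vec n \<in> Act"
proof -
  have "gen (f_vec n) * (Wf ns * Wh js) \<in> Sp" for ns js
    using W_Sp[of "n # ns" js] by (simp add: Wf_def mult.assoc)
  then show ?thesis using Sp_mult by (auto simp: Act_def)
qed

text \<open>x is moved to the right past the f's, and each step costs a bracket [x, f_n]. These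
  brackets dictate the order of the lemmas that follow: f_n and h_{-j-1}, then c, then all h_m, and
  only then e_m, whose brackets with f_n involve h and c.\<close>

lemma ActI:
  assumes "\<And>js. gen x * Wh js \<in> Sp" "\<And>n. lie x (f_vec n) \<in> Act"
  shows "x \<in> Act"
proof -
  have "gen x * (Wf ns * Wh js) \<in> Sp" for ns js
  proof (induction ns)
    case Nil
    then show ?case using assms(1) by (simp add: Wf_def)
  next
    case (Cons n ns)
    have "gen x * (gen (f_vec n) * (Wf ns * Wh js)) \<in> Sp"
      using Cons Act_f assms(2) W_Sp by (intro comm_step) (auto simp: Act_def)
    then show ?case by (simp add: Wf_def mult.assoc)
  qed
  then show ?thesis using Sp_mult by (auto simp: Act_def)
qed

lemma Act_h_neg: "h_vec (- int j - 1) \<in> Act"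
proof (rule ActI)
  show "gen (h_vec (- int j - 1)) * Wh js \<in> Sp" for js
    using W_Sp[of "[]" "j # js"] by (simp add: Wf_def Wh_def)
qed (simp add: lie_basis Act_scale[OF Act_f, of "- 2", simplified])

lemma gen_vac:
  assumes "x \<in> borel"
  shows "gen x \<in> Sp"
  using Sp_cong[OF Sp_scalar[OF one_Sp, of "borel_char lam x"]] Ker_vac[OF assms] by simp

lemma gen_Wh:
  assumes "x \<in> borel" "\<And>j. lie x (h_vec (- int j - 1)) \<in> Act"
  shows "gen x * Wh js \<in> Sp"
proof (induction js)
  case Nil
  then show ?case using gen_vac[OF assms(1)] by (simp add: Wh_def)
next
  case (Cons j js)
  have "Wh js \<in> Sp" using W_Sp[of "[]" js] by (simp add: Wf_def)
  then have "gen x * (gen (h_vec (- int j - 1)) * Wh js) \<in> Sp"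
    using Cons assms(2) by (intro comm_step Act_h_neg) (auto simp: Act_def)
  then show ?case by (simp add: Wh_def)
qed

lemma Act_c: "c_vec \<in> Act"
  by (rule ActI[OF gen_Wh]) (simp_all add: lie_basis Act_zero borel_iff)

lemma Act_h: "h_vec m \<in> Act"
proof (cases "m \<ge> 0")
  case True
  show ?thesis
  proof (rule ActI[OF gen_Wh])
    show "h_vec m \<in> borel" using True by (auto simp: borel_iff lookup_single when_def)
    show "lie (h_vec m) (f_vec n) \<in> Act" for n
      unfolding lie_basis by (intro Act_scale Act_f)
    show "lie (h_vec m) (h_vec (- int j - 1)) \<in> Act" for j
      unfolding lie_basis by (intro Act_scale Act_c)
  qed
next
  case False
  then have "m = - int (nat (- m - 1)) - 1" by simp
  then show ?thesis using Act_h_neg by metis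
qed

lemma Act_e: "e_vec m \<in> Act"
proof (rule ActI)
  have "\<forall>m. gen (e_vec m) * Wh js \<in> Sp" for js
  proof (induction js)
    case Nil
    have "e_vec m \<in> borel" for m by (auto simp: borel_iff lookup_single when_def)
    then show ?case using gen_vac by (simp add: Wh_def)
  next
    case (Cons j js)
    have "gen (e_vec m) * (gen (h_vec (- int j - 1)) * Wh js) \<in> Sp" for m
    proof (intro comm_step Act_h_neg)
      show "gen (e_vec m) * Wh js \<in> Sp" using Cons by blast
      show "gen (lie (e_vec m) (h_vec (- int j - 1))) * Wh js \<in> Sp"
        unfolding lie_basis by (intro gen_scale_Sp) (use Cons in blast)
    qed
    then show ?case by (simp add: Wh_def)
  qed
  then show "gen (e_vec m) * Wh js \<in> Sp" for js by blast
  show "lie (e_vec m) (f_vec n) \<in> Act" for n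
    unfolding lie_basis by (intro Act_add Act_scale Act_h Act_c)
qed

lemma Act_d: "d_vec \<in> Act"
proof (rule ActI[OF gen_Wh])
  show "d_vec \<in> borel" by (auto simp: borel_iff)
  show "lie d_vec (f_vec n) \<in> Act" for n
    unfolding lie_basis by (intro Act_scale Act_f)
  show "lie d_vec (h_vec (- int j - 1)) \<in> Act" for j
    unfolding lie_basis by (intro Act_scale Act_h)
qed

lemma Sp_UNIV: "p \<in> Sp"
proof -
  have Act: "x \<in> Act" for x
    by (induction x rule: affine_induct) (simp_all add: Act_e Act_f Act_h Act_c Act_d Act_add Act_scale)
  have "keys p \<subseteq> lists UNIV" by simp
  then show ?thesis
  proof (induction p rule: word_induct)
    case (2 c)
    show ?case using Sp_scalar[OF one_Sp, of c] by simp
  next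
    case (4 x p)
    then show ?case using Act by (simp add: Act_def)
  qed (simp_all add: Sp_add Ker_Sp Ker_zero)
qed

text \<open>Modulo \<open>Ker\<close> every p is some \<open>Psi q\<close>, and \<open>Psi q\<close>
  sends the vacuum to q. If p kills the vacuum, then q = 0 and p itself lies in
  \<open>Ker\<close>.\<close>

lemma Ker_complete:
  assumes "\<And>p. p \<in> Ker \<Longrightarrow> app (ev p) vac = 0" "app (ev p) vac = 0"
  shows "p \<in> Ker"
proof -
  obtain q where q: "q \<in> span_on EV" "p - Psi q \<in> Ker" using Sp_UNIV[of p] by (auto simp: Sp_def)
  have "app (ev p) vac - q = 0"
    using assms(1)[OF q(2)] ev_Psi[OF q(1)] by simp
  then have "q = 0" using assms(2) by simp
  then show ?thesis using q(2) by simp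
qed

end

lemma sc_app: "app (sc c) (app (sc k) p) = app (sc (c * k)) p"
  by (rule poly_mapping_eqI) simp

text \<open>The unique value demanded by the definition exists because the character can be
  recovered from the action on the vacuum, which is constant on cosets.\<close>

lemma one_dim_smult:
  assumes "keys p \<subseteq> lists borel"
  shows "UB.cls p \<odot>\<^bsub>one_dim_module lam\<^esub> v = eval_falg (borel_char lam) p * v"
proof -
  have eq: "eval_falg (borel_char lam) q = eval_falg (borel_char lam) p" if "q \<in> UB.cls p" for q
  proof -
    have qp: "q - p \<in> env_ideal borel" using UB.in_cls[OF that] .
    then have "q - p \<in> carrier (falg borel)" using UB.I_closed(6) by (rule subsetD[rotated])
    then have "keys (q - p) \<subseteq> lists borel" by simp
    then have "keys q \<subseteq> lists borel" using falg_closed(1)[OF _ assms, of "q - p"] by simp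
    moreover have "ev q = ev p" using ev_ideal[of "q - p"] qp env_ideal_borel by auto
    ultimately have "single 0 (eval_falg (borel_char lam) q) = (single 0 (eval_falg (borel_char lam) p) :: alg)"
      using ev_borel[of q] ev_borel[OF assms] by simp
    then show ?thesis by (metis lookup_single_eq)
  qed
  have "(THE a. \<forall>q\<in>UB.cls p. eval_falg (borel_char lam) q = a) = eval_falg (borel_char lam) p"
  proof (rule the_equality)
    show "\<forall>q\<in>UB.cls p. eval_falg (borel_char lam) q = eval_falg (borel_char lam) p" using eq by blast
    show "c = eval_falg (borel_char lam) p" if "\<forall>q\<in>UB.cls p. eval_falg (borel_char lam) q = c" for c
      by (rule sym[OF bspec[OF that UB.self_in_cls]])
  qed
  then show ?thesis by (simp add: one_dim_module_def)
qed

interpretation V: scalar_extension "env_incl borel UNIV" "env borel" Uaff "one_dim_module lam"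
proof (intro scalar_extension.intro ring_Uaff)
  show "env_incl borel UNIV r \<in> carrier Uaff" if r: "r \<in> carrier (env borel)" for r
    using r by (auto simp: env_def[of borel] UB.carrier_Q env_incl_cls Uaff_simps)
qed (simp_all add: one_dim_module_def)

lemma verma_eq: "verma lam = V.E"
  by (simp add: verma_def)

text \<open>\<open>\<Phi>\<close> sends u \<otimes> c to c times the value of u on the vacuum. It is
  onto by \<open>ev_Psi\<close>. Every element has the form u \<otimes> 1, so
  \<open>Ker_complete\<close> gives injectivity.\<close>

lemma verma_model:
  obtains \<Phi> where "bij_betw \<Phi> (carrier (verma lam)) (span_on EV)"
    "\<And>U V. U \<in> carrier (verma lam) \<Longrightarrow> V \<in> carrier (verma lam) \<Longrightarrow> \<Phi> (U \<oplus>\<^bsub>verma lam\<^esub> V) = \<Phi> U + \<Phi> V"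
    "\<And>u V. u \<in> carrier Uaff \<Longrightarrow> V \<in> carrier (verma lam) \<Longrightarrow> \<Phi> (u \<odot>\<^bsub>verma lam\<^esub> V) = app (uact u) (\<Phi> V)"
proof -
  interpret A: comm_group "add_monoid V.E" by (rule V.add_comm_group_E)
  have M: "m \<in> carrier (one_dim_module lam)" "m \<oplus>\<^bsub>one_dim_module lam\<^esub> n = m + n" for m n
    by (simp_all add: one_dim_module_def)
  have clsU: "U.cls p \<in> carrier Uaff" for p by (simp add: Uaff_simps)
  let ?\<beta> = "\<lambda>u c. app (sc c) (app (uact u) vac)"
  obtain \<Phi> where \<Phi>: "\<And>s m. s \<in> carrier Uaff \<Longrightarrow> m \<in> carrier (one_dim_module lam) \<Longrightarrow> \<Phi> (V.tens s m) = ?\<beta> s m"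
    "\<And>U V. U \<in> carrier V.E \<Longrightarrow> V \<in> carrier V.E \<Longrightarrow> \<Phi> (U \<oplus>\<^bsub>V.E\<^esub> V) = \<Phi> U + \<Phi> V"
  proof (rule V.E_lift[of ?\<beta>])
    fix s t m assume "s \<in> carrier Uaff" "t \<in> carrier Uaff"
    then show "?\<beta> (s \<oplus>\<^bsub>Uaff\<^esub> t) m = ?\<beta> s m + ?\<beta> t m"
      by (auto simp: Uaff_simps app_add_right)
  next
    fix s m n
    show "?\<beta> s (m \<oplus>\<^bsub>one_dim_module lam\<^esub> n) = ?\<beta> s m + ?\<beta> s n"
      by (simp add: M sc_hom)
  next
    fix s r m assume "s \<in> carrier Uaff" "r \<in> carrier (env borel)"
    then obtain p q where pq: "s = U.cls p" "r = UB.cls q" "keys q \<subseteq> lists borel"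
      by (auto simp: Uaff_simps env_def[of borel] UB.carrier_Q)
    let ?k = "eval_falg (borel_char lam) q"
    have k: "app (ev p) (app (ev q) vac) = app (sc ?k) (app (ev p) vac)"
      unfolding ev_borel[OF pq(3)] by (rule clin_single[OF clin_ev])
    have "?\<beta> (s \<otimes>\<^bsub>Uaff\<^esub> env_incl borel UNIV r) m = app (sc m) (app (ev p) (app (ev q) vac))"
      by (simp add: pq env_incl_cls Uaff_simps)
    also have "\<dots> = app (sc (?k * m)) (app (ev p) vac)"
      by (simp only: k sc_app mult.commute[of m])
    also have "\<dots> = ?\<beta> s (r \<odot>\<^bsub>one_dim_module lam\<^esub> m)"
      by (simp only: pq(1,2) one_dim_smult[OF pq(3)] uact_cls)
    finally show "?\<beta> (s \<otimes>\<^bsub>Uaff\<^esub> env_incl borel UNIV r) m = ?\<beta> s (r \<odot>\<^bsub>one_dim_module lam\<^esub> m)" .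
  qed blast
  have \<Phi>0: "\<Phi> \<zero>\<^bsub>V.E\<^esub> = 0"
    using \<Phi>(2)[OF V.zero_closed_E V.zero_closed_E] A.r_one[of "\<zero>\<^bsub>V.E\<^esub>"] V.zero_closed_E by simp
  have \<Phi>smult: "\<Phi> (u \<odot>\<^bsub>V.E\<^esub> U) = app (uact u) (\<Phi> U)" if u: "u \<in> carrier Uaff" and "U \<in> carrier V.E" for u U
  proof (rule V.E_induct[OF that(2), where P = "\<lambda>U. \<Phi> (u \<odot>\<^bsub>V.E\<^esub> U) = app (uact u) (\<Phi> U)"])
    fix s m assume tens: "s \<in> carrier Uaff" "m \<in> carrier (one_dim_module lam)"
    obtain p q where "u = U.cls p" "s = U.cls q" using u tens by (auto simp: Uaff_simps)
    then show "\<Phi> (u \<odot>\<^bsub>V.E\<^esub> V.tens s m) = app (uact u) (\<Phi> (V.tens s m))"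
      using tens u by (simp add: V.smult_tens \<Phi> clsU M Uaff_simps clin_app[OF clin_ev])
  next
    fix U V assume "U \<in> carrier V.E" "V \<in> carrier V.E"
      "\<Phi> (u \<odot>\<^bsub>V.E\<^esub> U) = app (uact u) (\<Phi> U)" "\<Phi> (u \<odot>\<^bsub>V.E\<^esub> V) = app (uact u) (\<Phi> V)"
    then show "\<Phi> (u \<odot>\<^bsub>V.E\<^esub> (U \<oplus>\<^bsub>V.E\<^esub> V)) = app (uact u) (\<Phi> (U \<oplus>\<^bsub>V.E\<^esub> V))"
      by (simp add: V.smult_add u \<Phi>(2) V.smult_closed_E app_add_right)
  qed (simp add: V.smult_zero u \<Phi>0)
  define \<nu> where "\<nu> p = V.tens (U.cls p) 1" for p
  have \<nu>_closed: "\<nu> p \<in> carrier V.E" for p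
    by (simp add: \<nu>_def V.tens_closed clsU M)
  have \<nu>_add: "\<nu> (p + q) = \<nu> p \<oplus>\<^bsub>V.E\<^esub> \<nu> q" for p q
    by (simp add: \<nu>_def clsU M Uaff_simps flip: V.tens_add_left)
  have \<nu>_mult: "\<nu> (p * q) = U.cls p \<odot>\<^bsub>V.E\<^esub> \<nu> q" for p q
    by (simp add: \<nu>_def clsU M Uaff_simps V.smult_tens)
  have \<Phi>\<nu>: "\<Phi> (\<nu> p) = app (ev p) vac" for p
    by (simp add: \<nu>_def \<Phi> clsU M sc_hom)
  have \<nu>_borel: "\<nu> q = V.tens \<one>\<^bsub>Uaff\<^esub> (eval_falg (borel_char lam) q)" if "keys q \<subseteq> lists borel" for q
  proof -
    have r: "UB.cls q \<in> carrier (env borel)" using that by (simp add: env_def[of borel] UB.carrier_Q)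
    have "V.tens (\<one>\<^bsub>Uaff\<^esub> \<otimes>\<^bsub>Uaff\<^esub> env_incl borel UNIV (UB.cls q)) 1 = V.tens \<one>\<^bsub>Uaff\<^esub> (UB.cls q \<odot>\<^bsub>one_dim_module lam\<^esub> 1)"
      by (rule V.tens_balanced) (simp_all add: r M clsU Uaff_simps)
    then show ?thesis
      by (simp add: \<nu>_def env_incl_cls Uaff_simps one_dim_smult[OF that])
  qed
  have \<nu>_surj: "\<exists>p. U = \<nu> p" if "U \<in> carrier V.E" for U
  proof (rule V.E_induct[OF that, where P = "\<lambda>U. \<exists>p. U = \<nu> p"])
    fix s c assume "s \<in> carrier Uaff"
    then obtain p where p: "s = U.cls p" by (auto simp: Uaff_simps)
    have "\<nu> (single [] c) = V.tens \<one>\<^bsub>Uaff\<^esub> c"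
      by (subst \<nu>_borel) (simp_all add: eval_falg_eq ch.eval_scalar)
    then have "\<nu> (p * single [] c) = V.tens s c"
      by (simp add: \<nu>_mult p V.smult_tens clsU M Uaff_simps)
    then show "\<exists>p. V.tens s c = \<nu> p" by metis
  next
    fix U V assume "\<exists>p. U = \<nu> p" "\<exists>p. V = \<nu> p"
    then show "\<exists>p. U \<oplus>\<^bsub>V.E\<^esub> V = \<nu> p" by (metis \<nu>_add)
  next
    have "\<nu> 0 = \<zero>\<^bsub>V.E\<^esub>" by (simp add: \<nu>_def V.tens_zero_left M flip: Uaff_simps)
    then show "\<exists>p. \<zero>\<^bsub>V.E\<^esub> = \<nu> p" by metis
  qed
  define Ker where "Ker = {p. \<nu> p = \<zero>\<^bsub>V.E\<^esub>}"
  have Ker_diff: "p - q \<in> Ker \<longleftrightarrow> \<nu> p = \<nu> q" for p q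
  proof -
    have "\<nu> p = \<nu> (p - q) \<oplus>\<^bsub>V.E\<^esub> \<nu> q" by (simp flip: \<nu>_add)
    then show ?thesis
      unfolding Ker_def using A.l_one[of "\<nu> q"] A.r_cancel_one'[of "\<nu> q" "\<nu> (p - q)"] \<nu>_closed by auto
  qed
  have \<nu>0: "\<nu> 0 = \<zero>\<^bsub>V.E\<^esub>" by (simp add: \<nu>_def V.tens_zero_left M flip: Uaff_simps)
  have complete: "p \<in> Ker" if "app (ev p) vac = 0" for p
  proof (rule Ker_complete[of Ker, OF _ _ _ _ _ that])
    show "p - q \<in> Ker" if "p \<in> Ker" "q \<in> Ker" for p q
      using that by (simp add: Ker_diff) (simp add: Ker_def)
    show "r * p \<in> Ker" if "p \<in> Ker" for p r
      using that by (simp add: Ker_def \<nu>_mult V.smult_zero clsU)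
    show "env_ideal UNIV \<subseteq> Ker"
    proof
      fix p :: "affine list \<Rightarrow>\<^sub>0 complex" assume "p \<in> env_ideal UNIV"
      then have "U.cls p = U.cls 0" by (simp add: U.cls_eq_iff)
      then show "p \<in> Ker" using \<nu>0 by (simp add: Ker_def \<nu>_def)
    qed
    show "gen x - single [] (borel_char lam x) \<in> Ker" if "x \<in> borel" for x
      unfolding Ker_diff
      using that by (simp add: \<nu>_borel falg_closed eval_falg_eq ch.eval_gen ch.eval_scalar)
    show "app (ev p) vac = 0" if "p \<in> Ker" for p
      using that \<Phi>\<nu>[of p] by (simp add: Ker_def \<Phi>0)
  qed
  have "bij_betw \<Phi> (carrier V.E) (span_on EV)"
  proof (rule bij_betwI')
    fix U V assume "U \<in> carrier V.E" "V \<in> carrier V.E"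
    then obtain p q where pq: "U = \<nu> p" "V = \<nu> q" using \<nu>_surj by blast
    show "(\<Phi> U = \<Phi> V) = (U = V)"
      using complete[of "p - q"] Ker_diff[of p q] \<Phi>\<nu>[of p] \<Phi>\<nu>[of q] unfolding pq by auto
  next
    fix U assume "U \<in> carrier V.E"
    then obtain p where "U = \<nu> p" using \<nu>_surj by blast
    then show "\<Phi> U \<in> span_on EV"
      using gsub_ev[OF gsub_EV] by (simp add: \<Phi>\<nu> span_on_single EV_iff del: single_one)
  next
    fix q assume "q \<in> span_on EV"
    then show "\<exists>U\<in>carrier V.E. q = \<Phi> U"
      using ev_Psi \<nu>_closed \<Phi>\<nu> by metis
  qed
  with \<Phi>(2) \<Phi>smult that show thesis unfolding verma_eq by blast
qed

lemma verma_closed: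
  "U \<in> carrier (verma lam) \<Longrightarrow> V \<in> carrier (verma lam) \<Longrightarrow> U \<oplus>\<^bsub>verma lam\<^esub> V \<in> carrier (verma lam)"
  "u \<in> carrier Uaff \<Longrightarrow> V \<in> carrier (verma lam) \<Longrightarrow> u \<odot>\<^bsub>verma lam\<^esub> V \<in> carrier (verma lam)"
  unfolding verma_eq by (simp_all add: V.add_closed_E V.smult_closed_E)

end


section \<open>Localization\<close>

text \<open>A quantitative Ore condition. By F u = u F + [F, u], one power of F either moves to the
  right or is absorbed by a commutator of smaller ad-nilpotency degree; hence the double induction
  on \<open>m\<close> and \<open>k\<close>.\<close>

lemma ore_step:
  assumes "ring_ideal I" "(comm_with F ^^ m) u \<in> I"
  shows "\<exists>r. F ^ (k + m) * u - r * F ^ k \<in> I"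
  using assms(2)
proof (induction m arbitrary: u k)
  case 0
  then show ?case using ring_idealD(3)[OF assms(1)] by (intro exI[of _ 0]) simp
next
  case (Suc m)
  note I = ring_idealD[OF assms(1)]
  have c: "(comm_with F ^^ m) (comm_with F u) \<in> I"
    using Suc.prems by (simp add: funpow_swap1)
  show ?case
  proof (induction k)
    case 0
    show ?case by (rule exI[of _ "F ^ Suc m * u"]) (simp add: I)
  next
    case (Suc k)
    then obtain r where r: "F ^ (k + Suc m) * u - r * F ^ k \<in> I" by blast
    obtain r' where r': "F ^ (Suc k + m) * comm_with F u - r' * F ^ Suc k \<in> I"
      using Suc.IH Suc.prems \<open>\<And>u k. (comm_with F ^^ m) u \<in> I \<Longrightarrow> \<exists>r. F ^ (k + m) * u - r * F ^ k \<in> I\<close> c by blast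
    have "F ^ (Suc k + Suc m) * u = F ^ (k + Suc m) * (F * u)"
      by (simp add: power_Suc2 mult.assoc del: power_Suc)
    also have "F * u = u * F + comm_with F u" by (simp add: comm_with_def)
    finally have "F ^ (Suc k + Suc m) * u - (r + r') * F ^ Suc k
      = (F ^ (k + Suc m) * u - r * F ^ k) * F + (F ^ (Suc k + m) * comm_with F u - r' * F ^ Suc k)"
      by (simp add: algebra_simps power_commutes)
    also have "\<dots> \<in> I" by (rule I(5)[OF I(4)[OF r] r'])
    finally show ?case by blast
  qed
qed

lemma polyop_uminus_arg: "polyop T \<Longrightarrow> polyop (\<lambda>w. T (- w))"
proof (induction rule: polyop.induct)
  case (step T)
  have "polyop (\<lambda>w. (- 1) * (sc w * T (- w)))"
    by (intro polyop_mult_left polyop.step step.IH) simp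
  then show ?case by (simp add: sc_hom)
qed (simp_all add: polyop.intros)

lemma polyop_gchoose: "polyop (\<lambda>w. sc (w gchoose j))"
proof -
  have "polyop (\<lambda>w. sc (\<Prod>i=0..<j. w - of_nat i))"
    by (induction j)
      (simp_all add: polyop.const sc_mult sc_hom polyop_mult polyop_diff polyop_id)
  from polyop_mult[OF this polyop.const[OF clin_sc[of "inverse (fact j)"]]]
  show ?thesis
    by (simp add: gbinomial_prod_rev divide_inverse sc_mult)
qed

text \<open>For natural w this expands conjugation by x_i^w binomially, with Pascal's rule as the
  inductive step. Both sides depend polynomially on w, which gives the complex case.\<close>

lemma conj_theta:
  assumes n: "(comm_with (mul (X i) 1) ^^ n) T = 0" and poly: "polyop (\<lambda>w. conj_by i w T)"
  shows "(\<Sum>j<n. sc (w gchoose j) * (comm_with (mul (X i) 1) ^^ j) T * mul (X i) (- of_nat j)) = conj_by i (- w) T"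
proof -
  let ?F = "mul (X i) 1"
  define c where "c j = (comm_with ?F ^^ j) T" for j
  define S where "S w = (\<Sum>j<n. sc (w gchoose j) * c j * mul (X i) (- of_nat j))" for w
  have c_Suc: "?F * c j = c j * ?F + c (Suc j)" for j
    by (simp add: c_def comm_with_def)
  define dd where "dd j = c j * mul (X i) (- of_nat j)" for j
  have dd: "?F * dd j * mul (X i) (- 1) = dd j + dd (Suc j)" for j
  proof -
    have "?F * dd j * mul (X i) (- 1) = c j * (?F * (mul (X i) (- of_nat j) * mul (X i) (- 1)))
        + c (Suc j) * (mul (X i) (- of_nat j) * mul (X i) (- 1))"
      unfolding dd_def mult.assoc[symmetric] c_Suc by (simp add: algebra_simps)
    also have "?F * (mul (X i) (- of_nat j) * mul (X i) (- 1)) = mul (X i) (- of_nat j)"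
      by (simp add: mul_commute[of "X i" "- of_nat j"] mul_inverse_left)
    also have "mul (X i) (- of_nat j) * mul (X i) (- 1) = mul (X i) (- of_nat (Suc j))"
      unfolding mul_add[symmetric] by (rule arg_cong) simp
    finally show ?thesis by (simp add: dd_def)
  qed
  \<comment> \<open>One summand more than in \<open>S\<close> is kept. It vanishes, and it leaves
    room for the index shift in Pascal's rule.\<close>
  have S_dd: "S (of_nat m) = (\<Sum>j<Suc n. of_nat (m choose j) * dd j)" for m
    using n by (simp add: S_def dd_def mult.assoc sc_of_nat c_def flip: binomial_gbinomial)
  have nat: "S (of_nat m) = conj_by i (- of_nat m) T" for m
  proof (induction m)
    case 0
    have "S (of_nat 0) = dd 0"
      unfolding S_dd sum.lessThan_Suc_shift by simp
    then show ?case by (simp add: dd_def c_def conj_by_def)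
  next
    case (Suc m)
    have nz: "dd n = 0" "dd (Suc n) = 0" using n by (simp_all add: dd_def c_def comm_with_def)
    have "?F * S (of_nat m) * mul (X i) (- 1) = (\<Sum>j<Suc n. of_nat (m choose j) * (?F * dd j * mul (X i) (- 1)))"
      unfolding S_dd sum_distrib_left sum_distrib_right
      by (rule sum.cong[OF refl]) (simp add: mult_of_nat_commute[of _ ?F, symmetric] flip: mult.assoc)
    also have "\<dots> = (\<Sum>j<Suc n. of_nat (m choose j) * dd j) + (\<Sum>j<n. of_nat (m choose j) * dd (Suc j))"
      unfolding dd by (simp add: distrib_left sum.distrib nz)
    also have "\<dots> = (\<Sum>j<Suc n. of_nat (Suc m choose j) * dd j)"
      by (simp only: sum.lessThan_Suc_shift) (simp add: distrib_right sum.distrib add_ac)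
    also have "\<dots> = S (of_nat (Suc m))" by (rule S_dd[symmetric])
    finally have "S (of_nat (Suc m)) = ?F * conj_by i (- of_nat m) T * mul (X i) (- 1)"
      using Suc by simp
    also have "\<dots> = conj_by i (- of_nat (Suc m)) T"
    proof -
      have "mul (X i) (- of_nat (Suc m)) = mul (X i) (- of_nat m) * mul (X i) (- 1)"
        "mul (X i) (of_nat (Suc m)) = ?F * mul (X i) (of_nat m)"
        unfolding mul_add[symmetric] by (rule arg_cong, simp)+
      then show ?thesis by (simp only: conj_by_def minus_minus mult.assoc)
    qed
    finally show ?case .
  qed
  have "clin T"
    using polyop_clin[OF poly, of 0] by (simp add: conj_by_def)
  then have "clin (c j)" for j
    by (induction j) (simp_all add: c_def comm_with_def)
  then have "polyop (\<lambda>w. S w - conj_by i (- w) T)"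
    unfolding S_def
    by (intro polyop_diff polyop_sum polyop_mult polyop_gchoose polyop_uminus_arg[OF poly] polyop.const) simp_all
  from polyop_vanish[OF this] nat show ?thesis
    by (simp add: S_def c_def)
qed

context fock
begin

lemma comm_with_ev: "(comm_with (f i) ^^ n) (ev p) = ev ((comm_with (gen (f_vec i)) ^^ n) p)"
  by (induction n arbitrary: p) (simp_all add: comm_with_def)

lemma polyop_conj_rho: "polyop (\<lambda>w. conj_by i w (rho x))"
proof (induction x rule: affine_induct)
  case (f m)
  show ?case by (simp add: polyop.const)
next
  case c
  show ?case by (simp add: polyop.const)
next
  case d
  have "conj_by i w d = d + sc w * sc (of_int i)" for w
  proof (rule conj_by_eq)
    show "d * mul (X i) w = mul (X i) w * (d + sc w * sc (of_int i))"
      by (simp add: d_def distrib_left distrib_right dg_mul scl sc_sc mult_ac)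
  qed
  then show ?case by (simp add: polyop.intros)
next
  case (add x y)
  then show ?case by (simp add: rho_add conj_by_add polyop.add)
next
  case (scale k x)
  then show ?case by (simp add: rho_scale conj_by_mult polyop_mult_left)
qed (simp_all add: polyop_conj_e polyop_conj_h)

lemma polyop_conj_ev: "polyop (\<lambda>w. conj_by i w (ev p))"
proof -
  have "keys p \<subseteq> lists UNIV" by simp
  then show ?thesis
    by (induction p rule: word_induct)
      (simp_all add: polyop.intros conj_by_add conj_by_mult polyop_conj_rho polyop_mult)
qed

end

text \<open>The third power of ad f_i vanishes on the Lie algebra, hence on single letters modulo
  the relations; the Leibniz rule extends nilpotency to words and sums.\<close>

lemma ad_f_nilpotent: "\<exists>n. (comm_with (gen (f_vec i)) ^^ n) p \<in> env_ideal UNIV"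
proof -
  let ?F = "gen (f_vec i) :: affine list \<Rightarrow>\<^sub>0 complex"
  note I = ring_idealD[OF ring_ideal_env]
  have gen: "(comm_with ?F ^^ 3) (gen x) \<in> env_ideal UNIV" for x
  proof -
    have st: "comm_with ?F u \<in> env_ideal UNIV" if "u \<in> env_ideal UNIV" for u
      using comm_with_ideal[OF ring_ideal_env that, where f = ?F and n = 1] by simp
    have g: "comm_with ?F (gen x) - gen (lie (f_vec i) x) \<in> env_ideal UNIV" for x
      using I(2)[OF I(1) gen_lie[of "f_vec i" x]] by (simp add: comm_with_def)
    have d: "comm_with ?F (u - v) = comm_with ?F u - comm_with ?F v" for u v
      by (simp add: comm_with_def algebra_simps)
    \<comment> \<open>Telescoping: commutators of letters are replaced by letters of brackets one at
      a time, each with an error in the ideal.\<close>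
    have "comm_with ?F (comm_with ?F (comm_with ?F (gen x)))
      = comm_with ?F (comm_with ?F (comm_with ?F (gen x) - gen (lie (f_vec i) x)))
        + comm_with ?F (comm_with ?F (gen (lie (f_vec i) x)) - gen (lie (f_vec i) (lie (f_vec i) x)))
        + (comm_with ?F (gen (lie (f_vec i) (lie (f_vec i) x))) - gen (lie (f_vec i) (lie (f_vec i) (lie (f_vec i) x))))
        + gen (lie (f_vec i) (lie (f_vec i) (lie (f_vec i) x)))"
      by (simp add: d)
    also have "lie (f_vec i) (lie (f_vec i) (lie (f_vec i) x)) = 0"
      by (simp add: f_vec_def ad_cube_loop)
    also have "comm_with ?F (comm_with ?F (comm_with ?F (gen x) - gen (lie (f_vec i) x)))
        + comm_with ?F (comm_with ?F (gen (lie (f_vec i) x)) - gen (lie (f_vec i) (lie (f_vec i) x)))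
        + (comm_with ?F (gen (lie (f_vec i) (lie (f_vec i) x))) - gen 0) + gen 0 \<in> env_ideal UNIV"
    proof (intro I(5) st g)
      show "gen (0 :: affine) \<in> env_ideal UNIV" using I(2)[OF I(1) gen_add[of 0 0]] by simp
      show "comm_with ?F (gen (lie (f_vec i) (lie (f_vec i) x))) - gen 0 \<in> env_ideal UNIV"
        using g[of "lie (f_vec i) (lie (f_vec i) x)"] by (simp add: f_vec_def ad_cube_loop)
    qed
    finally show ?thesis by (simp add: numeral_3_eq_3)
  qed
  have "keys p \<subseteq> lists UNIV" by simp
  then show ?thesis
  proof (induction p rule: word_induct)
    case 1
    show ?case by (rule exI[of _ 0]) (simp add: I)
  next
    case (2 c)
    have "?F * single [] c = single [] c * ?F"
      by (simp add: gen_def mult_single plus_list_def)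
    then show ?case by (intro exI[of _ 1]) (simp add: comm_with_def I)
  next
    case (3 p q)
    then show ?case using comm_with_nilpotent_add[OF ring_ideal_env] by blast
  next
    case (4 x p)
    then show ?case using comm_with_nilpotent_mult[OF ring_ideal_env gen] by blast
  qed
qed

lemma ore_condition: "\<exists>N q. gen (f_vec i) ^ N * p - q * gen (f_vec i) ^ n \<in> env_ideal UNIV"
  using ad_f_nilpotent[of i p] ore_step[OF ring_ideal_env] by metis

lemma f_U_power: "f_U i [^]\<^bsub>Uaff\<^esub> (n::nat) = U.cls (gen (f_vec i) ^ n)"
proof -
  interpret R: ring Uaff by (rule ring_Uaff)
  show ?thesis
    by (induction n) (simp_all add: Uaff_simps env_of_eq power_Suc2 del: power_Suc)
qed

locale loc_rep = verma_rep J K L lam for J K L :: complex and lam :: "affine \<Rightarrow> complex" +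
  fixes i :: int
begin

abbreviation "fU n \<equiv> U.cls (gen (f_vec i) ^ n)"

lemma f_powers_eq: "f_powers i = range fU"
  unfolding f_powers_def by (auto simp: f_U_power)

lemma clsU: "U.cls p \<in> carrier Uaff"
  by (simp add: Uaff_simps)

lemma loc_gens_iff: "Inl u \<in> loc_gens Uaff (f_powers i) \<longleftrightarrow> u \<in> carrier Uaff"
  "Inr u \<in> loc_gens Uaff (f_powers i) \<longleftrightarrow> u \<in> f_powers i"
  by (auto simp: loc_gens_def)

lemma loc_rels_carrier: "loc_rels Uaff (f_powers i) \<subseteq> carrier (falg (loc_gens Uaff (f_powers i)))"
proof -
  interpret R: ring Uaff by (rule ring_Uaff)
  have "s \<in> carrier Uaff" if "s \<in> f_powers i" for s
    using that clsU by (auto simp: f_powers_eq)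
  then show ?thesis
    unfolding loc_rels_def
    by (intro Un_least subsetI; clarify; simp add: falg_closed loc_gens_iff zero_list_def)
qed

sublocale DQ: falg_quotient "loc_gens Uaff (f_powers i)" "loc_ideal Uaff (f_powers i)"
  unfolding loc_ideal_def
  by (rule falg_quotient.intro) (intro ring.genideal_ideal[OF ring_falg] loc_rels_carrier)

lemma DU_eq: "DU i = falg (loc_gens Uaff (f_powers i)) Quot loc_ideal Uaff (f_powers i)"
  by (simp add: localization_def)

lemma ring_DU: "ring (DU i)"
  using DQ.ring_Q by (simp add: DU_eq)

lemma DU_of_eq: "DU_of i u = DQ.cls (gen (Inl u))"
  by (simp add: loc_of_def DQ.cls_def)

lemma loc_ideal_rel: "r \<in> loc_rels Uaff (f_powers i) \<Longrightarrow> r \<in> loc_ideal Uaff (f_powers i)"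
  unfolding loc_ideal_def using ring.genideal_self[OF ring_falg loc_rels_carrier] by blast

lemma gen_closed: "u \<in> carrier Uaff \<Longrightarrow> keys (gen (Inl u) :: _ \<Rightarrow>\<^sub>0 int) \<subseteq> lists (loc_gens Uaff (f_powers i))"
  "s \<in> f_powers i \<Longrightarrow> keys (gen (Inr s) :: _ \<Rightarrow>\<^sub>0 int) \<subseteq> lists (loc_gens Uaff (f_powers i))"
  by (intro falg_closed; simp add: loc_gens_iff)+

lemma DU_of_closed: "u \<in> carrier Uaff \<Longrightarrow> DU_of i u \<in> carrier (DU i)"
  by (simp add: DU_of_eq DU_eq DQ.cls_closed gen_closed)

lemma DU_of_hom:
  assumes "u \<in> carrier Uaff" "v \<in> carrier Uaff"
  shows "DU_of i (u \<oplus>\<^bsub>Uaff\<^esub> v) = DU_of i u \<oplus>\<^bsub>DU i\<^esub> DU_of i v"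
    "DU_of i (u \<otimes>\<^bsub>Uaff\<^esub> v) = DU_of i u \<otimes>\<^bsub>DU i\<^esub> DU_of i v"
  unfolding DU_of_eq DU_eq DQ.cls_hom[OF gen_closed(1)[OF assms(1)] gen_closed(1)[OF assms(2)]] DQ.cls_eq_iff
  by (rule loc_ideal_rel, unfold loc_rels_def, use assms in blast)+

lemma DU_of_one: "DU_of i \<one>\<^bsub>Uaff\<^esub> = \<one>\<^bsub>DU i\<^esub>"
  unfolding DU_of_eq DU_eq DQ.cls_one DQ.cls_eq_iff
  by (rule loc_ideal_rel) (simp add: loc_rels_def)

text \<open>The generator adjoined as f_i^{-n}, which serves as denominator in
  \<open>E_fraction\<close>.\<close>

definition g :: "nat \<Rightarrow> (((affine list \<Rightarrow>\<^sub>0 complex) set + (affine list \<Rightarrow>\<^sub>0 complex) set) list \<Rightarrow>\<^sub>0 int) set" where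
  "g n = DQ.cls (gen (Inr (fU n)))"

lemma g_closed: "g n \<in> carrier (DU i)"
  unfolding g_def DU_eq by (intro DQ.cls_closed gen_closed(2)) (simp add: f_powers_eq)

lemma g_inverse: "g n \<otimes>\<^bsub>DU i\<^esub> DU_of i (fU n) = \<one>\<^bsub>DU i\<^esub>" "DU_of i (fU n) \<otimes>\<^bsub>DU i\<^esub> g n = \<one>\<^bsub>DU i\<^esub>"
proof -
  have fU: "fU n \<in> f_powers i" by (simp add: f_powers_eq)
  have c: "keys (gen (Inr (fU n)) :: _ \<Rightarrow>\<^sub>0 int) \<subseteq> lists (loc_gens Uaff (f_powers i))"
    "keys (gen (Inl (fU n)) :: _ \<Rightarrow>\<^sub>0 int) \<subseteq> lists (loc_gens Uaff (f_powers i))"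
    using fU by (intro gen_closed; simp add: clsU)+
  show "g n \<otimes>\<^bsub>DU i\<^esub> DU_of i (fU n) = \<one>\<^bsub>DU i\<^esub>" "DU_of i (fU n) \<otimes>\<^bsub>DU i\<^esub> g n = \<one>\<^bsub>DU i\<^esub>"
    unfolding g_def DU_of_eq DU_eq DQ.cls_hom[OF c] DQ.cls_hom[OF c(2,1)] DQ.cls_one DQ.cls_eq_iff
    by (rule loc_ideal_rel, unfold loc_rels_def, use fU in blast)+
qed

lemma g_add: "g (n + k) \<otimes>\<^bsub>DU i\<^esub> DU_of i (fU k) = g n"
proof -
  interpret R: ring "DU i" by (rule ring_DU)
  note c = g_closed DU_of_closed[OF clsU]
  have "g (n + k) \<otimes>\<^bsub>DU i\<^esub> DU_of i (fU k) = g (n + k) \<otimes>\<^bsub>DU i\<^esub> DU_of i (fU k) \<otimes>\<^bsub>DU i\<^esub> (DU_of i (fU n) \<otimes>\<^bsub>DU i\<^esub> g n)"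
    by (simp add: g_inverse c)
  also have "\<dots> = g (n + k) \<otimes>\<^bsub>DU i\<^esub> (DU_of i (fU k) \<otimes>\<^bsub>DU i\<^esub> DU_of i (fU n)) \<otimes>\<^bsub>DU i\<^esub> g n"
    by (simp add: R.m_assoc c)
  also have "DU_of i (fU k) \<otimes>\<^bsub>DU i\<^esub> DU_of i (fU n) = DU_of i (fU (n + k))"
    by (simp add: clsU Uaff_simps add.commute flip: DU_of_hom power_add)
  finally show ?thesis by (simp add: g_inverse c)
qed

lemma g_mult: "g k \<otimes>\<^bsub>DU i\<^esub> g n = g (k + n)"
proof -
  interpret R: ring "DU i" by (rule ring_DU)
  note c = g_closed DU_of_closed[OF clsU]
  have "g k \<otimes>\<^bsub>DU i\<^esub> g n = g (k + n) \<otimes>\<^bsub>DU i\<^esub> DU_of i (fU n) \<otimes>\<^bsub>DU i\<^esub> g n"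
    by (simp add: g_add)
  then show ?thesis by (simp add: R.m_assoc c g_inverse)
qed

subsection \<open>The localized algebra acts on polynomials\<close>

text \<open>The evaluation of the localized algebra must assign an operator to each formal inverse.
  Inverses are unique, so for f_i^n the choice is multiplication by x_i^{-n}.\<close>

definition einv :: "alg endo \<Rightarrow> alg endo" where
  "einv S = (SOME S'. S' * S = 1 \<and> S * S' = 1)"

lemma einv_eq: "S' * S = 1 \<Longrightarrow> S * S' = 1 \<Longrightarrow> einv S = S'"
proof -
  assume *: "S' * S = 1" "S * S' = 1"
  then have "einv S * S = 1 \<and> S * einv S = 1"
    unfolding einv_def by (intro someI[of "\<lambda>S'. S' * S = 1 \<and> S * S' = 1" S']) simp
  then have "einv S * (S * S') = S'" by (simp flip: mult.assoc)
  then show ?thesis using * by simp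
qed

lemma uact_fU: "uact (fU n) = mul (X i) (of_nat n)"
proof -
  have "ev (gen (f_vec i) ^ n) = f i ^ n" by (induction n) simp_all
  then show ?thesis by (simp add: mul_power)
qed

lemma einv_mul: "einv (mul (X i) (of_nat n)) = mul (X i) (- of_nat n)"
  by (rule einv_eq) (simp_all add: mul_inverse)

lemma einv_fU: "einv (uact (fU n)) = mul (X i) (- of_nat n)"
  unfolding uact_fU by (rule einv_mul)

definition dev :: "_ \<Rightarrow> alg endo" where
  "dev = eval_words (of_int :: int \<Rightarrow> alg endo) (case_sum uact (einv \<circ> uact))"

sublocale de: word_evaluation "of_int :: int \<Rightarrow> alg endo" "case_sum uact (einv \<circ> uact)"
  by unfold_locales (simp_all, rule mult_of_int_commute)

lemma dev_simps [simp]: "dev 0 = 0" "dev (p + q) = dev p + dev q" "dev (p - q) = dev p - dev q"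
  "dev (p * q) = dev p * dev q" "dev 1 = 1" "dev (gen (Inl u)) = uact u" "dev (gen (Inr u)) = einv (uact u)"
  by (simp_all add: dev_def de.eval_zero de.eval_add de.eval_diff de.eval_mult de.eval_one de.eval_gen)

lemma dev_ideal: "p \<in> loc_ideal Uaff (f_powers i) \<Longrightarrow> dev p = 0"
proof -
  have "ring_ideal {p. dev p = 0}" by (simp add: ring_ideal_def)
  moreover have "loc_rels Uaff (f_powers i) \<subseteq> {p. dev p = 0}"
    unfolding loc_rels_def f_powers_eq
    by (auto simp: Uaff_simps einv_mul uact_fU mul_inverse simp del: uact_cls) (simp_all add: Uaff_simps)
  ultimately have "loc_ideal Uaff (f_powers i) \<subseteq> {p. dev p = 0}"
    unfolding loc_ideal_def by (intro falg_genideal_le loc_rels_carrier)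
  then show "p \<in> loc_ideal Uaff (f_powers i) \<Longrightarrow> dev p = 0" by blast
qed

definition duact :: "_ set \<Rightarrow> alg endo" where
  "duact u = dev (SOME p. p \<in> u)"

lemma duact_cls: "duact (DQ.cls p) = dev p"
proof -
  have "(SOME q. q \<in> DQ.cls p) \<in> DQ.cls p" using DQ.self_in_cls by (rule someI)
  from dev_ideal[OF DQ.in_cls[OF this]] show ?thesis by (simp add: duact_def)
qed

lemma duact_hom:
  assumes "u \<in> carrier (DU i)" "v \<in> carrier (DU i)"
  shows "duact (u \<oplus>\<^bsub>DU i\<^esub> v) = duact u + duact v" "duact (u \<otimes>\<^bsub>DU i\<^esub> v) = duact u * duact v"
proof -
  obtain p q where pq: "u = DQ.cls p" "keys p \<subseteq> lists (loc_gens Uaff (f_powers i))"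
    "v = DQ.cls q" "keys q \<subseteq> lists (loc_gens Uaff (f_powers i))"
    using assms by (auto simp: DU_eq DQ.carrier_Q)
  show "duact (u \<oplus>\<^bsub>DU i\<^esub> v) = duact u + duact v" "duact (u \<otimes>\<^bsub>DU i\<^esub> v) = duact u * duact v"
    unfolding pq(1,3) DU_eq DQ.cls_hom[OF pq(2,4)] duact_cls by simp_all
qed

lemma duact_zero: "duact \<zero>\<^bsub>DU i\<^esub> = 0" and duact_one: "duact \<one>\<^bsub>DU i\<^esub> = 1"
  unfolding DU_eq DQ.cls_zero DQ.cls_one duact_cls by simp_all

lemma duact_DU_of: "duact (DU_of i u) = uact u"
  by (simp add: DU_of_eq duact_cls)

lemma duact_g: "duact (g n) = mul (X i) (- of_nat n)"
  by (simp add: g_def duact_cls einv_fU del: uact_cls)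

lemma duact_finsum:
  assumes "finite B" "G \<in> B \<rightarrow> carrier (DU i)"
  shows "duact (finsum (DU i) G B) = (\<Sum>b\<in>B. duact (G b))"
proof -
  interpret R: ring "DU i" by (rule ring_DU)
  show ?thesis
    using assms by (induction B) (simp_all add: duact_zero R.finsum_insert duact_hom Pi_iff)
qed

text \<open>The sum over the indices with nonzero (ad f_i)^j(u) is extended to all j below a
  nilpotency bound. The added terms act by 0, and \<open>conj_theta\<close> evaluates the
  result.\<close>

lemma duact_Theta: "duact (Theta i w (DU_of i (U.cls p))) = conj_by i (- w) (ev p)"
proof -
  interpret R: ring "DU i" by (rule ring_DU)
  let ?F = "gen (f_vec i) :: affine list \<Rightarrow>\<^sub>0 complex"
  have fU: "f_U i = fU 1" by (simp add: env_of_eq)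
  have sub: "DU_of i (U.cls p) \<ominus>\<^bsub>DU i\<^esub> DU_of i (U.cls q) = DU_of i (U.cls (p - q))" for p q
  proof -
    have "DU_of i (U.cls (p - q)) \<oplus>\<^bsub>DU i\<^esub> DU_of i (U.cls q) = DU_of i (U.cls p)"
      by (simp add: clsU Uaff_simps flip: DU_of_hom)
    then have "DU_of i (U.cls p) \<ominus>\<^bsub>DU i\<^esub> DU_of i (U.cls q)
      = DU_of i (U.cls (p - q)) \<oplus>\<^bsub>DU i\<^esub> DU_of i (U.cls q) \<ominus>\<^bsub>DU i\<^esub> DU_of i (U.cls q)" by simp
    then show ?thesis
      by (simp add: DU_of_closed clsU R.a_assoc R.minus_eq R.r_neg)
  qed
  have ad: "(ad_f i ^^ j) (DU_of i (U.cls p)) = DU_of i (U.cls ((comm_with ?F ^^ j) p))" for j p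
  proof (induction j arbitrary: p)
    case (Suc j)
    have "ad_f i (DU_of i (U.cls p)) = DU_of i (U.cls (comm_with ?F p))" for p
      unfolding ad_f_def comm_with_def fU
      by (simp add: clsU Uaff_simps sub flip: DU_of_hom)
    then show ?case using Suc by (simp add: funpow_Suc_right del: funpow.simps)
  qed simp
  obtain n where n: "(comm_with ?F ^^ n) p \<in> env_ideal UNIV"
    using ad_f_nilpotent by blast
  let ?B = "{j. (ad_f i ^^ j) (DU_of i (U.cls p)) \<noteq> \<zero>\<^bsub>DU i\<^esub>}"
  have DU0: "DU_of i (U.cls 0) = \<zero>\<^bsub>DU i\<^esub>"
    using sub[of 0 0] by (simp add: DU_of_closed clsU R.minus_eq R.r_neg)
  have B: "?B \<subseteq> {..<n}"
  proof (rule ccontr)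
    assume "\<not> ?B \<subseteq> {..<n}"
    then obtain j where j: "(ad_f i ^^ j) (DU_of i (U.cls p)) \<noteq> \<zero>\<^bsub>DU i\<^esub>" "n \<le> j" by force
    have "(comm_with ?F ^^ j) p \<in> env_ideal UNIV"
      by (rule comm_with_nilpotent_mono[OF ring_ideal_env n j(2)])
    then have "U.cls ((comm_with ?F ^^ j) p) = U.cls 0" by (simp add: U.cls_eq_iff)
    then show False using j(1) by (simp add: ad DU0)
  qed
  let ?G = "\<lambda>j. DU_of i (env_scalar UNIV (w gchoose j)) \<otimes>\<^bsub>DU i\<^esub> ((ad_f i ^^ j) (DU_of i (U.cls p)))
       \<otimes>\<^bsub>DU i\<^esub> (loc_inv Uaff (f_powers i) (f_U i) [^]\<^bsub>DU i\<^esub> j)"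
  have inv: "loc_inv Uaff (f_powers i) (f_U i) = g 1"
    by (simp add: loc_inv_def g_def DQ.cls_def env_of_eq)
  have inv_pow: "g 1 [^]\<^bsub>DU i\<^esub> j = g j" for j :: nat
  proof (induction j)
    case 0
    have "g 0 = \<one>\<^bsub>DU i\<^esub>"
      using g_inverse(1)[of 0] DU_of_one g_closed[of 0] by (simp add: Uaff_simps)
    then show ?case by simp
  next
    case (Suc j)
    then show ?case using g_mult[of j 1] by simp
  qed
  have G: "duact (?G j) = sc (w gchoose j) * (comm_with (f i) ^^ j) (ev p) * mul (X i) (- of_nat j)"
    and Gc: "?G j \<in> carrier (DU i)" for j
    unfolding ad inv inv_pow env_scalar_eq
    by (simp_all add: duact_hom DU_of_closed clsU g_closed duact_DU_of duact_g comm_with_ev)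
  have "duact (Theta i w (DU_of i (U.cls p))) = (\<Sum>j\<in>?B. duact (?G j))"
    unfolding Theta_def using B Gc by (intro duact_finsum) (auto intro: finite_subset)
  also have "\<dots> = (\<Sum>j<n. duact (?G j))"
  proof (rule sum.mono_neutral_left)
    show "\<forall>j\<in>{..<n} - ?B. duact (?G j) = 0"
    proof
      fix j assume "j \<in> {..<n} - ?B"
      then have "(ad_f i ^^ j) (DU_of i (U.cls p)) = \<zero>\<^bsub>DU i\<^esub>" by simp
      then have "uact (U.cls ((comm_with ?F ^^ j) p)) = 0"
        using duact_DU_of[of "U.cls ((comm_with ?F ^^ j) p)"] by (simp add: ad duact_zero)
      then show "duact (?G j) = 0" unfolding G by (simp add: comm_with_ev)
    qed
  qed (use B in auto)
  also have "\<dots> = (\<Sum>j<n. sc (w gchoose j) * (comm_with (f i) ^^ j) (ev p) * mul (X i) (- of_nat j))"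
    by (simp only: G)
  also have "\<dots> = conj_by i (- w) (ev p)"
    using n by (intro conj_theta polyop_conj_ev) (simp add: comm_with_ev ev_ideal)
  finally show ?thesis .
qed

lemma Theta_closed: "Theta i w (DU_of i (U.cls p)) \<in> carrier (DU i)"
proof -
  interpret R: ring "DU i" by (rule ring_DU)
  have ad: "(ad_f i ^^ j) (DU_of i (U.cls p)) \<in> carrier (DU i)" for j
    by (induction j) (auto simp: ad_f_def env_of_eq DU_of_closed clsU)
  have "loc_inv Uaff (f_powers i) (f_U i) = g 1"
    by (simp add: loc_inv_def g_def DQ.cls_def env_of_eq)
  then show ?thesis
    unfolding Theta_def by (intro R.finsum_closed) (auto simp: ad g_closed env_scalar_eq DU_of_closed clsU)
qed

subsection \<open>The localized module\<close>

sublocale E: scalar_extension "DU_of i" Uaff "DU i" "verma lam"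
  by (intro scalar_extension.intro ring_DU DU_of_closed verma_closed)

lemma loc_DU_eq: "loc_DU_module i (verma lam) = E.E"
  by (simp add: loc_DU_module_def)

text \<open>Common denominators make the set of fractions additive, and the Ore condition moves a
  denominator to the left of an element of U. As the localized algebra is generated by U and the
  inverses, every element is such a fraction.\<close>

lemma E_fraction:
  assumes "U \<in> carrier E.E"
  shows "\<exists>n m. m \<in> carrier (verma lam) \<and> U = E.tens (g n) m"
proof -
  interpret R: ring "DU i" by (rule ring_DU)
  define W where "W = {E.tens (g n) m | n m. m \<in> carrier (verma lam)}"
  have up: "E.tens (g n) m = E.tens (g (n + k)) (fU k \<odot>\<^bsub>verma lam\<^esub> m)" if "m \<in> carrier (verma lam)" for n k m
    using E.tens_balanced[OF g_closed clsU that, of "n + k" "gen (f_vec i) ^ k"] by (simp add: g_add)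
  have W_add: "U \<oplus>\<^bsub>E.E\<^esub> V \<in> W" if "U \<in> W" "V \<in> W" for U V
  proof -
    obtain n m k m' where *: "U = E.tens (g n) m" "m \<in> carrier (verma lam)" "V = E.tens (g k) m'" "m' \<in> carrier (verma lam)"
      using \<open>U \<in> W\<close> \<open>V \<in> W\<close> by (auto simp: W_def)
    have "U \<oplus>\<^bsub>E.E\<^esub> V = E.tens (g (n + k)) (fU k \<odot>\<^bsub>verma lam\<^esub> m \<oplus>\<^bsub>verma lam\<^esub> fU n \<odot>\<^bsub>verma lam\<^esub> m')"
      using up[OF *(2), of n k] up[OF *(4), of k n] *
      by (simp add: E.tens_add_right g_closed verma_closed clsU add.commute)
    then show ?thesis using * by (auto simp: W_def intro!: exI verma_closed clsU)
  qed
  have W_DU: "E.tens (DU_of i u) m \<in> W" if "u \<in> carrier Uaff" "m \<in> carrier (verma lam)" for u m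
  proof -
    have "E.tens (\<one>\<^bsub>DU i\<^esub> \<otimes>\<^bsub>DU i\<^esub> DU_of i u) m = E.tens \<one>\<^bsub>DU i\<^esub> (u \<odot>\<^bsub>verma lam\<^esub> m)"
      using that by (intro E.tens_balanced) simp_all
    moreover have "g 0 = \<one>\<^bsub>DU i\<^esub>"
      using g_inverse(1)[of 0] DU_of_one g_closed[of 0] by (simp add: Uaff_simps)
    ultimately have "E.tens (DU_of i u) m = E.tens (g 0) (u \<odot>\<^bsub>verma lam\<^esub> m)"
      using that by (simp add: DU_of_closed)
    then show ?thesis
      using verma_closed(2)[OF that] unfolding W_def by blast
  qed
  \<comment> \<open>The localized algebra is a quotient of an integral free algebra, so the scalars
    of its words are integers; these come from U.\<close>
  have int: "DQ.cls (single [] k) = DU_of i (U.cls (of_int k))" for k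
  proof (induction k rule: int_induct[of _ 0])
    case base
    interpret RU: ring Uaff by (rule ring_Uaff)
    have "DU_of i (U.cls 0) \<oplus>\<^bsub>DU i\<^esub> DU_of i (U.cls 0) = DU_of i (U.cls 0)"
      by (simp add: clsU Uaff_simps flip: DU_of_hom)
    then have "DU_of i (U.cls 0) = \<zero>\<^bsub>DU i\<^esub>"
      using R.add.l_cancel_one'[of "DU_of i (U.cls 0)" "DU_of i (U.cls 0)"] DU_of_closed[OF clsU] by simp
    then show ?case by (simp add: DU_eq DQ.cls_zero)
  next
    case (step1 k)
    have "DQ.cls (single [] (k + 1)) = DQ.cls (single [] k) \<oplus>\<^bsub>DU i\<^esub> DQ.cls (single [] 1)"
      by (simp add: DU_eq DQ.cls_hom falg_closed single_add del: falg_simps keys_single)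
    also have "DQ.cls (single [] 1) = DU_of i (U.cls 1)"
      using DU_of_one by (simp add: Uaff_simps DU_eq DQ.cls_one zero_list_def flip: single_one)
    finally show ?case by (simp add: step1 clsU Uaff_simps flip: DU_of_hom)
  next
    case (step2 k)
    have one: "DQ.cls (single [] 1) = DU_of i (U.cls 1)"
      using DU_of_one by (simp add: Uaff_simps DU_eq DQ.cls_one zero_list_def flip: single_one)
    have "DQ.cls (single [] (k - 1)) \<oplus>\<^bsub>DU i\<^esub> DU_of i (U.cls 1) = DQ.cls (single [] k)"
      unfolding one[symmetric]
      by (simp add: DU_eq DQ.cls_hom falg_closed del: falg_simps keys_single flip: single_add)
    also have "\<dots> = DU_of i (U.cls (of_int (k - 1))) \<oplus>\<^bsub>DU i\<^esub> DU_of i (U.cls 1)"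
      by (simp add: step2 clsU Uaff_simps flip: DU_of_hom)
    finally show ?case
      using R.add.right_cancel[of "DU_of i (U.cls 1)" "DQ.cls (single [] (k - 1))" "DU_of i (U.cls (of_int (k - 1)))"]
        DQ.cls_closed[OF falg_closed(5), of "k - 1"] DU_of_closed[OF clsU]
      by (simp add: DU_eq)
  qed
  have W_tens: "E.tens (DQ.cls p) m \<in> W"
    if "keys p \<subseteq> lists (loc_gens Uaff (f_powers i))" "m \<in> carrier (verma lam)" for p m
  proof -
    have "keys p \<subseteq> lists (loc_gens Uaff (f_powers i)) \<and> E.tens (DQ.cls p) m \<in> W"
      using that(1)
    proof (induction p rule: word_induct)
      case 1
      have "E.tens (DU_of i (U.cls (of_int 0))) m \<in> W" by (rule W_DU[OF clsU that(2)])
      then show ?case using int[of 0] by simp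
    next
      case (2 k)
      then show ?case using W_DU[OF clsU that(2)] by (simp add: int falg_closed del: keys_single)
    next
      case (3 p q)
      then have "E.tens (DQ.cls (p + q)) m = E.tens (DQ.cls p) m \<oplus>\<^bsub>E.E\<^esub> E.tens (DQ.cls q) m"
        using E.tens_add_left[of "DQ.cls p" "DQ.cls q" m] that(2)
        by (simp add: DU_eq DQ.cls_closed DQ.cls_hom)
      then show ?case using 3 W_add by (simp add: falg_closed)
    next
      case (4 x p)
      then have c: "DQ.cls (gen x) \<in> carrier (DU i)" "DQ.cls p \<in> carrier (DU i)" "keys (gen x :: _ \<Rightarrow>\<^sub>0 int) \<subseteq> lists (loc_gens Uaff (f_powers i))"
        by (simp_all add: DU_eq DQ.cls_closed falg_closed)
      obtain n m' where m': "m' \<in> carrier (verma lam)" "E.tens (DQ.cls p) m = E.tens (g n) m'"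
        using 4 by (auto simp: W_def)
      have "E.tens (DQ.cls (gen x * p)) m = DQ.cls (gen x) \<odot>\<^bsub>E.E\<^esub> E.tens (DQ.cls p) m"
        using c 4 that(2) by (simp add: E.smult_tens) (simp add: DU_eq DQ.cls_hom)
      also have "\<dots> = E.tens (DQ.cls (gen x) \<otimes>\<^bsub>DU i\<^esub> g n) m'"
        using c m' by (simp add: E.smult_tens g_closed)
      also have "\<dots> \<in> W"
      proof (cases x)
        case (Inl u)
        then have u: "u \<in> carrier Uaff" using 4(1) by (simp add: loc_gens_iff)
        then obtain q where q: "u = U.cls q" by (auto simp: Uaff_simps)
        obtain N r where "gen (f_vec i) ^ N * q - r * gen (f_vec i) ^ n \<in> env_ideal UNIV"
          using ore_condition by blast
        then have "fU N \<otimes>\<^bsub>Uaff\<^esub> u = U.cls r \<otimes>\<^bsub>Uaff\<^esub> fU n"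
          by (simp add: q Uaff_simps U.cls_eq_iff)
        then have eq: "DU_of i (fU N) \<otimes>\<^bsub>DU i\<^esub> DU_of i u = DU_of i (U.cls r) \<otimes>\<^bsub>DU i\<^esub> DU_of i (fU n)"
          by (simp add: clsU u flip: DU_of_hom)
        note cl = g_closed DU_of_closed[OF clsU] DU_of_closed[OF u]
        have "DU_of i u \<otimes>\<^bsub>DU i\<^esub> g n = (g N \<otimes>\<^bsub>DU i\<^esub> DU_of i (fU N)) \<otimes>\<^bsub>DU i\<^esub> DU_of i u \<otimes>\<^bsub>DU i\<^esub> g n"
          by (simp add: g_inverse cl)
        also have "\<dots> = g N \<otimes>\<^bsub>DU i\<^esub> (DU_of i (fU N) \<otimes>\<^bsub>DU i\<^esub> DU_of i u) \<otimes>\<^bsub>DU i\<^esub> g n"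
          by (simp add: R.m_assoc cl)
        also have "\<dots> = g N \<otimes>\<^bsub>DU i\<^esub> DU_of i (U.cls r) \<otimes>\<^bsub>DU i\<^esub> (DU_of i (fU n) \<otimes>\<^bsub>DU i\<^esub> g n)"
          unfolding eq by (simp add: R.m_assoc cl)
        also have "\<dots> = g N \<otimes>\<^bsub>DU i\<^esub> DU_of i (U.cls r)"
          by (simp add: g_inverse cl)
        finally have "E.tens (DQ.cls (gen x) \<otimes>\<^bsub>DU i\<^esub> g n) m' = E.tens (g N) (U.cls r \<odot>\<^bsub>verma lam\<^esub> m')"
          using E.tens_balanced[OF g_closed clsU m'(1)] by (simp add: Inl flip: DU_of_eq)
        then show ?thesis using m' by (auto simp: W_def intro!: exI verma_closed clsU)
      next
        case (Inr s)
        then have "s \<in> f_powers i" using 4(1) by (simp add: loc_gens_iff)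
        then obtain k where "s = fU k" using f_powers_eq by blast
        then have "E.tens (DQ.cls (gen x) \<otimes>\<^bsub>DU i\<^esub> g n) m' = E.tens (g (k + n)) m'"
          using g_mult[of k n] by (simp add: Inr g_def)
        then show ?thesis using m' by (auto simp: W_def)
      qed
      finally show ?case using 4 c by (simp add: falg_closed)
    qed
    then show ?thesis by simp
  qed
  have "U \<in> W"
  proof (rule E.E_induct[OF assms, where P = "\<lambda>U. U \<in> W"])
    fix s m assume "s \<in> carrier (DU i)" "m \<in> carrier (verma lam)"
    then show "E.tens s m \<in> W" using W_tens by (auto simp: DU_eq DQ.carrier_Q)
  next
    obtain \<Phi> where "bij_betw \<Phi> (carrier (verma lam)) (span_on EV)" using verma_model .
    then obtain m where m: "m \<in> carrier (verma lam)" by (metis bij_betw_imp_surj_on image_iff span_on_zero)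
    have "\<zero>\<^bsub>E.E\<^esub> = E.tens (DQ.cls 0) m"
      using E.tens_zero_left[OF m] by (simp add: DU_eq DQ.cls_zero)
    also have "\<dots> \<in> W" by (rule W_tens[OF _ m]) simp
    finally show "\<zero>\<^bsub>E.E\<^esub> \<in> W" .
  qed (rule W_add)
  then show ?thesis by (auto simp: W_def)
qed

text \<open>Two fractions can be given the same denominator, so injectivity reduces to that of the
  model of M(\<lambda>) and to invertibility of x_i. The last clause locates the embedded
  M(\<lambda>), as needed for the quotient.\<close>

lemma loc_model:
  obtains \<L> where "bij_betw \<L> (carrier E.E) (span_on (ET i 0))"
    "\<And>U V. U \<in> carrier E.E \<Longrightarrow> V \<in> carrier E.E \<Longrightarrow> \<L> (U \<oplus>\<^bsub>E.E\<^esub> V) = \<L> U + \<L> V"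
    "\<And>s U. s \<in> carrier (DU i) \<Longrightarrow> U \<in> carrier E.E \<Longrightarrow> \<L> (s \<odot>\<^bsub>E.E\<^esub> U) = app (duact s) (\<L> U)"
    "\<L> ` loc_image i (verma lam) = span_on EV"
proof -
  interpret A: comm_group "add_monoid E.E" by (rule E.add_comm_group_E)
  interpret R: ring "DU i" by (rule ring_DU)
  obtain \<Phi> where \<Phi>: "bij_betw \<Phi> (carrier (verma lam)) (span_on EV)"
    "\<And>U V. U \<in> carrier (verma lam) \<Longrightarrow> V \<in> carrier (verma lam) \<Longrightarrow> \<Phi> (U \<oplus>\<^bsub>verma lam\<^esub> V) = \<Phi> U + \<Phi> V"
    "\<And>u V. u \<in> carrier Uaff \<Longrightarrow> V \<in> carrier (verma lam) \<Longrightarrow> \<Phi> (u \<odot>\<^bsub>verma lam\<^esub> V) = app (uact u) (\<Phi> V)"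
    using verma_model by blast
  have lift: "\<And>s t m. s \<in> carrier (DU i) \<Longrightarrow> t \<in> carrier (DU i) \<Longrightarrow> m \<in> carrier (verma lam) \<Longrightarrow>
      app (duact (s \<oplus>\<^bsub>DU i\<^esub> t)) (\<Phi> m) = app (duact s) (\<Phi> m) + app (duact t) (\<Phi> m)"
    "\<And>s m n. s \<in> carrier (DU i) \<Longrightarrow> m \<in> carrier (verma lam) \<Longrightarrow> n \<in> carrier (verma lam) \<Longrightarrow>
      app (duact s) (\<Phi> (m \<oplus>\<^bsub>verma lam\<^esub> n)) = app (duact s) (\<Phi> m) + app (duact s) (\<Phi> n)"
    "\<And>s r m. s \<in> carrier (DU i) \<Longrightarrow> r \<in> carrier Uaff \<Longrightarrow> m \<in> carrier (verma lam) \<Longrightarrow>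
      app (duact (s \<otimes>\<^bsub>DU i\<^esub> DU_of i r)) (\<Phi> m) = app (duact s) (\<Phi> (r \<odot>\<^bsub>verma lam\<^esub> m))"
    by (simp_all add: duact_hom \<Phi> app_add_right DU_of_closed duact_DU_of)
  obtain \<L> where \<L>: "\<And>s m. s \<in> carrier (DU i) \<Longrightarrow> m \<in> carrier (verma lam) \<Longrightarrow> \<L> (E.tens s m) = app (duact s) (\<Phi> m)"
    "\<And>U V. U \<in> carrier E.E \<Longrightarrow> V \<in> carrier E.E \<Longrightarrow> \<L> (U \<oplus>\<^bsub>E.E\<^esub> V) = \<L> U + \<L> V"
    using E.E_lift[of "\<lambda>s m. app (duact s) (\<Phi> m)", OF lift] by blast
  have \<L>0: "\<L> \<zero>\<^bsub>E.E\<^esub> = 0"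
    using \<L>(2)[OF E.zero_closed_E E.zero_closed_E] A.r_one[of "\<zero>\<^bsub>E.E\<^esub>"] E.zero_closed_E by simp
  have smult: "\<L> (s \<odot>\<^bsub>E.E\<^esub> U) = app (duact s) (\<L> U)" if s: "s \<in> carrier (DU i)" and U: "U \<in> carrier E.E" for s U
  proof (rule E.E_induct[OF U, where P = "\<lambda>U. \<L> (s \<odot>\<^bsub>E.E\<^esub> U) = app (duact s) (\<L> U)"])
    fix U V assume "U \<in> carrier E.E" "V \<in> carrier E.E"
      "\<L> (s \<odot>\<^bsub>E.E\<^esub> U) = app (duact s) (\<L> U)" "\<L> (s \<odot>\<^bsub>E.E\<^esub> V) = app (duact s) (\<L> V)"
    then show "\<L> (s \<odot>\<^bsub>E.E\<^esub> (U \<oplus>\<^bsub>E.E\<^esub> V)) = app (duact s) (\<L> (U \<oplus>\<^bsub>E.E\<^esub> V))"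
      by (simp add: E.smult_add s \<L>(2) E.smult_closed_E app_add_right)
  qed (simp_all add: E.smult_tens s \<L>(1) duact_hom E.smult_zero \<L>0)
  have ETn: "app (mul (X i) (- of_nat n)) p \<in> span_on (ET i 0)" if "p \<in> span_on EV" for n p
  proof -
    have "p \<in> span_on (ET i 0)" using that EV_ET by (rule span_on_mono)
    from mul_ET[OF this, of "- of_nat n"] ET_cong[of "- of_nat n + 0" 0 i] show ?thesis by simp
  qed
  have up: "E.tens (g n) m = E.tens (g (n + k)) (fU k \<odot>\<^bsub>verma lam\<^esub> m)" if "m \<in> carrier (verma lam)" for n k m
    using E.tens_balanced[OF g_closed clsU that, of "n + k" "gen (f_vec i) ^ k"] by (simp add: g_add)
  have bij: "bij_betw \<L> (carrier E.E) (span_on (ET i 0))"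
  proof (rule bij_betwI')
    fix U V assume "U \<in> carrier E.E" "V \<in> carrier E.E"
    then obtain n m k m' where *: "U = E.tens (g n) m" "m \<in> carrier (verma lam)"
      "V = E.tens (g k) m'" "m' \<in> carrier (verma lam)"
      using E_fraction by meson
    let ?m = "fU k \<odot>\<^bsub>verma lam\<^esub> m" and ?m' = "fU n \<odot>\<^bsub>verma lam\<^esub> m'"
    have U: "U = E.tens (g (n + k)) ?m" and V: "V = E.tens (g (n + k)) ?m'"
      using up[OF *(2), of n k] up[OF *(4), of k n] * by (simp_all add: add.commute)
    have c: "?m \<in> carrier (verma lam)" "?m' \<in> carrier (verma lam)"
      using * clsU verma_closed by auto
    show "(\<L> U = \<L> V) = (U = V)"
    proof
      assume "\<L> U = \<L> V"
      then have "app (mul (X i) (- of_nat (n + k))) (\<Phi> ?m) = app (mul (X i) (- of_nat (n + k))) (\<Phi> ?m')"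
        unfolding U V by (simp add: \<L>(1) g_closed c duact_g del: of_nat_add)
      then have "\<Phi> ?m = \<Phi> ?m'" by (metis mul_cancel(1))
      then have "?m = ?m'" using \<Phi>(1) c by (meson bij_betw_imp_inj_on inj_onD)
      then show "U = V" using U V by simp
    qed simp
  next
    fix U assume "U \<in> carrier E.E"
    then obtain n m where *: "U = E.tens (g n) m" "m \<in> carrier (verma lam)"
      using E_fraction by meson
    then show "\<L> U \<in> span_on (ET i 0)"
      using ETn bij_betwE[OF \<Phi>(1)] by (simp add: \<L>(1) g_closed duact_g)
  next
    fix q assume "q \<in> span_on (ET i 0)"
    then obtain n :: nat where "app (mul (X i) (of_nat n - 0)) q \<in> span_on EV"
      using ET_shift_nat by blast
    then have "app (mul (X i) (of_nat n)) q \<in> \<Phi> ` carrier (verma lam)"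
      using bij_betw_imp_surj_on[OF \<Phi>(1)] by simp
    then obtain m where m: "m \<in> carrier (verma lam)" "\<Phi> m = app (mul (X i) (of_nat n)) q"
      by (metis imageE)
    then have "\<L> (E.tens (g n) m) = q" by (simp add: \<L>(1) g_closed duact_g)
    then show "\<exists>U\<in>carrier E.E. q = \<L> U" using E.tens_closed[OF g_closed m(1)] by metis
  qed
  have "\<L> ` loc_image i (verma lam) = \<Phi> ` carrier (verma lam)"
    unfolding loc_image_def image_image
    by (rule image_cong[OF refl]) (simp add: \<L>(1) duact_one flip: E.tens_def)
  then have "\<L> ` loc_image i (verma lam) = span_on EV"
    using bij_betw_imp_surj_on[OF \<Phi>(1)] by simp
  with bij \<L>(2) smult that show thesis by blast
qed

end


section \<open>Modules modelled on spans of monomials\<close>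

definition restr :: "expo set \<Rightarrow> alg \<Rightarrow> alg" where
  "restr S = Poly_Mapping.mapp (\<lambda>\<mu> c. if \<mu> \<in> S then c else 0)"

lemma lookup_restr [simp]: "lookup (restr S p) \<mu> = (if \<mu> \<in> S then lookup p \<mu> else 0)"
  by (auto simp: restr_def lookup_mapp in_keys_iff when_def)

lemma span_on_iff: "p \<in> span_on S \<longleftrightarrow> (\<forall>\<mu>. lookup p \<mu> \<noteq> 0 \<longrightarrow> \<mu> \<in> S)"
  by (auto simp: span_on_def in_keys_iff)

lemma restr_add: "restr S (p + q) = restr S p + restr S q"
  by (rule poly_mapping_eqI) (simp add: lookup_add)

lemma restr_diff: "restr S (p - q) = restr S p - restr S q"
  by (rule poly_mapping_eqI) (simp add: lookup_minus)

lemma restr_zero [simp]: "restr S 0 = 0"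
  by (rule poly_mapping_eqI) simp

lemma restr_span_on: "restr S p \<in> span_on S"
  by (auto simp: span_on_iff)

lemma restr_id: "p \<in> span_on S \<Longrightarrow> restr S p = p"
  by (rule poly_mapping_eqI) (auto simp: span_on_iff)

lemma restr_eq_0_iff: "p \<in> span_on S' \<Longrightarrow> restr S p = 0 \<longleftrightarrow> p \<in> span_on (S' - S)"
  by (auto simp: span_on_iff poly_mapping_eq_iff fun_eq_iff)

context verma_rep
begin

text \<open>The weight of a monomial: each f lowers the eigenvalue of h_0 by 2, and
  \<open>gd\<close> adds the degree for d; complex exponents count in the same way. The value 0
  outside the Cartan subalgebra follows the convention of \<open>cartan_dual\<close>.\<close>

definition wtf :: "expo \<Rightarrow> affine \<Rightarrow> complex" where
  "wtf \<nu> x = (if x \<in> cartan then cch 0 x * (J - 2 * wt gX \<nu>) + central x * K + deriv x * (L + wt gd \<nu>) else 0)"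

lemma lookup_rho_cartan:
  assumes "x \<in> cartan"
  shows "lookup (app (rho x) p) \<nu> = wtf \<nu> x * lookup p \<nu>"
proof -
  obtain x: "x = cch 0 x *\<^sub>C h_vec 0 + central x *\<^sub>C c_vec + deriv x *\<^sub>C d_vec"
    using cartanE[OF assms] .
  have rho: "rho x = sc (cch 0 x) * h 0 + sc (central x) * sc K + sc (deriv x) * d"
    by (subst x) (simp add: rho_add rho_scale)
  show ?thesis
    unfolding rho using assms by (simp add: wtf_def h_0 d_def lookup_add lookup_minus algebra_simps)
qed

lemma wtf_dual: "wtf \<nu> \<in> cartan_dual"
proof -
  have "x + y \<in> cartan \<and> k *\<^sub>C x \<in> cartan" if xy: "x \<in> cartan" "y \<in> cartan" for x y k
  proof -
    obtain x: "x = cch 0 x *\<^sub>C h_vec 0 + central x *\<^sub>C c_vec + deriv x *\<^sub>C d_vec"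
      using cartanE[OF xy(1)] .
    obtain y: "y = cch 0 y *\<^sub>C h_vec 0 + central y *\<^sub>C c_vec + deriv y *\<^sub>C d_vec"
      using cartanE[OF xy(2)] .
    have "x + y = (cch 0 x + cch 0 y) *\<^sub>C h_vec 0 + (central x + central y) *\<^sub>C c_vec + (deriv x + deriv y) *\<^sub>C d_vec"
      by (subst x, subst y) (simp only: scaleC_add_left add_ac)
    moreover have "k *\<^sub>C x = (k * cch 0 x) *\<^sub>C h_vec 0 + (k * central x) *\<^sub>C c_vec + (k * deriv x) *\<^sub>C d_vec"
      by (subst x) (simp only: scaleC_add_right scaleC_scaleC)
    ultimately show ?thesis using cartanI by metis
  qed
  then show ?thesis
    by (auto simp: cartan_dual_def wtf_def lookup_add algebra_simps)
qed

lemma wtf_vecs: "wtf \<nu> (h_vec 0) = J - 2 * wt gX \<nu>" "wtf \<nu> d_vec = L + wt gd \<nu>"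
  by (simp_all add: wtf_def vec_in_cartan)

lemma wtf_lattice:
  "wtf \<nu> = (\<lambda>x. wtf \<nu>' x + lattice_elt k n x) \<longleftrightarrow> wt gX \<nu> = wt gX \<nu>' - of_int k \<and> wt gd \<nu> = wt gd \<nu>' + of_int n"
proof
  assume eq: "wtf \<nu> = (\<lambda>x. wtf \<nu>' x + lattice_elt k n x)"
  from fun_cong[OF eq, of "h_vec 0"] fun_cong[OF eq, of d_vec]
  have "2 * wt gX \<nu> = 2 * (wt gX \<nu>' - of_int k)" "wt gd \<nu> = wt gd \<nu>' + of_int n"
    by (simp_all add: wtf_vecs lattice_elt_eq vec_in_cartan algebra_simps)
  then show "wt gX \<nu> = wt gX \<nu>' - of_int k \<and> wt gd \<nu> = wt gd \<nu>' + of_int n"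
    unfolding mult_cancel_left by simp
next
  assume wt: "wt gX \<nu> = wt gX \<nu>' - of_int k \<and> wt gd \<nu> = wt gd \<nu>' + of_int n"
  show "wtf \<nu> = (\<lambda>x. wtf \<nu>' x + lattice_elt k n x)"
  proof
    fix x
    show "wtf \<nu> x = wtf \<nu>' x + lattice_elt k n x"
    proof (cases "x \<in> cartan")
      case True
      then show ?thesis by (simp add: wtf_def lattice_elt_eq wt algebra_simps)
    next
      case False
      then show ?thesis by (simp add: wtf_def lattice_elt_def beta_def delta_def)
    qed
  qed
qed

end

text \<open>The modules below are isomorphic to subquotients of the module of generalized
  polynomials: the vectors are the combinations of monomials in \<open>S\<close>, and \<open>restr S\<close>
  projects away the monomials that are zero in the quotient.\<close>

locale monomial_model = verma_rep +
  fixes M :: "'m U_module" and phi :: "'m \<Rightarrow> alg" and S :: "expo set"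
  assumes bij: "bij_betw phi (carrier M) (span_on S)"
    and phi_add: "x \<in> carrier M \<Longrightarrow> y \<in> carrier M \<Longrightarrow> phi (x \<oplus>\<^bsub>M\<^esub> y) = phi x + phi y"
    and phi_smult: "x \<in> carrier M \<Longrightarrow> phi (U.cls p \<odot>\<^bsub>M\<^esub> x) = restr S (app (ev p) (phi x))"
    and smult_closed: "x \<in> carrier M \<Longrightarrow> U.cls p \<odot>\<^bsub>M\<^esub> x \<in> carrier M"
    and add_group: "comm_group (add_monoid M)"
begin

lemma abelian_group: "abelian_group M"
  using add_group comm_group.axioms(1)[OF add_group]
  by (intro abelian_group.intro abelian_monoid.intro abelian_group_axioms.intro)

sublocale A: abelian_group M
  by (rule abelian_group)

definition psi :: "alg \<Rightarrow> 'm" where "psi = inv_into (carrier M) phi"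

lemma phi_closed: "x \<in> carrier M \<Longrightarrow> phi x \<in> span_on S"
  using bij by (rule bij_betw_apply)

lemma psi: "p \<in> span_on S \<Longrightarrow> psi p \<in> carrier M" "p \<in> span_on S \<Longrightarrow> phi (psi p) = p"
  "x \<in> carrier M \<Longrightarrow> psi (phi x) = x"
  unfolding psi_def using bij
  by (auto simp: bij_betw_inv_into_left bij_betw_inv_into_right dest: bij_betw_inv_into bij_betwE)

lemma phi_inj: "x \<in> carrier M \<Longrightarrow> y \<in> carrier M \<Longrightarrow> phi x = phi y \<longleftrightarrow> x = y"
  using bij by (metis bij_betw_inv_into_left)

lemma phi_zero [simp]: "phi \<zero>\<^bsub>M\<^esub> = 0"
  using phi_add[of "\<zero>\<^bsub>M\<^esub>" "\<zero>\<^bsub>M\<^esub>"] by simp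

lemma phi_eq_0: "x \<in> carrier M \<Longrightarrow> phi x = 0 \<longleftrightarrow> x = \<zero>\<^bsub>M\<^esub>"
  using phi_inj[of x "\<zero>\<^bsub>M\<^esub>"] by simp

lemma phi_finsum:
  "finite B \<Longrightarrow> (\<And>b. b \<in> B \<Longrightarrow> w b \<in> carrier M) \<Longrightarrow> phi (finsum M w B) = (\<Sum>b\<in>B. phi (w b))"
  by (induction B rule: finite_induct) (simp_all add: phi_add A.finsum_insert Pi_iff)

lemma act_closed: "x \<in> carrier M \<Longrightarrow> act M g x \<in> carrier M"
  and phi_act: "x \<in> carrier M \<Longrightarrow> phi (act M g x) = restr S (app (rho g) (phi x))"
  by (simp_all add: act_def env_of_eq smult_closed phi_smult)

lemma scal_closed: "x \<in> carrier M \<Longrightarrow> scal M c x \<in> carrier M"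
  and phi_scal: "x \<in> carrier M \<Longrightarrow> phi (scal M c x) = app (sc c) (phi x)"
  by (simp_all add: scal_def env_scalar_eq smult_closed phi_smult restr_id span_on_sc phi_closed)

text \<open>Cartan elements act diagonally on monomials, so the eigenvector equations can be
  compared coefficient by coefficient.\<close>

lemma weight_space_iff:
  assumes "\<mu> \<in> cartan_dual"
  shows "x \<in> weight_space M \<mu> \<longleftrightarrow> x \<in> carrier M \<and> phi x \<in> span_on {\<nu>. wtf \<nu> = \<mu>}"
proof (cases "x \<in> carrier M")
  case True
  have out: "wtf \<nu> g = \<mu> g" if "g \<notin> cartan" for g \<nu>
    using that assms by (simp add: wtf_def cartan_dual_def)
  have "act M g x = scal M (\<mu> g) x \<longleftrightarrow> (\<forall>\<nu>. lookup (phi x) \<nu> \<noteq> 0 \<longrightarrow> wtf \<nu> g = \<mu> g)"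
    if "g \<in> cartan" for g
  proof -
    have "act M g x = scal M (\<mu> g) x \<longleftrightarrow> restr S (app (rho g) (phi x)) = app (sc (\<mu> g)) (phi x)"
      using phi_inj[OF act_closed[OF True] scal_closed[OF True]] by (simp add: phi_act phi_scal True)
    also have "\<dots> \<longleftrightarrow> (\<forall>\<nu>. lookup (phi x) \<nu> \<noteq> 0 \<longrightarrow> wtf \<nu> g = \<mu> g)"
      using phi_closed[OF True]
      by (auto simp: poly_mapping_eq_iff fun_eq_iff lookup_rho_cartan that span_on_iff)
    finally show ?thesis .
  qed
  then have "x \<in> weight_space M \<mu> \<longleftrightarrow> (\<forall>g\<in>cartan. \<forall>\<nu>. lookup (phi x) \<nu> \<noteq> 0 \<longrightarrow> wtf \<nu> g = \<mu> g)"
    using True by (simp add: weight_space_def)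
  then show ?thesis using True out by (auto simp: span_on_iff fun_eq_iff)
qed (simp add: weight_space_def)

text \<open>The weight components of v are its restrictions to the monomials of a given weight;
  uniqueness holds because each monomial has exactly one weight.\<close>

lemma weight_module: "weight_module M"
  unfolding weight_module_def
proof
  fix v assume v: "v \<in> carrier M"
  define P where "P \<mu> = restr {\<nu>. wtf \<nu> = \<mu>} (phi v)" for \<mu>
  define w where "w \<mu> = psi (P \<mu>)" for \<mu>
  have PS: "P \<mu> \<in> span_on S" for \<mu> using phi_closed[OF v] by (auto simp: P_def span_on_iff)
  have w: "w \<mu> \<in> carrier M" "phi (w \<mu>) = P \<mu>" for \<mu> by (simp_all add: w_def psi PS)
  have w0: "w \<mu> = \<zero>\<^bsub>M\<^esub> \<longleftrightarrow> P \<mu> = 0" for \<mu> using phi_eq_0[OF w(1)] w(2) by simp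
  have sub: "{\<mu>. w \<mu> \<noteq> \<zero>\<^bsub>M\<^esub>} \<subseteq> wtf ` keys (phi v)"
  proof
    fix \<mu> assume "\<mu> \<in> {\<mu>. w \<mu> \<noteq> \<zero>\<^bsub>M\<^esub>}"
    then have "P \<mu> \<noteq> 0" by (simp add: w0)
    then obtain \<nu> where "lookup (P \<mu>) \<nu> \<noteq> 0" by (auto simp: poly_mapping_eq_iff fun_eq_iff)
    then show "\<mu> \<in> wtf ` keys (phi v)" by (auto simp: P_def in_keys_iff split: if_splits)
  qed
  then have fin: "finite {\<mu>. w \<mu> \<noteq> \<zero>\<^bsub>M\<^esub>}" by (rule finite_subset) simp
  have "phi (finsum M w {\<mu>. w \<mu> \<noteq> \<zero>\<^bsub>M\<^esub>}) = (\<Sum>\<mu>\<in>{\<mu>. w \<mu> \<noteq> \<zero>\<^bsub>M\<^esub>}. P \<mu>)"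
    by (subst phi_finsum) (simp_all add: fin w)
  also have "\<dots> = (\<Sum>\<mu>\<in>wtf ` keys (phi v). P \<mu>)"
    by (rule sum.mono_neutral_left[OF _ sub]) (auto simp: w0)
  also have "\<dots> = phi v"
  proof (rule poly_mapping_eqI)
    fix \<nu>
    have "lookup (\<Sum>\<mu>\<in>wtf ` keys (phi v). P \<mu>) \<nu> = (\<Sum>\<mu>\<in>wtf ` keys (phi v). if \<mu> = wtf \<nu> then lookup (phi v) \<nu> else 0)"
      unfolding lookup_sum P_def by (rule sum.cong[OF refl]) auto
    also have "\<dots> = lookup (phi v) \<nu>" by (auto simp: in_keys_iff)
    finally show "lookup (\<Sum>\<mu>\<in>wtf ` keys (phi v). P \<mu>) \<nu> = lookup (phi v) \<nu>" .
  qed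
  finally have "phi (finsum M w {\<mu>. w \<mu> \<noteq> \<zero>\<^bsub>M\<^esub>}) = phi v" .
  moreover have "finsum M w {\<mu>. w \<mu> \<noteq> \<zero>\<^bsub>M\<^esub>} \<in> carrier M"
    using w(1) by (intro A.finsum_closed) auto
  ultimately have sum: "finsum M w {\<mu>. w \<mu> \<noteq> \<zero>\<^bsub>M\<^esub>} = v"
    using phi_inj v by blast
  show "\<exists>!w. (\<forall>\<mu>\<in>cartan_dual. w \<mu> \<in> weight_space M \<mu>) \<and> (\<forall>\<mu>. \<mu> \<notin> cartan_dual \<longrightarrow> w \<mu> = \<zero>\<^bsub>M\<^esub>) \<and>
     finite {\<mu>. w \<mu> \<noteq> \<zero>\<^bsub>M\<^esub>} \<and> v = finsum M w {\<mu>. w \<mu> \<noteq> \<zero>\<^bsub>M\<^esub>}"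
  proof (rule ex1I[of _ w], intro conjI ballI allI impI)
    show "w \<mu> \<in> weight_space M \<mu>" if "\<mu> \<in> cartan_dual" for \<mu>
      using that w by (simp add: weight_space_iff P_def restr_span_on)
    show "w \<mu> = \<zero>\<^bsub>M\<^esub>" if "\<mu> \<notin> cartan_dual" for \<mu>
      unfolding w0 P_def using that wtf_dual by (intro poly_mapping_eqI) auto
  next
    fix u assume u: "(\<forall>\<mu>\<in>cartan_dual. u \<mu> \<in> weight_space M \<mu>) \<and> (\<forall>\<mu>. \<mu> \<notin> cartan_dual \<longrightarrow> u \<mu> = \<zero>\<^bsub>M\<^esub>) \<and>
     finite {\<mu>. u \<mu> \<noteq> \<zero>\<^bsub>M\<^esub>} \<and> v = finsum M u {\<mu>. u \<mu> \<noteq> \<zero>\<^bsub>M\<^esub>}"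
    have uc: "u \<mu> \<in> carrier M \<and> phi (u \<mu>) \<in> span_on {\<nu>. wtf \<nu> = \<mu>}" for \<mu>
      using u weight_space_iff by (cases "\<mu> \<in> cartan_dual") auto
    have "phi (u \<mu>) = P \<mu>" for \<mu>
    proof (rule poly_mapping_eqI)
      fix \<nu>
      have "lookup (phi v) \<nu> = (\<Sum>\<mu>\<in>{\<mu>. u \<mu> \<noteq> \<zero>\<^bsub>M\<^esub>}. lookup (phi (u \<mu>)) \<nu>)"
        using u uc by (simp add: phi_finsum lookup_sum)
      also have "\<dots> = (\<Sum>\<mu>\<in>{\<mu>. u \<mu> \<noteq> \<zero>\<^bsub>M\<^esub>}. if \<mu> = wtf \<nu> then lookup (phi (u (wtf \<nu>))) \<nu> else 0)"
        using uc by (intro sum.cong[OF refl]) (auto simp: span_on_iff)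
      also have "\<dots> = lookup (phi (u (wtf \<nu>))) \<nu>" using u by auto
      finally show "lookup (phi (u \<mu>)) \<nu> = lookup (P \<mu>) \<nu>"
        using uc[of \<mu>] by (auto simp: P_def span_on_iff)
    qed
    then show "u = w" using uc w by (metis ext phi_inj)
  qed (use fin sum in auto)
qed

lemma weight_support: "weight_support M = wtf ` S"
proof (intro equalityI subsetI)
  fix \<mu> assume "\<mu> \<in> weight_support M"
  then have \<mu>: "\<mu> \<in> cartan_dual" "weight_space M \<mu> \<noteq> {\<zero>\<^bsub>M\<^esub>}" by (auto simp: weight_support_def)
  moreover have "\<zero>\<^bsub>M\<^esub> \<in> weight_space M \<mu>" by (simp add: weight_space_iff \<mu>)
  ultimately obtain x where x: "x \<in> weight_space M \<mu>" "x \<noteq> \<zero>\<^bsub>M\<^esub>" by blast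
  then have xc: "x \<in> carrier M" "phi x \<in> span_on {\<nu>. wtf \<nu> = \<mu>}" by (simp_all add: weight_space_iff \<mu>)
  then have "phi x \<noteq> 0" using x phi_eq_0 by simp
  then obtain \<nu> where "lookup (phi x) \<nu> \<noteq> 0" by (auto simp: poly_mapping_eq_iff fun_eq_iff)
  then show "\<mu> \<in> wtf ` S" using xc phi_closed[OF xc(1)] by (auto simp: span_on_iff)
next
  fix \<mu> assume "\<mu> \<in> wtf ` S"
  then obtain \<nu> where \<nu>: "\<nu> \<in> S" "\<mu> = wtf \<nu>" by blast
  then have s: "single \<nu> 1 \<in> span_on S" by (simp add: span_on_single)
  have "psi (single \<nu> 1) \<in> weight_space M \<mu>"
    using \<nu> s by (simp add: weight_space_iff wtf_dual psi span_on_single)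
  moreover have "psi (single \<nu> 1) \<noteq> \<zero>\<^bsub>M\<^esub>" using psi(2)[OF s] phi_zero by force
  ultimately show "\<mu> \<in> weight_support M" by (auto simp: weight_support_def \<nu> wtf_dual)
qed

text \<open>The images of submodules under \<open>phi\<close>. All of U acts, including its scalars,
  so closure under negation is implied.\<close>

definition rsub :: "alg set \<Rightarrow> bool" where
  "rsub N \<longleftrightarrow> 0 \<in> N \<and> N \<subseteq> span_on S \<and> (\<forall>p\<in>N. \<forall>q\<in>N. p + q \<in> N) \<and> (\<forall>u. \<forall>p\<in>N. restr S (app (ev u) p) \<in> N)"

lemma phi_uminus: "x \<in> carrier M \<Longrightarrow> phi (\<ominus>\<^bsub>M\<^esub> x) = - phi x"
  using phi_add[of x "\<ominus>\<^bsub>M\<^esub> x"] by (simp add: A.r_neg eq_neg_iff_add_eq_0 add.commute)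

lemma minus_via_scalar: "q \<in> span_on S \<Longrightarrow> restr S (app (ev (single [] (- 1))) q) = - q"
  by (simp add: restr_id span_on_sc) (rule poly_mapping_eqI, simp)

lemma irreducible_iff:
  "irreducible_module Uaff M \<longleftrightarrow> S \<noteq> {} \<and> (\<forall>N. rsub N \<longrightarrow> N = {0} \<or> N = span_on S)"
proof -
  have S0: "span_on S = {0} \<longleftrightarrow> S = {}"
  proof
    assume *: "span_on S = {0}"
    have "\<mu> \<notin> S" for \<mu> using span_on_single[of \<mu> S 1] * by auto
    then show "S = {}" by blast
  qed (auto simp: span_on_def)
  have img: "phi ` carrier M = span_on S" using bij by (rule bij_betw_imp_surj_on)
  have z: "carrier M = {\<zero>\<^bsub>M\<^esub>} \<longleftrightarrow> span_on S = {0}"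
    unfolding img[symmetric] using phi_eq_0 by (auto simp: image_def)
  have 1: "rsub (phi ` H) \<and> H \<subseteq> carrier M" if "submodule H Uaff M" for H
  proof -
    interpret H: submodule H Uaff M by fact
    have sub: "H \<subseteq> carrier M" using H.subset by simp
    have z: "\<zero>\<^bsub>M\<^esub> \<in> H" and a: "x \<in> H \<Longrightarrow> y \<in> H \<Longrightarrow> x \<oplus>\<^bsub>M\<^esub> y \<in> H" for x y
      using H.one_closed H.m_closed by simp_all
    have sm: "U.cls p \<odot>\<^bsub>M\<^esub> x \<in> H" if "x \<in> H" for x p
      using that H.smult_closed by (simp add: Uaff_simps)
    have "0 \<in> phi ` H" using z by (metis imageI phi_zero)
    moreover have "phi ` H \<subseteq> span_on S" using sub img by blast
    moreover have "phi x + phi y \<in> phi ` H" if "x \<in> H" "y \<in> H" for x y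
      using phi_add[of x y, symmetric] sub that by (intro image_eqI[of _ phi "x \<oplus>\<^bsub>M\<^esub> y"] a) auto
    moreover have "restr S (app (ev u) (phi x)) \<in> phi ` H" if "x \<in> H" for x u
      using phi_smult[of x u, symmetric] sub that by (intro image_eqI[of _ phi "U.cls u \<odot>\<^bsub>M\<^esub> x"] sm) auto
    ultimately show ?thesis using sub by (auto simp: rsub_def)
  qed
  have 2: "submodule (psi ` N) Uaff M" if N: "rsub N" for N
  proof -
    have sub: "N \<subseteq> span_on S" using N by (simp add: rsub_def)
    have mem: "x \<in> psi ` N \<longleftrightarrow> x \<in> carrier M \<and> phi x \<in> N" for x
    proof
      assume "x \<in> psi ` N"
      then obtain p where "p \<in> N" "x = psi p" by blast
      then show "x \<in> carrier M \<and> phi x \<in> N" using sub psi(1,2)[of p] by auto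
    next
      assume "x \<in> carrier M \<and> phi x \<in> N"
      then show "x \<in> psi ` N" using psi(3)[of x] by (intro image_eqI[of _ _ "phi x"]) auto
    qed
    show ?thesis
    proof (intro submodule.intro subgroup.intro submodule_axioms.intro)
      show "inv\<^bsub>add_monoid M\<^esub> x \<in> psi ` N" if "x \<in> psi ` N" for x
      proof -
        have x: "x \<in> carrier M" "phi x \<in> N" using that mem by auto
        then have "- phi x \<in> N"
          using N minus_via_scalar[of "phi x"] phi_closed by (metis rsub_def)
        then show ?thesis using x phi_uminus[OF x(1)] mem by (simp flip: a_inv_def)
      qed
    qed (use N psi(1) sub in \<open>auto simp: mem rsub_def phi_add phi_smult smult_closed Uaff_simps\<close>)
  qed
  have psi_phi: "psi ` phi ` H = H" if "H \<subseteq> carrier M" for H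
    unfolding image_image by (rule image_cong[THEN trans, OF refl _ image_ident]) (use that psi(3) in auto)
  have phi_psi: "phi ` psi ` N = N" if "rsub N" for N
    unfolding image_image
    by (rule image_cong[THEN trans, OF refl _ image_ident]) (use that psi(2) in \<open>auto simp: rsub_def\<close>)
  show ?thesis
    unfolding irreducible_module_def z S0
  proof (intro conj_cong refl iffI allI impI)
    fix N assume *: "\<forall>N. submodule N Uaff M \<longrightarrow> N = {\<zero>\<^bsub>M\<^esub>} \<or> N = carrier M" and N: "rsub N"
    then consider "psi ` N = {\<zero>\<^bsub>M\<^esub>}" | "psi ` N = carrier M" using 2 by blast
    then show "N = {0} \<or> N = span_on S"
    proof cases
      case 1
      then have "phi ` psi ` N = {0}" by simp
      then show ?thesis by (simp add: phi_psi[OF N])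
    next
      case 2
      then have "phi ` psi ` N = span_on S" by (simp add: img)
      then show ?thesis by (simp add: phi_psi[OF N])
    qed
  next
    fix H assume *: "\<forall>N. rsub N \<longrightarrow> N = {0} \<or> N = span_on S" and H: "submodule H Uaff M"
    then have "phi ` H = {0} \<or> phi ` H = span_on S" using 1 by blast
    then consider "phi ` H = phi ` {\<zero>\<^bsub>M\<^esub>}" | "phi ` H = phi ` carrier M" using img by auto
    then show "H = {\<zero>\<^bsub>M\<^esub>} \<or> H = carrier M"
    proof cases
      case one: 1
      then have "psi ` phi ` H = psi ` phi ` {\<zero>\<^bsub>M\<^esub>}" by (rule arg_cong)
      then show ?thesis using 1[OF H] psi_phi[of H] psi_phi[of "{\<zero>\<^bsub>M\<^esub>}"] by simp
    next
      case two: 2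
      then have "psi ` phi ` H = psi ` phi ` carrier M" by (rule arg_cong)
      then show ?thesis using 1[OF H] psi_phi[of H] psi_phi[of "carrier M"] by simp
    qed
  qed
qed

lemma injective_iff:
  "acts_injectively M g \<longleftrightarrow> (\<forall>p\<in>span_on S. restr S (app (rho g) p) = 0 \<longrightarrow> p = 0)"
proof
  assume *: "acts_injectively M g"
  show "\<forall>p\<in>span_on S. restr S (app (rho g) p) = 0 \<longrightarrow> p = 0"
  proof (intro ballI impI)
    fix p assume p: "p \<in> span_on S" "restr S (app (rho g) p) = 0"
    have "phi (act M g (psi p)) = phi (act M g \<zero>\<^bsub>M\<^esub>)" by (simp add: phi_act psi p)
    then have "act M g (psi p) = act M g \<zero>\<^bsub>M\<^esub>" using phi_inj act_closed psi p by simp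
    then have "psi p = \<zero>\<^bsub>M\<^esub>" using * psi p by (simp add: acts_injectively_def inj_on_eq_iff)
    then show "p = 0" using psi(2)[OF p(1)] by simp
  qed
next
  assume *: "\<forall>p\<in>span_on S. restr S (app (rho g) p) = 0 \<longrightarrow> p = 0"
  show "acts_injectively M g"
    unfolding acts_injectively_def
  proof (rule inj_onI)
    fix x y assume xy: "x \<in> carrier M" "y \<in> carrier M" "act M g x = act M g y"
    then have "restr S (app (rho g) (phi x)) = restr S (app (rho g) (phi y))"
      using phi_act by metis
    then have "restr S (app (rho g) (phi x - phi y)) = 0" by (simp add: app_diff_right restr_diff)
    then have "phi x - phi y = 0" using * phi_closed xy span_on_diff by blast
    then show "x = y" using phi_inj xy by simp
  qed
qed

end

text \<open>A condition on exponents alone that yields density and infinite multiplicities: weights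
  of monomials in S differ by lattice elements, and each lattice translate of such a weight is
  attained infinitely often.\<close>

definition abundant :: "expo set \<Rightarrow> bool" where
  "abundant S \<longleftrightarrow> S \<noteq> {} \<and> (\<forall>\<nu>\<in>S. \<forall>\<nu>'\<in>S. wt gX \<nu> - wt gX \<nu>' \<in> \<int> \<and> wt gd \<nu> - wt gd \<nu>' \<in> \<int>)
    \<and> (\<forall>\<nu>\<in>S. \<forall>k n. infinite {\<nu>'\<in>S. wt gX \<nu>' = wt gX \<nu> - of_int k \<and> wt gd \<nu>' = wt gd \<nu> + of_int n})"

context monomial_model
begin

lemma dense_module:
  assumes "abundant S"
  shows "dense_module M"
proof -
  obtain \<nu> where \<nu>: "\<nu> \<in> S" using assms by (auto simp: abundant_def)
  have "wtf ` S = {(\<lambda>x. wtf \<nu> x + \<gamma> x) | \<gamma>. \<gamma> \<in> root_lattice}"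
  proof (intro equalityI subsetI)
    fix \<mu> assume "\<mu> \<in> wtf ` S"
    then obtain \<nu>' where \<nu>': "\<nu>' \<in> S" "\<mu> = wtf \<nu>'" by blast
    then obtain k n where "wt gX \<nu> - wt gX \<nu>' = of_int k" "wt gd \<nu>' - wt gd \<nu> = of_int n"
      using assms \<nu> unfolding abundant_def by (meson Ints_cases)
    then have "\<mu> = (\<lambda>x. wtf \<nu> x + lattice_elt k n x)"
      unfolding \<nu>' wtf_lattice by (simp add: algebra_simps)
    then show "\<mu> \<in> {(\<lambda>x. wtf \<nu> x + \<gamma> x) | \<gamma>. \<gamma> \<in> root_lattice}"
      unfolding root_lattice_def by blast
  next
    fix \<mu> assume "\<mu> \<in> {(\<lambda>x. wtf \<nu> x + \<gamma> x) | \<gamma>. \<gamma> \<in> root_lattice}"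
    then obtain k n where \<mu>: "\<mu> = (\<lambda>x. wtf \<nu> x + lattice_elt k n x)"
      unfolding root_lattice_def by blast
    have "infinite {\<nu>'\<in>S. wt gX \<nu>' = wt gX \<nu> - of_int k \<and> wt gd \<nu>' = wt gd \<nu> + of_int n}"
      using assms \<nu> unfolding abundant_def by blast
    then obtain \<nu>' where "\<nu>' \<in> S" "wt gX \<nu>' = wt gX \<nu> - of_int k \<and> wt gd \<nu>' = wt gd \<nu> + of_int n"
      using not_finite_existsD by blast
    then have "\<nu>' \<in> S" "wtf \<nu>' = \<mu>" unfolding \<mu> by (simp_all only: wtf_lattice)
    then show "\<mu> \<in> wtf ` S" by blast
  qed
  then show ?thesis
    using weight_module weight_support wtf_dual by (auto simp: dense_module_def)
qed

text \<open>A finite set of vectors involves finitely many monomials, whereas infinitely many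
  monomials have the given weight.\<close>

lemma infinite_multiplicities:
  assumes "abundant S"
  shows "infinite_multiplicities M"
  unfolding infinite_multiplicities_def
proof (intro ballI notI)
  fix \<mu> assume "\<mu> \<in> weight_support M" and fin: "finite_dim_subspace M (weight_space M \<mu>)"
  then obtain \<nu> where \<nu>: "\<nu> \<in> S" "\<mu> = wtf \<nu>" unfolding weight_support by blast
  obtain B where B: "finite B" "B \<subseteq> weight_space M \<mu>"
    "\<And>v. v \<in> weight_space M \<mu> \<Longrightarrow> \<exists>c. v = finsum M (\<lambda>b. scal M (c b) b) B"
    using fin unfolding finite_dim_subspace_def by blast
  have Bc: "b \<in> carrier M" if "b \<in> B" for b using that B(2) by (auto simp: weight_space_def)
  have "infinite {\<nu>'\<in>S. wt gX \<nu>' = wt gX \<nu> - of_int 0 \<and> wt gd \<nu>' = wt gd \<nu> + of_int 0}" (is "infinite ?A")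
    using assms \<nu> unfolding abundant_def by blast
  moreover have "finite (\<Union>b\<in>B. keys (phi b))" using B(1) by simp
  ultimately obtain \<nu>' where \<nu>': "\<nu>' \<in> ?A" "\<nu>' \<notin> (\<Union>b\<in>B. keys (phi b))"
    by (meson finite_subset subsetI)
  have wt: "wtf \<nu>' = \<mu>"
    using \<nu>'(1) wtf_lattice[of \<nu>' \<nu> 0 0] by (simp add: \<nu> lattice_elt_def)
  have s: "single \<nu>' 1 \<in> span_on S" using \<nu>'(1) by (simp add: span_on_single)
  then have "psi (single \<nu>' 1) \<in> weight_space M \<mu>"
    using wt wtf_dual[of \<nu>'] by (simp add: weight_space_iff psi span_on_single)
  then obtain c where "psi (single \<nu>' 1) = finsum M (\<lambda>b. scal M (c b) b) B" using B(3) by blast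
  then have "phi (psi (single \<nu>' 1)) = (\<Sum>b\<in>B. app (sc (c b)) (phi b))"
    using B(1) Bc by (simp add: phi_finsum scal_closed phi_scal)
  then have "lookup (single \<nu>' 1) \<nu>' = (\<Sum>b\<in>B. c b * lookup (phi b) \<nu>')"
    by (simp add: psi s lookup_sum)
  moreover have "(\<Sum>b\<in>B. c b * lookup (phi b) \<nu>') = 0"
    using \<nu>'(2) by (intro sum.neutral) (auto simp: in_keys_iff)
  ultimately show False by simp
qed

end

section \<open>Monomials of prescribed weight\<close>

lemma Ints_wt_gd:
  assumes "\<mu> \<in> ET i z"
  shows "wt gd \<mu> - of_int i * z \<in> \<int>"
proof -
  obtain \<nu> where \<nu>: "\<mu> = single (X i) (lookup \<mu> (X i)) + \<nu>" "\<nu> \<in> EV" "lookup \<nu> (X i) = 0"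
    using ET_decompose[OF assms] .
  have NI: "x \<in> \<nat> \<Longrightarrow> x \<in> \<int>" for x :: complex by (auto elim!: Nats_cases)
  have gd: "gd v \<in> \<int>" for v by (cases v) simp_all
  have "gd v * lookup \<nu> v \<in> \<int>" for v
    using \<nu>(2) unfolding EV_iff by (intro Ints_mult[OF gd NI]) blast
  then have "wt gd \<nu> \<in> \<int>" unfolding wt_def by (intro Ints_sum)
  moreover have "of_int i * (lookup \<mu> (X i) - z) \<in> \<int>"
    using assms unfolding ET_iff by (intro Ints_mult) auto
  moreover have "wt gd \<mu> - of_int i * z = wt gd \<nu> + of_int i * (lookup \<mu> (X i) - z)"
    by (subst \<nu>(1)) (simp add: wt_add wt_single algebra_simps)
  ultimately show ?thesis by simp
qed

text \<open>Besides x_i^{c-2-r} x_{i+1}^r two further variables occur, whose indices add up to a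
  fixed T; moving one index up and the other down keeps both degrees. The parameter r makes the
  exponent of x_i as negative as desired.\<close>

lemma infinitely_many_monomials:
  assumes "c - z \<in> \<int>" "t - of_int i * z \<in> \<int>"
  shows "infinite {\<nu> \<in> ET i z. lookup \<nu> (X i) = c - 2 - of_nat r \<and> wt gX \<nu> = c \<and> wt gd \<nu> = t}" (is "infinite ?A")
proof -
  have "(t - of_int i * z) - of_int i * (c - z - 2) - of_nat r \<in> \<int>"
    by (rule Ints_diff[OF Ints_diff[OF assms(2) Ints_mult[OF Ints_of_int Ints_diff[OF assms(1) Ints_numeral]]] Ints_of_nat])
  then obtain T where T: "(t - of_int i * z) - of_int i * (c - z - 2) - of_nat r = of_int T"
    by (rule Ints_cases)
  \<comment> \<open>Large enough that the two moving indices differ from i, from i + 1 and from each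
    other.\<close>
  define B where "B = \<bar>i\<bar> + 2 + \<bar>T\<bar>"
  define \<mu> where "\<mu> n = single (X i) (c - 2 - of_nat r) + single (X (i + 1)) (of_nat r)
    + single (X (B + int n)) 1 + single (X (T - (B + int n))) 1" for n
  have ne: "B + int n \<noteq> i" "B + int n \<noteq> i + 1" "T - (B + int n) \<noteq> i" "T - (B + int n) \<noteq> B + int m" for n m
    by (auto simp: B_def)
  have lk: "lookup (\<mu> n) (X (B + int m)) = (if n = m then 1 else 0)" for n m
    using ne[of m] ne(4)[of n m] by (auto simp: \<mu>_def lookup_add lookup_single when_def)
  have "inj \<mu>"
  proof (rule injI)
    fix n m assume "\<mu> n = \<mu> m"
    then have "lookup (\<mu> n) (X (B + int m)) = lookup (\<mu> m) (X (B + int m))" by simp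
    then show "n = m" unfolding lk by (simp split: if_splits)
  qed
  moreover have "\<mu> n \<in> ?A" for n
  proof -
    have "lookup (\<mu> n) (X i) = c - 2 - of_nat r"
      using ne(1,3)[of n] by (auto simp: \<mu>_def lookup_add lookup_single when_def)
    moreover have "c - 2 - of_nat r - z \<in> \<int>"
      using Ints_diff[OF assms(1), of "2 + of_nat r"] by (simp add: algebra_simps)
    moreover have "wt gX (\<mu> n) = c" by (simp add: \<mu>_def wt_add wt_single)
    moreover have "wt gd (\<mu> n) = t"
      using T by (simp add: \<mu>_def wt_add wt_single algebra_simps)
    moreover have "lookup (\<mu> n) v \<in> \<nat>" if "v \<noteq> X i" for v
      using that by (auto simp: \<mu>_def lookup_add lookup_single when_def)
    ultimately show ?thesis by (simp add: ET_iff)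
  qed
  ultimately show ?thesis
    by (meson finite_subset image_subsetI infinite_UNIV_nat finite_imageD)
qed

lemma abundant_ET: "abundant (ET i z)" and abundant_EQ: "abundant (EQ i)"
proof -
  have diff: "wt gX \<nu> - wt gX \<nu>' \<in> \<int> \<and> wt gd \<nu> - wt gd \<nu>' \<in> \<int>" if "\<nu> \<in> ET i z" "\<nu>' \<in> ET i z" for \<nu> \<nu>' z
    using Ints_diff[OF Ints_wt[OF that(1)] Ints_wt[OF that(2)]]
      Ints_diff[OF Ints_wt_gd[OF that(1)] Ints_wt_gd[OF that(2)]] by simp
  have wt: "wt gX \<nu> - of_int k - z \<in> \<int>" "wt gd \<nu> + of_int n - of_int i * z \<in> \<int>" if "\<nu> \<in> ET i z" for \<nu> k n z
    using Ints_diff[OF Ints_wt[OF that], of "of_int k"] Ints_add[OF Ints_wt_gd[OF that], of "of_int n"]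
    by (simp_all add: algebra_simps)
  have "single (X i) z \<in> ET i z" "single (X i) (- 1) \<in> EQ i"
    using Nats_minus_one[of 0] by (auto simp: EQ_iff ET_iff lookup_single when_def)
  then have "ET i z \<noteq> {}" "EQ i \<noteq> {}" by blast+
  moreover have "infinite {\<nu>' \<in> ET i z. wt gX \<nu>' = wt gX \<nu> - of_int k \<and> wt gd \<nu>' = wt gd \<nu> + of_int n}"
    if "\<nu> \<in> ET i z" for \<nu> k n
    using infinitely_many_monomials[OF wt(1)[OF that, of k] wt(2)[OF that, of n], of 0] by (rule infinite_super[rotated]) auto
  moreover have "infinite {\<nu>' \<in> EQ i. wt gX \<nu>' = wt gX \<nu> - of_int k \<and> wt gd \<nu>' = wt gd \<nu> + of_int n}"
    if "\<nu> \<in> EQ i" for \<nu> k n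
  proof -
    have \<nu>: "\<nu> \<in> ET i 0" using that by (simp add: EQ_iff)
    then have "wt gX \<nu> - of_int k \<in> \<int>" using wt(1)[OF \<nu>, of k] by (simp only: diff_0_right)
    then obtain s where s: "wt gX \<nu> - of_int k = of_int s" by (rule Ints_cases)
    \<comment> \<open>The choice r = |s| makes s - 2 - r negative, so the monomials found lie
      outside the Verma module.\<close>
    have "of_int s - 2 - of_nat (nat \<bar>s\<bar>) \<notin> (\<nat> :: complex set)"
    proof
      assume "of_int s - 2 - of_nat (nat \<bar>s\<bar>) \<in> (\<nat> :: complex set)"
      then obtain m where "of_int s - 2 - of_nat (nat \<bar>s\<bar>) = (of_nat m :: complex)" by (auto elim: Nats_cases)
      then have "of_int (s - 2 - int (nat \<bar>s\<bar>)) = (of_int (int m) :: complex)" by simp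
      then show False unfolding of_int_eq_iff by simp
    qed
    then show ?thesis
      using infinitely_many_monomials[OF wt(1)[OF \<nu>, of k] wt(2)[OF \<nu>, of n], of "nat \<bar>s\<bar>"] unfolding s
      by (elim infinite_super[rotated]) (auto simp: EQ_iff)
  qed
  ultimately show "abundant (ET i z)" "abundant (EQ i)"
    using diff unfolding abundant_def by (auto simp: EQ_iff)
qed

lemma comm_group_cong:
  assumes "comm_group G" "carrier H = carrier G" "monoid.mult H = monoid.mult G" "one H = one G"
  shows "comm_group H"
proof -
  interpret G: comm_group G by fact
  show ?thesis
    by (rule comm_groupI) (auto simp: assms(2-) G.m_assoc intro: G.l_inv_ex G.m_comm)
qed

section \<open>The localizations and the quotient as monomial models\<close>

context loc_rep
begin

lemma loc_module_model:
  obtains \<L> where "monomial_model J K L lam (loc_module i (verma lam)) \<L> (ET i 0)"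
    "\<L> ` loc_image i (verma lam) = span_on EV"
proof -
  obtain \<L> where \<L>: "bij_betw \<L> (carrier E.E) (span_on (ET i 0))"
    "\<And>U V. U \<in> carrier E.E \<Longrightarrow> V \<in> carrier E.E \<Longrightarrow> \<L> (U \<oplus>\<^bsub>E.E\<^esub> V) = \<L> U + \<L> V"
    "\<And>s U. s \<in> carrier (DU i) \<Longrightarrow> U \<in> carrier E.E \<Longrightarrow> \<L> (s \<odot>\<^bsub>E.E\<^esub> U) = app (duact s) (\<L> U)"
    "\<L> ` loc_image i (verma lam) = span_on EV"
    using loc_model by blast
  have id: "restr (ET i 0) (app (ev p) (\<L> U)) = app (ev p) (\<L> U)" if "U \<in> carrier E.E" for p U
    using gsub_ev[OF gsub_ET] bij_betw_apply[OF \<L>(1) that] restr_id by blast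
  have M: "carrier (loc_module i (verma lam)) = carrier E.E" "add (loc_module i (verma lam)) = add E.E"
    "smult (loc_module i (verma lam)) = (\<lambda>u. smult E.E (DU_of i u))"
    "ring.zero (loc_module i (verma lam)) = ring.zero E.E"
    by (simp_all only: loc_module_def restrict_scalars_def loc_DU_eq module.simps ring.simps partial_object.simps monoid.simps)
  have G: "comm_group (add_monoid (loc_module i (verma lam)))"
    by (rule comm_group_cong[OF E.add_comm_group_E]) (simp_all add: M)
  have "monomial_model J K L lam (loc_module i (verma lam)) \<L> (ET i 0)"
    unfolding monomial_model_def monomial_model_axioms_def M
  proof (intro conjI allI impI)
    show "verma_rep J K L lam" by (rule verma_rep_axioms)
    show "\<L> (DU_of i (U.cls p) \<odot>\<^bsub>E.E\<^esub> x) = restr (ET i 0) (app (ev p) (\<L> x))" if "x \<in> carrier E.E" for p x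
      using \<L>(3)[OF DU_of_closed[OF clsU] that, of p] by (simp only: duact_DU_of uact_cls id[OF that])
  qed (rule \<L>(1,2) G[unfolded M] E.smult_closed_E[OF DU_of_closed[OF clsU]]; assumption)+
  then show thesis using that \<L>(4) by blast
qed

text \<open>With \<open>\<phi>\<close> equal to x_i^z times the untwisted model, the twisted action
  by \<Theta>_{-z}(u) = x_i^{-z} u x_i^z becomes the plain action of u.\<close>

lemma twisted_model:
  obtains \<phi> where "monomial_model J K L lam (twisted_loc_module i z (verma lam)) \<phi> (ET i z)"
proof -
  obtain \<L> where \<L>: "bij_betw \<L> (carrier E.E) (span_on (ET i 0))"
    "\<And>U V. U \<in> carrier E.E \<Longrightarrow> V \<in> carrier E.E \<Longrightarrow> \<L> (U \<oplus>\<^bsub>E.E\<^esub> V) = \<L> U + \<L> V"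
    "\<And>s U. s \<in> carrier (DU i) \<Longrightarrow> U \<in> carrier E.E \<Longrightarrow> \<L> (s \<odot>\<^bsub>E.E\<^esub> U) = app (duact s) (\<L> U)"
    "\<L> ` loc_image i (verma lam) = span_on EV"
    using loc_model by blast
  define \<phi> where "\<phi> U = app (mul (X i) z) (\<L> U)" for U
  have mz: "bij_betw (app (mul (X i) z)) (span_on (ET i 0)) (span_on (ET i z))"
  proof (rule bij_betwI[where g = "app (mul (X i) (- z))"])
    show "app (mul (X i) z) \<in> span_on (ET i 0) \<rightarrow> span_on (ET i z)"
      using mul_ET[of _ i 0 z] by simp
    show "app (mul (X i) (- z)) \<in> span_on (ET i z) \<rightarrow> span_on (ET i 0)"
      using mul_ET[of _ i z "- z"] by simp
  qed simp_all
  have bij: "bij_betw \<phi> (carrier E.E) (span_on (ET i z))"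
    using bij_betw_trans[OF \<L>(1) mz] by (simp add: \<phi>_def[abs_def] comp_def)
  have sm: "\<phi> (Theta i (- z) (DU_of i (U.cls p)) \<odot>\<^bsub>E.E\<^esub> U) = restr (ET i z) (app (ev p) (\<phi> U))"
    if "U \<in> carrier E.E" for p U
  proof -
    have "mul (X i) z * conj_by i z (ev p) = ev p * mul (X i) z"
      by (simp add: conj_by_def mul_inverse flip: mult.assoc)
    then have "app (mul (X i) z * conj_by i z (ev p)) (\<L> U) = app (ev p * mul (X i) z) (\<L> U)" by (rule arg_cong)
    then have "app (mul (X i) z) (app (conj_by i z (ev p)) (\<L> U)) = app (ev p) (\<phi> U)"
      by (simp only: \<phi>_def app_simps)
    then have "\<phi> (Theta i (- z) (DU_of i (U.cls p)) \<odot>\<^bsub>E.E\<^esub> U) = app (ev p) (\<phi> U)"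
      by (simp add: \<phi>_def \<L>(3) Theta_closed that duact_Theta)
    then show ?thesis
      using gsub_ev[OF gsub_ET bij_betw_apply[OF bij that]] by (simp add: restr_id)
  qed
  have M: "carrier (twisted_loc_module i z (verma lam)) = carrier E.E" "add (twisted_loc_module i z (verma lam)) = add E.E"
    "smult (twisted_loc_module i z (verma lam)) = (\<lambda>u. smult E.E (Theta i (- z) (DU_of i u)))"
    "ring.zero (twisted_loc_module i z (verma lam)) = ring.zero E.E"
    by (simp_all add: twisted_loc_module_def twisted_DU_module_def restrict_scalars_def loc_DU_eq)
  have add: "\<phi> (U \<oplus>\<^bsub>E.E\<^esub> V) = \<phi> U + \<phi> V" if "U \<in> carrier E.E" "V \<in> carrier E.E" for U V
    by (simp only: \<phi>_def \<L>(2)[OF that] app_add_right)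
  have G: "comm_group (add_monoid (twisted_loc_module i z (verma lam)))"
    by (rule comm_group_cong[OF E.add_comm_group_E]) (simp_all add: M)
  have "monomial_model J K L lam (twisted_loc_module i z (verma lam)) \<phi> (ET i z)"
    unfolding monomial_model_def monomial_model_axioms_def M
  proof (intro conjI allI impI)
    show "verma_rep J K L lam" by (rule verma_rep_axioms)
  qed (rule bij add sm G[unfolded M] E.smult_closed_E[OF Theta_closed]; assumption)+
  then show thesis by (rule that)
qed

end

lemma restr_EQ_diff: "p \<in> span_on (ET i 0) \<Longrightarrow> p - restr (EQ i) p \<in> span_on EV"
  by (auto simp: span_on_iff lookup_minus EQ_def split: if_splits)

lemma restr_EQ_eq_0: "p \<in> span_on (ET i 0) \<Longrightarrow> restr (EQ i) p = 0 \<longleftrightarrow> p \<in> span_on EV"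
  using EV_ET restr_eq_0_iff[of p "ET i 0" "EQ i"] by (auto simp: EQ_def Diff_Diff_Int Int_absorb1)

lemma restr_EQ_eq:
  assumes "p \<in> span_on (ET i 0)" "q \<in> span_on (ET i 0)"
  shows "restr (EQ i) p = restr (EQ i) q \<longleftrightarrow> p - q \<in> span_on EV"
  using restr_EQ_eq_0[OF span_on_diff[OF assms]] by (simp add: restr_diff)

lemma EQ_ET: "p \<in> span_on (EQ i) \<Longrightarrow> p \<in> span_on (ET i 0)"
  by (auto simp: span_on_iff EQ_def)

text \<open>What \<open>restr\<close> discards lies in the Verma module, which is stable under the
  action, so it contributes nothing after the second projection.\<close>

lemma (in fock) restr_EQ_ev:
  assumes "p \<in> span_on (ET i 0)"
  shows "restr (EQ i) (app (ev u) (restr (EQ i) p)) = restr (EQ i) (app (ev u) p)"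
proof -
  have "restr (EQ i) p \<in> span_on (ET i 0)" using restr_span_on EQ_ET by blast
  moreover have "app (ev u) (restr (EQ i) p) - app (ev u) p \<in> span_on EV"
    using gsub_ev[OF gsub_EV restr_EQ_diff[OF assms], of "- u"] by (simp add: app_diff_right)
  ultimately show ?thesis
    using gsub_ev[OF gsub_ET] assms by (simp add: restr_EQ_eq)
qed

context loc_rep
begin

lemma quotient_model:
  obtains \<phi> where "monomial_model J K L lam (loc_quotient i (verma lam)) \<phi> (EQ i)"
proof -
  let ?M = "loc_module i (verma lam)" and ?N = "loc_image i (verma lam)"
  obtain \<L> where "monomial_model J K L lam ?M \<L> (ET i 0)" and N_img: "\<L> ` ?N = span_on EV"
    using loc_module_model by blast
  then interpret M: monomial_model J K L lam ?M \<L> "ET i 0" by simp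
  have N_sub: "?N \<subseteq> carrier ?M"
    using E.tens_closed DU_of_closed ring.ring_simprules(6)[OF ring_DU]
    by (auto simp: loc_image_def loc_module_def restrict_scalars_def loc_DU_eq simp flip: E.tens_def)
  have N: "x \<in> ?N \<longleftrightarrow> x \<in> carrier ?M \<and> \<L> x \<in> span_on EV" for x
  proof
    assume x: "x \<in> carrier ?M \<and> \<L> x \<in> span_on EV"
    then obtain y where "y \<in> ?N" "\<L> y = \<L> x" unfolding N_img[symmetric] by force
    then show "x \<in> ?N" using M.phi_inj x N_sub by blast
  qed (use N_img N_sub in blast)
  have "abelian_subgroup ?N ?M"
  proof (rule abelian_subgroupI3[OF additive_subgroup.intro M.abelian_group], rule subgroup.intro)
    show "inv\<^bsub>add_monoid ?M\<^esub> x \<in> ?N" if "x \<in> ?N" for x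
      using that M.phi_uminus[of x] span_on_diff[OF span_on_zero, of "\<L> x" EV]
      by (simp add: N flip: a_inv_def)
  qed (auto simp: N M.phi_add span_on_add)
  then interpret N: abelian_subgroup ?N ?M .
  \<comment> \<open>Any representative may be chosen: two of them differ by an element of the Verma
    module, which \<open>restr (EQ i)\<close> kills.\<close>
  define \<phi> where "\<phi> C = restr (EQ i) (\<L> (SOME x. x \<in> C))" for C
  have coset_mem: "y \<in> ?N +>\<^bsub>?M\<^esub> x \<longleftrightarrow> y \<in> carrier ?M \<and> \<L> y - \<L> x \<in> span_on EV" if x: "x \<in> carrier ?M" for x y
  proof
    assume "y \<in> ?N +>\<^bsub>?M\<^esub> x"
    then obtain n where "n \<in> ?N" "y = n \<oplus>\<^bsub>?M\<^esub> x" unfolding a_r_coset_def' by blast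
    then show "y \<in> carrier ?M \<and> \<L> y - \<L> x \<in> span_on EV" using x by (simp add: N M.phi_add)
  next
    assume y: "y \<in> carrier ?M \<and> \<L> y - \<L> x \<in> span_on EV"
    then have "y \<oplus>\<^bsub>?M\<^esub> \<ominus>\<^bsub>?M\<^esub> x \<in> ?N" using x by (simp add: N M.phi_add M.phi_uminus)
    moreover have "y = y \<oplus>\<^bsub>?M\<^esub> \<ominus>\<^bsub>?M\<^esub> x \<oplus>\<^bsub>?M\<^esub> x" using x y by (simp add: M.A.a_assoc M.A.l_neg)
    ultimately show "y \<in> ?N +>\<^bsub>?M\<^esub> x" unfolding a_r_coset_def' by blast
  qed
  have coset_eq: "?N +>\<^bsub>?M\<^esub> x = ?N +>\<^bsub>?M\<^esub> y \<longleftrightarrow> \<L> x - \<L> y \<in> span_on EV"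
    if x: "x \<in> carrier ?M" and y: "y \<in> carrier ?M" for x y
  proof
    assume "?N +>\<^bsub>?M\<^esub> x = ?N +>\<^bsub>?M\<^esub> y"
    then show "\<L> x - \<L> y \<in> span_on EV" using coset_mem[OF x, of x] coset_mem[OF y, of x] x by simp
  next
    assume *: "\<L> x - \<L> y \<in> span_on EV"
    have "\<L> u - \<L> x \<in> span_on EV \<longleftrightarrow> \<L> u - \<L> y \<in> span_on EV" for u
      using span_on_add[OF _ *, of "\<L> u - \<L> x"] span_on_diff[OF _ *, of "\<L> u - \<L> y"] by auto
    then show "?N +>\<^bsub>?M\<^esub> x = ?N +>\<^bsub>?M\<^esub> y" using coset_mem[OF x] coset_mem[OF y] by blast
  qed
  have \<phi>: "\<phi> (?N +>\<^bsub>?M\<^esub> x) = restr (EQ i) (\<L> x)" if x: "x \<in> carrier ?M" for x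
  proof -
    have "x \<in> ?N +>\<^bsub>?M\<^esub> x" using coset_mem[OF x] x by simp
    then have "(SOME y. y \<in> ?N +>\<^bsub>?M\<^esub> x) \<in> ?N +>\<^bsub>?M\<^esub> x" by (rule someI)
    then show ?thesis
      unfolding coset_mem[OF x] \<phi>_def using x M.phi_closed by (simp add: restr_EQ_eq)
  qed
  have C: "C \<in> a_rcosets\<^bsub>?M\<^esub> ?N \<longleftrightarrow> (\<exists>x\<in>carrier ?M. C = ?N +>\<^bsub>?M\<^esub> x)" for C
    by (auto simp: A_RCOSETS_def')
  have sm: "(\<Union>y\<in>?N +>\<^bsub>?M\<^esub> x. ?N +>\<^bsub>?M\<^esub> (U.cls p \<odot>\<^bsub>?M\<^esub> y)) = ?N +>\<^bsub>?M\<^esub> (U.cls p \<odot>\<^bsub>?M\<^esub> x)"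
    if x: "x \<in> carrier ?M" for x p
  proof -
    have "?N +>\<^bsub>?M\<^esub> (U.cls p \<odot>\<^bsub>?M\<^esub> y) = ?N +>\<^bsub>?M\<^esub> (U.cls p \<odot>\<^bsub>?M\<^esub> x)" if "y \<in> ?N +>\<^bsub>?M\<^esub> x" for y
    proof -
      have y: "y \<in> carrier ?M" "\<L> y - \<L> x \<in> span_on EV" using that coset_mem[OF x] by blast+
      have id: "restr (ET i 0) (app (ev p) (\<L> u)) = app (ev p) (\<L> u)" if "u \<in> carrier ?M" for u
        using gsub_ev[OF gsub_ET M.phi_closed[OF that]] by (rule restr_id)
      show ?thesis
        using gsub_ev[OF gsub_EV y(2), of p]
        by (simp add: coset_eq M.smult_closed x y M.phi_smult id app_diff_right)
    qed
    moreover have "x \<in> ?N +>\<^bsub>?M\<^esub> x" using coset_mem[OF x] x by simp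
    ultimately show ?thesis by blast
  qed
  have Q: "carrier (loc_quotient i (verma lam)) = a_rcosets\<^bsub>?M\<^esub> ?N"
    "add (loc_quotient i (verma lam)) = set_add ?M" "ring.zero (loc_quotient i (verma lam)) = ?N"
    "smult (loc_quotient i (verma lam)) = (\<lambda>r X. \<Union>x\<in>X. ?N +>\<^bsub>?M\<^esub> (r \<odot>\<^bsub>?M\<^esub> x))"
    by (simp_all add: loc_quotient_def quotient_module_def)
  have G: "comm_group (add_monoid (loc_quotient i (verma lam)))"
    by (rule comm_group_cong[OF N.a_factorgroup_is_comm_group])
      (simp_all add: Q A_FactGroup_def FactGroup_def A_RCOSETS_def set_add_def)
  have bij: "bij_betw \<phi> (a_rcosets\<^bsub>?M\<^esub> ?N) (span_on (EQ i))"
  proof (rule bij_betwI')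
    fix C C' assume "C \<in> a_rcosets\<^bsub>?M\<^esub> ?N" "C' \<in> a_rcosets\<^bsub>?M\<^esub> ?N"
    then obtain x y where xy: "x \<in> carrier ?M" "C = ?N +>\<^bsub>?M\<^esub> x" "y \<in> carrier ?M" "C' = ?N +>\<^bsub>?M\<^esub> y"
      unfolding C by (elim bexE)
    then show "(\<phi> C = \<phi> C') = (C = C')"
      using M.phi_closed by (simp add: \<phi> coset_eq restr_EQ_eq)
  next
    fix C assume "C \<in> a_rcosets\<^bsub>?M\<^esub> ?N"
    then show "\<phi> C \<in> span_on (EQ i)" using \<phi> restr_span_on unfolding C by auto
  next
    fix q assume q: "q \<in> span_on (EQ i)"
    have c: "M.psi q \<in> carrier ?M" and "\<L> (M.psi q) = q" using M.psi(1,2)[OF EQ_ET[OF q]] by auto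
    then have "q = \<phi> (?N +>\<^bsub>?M\<^esub> M.psi q)" by (simp add: \<phi> restr_id q)
    then show "\<exists>C\<in>a_rcosets\<^bsub>?M\<^esub> ?N. q = \<phi> C" by (rule bexI) (use c in \<open>auto simp: C\<close>)
  qed
  have add: "\<phi> (C <+>\<^bsub>?M\<^esub> C') = \<phi> C + \<phi> C'" if CC: "C \<in> a_rcosets\<^bsub>?M\<^esub> ?N" "C' \<in> a_rcosets\<^bsub>?M\<^esub> ?N" for C C'
  proof -
    obtain x where x: "x \<in> carrier ?M" "C = ?N +>\<^bsub>?M\<^esub> x" using CC(1)[unfolded C] ..
    obtain y where y: "y \<in> carrier ?M" "C' = ?N +>\<^bsub>?M\<^esub> y" using CC(2)[unfolded C] ..
    from x y show ?thesis by (simp add: N.a_rcos_sum \<phi> M.phi_add restr_add)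
  qed
  have smult: "(\<Union>x\<in>C. ?N +>\<^bsub>?M\<^esub> (U.cls p \<odot>\<^bsub>?M\<^esub> x)) \<in> a_rcosets\<^bsub>?M\<^esub> ?N
    \<and> \<phi> (\<Union>x\<in>C. ?N +>\<^bsub>?M\<^esub> (U.cls p \<odot>\<^bsub>?M\<^esub> x)) = restr (EQ i) (app (ev p) (\<phi> C))"
    if CC: "C \<in> a_rcosets\<^bsub>?M\<^esub> ?N" for C p
  proof -
    obtain x where x: "x \<in> carrier ?M" "C = ?N +>\<^bsub>?M\<^esub> x" using CC[unfolded C] ..
    have "app (ev p) (\<L> x) \<in> span_on (ET i 0)" using gsub_ev[OF gsub_ET M.phi_closed[OF x(1)]] .
    then have "restr (EQ i) (restr (ET i 0) (app (ev p) (\<L> x))) = restr (EQ i) (app (ev p) (\<L> x))"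
      by (simp add: restr_id)
    then show ?thesis
      unfolding x(2) sm[OF x(1)] C
      using x M.phi_closed by (auto simp: \<phi> M.smult_closed M.phi_smult restr_EQ_ev)
  qed
  have "monomial_model J K L lam (loc_quotient i (verma lam)) \<phi> (EQ i)"
    unfolding monomial_model_def monomial_model_axioms_def Q
  proof (intro conjI allI impI)
    show "verma_rep J K L lam" by (rule verma_rep_axioms)
  qed (use bij add smult G[unfolded Q] in blast)+
  then show thesis by (rule that)
qed

end

text \<open>In a model the action is expressed by \<open>restr S\<close> and \<open>ev\<close>
  alone, so one model followed by the inverse of the other is U-linear.\<close>

lemma model_isomorphic:
  assumes "monomial_model J K L lam M \<phi> S" "monomial_model J K L lam M' \<phi>' S"
  shows "module_isomorphic Uaff M M'"
proof -
  interpret M: monomial_model J K L lam M \<phi> S by fact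
  interpret M': monomial_model J K L lam M' \<phi>' S by fact
  define \<theta> where "\<theta> x = M'.psi (\<phi> x)" for x
  have \<theta>: "\<theta> x \<in> carrier M'" "\<phi>' (\<theta> x) = \<phi> x" if "x \<in> carrier M" for x
    using M'.psi(1,2)[OF M.phi_closed[OF that]] by (simp_all add: \<theta>_def)
  have "bij_betw \<theta> (carrier M) (carrier M')"
    using bij_betw_trans[OF M.bij bij_betw_inv_into[OF M'.bij]]
    by (simp add: \<theta>_def[abs_def] M'.psi_def comp_def)
  moreover have "\<theta> (x \<oplus>\<^bsub>M\<^esub> y) = \<theta> x \<oplus>\<^bsub>M'\<^esub> \<theta> y" if "x \<in> carrier M" "y \<in> carrier M" for x y
    using that \<theta> by (subst M'.phi_inj[symmetric]) (simp_all add: M.phi_add M'.phi_add)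
  moreover have "\<theta> (U.cls p \<odot>\<^bsub>M\<^esub> x) = U.cls p \<odot>\<^bsub>M'\<^esub> \<theta> x" if "x \<in> carrier M" for x p
    using that \<theta> M.smult_closed M'.smult_closed
    by (subst M'.phi_inj[symmetric]) (simp_all add: M.phi_smult M'.phi_smult)
  ultimately show ?thesis
    unfolding module_isomorphic_def by (intro exI[of _ \<theta>]) (auto simp: Uaff_simps)
qed

lemma vec_nonzero: "e_vec n \<noteq> 0" "f_vec n \<noteq> 0"
proof -
  have "cce n (e_vec n) = 1" "ccf n (f_vec n) = 1" "sl2_ce 0 = 0" "sl2_cf 0 = 0"
    using sl2_coord_diff(1,2)[of 0 0] by simp_all
  then show "e_vec n \<noteq> 0" "f_vec n \<noteq> 0"
    by (metis affine_sel(10) lookup_zero zero_neq_one)+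
qed

text \<open>Multiplication by x_n with n \<noteq> i leaves the exponent of x_i unchanged, so it
  cannot move a monomial into the Verma module.\<close>

lemma mul_EQ_EV:
  assumes "n \<noteq> i" "p \<in> span_on (EQ i)" "app (mul (X n) 1) p \<in> span_on EV"
  shows "p = 0"
proof (rule poly_mapping_eqI)
  fix \<mu>
  have "lookup (app (mul (X n) 1) p) (\<mu> + single (X n) 1) = lookup p \<mu>"
    by (simp add: lookup_mul)
  then have "lookup p \<mu> \<noteq> 0 \<Longrightarrow> \<mu> + single (X n) 1 \<in> EV"
    using assms(3) unfolding span_on_iff by metis
  then have "lookup p \<mu> \<noteq> 0 \<Longrightarrow> lookup \<mu> (X i) \<in> \<nat>"
    using assms(1) by (auto simp: EV_iff lookup_add lookup_single when_def dest: spec[of _ "X i"])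
  then show "lookup p \<mu> = lookup 0 \<mu>"
    using assms(2) by (auto simp: span_on_iff EQ_iff)
qed

section \<open>Irreducibility, density, injectivity and isomorphisms for the models\<close>

context fock
begin

lemma span_ET_rho: "p \<in> span_on (ET i z) \<Longrightarrow> app (rho x) p \<in> span_on (ET i z)"
  by (rule gsubD(4)[OF gsub_ET])

lemma restr_EQ_rho:
  "p \<in> span_on (ET i 0) \<Longrightarrow> restr (EQ i) (app (rho x) (restr (EQ i) p)) = restr (EQ i) (app (rho x) p)"
  using restr_EQ_ev[of p i "gen x"] by simp

end

context verma_rep
begin

lemma twisted_rsub_iff:
  assumes "monomial_model J K L lam M \<phi> (ET i z)"
  shows "monomial_model.rsub J K L (ET i z) N \<longleftrightarrow> gsub N \<and> N \<subseteq> span_on (ET i z)"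
proof -
  interpret M: monomial_model J K L lam M \<phi> "ET i z" by fact
  have id: "restr (ET i z) (app (ev u) p) = app (ev u) p" if "p \<in> span_on (ET i z)" for u p
    using gsub_ev[OF gsub_ET that] by (rule restr_id)
  show ?thesis
  proof (intro iffI conjI)
    assume N: "M.rsub N"
    then show sub: "N \<subseteq> span_on (ET i z)" by (simp add: M.rsub_def)
    have ev: "app (ev u) p \<in> N" if "p \<in> N" for u p
    proof -
      have "p \<in> span_on (ET i z)" using sub that by blast
      then have "restr (ET i z) (app (ev u) p) = app (ev u) p" by (rule id)
      moreover have "restr (ET i z) (app (ev u) p) \<in> N" using N that by (simp add: M.rsub_def)
      ultimately show ?thesis by simp
    qed
    have "app (sc c) p \<in> N" "app (rho x) p \<in> N" if "p \<in> N" for c x p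
      using ev[OF that, of "single [] c"] ev[OF that, of "gen x"] by simp_all
    then show "gsub N" using N by (simp add: gsub_def M.rsub_def)
  next
    assume N: "gsub N \<and> N \<subseteq> span_on (ET i z)"
    have "restr (ET i z) (app (ev u) p) \<in> N" if "p \<in> N" for u p
      using gsub_ev[of N p u] id[of p u] N that by auto
    then show "M.rsub N" using N gsubD[of N] by (simp add: M.rsub_def)
  qed
qed

lemma twisted_properties:
  assumes "monomial_model J K L lam M \<phi> (ET i z)" "K \<noteq> 0" "z \<notin> \<int>"
  shows "irreducible_module Uaff M \<longleftrightarrow> z - J + of_int i * K \<notin> \<int>" (is ?irr)
    and "z - J + of_int i * K \<notin> \<int> \<Longrightarrow> dense_module M \<and> torsion_free_module M \<and> infinite_multiplicities M"
proof -
  interpret M: monomial_model J K L lam M \<phi> "ET i z" by fact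
  have ne: "ET i z \<noteq> {}" using abundant_ET by (simp add: abundant_def)
  show ?irr
    unfolding M.irreducible_iff twisted_rsub_iff[OF assms(1)]
    using ne twisted_irreducible[OF assms(2) _ _ _ assms(3), of _ i] twisted_reducible[OF assms(3), of i]
    by (metis psubsetE)
  assume J: "z - J + of_int i * K \<notin> \<int>"
  have id: "restr (ET i z) (app (rho x) p) = app (rho x) p" if "p \<in> span_on (ET i z)" for x p
    using span_ET_rho[OF that] by (rule restr_id)
  have "acts_injectively M (e_vec n)" "acts_injectively M (f_vec n)" for n
    unfolding M.injective_iff using e_twisted_injective[OF assms(3) J] id[of _ "e_vec n"] id[of _ "f_vec n"] by simp_all
  then show "dense_module M \<and> torsion_free_module M \<and> infinite_multiplicities M"
    using M.dense_module M.infinite_multiplicities M.weight_module abundant_ET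
    by (simp add: torsion_free_module_def)
qed

text \<open>Submodules of the quotient correspond to submodules of the localization that contain the
  Verma module: a reducing \<open>N\<close> is intersected with \<open>span_on (EQ i)\<close>, and
  conversely \<open>N'\<close> is the preimage under \<open>restr (EQ i)\<close>.\<close>

lemma quotient_properties:
  assumes "monomial_model J K L lam M \<phi> (EQ i)" "K \<noteq> 0"
  shows "irreducible_module Uaff M \<longleftrightarrow> J - of_int i * K \<notin> \<int>" (is ?irr)
    and "J - of_int i * K \<notin> \<int> \<Longrightarrow>
      dense_module M \<and> in_W (lattice_elt (- 1) i) M \<and> infinite_multiplicities M"
proof -
  interpret M: monomial_model J K L lam M \<phi> "EQ i" by fact
  have ne: "EQ i \<noteq> {}" using abundant_EQ by (simp add: abundant_def)
  show ?irr
  proof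
    assume irr: "irreducible_module Uaff M"
    show "J - of_int i * K \<notin> \<int>"
    proof
      assume "J - of_int i * K \<in> \<int>"
      then obtain N where N: "gsub N" "span_on EV \<subset> N" "N \<subset> span_on (ET i 0)"
        by (rule quotient_reducible)
      have rN: "restr (EQ i) p \<in> N" if "p \<in> N" for p
      proof -
        have "p - restr (EQ i) p \<in> N" using restr_EQ_diff[of p i] that N by blast
        then show ?thesis using gsubD(9)[OF N(1) that, of "p - restr (EQ i) p"] by simp
      qed
      have "M.rsub (N \<inter> span_on (EQ i))"
        using gsubD(1,2)[OF N(1)] rN gsub_ev[OF N(1)] restr_span_on
        by (auto simp: M.rsub_def span_on_add)
      then consider "N \<inter> span_on (EQ i) = {0}" | "N \<inter> span_on (EQ i) = span_on (EQ i)"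
        using irr unfolding M.irreducible_iff by blast
      then show False
      proof cases
        case 1
        obtain p where p: "p \<in> N" "p \<notin> span_on EV" using N(2) by blast
        then have "p \<in> span_on (ET i 0)" using N(3) by blast
        then have "restr (EQ i) p \<noteq> 0" using p restr_EQ_eq_0 by blast
        then show False using 1 rN[OF p(1)] restr_span_on by blast
      next
        case 2
        obtain p where p: "p \<in> span_on (ET i 0)" "p \<notin> N" using N(3) by blast
        have "restr (EQ i) p \<in> N" using 2 restr_span_on by blast
        moreover have "p - restr (EQ i) p \<in> N" using restr_EQ_diff[OF p(1)] N(2) by blast
        ultimately have "restr (EQ i) p + (p - restr (EQ i) p) \<in> N" by (rule gsubD(2)[OF N(1)])
        then show False using p(2) by simp
      qed
    qed
  next
    assume J: "J - of_int i * K \<notin> \<int>"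
    show "irreducible_module Uaff M"
      unfolding M.irreducible_iff
    proof (intro conjI ne allI impI disjCI)
      fix N assume N: "M.rsub N" "N \<noteq> span_on (EQ i)"
      define N' where "N' = {p \<in> span_on (ET i 0). restr (EQ i) p \<in> N}"
      have ev: "restr (EQ i) (app (ev u) p) \<in> N" if "p \<in> span_on (ET i 0)" "restr (EQ i) p \<in> N" for u p
        using N(1) restr_EQ_ev[OF that(1), of u] that(2) unfolding M.rsub_def by metis
      have N'_sub: "gsub N'"
        unfolding gsub_def N'_def
        using N(1) gsubD(1-4)[OF gsub_ET[of i 0]] ev[of _ "gen x" for x] ev[of _ "single [] c" for c]
        by (auto simp: M.rsub_def restr_add)
      have EV: "span_on EV \<subseteq> N'"
      proof
        fix p assume p: "p \<in> span_on EV"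
        then have "p \<in> span_on (ET i 0)" using EV_ET by (rule span_on_mono)
        then show "p \<in> N'" using p N(1) restr_EQ_eq_0[of p i] by (simp add: N'_def M.rsub_def)
      qed
      have "N' \<noteq> span_on (ET i 0)"
      proof
        assume *: "N' = span_on (ET i 0)"
        have "q \<in> N" if "q \<in> span_on (EQ i)" for q
        proof -
          have "q \<in> N'" using EQ_ET[OF that] * by simp
          then show ?thesis using restr_id[OF that] by (simp add: N'_def)
        qed
        then show False using N unfolding M.rsub_def by blast
      qed
      then have eq: "N' = span_on EV"
        using quotient_irreducible[OF assms(2) N'_sub _ _ J] EV unfolding N'_def by blast
      have "q = 0" if "q \<in> N" for q
      proof -
        have q: "q \<in> span_on (EQ i)" using that N(1) by (auto simp: M.rsub_def)
        then have "q \<in> N'" using that EQ_ET restr_id[OF q] by (simp add: N'_def)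
        then show ?thesis using span_on_EQ_EV q eq by blast
      qed
      then show "N = {0}" using N(1) by (auto simp: M.rsub_def)
    qed
  qed
  assume J: "J - of_int i * K \<notin> \<int>"
  have kill: "app (rho x) p \<in> span_on EV" if "p \<in> span_on (EQ i)" "restr (EQ i) (app (rho x) p) = 0" for x p
    using restr_EQ_eq_0[OF span_ET_rho[OF EQ_ET[OF that(1)]]] that(2) by simp
  have inj: "acts_injectively M (e_vec n)" "n \<noteq> i \<Longrightarrow> acts_injectively M (f_vec n)" for n
    unfolding M.injective_iff
    using e_quotient_injective[OF J] kill[where x = "e_vec n"] mul_EQ_EV kill[where x = "f_vec n"] by auto
  \<comment> \<open>f_i^n acts as multiplication by x_i^n followed by projection. Clearing
    denominators moves any vector into the Verma module, where the projection is 0.\<close>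
  have nil: "acts_locally_nilpotently M (f_vec i)"
    unfolding acts_locally_nilpotently_def
  proof
    fix v assume v: "v \<in> carrier M"
    have c: "(act M (f_vec i) ^^ n) v \<in> carrier M" for n
      by (induction n) (simp_all add: v M.act_closed)
    have ET: "app (mul (X i) (of_nat n)) (\<phi> v) \<in> span_on (ET i 0)" for n
      using mul_ET[OF EQ_ET[OF M.phi_closed[OF v]], of "of_nat n"] ET_cong[of "of_nat n + 0" 0 i] by simp
    have "\<phi> ((act M (f_vec i) ^^ n) v) = restr (EQ i) (app (mul (X i) (of_nat n)) (\<phi> v))" for n
    proof (induction n)
      case 0
      show ?case by (simp add: restr_id M.phi_closed v)
    next
      case (Suc n)
      then show ?case
        using restr_EQ_rho[OF ET, of "f_vec i" n] by (simp add: M.phi_act c app_mul_add)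
    qed
    moreover obtain n where "app (mul (X i) (of_nat n - 0)) (\<phi> v) \<in> span_on EV"
      using ET_shift_nat[OF EQ_ET[OF M.phi_closed[OF v]]] .
    ultimately have "\<phi> ((act M (f_vec i) ^^ n) v) = 0" using restr_EQ_eq_0[OF ET] by simp
    then show "\<exists>n. (act M (f_vec i) ^^ n) v = \<zero>\<^bsub>M\<^esub>" using M.phi_eq_0[OF c] by blast
  qed
  have "\<exists>x\<in>root_space \<gamma>. x \<noteq> 0 \<and> acts_injectively M x"
    if \<gamma>: "\<gamma> \<in> real_roots" "\<gamma> \<noteq> lattice_elt (- 1) i" for \<gamma>
  proof -
    obtain k n where kn: "\<gamma> = lattice_elt k n" "k = 1 \<or> k = - 1" using \<gamma>(1) by (auto simp: real_roots_def)
    then show ?thesis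
      using \<gamma>(2) e_root_space f_root_space inj vec_nonzero by metis
  qed
  moreover have "\<exists>x\<in>root_space (lattice_elt (- 1) i). x \<noteq> 0 \<and> acts_locally_nilpotently M x"
    using nil f_root_space vec_nonzero(2) by blast
  ultimately show "dense_module M \<and> in_W (lattice_elt (- 1) i) M \<and> infinite_multiplicities M"
    by (simp add: in_W_def M.dense_module M.infinite_multiplicities M.weight_module abundant_EQ)
qed

lemma twisted_isomorphic_only_if:
  assumes "monomial_model J K L lam M\<^sub>1 \<phi>\<^sub>1 (ET i\<^sub>1 z\<^sub>1)" "monomial_model J K L lam M\<^sub>2 \<phi>\<^sub>2 (ET i\<^sub>2 z\<^sub>2)"
    and "module_isomorphic Uaff M\<^sub>1 M\<^sub>2"
  shows "z\<^sub>1 - z\<^sub>2 \<in> \<int> \<and> i\<^sub>1 = i\<^sub>2"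
proof -
  interpret A: monomial_model J K L lam M\<^sub>1 \<phi>\<^sub>1 "ET i\<^sub>1 z\<^sub>1" by fact
  interpret B: monomial_model J K L lam M\<^sub>2 \<phi>\<^sub>2 "ET i\<^sub>2 z\<^sub>2" by fact
  obtain \<theta> where \<theta>: "bij_betw \<theta> (carrier M\<^sub>1) (carrier M\<^sub>2)"
    "\<And>r x. r \<in> carrier Uaff \<Longrightarrow> x \<in> carrier M\<^sub>1 \<Longrightarrow> \<theta> (r \<odot>\<^bsub>M\<^sub>1\<^esub> x) = r \<odot>\<^bsub>M\<^sub>2\<^esub> \<theta> x"
    using assms(3) unfolding module_isomorphic_def by blast
  define T where "T p = \<phi>\<^sub>2 (\<theta> (A.psi p))" for p
  have \<theta>c: "\<theta> (A.psi p) \<in> carrier M\<^sub>2" if "p \<in> span_on (ET i\<^sub>1 z\<^sub>1)" for p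
    using bij_betw_apply[OF \<theta>(1)] A.psi(1)[OF that] by blast
  have T: "T p \<in> span_on (ET i\<^sub>2 z\<^sub>2)" if "p \<in> span_on (ET i\<^sub>1 z\<^sub>1)" for p
    unfolding T_def using B.phi_closed \<theta>c[OF that] by blast
  have T_ev: "T (app (ev u) p) = app (ev u) (T p)" if p: "p \<in> span_on (ET i\<^sub>1 z\<^sub>1)" for u p
  proof -
    have up: "app (ev u) p \<in> span_on (ET i\<^sub>1 z\<^sub>1)" by (rule gsub_ev[OF gsub_ET p])
    have c: "A.psi p \<in> carrier M\<^sub>1" using A.psi(1)[OF p] .
    have "\<phi>\<^sub>1 (U.cls u \<odot>\<^bsub>M\<^sub>1\<^esub> A.psi p) = app (ev u) p"
      by (simp add: A.phi_smult c A.psi(2) p restr_id up)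
    then have "A.psi (app (ev u) p) = U.cls u \<odot>\<^bsub>M\<^sub>1\<^esub> A.psi p"
      using A.psi(3)[OF A.smult_closed[OF c]] by metis
    then have "T (app (ev u) p) = restr (ET i\<^sub>2 z\<^sub>2) (app (ev u) (T p))"
      by (simp add: T_def \<theta>(2) c Uaff_simps B.phi_smult \<theta>c p)
    then show ?thesis using restr_id[OF gsub_ev[OF gsub_ET T[OF p]]] by simp
  qed
  have T_inj: "p = q" if "T p = T q" "p \<in> span_on (ET i\<^sub>1 z\<^sub>1)" "q \<in> span_on (ET i\<^sub>1 z\<^sub>1)" for p q
    using that \<theta>c A.psi B.phi_inj bij_betw_imp_inj_on[OF \<theta>(1)] unfolding T_def by (metis inj_onD)
  have T0: "T 0 = 0" using T_ev[of 0 0] by simp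
  have T_rho: "T (app (rho x) p) = app (rho x) (T p)" if "p \<in> span_on (ET i\<^sub>1 z\<^sub>1)" for x p
    using T_ev[OF that, of "gen x"] by simp
  have "i\<^sub>1 = i\<^sub>2"
  proof (rule ccontr)
    assume ne: "i\<^sub>1 \<noteq> i\<^sub>2"
    \<comment> \<open>This vector has exponent 0 in the variable of the first localization, so it is
      not divisible by that variable in the second module, whereas division is always possible in
      the first.\<close>
    let ?q = "single (single (X i\<^sub>2) z\<^sub>2) 1"
    have q: "?q \<in> span_on (ET i\<^sub>2 z\<^sub>2)"
      by (intro span_on_single) (auto simp: ET_iff lookup_single when_def)
    obtain x where x: "x \<in> carrier M\<^sub>1" "\<theta> x = B.psi ?q"
      using bij_betw_imp_surj_on[OF \<theta>(1)] B.psi(1)[OF q] by (metis imageE)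
    define p where "p = app (mul (X i\<^sub>1) (- 1)) (\<phi>\<^sub>1 x)"
    have p: "p \<in> span_on (ET i\<^sub>1 z\<^sub>1)"
      using mul_ET[OF A.phi_closed[OF x(1)], of "- 1"] ET_cong[of "- 1 + z\<^sub>1" z\<^sub>1 i\<^sub>1] by (simp add: p_def)
    have "app (rho (f_vec i\<^sub>1)) p = \<phi>\<^sub>1 x" by (simp add: p_def)
    then have "app (mul (X i\<^sub>1) 1) (T p) = T (\<phi>\<^sub>1 x)" using T_rho[OF p, of "f_vec i\<^sub>1"] by simp
    also have "\<dots> = ?q" unfolding T_def A.psi(3)[OF x(1)] x(2) by (rule B.psi(2)[OF q])
    finally have eq: "app (mul (X i\<^sub>1) 1) (T p) = ?q" .
    let ?\<mu> = "single (X i\<^sub>2) z\<^sub>2 - single (X i\<^sub>1) 1"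
    have "lookup (T p) ?\<mu> = lookup (app (mul (X i\<^sub>1) 1) (T p)) (single (X i\<^sub>2) z\<^sub>2)"
      by (simp only: lookup_mul)
    then have "?\<mu> \<in> ET i\<^sub>2 z\<^sub>2" using T[OF p] unfolding eq span_on_iff by simp
    then have "lookup ?\<mu> (X i\<^sub>1) \<in> \<nat>" using ne unfolding ET_iff by simp
    then show False using ne Nats_minus_one[of 0] by (simp add: lookup_minus lookup_single)
  qed
  moreover have "z\<^sub>1 - z\<^sub>2 \<in> \<int>"
  proof -
    let ?p = "single (single (X i\<^sub>1) z\<^sub>1) 1"
    have p: "?p \<in> span_on (ET i\<^sub>1 z\<^sub>1)"
      by (intro span_on_single) (auto simp: ET_iff lookup_single when_def)
    have "T ?p \<noteq> T 0" using T_inj[OF _ p span_on_zero] by auto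
    then obtain \<nu> where \<nu>: "lookup (T ?p) \<nu> \<noteq> 0" unfolding T0 by (auto simp: poly_mapping_eq_iff fun_eq_iff)
    \<comment> \<open>The eigenvalue of h_0 on this vector must occur in the second module, where
      all monomials have degree in z_2 + \<int>.\<close>
    have "app (rho (h_vec 0)) ?p = app (ev (single [] (J - 2 * z\<^sub>1))) ?p"
      by (rule poly_mapping_eqI)
        (auto simp: lookup_rho_cartan[OF vec_in_cartan(1)] wtf_vecs wt_single lookup_single when_def
          simp del: rho_h)
    then have "app (rho (h_vec 0)) (T ?p) = app (ev (single [] (J - 2 * z\<^sub>1))) (T ?p)"
      using T_rho[OF p, of "h_vec 0"] T_ev[OF p, of "single [] (J - 2 * z\<^sub>1)"] by simp
    then have "lookup (app (rho (h_vec 0)) (T ?p)) \<nu> = lookup (app (ev (single [] (J - 2 * z\<^sub>1))) (T ?p)) \<nu>" by simp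
    then have "wt gX \<nu> = z\<^sub>1"
      using \<nu> unfolding lookup_rho_cartan[OF vec_in_cartan(1)] wtf_vecs by simp
    moreover have "\<nu> \<in> ET i\<^sub>2 z\<^sub>2" using T[OF p] \<nu> unfolding span_on_iff by blast
    ultimately show ?thesis using Ints_wt by blast
  qed
  ultimately show ?thesis by simp
qed

end

theorem theorem6p3:
  fixes i :: int and z J K :: complex and lam :: "affine \<Rightarrow> complex"
  assumes "lam \<in> cartan_dual" and "lam c_vec = K" and "K \<noteq> 0" and "lam (h_vec 0) = J"
  shows
    "(z \<in> \<int> \<longrightarrow>
        module_isomorphic Uaff (twisted_loc_module i z (verma lam)) (loc_module i (verma lam)) \<and>
        (irreducible_module Uaff (loc_quotient i (verma lam)) \<longleftrightarrow>
           J - of_int i * K \<notin> \<int>) \<and>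
        (irreducible_module Uaff (loc_quotient i (verma lam)) \<longrightarrow>
           dense_module (loc_quotient i (verma lam)) \<and>
           in_W (lattice_elt (-1) i) (loc_quotient i (verma lam)) \<and>
           infinite_multiplicities (loc_quotient i (verma lam)))) \<and>
     (z \<notin> \<int> \<longrightarrow>
        (irreducible_module Uaff (twisted_loc_module i z (verma lam)) \<longleftrightarrow> z - J + of_int i * K \<notin> \<int>) \<and>
        (irreducible_module Uaff (twisted_loc_module i z (verma lam)) \<longrightarrow>
           dense_module (twisted_loc_module i z (verma lam)) \<and>
           torsion_free_module (twisted_loc_module i z (verma lam)) \<and>
           infinite_multiplicities (twisted_loc_module i z (verma lam)))) \<and>
     (\<forall>i\<^sub>1 i\<^sub>2 z\<^sub>1 z\<^sub>2.
        module_isomorphic Uaff (twisted_loc_module i\<^sub>1 z\<^sub>1 (verma lam)) (twisted_loc_module i\<^sub>2 z\<^sub>2 (verma lam)) \<longleftrightarrow>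
          z\<^sub>1 - z\<^sub>2 \<in> \<int> \<and> i\<^sub>1 = i\<^sub>2)"
proof -
  \<comment> \<open>The value on d is not prescribed; it shifts the d-eigenvalue of all weights by
    the same amount.\<close>
  define L where "L = lam d_vec"
  interpret V: verma_rep J K L lam
    by unfold_locales (simp_all add: assms L_def)
  have R: "loc_rep J K L lam" by (rule loc_rep.intro[OF V.verma_rep_axioms])
  have tw: "\<exists>\<phi>. monomial_model J K L lam (twisted_loc_module i z (verma lam)) \<phi> (ET i z)" for i z
    using loc_rep.twisted_model[OF R] by blast
  have lo: "\<exists>\<phi>. monomial_model J K L lam (loc_module i (verma lam)) \<phi> (ET i 0)"
    using loc_rep.loc_module_model[OF R] by blast
  have qu: "\<exists>\<phi>. monomial_model J K L lam (loc_quotient i (verma lam)) \<phi> (EQ i)"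
    using loc_rep.quotient_model[OF R] by blast
  \<comment> \<open>For integral z both modules are modelled on the same exponents
    \<open>ET i 0\<close>.\<close>
  have "module_isomorphic Uaff (twisted_loc_module i z (verma lam)) (loc_module i (verma lam))" if "z \<in> \<int>"
    using tw[of i z] lo ET_cong[of z 0 i] that model_isomorphic by auto
  moreover have "module_isomorphic Uaff (twisted_loc_module i\<^sub>1 z\<^sub>1 (verma lam)) (twisted_loc_module i\<^sub>2 z\<^sub>2 (verma lam))
      \<longleftrightarrow> z\<^sub>1 - z\<^sub>2 \<in> \<int> \<and> i\<^sub>1 = i\<^sub>2" for i\<^sub>1 i\<^sub>2 z\<^sub>1 z\<^sub>2
  proof -
    obtain \<phi>\<^sub>1 \<phi>\<^sub>2 where 1: "monomial_model J K L lam (twisted_loc_module i\<^sub>1 z\<^sub>1 (verma lam)) \<phi>\<^sub>1 (ET i\<^sub>1 z\<^sub>1)"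
      and 2: "monomial_model J K L lam (twisted_loc_module i\<^sub>2 z\<^sub>2 (verma lam)) \<phi>\<^sub>2 (ET i\<^sub>2 z\<^sub>2)"
      using tw[of i\<^sub>1 z\<^sub>1] tw[of i\<^sub>2 z\<^sub>2] by blast
    show ?thesis
      using V.twisted_isomorphic_only_if[OF 1 2] model_isomorphic[OF 1, of _ \<phi>\<^sub>2] 2 ET_cong[of z\<^sub>1 z\<^sub>2 i\<^sub>1] by auto
  qed
  moreover obtain \<phi> where "monomial_model J K L lam (loc_quotient i (verma lam)) \<phi> (EQ i)" using qu ..
  note V.quotient_properties[OF this \<open>K \<noteq> 0\<close>]
  moreover obtain \<psi> where "monomial_model J K L lam (twisted_loc_module i z (verma lam)) \<psi> (ET i z)" using tw ..
  note V.twisted_properties[OF this \<open>K \<noteq> 0\<close>]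
  ultimately show ?thesis by simp
qed

end
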